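(* Let $\mathrm{char}(\mathbb{F}_q)>3$, $\mathcal{O}=\mathbb{F}_q[t]$, $K=\mathbb{F}_q(t)$, and let $F\in\mathcal{O}[x_1,\dots,x_6]$ be a cubic form defining a smooth hypersurface $\mathcal{V}\subset\mathbb{P}^5_{\mathcal{O}}$. Let $L\subset K^6$ be a three-dimensional $K$-vector space with $F|_L\equiv0$, and let $L^\perp$ be its orthogonal complement in $K^6$, $\Lambda^\perp=L^\perp\cap\mathcal{O}^6$. Let $B$ be the non-zero form with coefficients in $\mathcal{O}$ on $L^\perp$ fixed in the context. Let $\mathbf{c}\in\Lambda^\perp\setminus\{\mathbf{0}\}$ be good (with respect to $L$), and let $\varpi\in\mathcal{O}$ be a monic irreducible polynomial with $\varpi\nmid B(\mathbf{c})$. Then $$S^\natural_\varpi(\mathbf{c})=|\varpi|^{1/2}+O(1).$$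
   Context: Notation. $|a|=q^{\deg a}$ for non-zero $a\in\mathcal{O}$, and $|0|=0$. For $\alpha=\sum_{i\le M}a_it^i\in\mathbb{F}_q((t^{-1}))$, $\psi(\alpha)=\exp(2\pi i\,\mathrm{Tr}_{\mathbb{F}_q/\mathbb{F}_p}(a_{-1})/p)$ with $p=\mathrm{char}(\mathbb{F}_q)$. For a monic $r\in\mathcal{O}$, $S_r(\mathbf{c})=\sum_{a}\sum_{\mathbf{x}}\psi((aF(\mathbf{x})-\mathbf{c}\cdot\mathbf{x})/r)$, the sum being over $a\in\mathcal{O}$ with $|a|<|r|$, $\gcd(a,r)=1$ and $\mathbf{x}\in\mathcal{O}^6$ with $\max|x_i|<|r|$; $S^\natural_r(\mathbf{c})=|r|^{-7/2}S_r(\mathbf{c})$. The implied constant is uniform in $\varpi$ and $\mathbf{c}$. Good vectors. Let $k$ be a field with $\mathrm{char}(k)\ne2$, $V\subset\mathbb{P}^5_k$ a smooth cubic fourfold containing the $k$-plane $M=\mathbb{P}(L)$, where $L\subset k^6$ is a three-dimensional $k$-subspace, and let $L^\perp\subset k^6$ be its orthogonal complement. After a linear change of variables suppose $L$ is $x_1=x_2=x_3=0$, so $V$ is given by $x_1Q_1(\mathbf{x},\mathbf{y})+x_2Q_2(\mathbf{x},\mathbf{y})+x_3Q_3(\mathbf{x},\mathbf{y})=0$ with quadratic forms $Q_i\in k[x_1,x_2,x_3,y_1,y_2,y_3]$. Blowing up $V$ along $M$ gives a quadric surface fibration over $\mathbb{P}(k^6/L)=\mathbb{P}^2$, whose fibre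 over $\mathbf{s}=(s_1:s_2:s_3)$ is the quadric $\sum_is_iQ_i(u\mathbf{s},\mathbf{y})=0$ in the variables $(u:y_1:y_2:y_3)$. Let $\mathcal{C}\subset\mathbb{P}(k^6/L)$ be the degree $6$ curve defined by the vanishing of the determinant of the $4\times4$ symmetric matrix of this quadratic form. Let $\mathcal{D}\subset\mathbb{P}(k^6/L)$ be the curve $\det(s_1M_1+s_2M_2+s_3M_3)=0$, where $M_i$ is the $3\times3$ symmetric matrix of the quadratic form $Q_i(\mathbf{0},\mathbf{y})$. For $\mathbf{c}\in L^\perp\setminus\{\mathbf{0}\}$ let $H_{\mathbf{c}}\subset\mathbb{P}^5$ be the hyperplane $\mathbf{c}\cdot\mathbf{x}=0$ (which contains $M$), let $H'_{\mathbf{c}}\subset\mathbb{P}(k^6/L)$ be the line which is its image under projection from $M$, and $\mathcal{C}_{\mathbf{c}}=H'_{\mathbf{c}}\cap\mathcal{C}$. The vector $\mathbf{c}$ is called good (with respect to $L$) if (i) $\mathcal{C}_{\mathbf{c}}$ is smooth of dimension $0$; (ii) $H_{\mathbf{c}}\subset\mathbb{P}^5$ contains no plane contained in $V$ other than $M$; (iii) $H'_{\mathbf{c}}$ is not an irreducible component of $\mathcal{D}$. Otherwise $\mathbf{c}$ is called bad. The form $B$. In the setting of the claim, "good" for $\mathbf{c}\in L^\perp\setminus\{\mathbf{0}\}$ refers to $k=K$, $V=\mathcal{V}\times_{\mathcal{O}}K$. Write $\Lambda=L\cap\mathcal{O}^6$, $\mathbb{F}_\varpi=\mathcal{O}/\varpi\mathcal{O}$,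 $L_\varpi=\Lambda/\varpi\Lambda\subset\mathbb{F}_\varpi^6$, $L_\varpi^\perp=\Lambda^\perp/\varpi\Lambda^\perp$. Fix coordinates $z_1,z_2,z_3$ on $L^\perp$ and a non-zero form $B\in\mathcal{O}[z_1,z_2,z_3]$ such that for $\mathbf{c}\in\Lambda^\perp\setminus\{\mathbf{0}\}$: if $B(\mathbf{c})\ne0$ then $\mathbf{c}$ is good, and for each prime $\varpi\nmid B(\mathbf{c})$ the reduction of $\mathbf{c}$ modulo $\varpi$ is non-zero and good with respect to $L_\varpi$, with $k=\mathbb{F}_\varpi$ and $V=\mathcal{V}\times_{\mathcal{O}}\mathbb{F}_\varpi$. (Such a $B$ exists because the bad vectors lie in a subvariety of $\mathbb{P}(L^\perp)$ all of whose irreducible components have dimension at most one.) *)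

theory Defs
  imports
    "HOL-Algebra.Algebraic_Closure_Type"
    "HOL-Analysis.Analysis"
    "HOL-Library.Poly_Mapping"
    "HOL-Computational_Algebra.Computational_Algebra"
begin

unbundle no fps_syntax

type_synonym ('n, 'r) mpoly = "('n \<Rightarrow>\<^sub>0 nat) \<Rightarrow>\<^sub>0 'r"

definition Const :: "'r \<Rightarrow> ('n, 'r::zero) mpoly" where
  "Const a = Poly_Mapping.single 0 a"

definition Var :: "'n \<Rightarrow> ('n, 'r::zero_neq_one) mpoly" where
  "Var i = Poly_Mapping.single (Poly_Mapping.single i 1) 1"

text \<open>\<open>mp_eval h x f\<close> substitutes \<open>x\<close> for the variables after applying the ring homomorphism \<open>h\<close>
  to the coefficients; it also serves for substituting polynomials for variables.\<close>

definition mp_eval :: "('r::zero \<Rightarrow> 's::comm_ring_1) \<Rightarrow> ('n::finite \<Rightarrow> 's) \<Rightarrow> ('n, 'r) mpoly \<Rightarrow> 's" where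
  "mp_eval h x f =
     (\<Sum>m\<in>Poly_Mapping.keys f. h (Poly_Mapping.lookup f m) * (\<Prod>i\<in>UNIV. x i ^ Poly_Mapping.lookup m i))"

definition mp_value :: "('n::finite, 'r::comm_ring_1) mpoly \<Rightarrow> 'r ^ 'n \<Rightarrow> 'r" where
  "mp_value f x = mp_eval (\<lambda>a. a) (($) x) f"

definition mp_deriv :: "'n \<Rightarrow> ('n, 'r::comm_ring_1) mpoly \<Rightarrow> ('n, 'r) mpoly" where
  "mp_deriv i f =
     (\<Sum>m\<in>Poly_Mapping.keys f. Poly_Mapping.single (m - Poly_Mapping.single i 1)
        (of_nat (Poly_Mapping.lookup m i) * Poly_Mapping.lookup f m))"

definition mp_gradient :: "('n::finite, 'r::comm_ring_1) mpoly \<Rightarrow> 'r ^ 'n \<Rightarrow> 'r ^ 'n" where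
  "mp_gradient f x = (\<chi> i. mp_value (mp_deriv i f) x)"

definition form_of_degree :: "nat \<Rightarrow> ('n::finite, 'r::zero) mpoly \<Rightarrow> bool" where
  "form_of_degree d f \<longleftrightarrow> (\<forall>m\<in>Poly_Mapping.keys f. (\<Sum>i\<in>UNIV. Poly_Mapping.lookup m i) = d)"

text \<open>The symmetric matrix of a quadratic form; \<open>h\<close> is the element \<open>1/2\<close> of the coefficient ring.\<close>

definition quad_matrix :: "'r \<Rightarrow> ('n::finite, 'r::comm_ring_1) mpoly \<Rightarrow> 'r ^ 'n ^ 'n" where
  "quad_matrix h q =
     (\<chi> i j. (if i = j then 1 else h) *
             Poly_Mapping.lookup q (Poly_Mapping.single i 1 + Poly_Mapping.single j 1))"

definition linear_form :: "'r ^ 'n \<Rightarrow> ('n::finite, 'r::comm_ring_1) mpoly" where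
  "linear_form a = (\<Sum>i\<in>UNIV. Const (a $ i) * Var i)"

definition vmap :: "('r \<Rightarrow> 's) \<Rightarrow> 'r ^ 'n \<Rightarrow> 's ^ ('n::finite)" where
  "vmap h x = (\<chi> i. h (x $ i))"

definition dot :: "'r::comm_ring_1 ^ 'n \<Rightarrow> 'r ^ ('n::finite) \<Rightarrow> 'r" where
  "dot x y = (\<Sum>i\<in>UNIV. x $ i * y $ i)"

definition orth :: "('r::comm_ring_1 ^ 'n) set \<Rightarrow> ('r ^ ('n::finite)) set" where
  "orth L = {c. \<forall>x\<in>L. dot c x = 0}"


text \<open>Smoothness is a geometric property and is expressed by the Jacobian criterion at the points
  over an algebraically closed field. The first definition is for the hypersurface \<open>f = 0\<close>, the
  second one for the subscheme \<open>f = g = 0\<close> of the projective plane (Jacobian of rank two).\<close>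

definition smooth_hypersurface :: "('n::finite, 'k::alg_closed_field) mpoly \<Rightarrow> bool" where
  "smooth_hypersurface f \<longleftrightarrow> (\<forall>x. x \<noteq> 0 \<and> mp_value f x = 0 \<longrightarrow> mp_gradient f x \<noteq> 0)"

definition smooth_of_dim_0 :: "(3, 'k::alg_closed_field) mpoly \<Rightarrow> (3, 'k) mpoly \<Rightarrow> bool" where
  "smooth_of_dim_0 f g \<longleftrightarrow>
     (\<forall>p. p \<noteq> 0 \<and> mp_value f p = 0 \<and> mp_value g p = 0 \<longrightarrow>
        (\<forall>a b. a *s mp_gradient f p + b *s mp_gradient g p = 0 \<longrightarrow> a = 0 \<and> b = 0))"


text \<open>Geometric points of \<open>Spec O\<close> for \<open>O = F\<^sub>q[t]\<close>: the generic one, and for each \<open>\<theta>\<close> in the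
  algebraic closure of \<open>F\<^sub>q\<close> the point \<open>t \<mapsto> \<theta>\<close>, which lies over the prime of which \<open>\<theta>\<close> is a root.
  If \<open>\<theta>\<close> is a root of \<open>\<pi>\<close>, then \<open>reduce_at \<theta>\<close> has kernel \<open>\<pi> O\<close>, and identifies the residue field
  \<open>O/\<pi> O\<close> with the subfield \<open>F\<^sub>q(\<theta>)\<close> of its algebraic closure.\<close>

definition reduce_at :: "'a::field alg_closure \<Rightarrow> 'a poly \<Rightarrow> 'a alg_closure" where
  "reduce_at \<theta> f = poly (map_poly to_ac f) \<theta>"

definition root_of :: "'a::field alg_closure \<Rightarrow> 'a poly \<Rightarrow> bool" where
  "root_of \<theta> \<pi> \<longleftrightarrow> reduce_at \<theta> \<pi> = 0"

definition generic_point :: "'a::field poly \<Rightarrow> 'a poly fract alg_closure" where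
  "generic_point f = to_ac (to_fract f)"

definition smooth_over_O :: "('n::finite, 'a::field poly) mpoly \<Rightarrow> bool" where
  "smooth_over_O F \<longleftrightarrow>
     smooth_hypersurface (Poly_Mapping.map generic_point F) \<and>
     (\<forall>\<theta>. smooth_hypersurface (Poly_Mapping.map (reduce_at \<theta>) F))"


text \<open>Linear coordinates in which \<open>L\<close> is \<open>x\<^sub>1 = x\<^sub>2 = x\<^sub>3 = 0\<close> and the cubic is
  \<open>x\<^sub>1 Q\<^sub>1 + x\<^sub>2 Q\<^sub>2 + x\<^sub>3 Q\<^sub>3\<close>: the old coordinate vector is \<open>g *v v\<close>, where \<open>v $ Inl i\<close> is \<open>x\<^sub>i\<close>
  and \<open>v $ Inr j\<close> is \<open>y\<^sub>j\<close>.\<close>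

definition adapted_coordinates ::
    "(6, 'k::field) mpoly \<Rightarrow> ('k ^ 6) set \<Rightarrow> 'k ^ (3 + 3) ^ 6 \<Rightarrow> (3 \<Rightarrow> (3 + 3, 'k) mpoly) \<Rightarrow> bool" where
  "adapted_coordinates F L g Q \<longleftrightarrow>
     invertible g \<and>
     (\<forall>v. g *v v \<in> L \<longleftrightarrow> (\<forall>i. v $ Inl i = 0)) \<and>
     (\<forall>i. form_of_degree 2 (Q i)) \<and>
     mp_eval Const (\<lambda>i. linear_form (g $ i)) F = (\<Sum>i\<in>UNIV. Var (Inl i) * Q i)"

text \<open>The form \<open>\<Sum> s\<^sub>i Q\<^sub>i(u s, y)\<close> in the variables \<open>u\<close> (\<open>None\<close>) and \<open>y\<^sub>j\<close> (\<open>Some j\<close>), with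
  coefficients in the polynomial ring in \<open>s\<close>.\<close>

definition fibre_form :: "(3 \<Rightarrow> (3 + 3, 'k::field) mpoly) \<Rightarrow> (3 option, (3, 'k) mpoly) mpoly" where
  "fibre_form Q =
     (\<Sum>i\<in>UNIV. Const (Var i) *
        mp_eval (\<lambda>a. Const (Const a))
          (\<lambda>k. case k of Inl i \<Rightarrow> Var None * Const (Var i) | Inr j \<Rightarrow> Var (Some j)) (Q i))"

definition C_form :: "(3 \<Rightarrow> (3 + 3, 'k::field) mpoly) \<Rightarrow> (3, 'k) mpoly" where
  "C_form Q = det (quad_matrix (Const (1 / 2)) (fibre_form Q))"

definition net_matrix :: "(3 \<Rightarrow> (3 + 3, 'k::field) mpoly) \<Rightarrow> 3 \<Rightarrow> 'k ^ 3 ^ 3" where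
  "net_matrix Q i =
     quad_matrix (1 / 2) (mp_eval Const (\<lambda>k. case k of Inl _ \<Rightarrow> 0 | Inr j \<Rightarrow> Var j) (Q i))"

definition D_form :: "(3 \<Rightarrow> (3 + 3, 'k::field) mpoly) \<Rightarrow> (3, 'k) mpoly" where
  "D_form Q = det (\<Sum>i\<in>UNIV. \<chi> a b. Var i * Const (net_matrix Q i $ a $ b))"

text \<open>The equation of the image of the hyperplane \<open>c \<cdot> x = 0\<close> under projection from \<open>P(L)\<close>, for
  \<open>c\<close> orthogonal to \<open>L\<close>: in the new coordinates \<open>c\<close> becomes \<open>transpose g *v c\<close>, whose
  \<open>Inr\<close>-entries vanish.\<close>

definition line_form :: "'k::field ^ (3 + 3) ^ 6 \<Rightarrow> 'k ^ 6 \<Rightarrow> (3, 'k) mpoly" where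
  "line_form g c = linear_form (\<chi> i. (transpose g *v c) $ Inl i)"

definition plane_in :: "(6, 'k::field) mpoly \<Rightarrow> ('k ^ 6) set \<Rightarrow> bool" where
  "plane_in F P \<longleftrightarrow> vec.subspace P \<and> vec.dim P = 3 \<and> (\<forall>x\<in>P. mp_value F x = 0)"

text \<open>Good vectors. All three conditions are geometric, so the definition is stated for the data
  base changed to an algebraic closure, and is specialised to the two kinds of ground field below.
  The conditions do not depend on the choice of coordinates. In the last one the irreducible
  components of \<open>D\<close> are given by the prime factors of its equation (which is non-zero when the
  cubic is smooth).\<close>

definition good :: "(6, 'k::alg_closed_field) mpoly \<Rightarrow> ('k ^ 6) set \<Rightarrow> 'k ^ 6 \<Rightarrow> bool" where
  "good F L c \<longleftrightarrow>
     c \<in> orth L \<and> c \<noteq> 0 \<and>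
     (\<exists>g Q. adapted_coordinates F L g Q \<and>
        smooth_of_dim_0 (line_form g c) (C_form Q) \<and>
        (\<forall>P. plane_in F P \<and> (\<forall>x\<in>P. dot c x = 0) \<longrightarrow> P = L) \<and>
        \<not> line_form g c dvd D_form Q)"

definition integral_points :: "('a::field poly fract ^ 6) set \<Rightarrow> ('a poly ^ 6) set" where
  "integral_points L = {x. vmap to_fract x \<in> L}"

definition good_generic ::
    "(6, 'a::field poly) mpoly \<Rightarrow> ('a poly fract ^ 6) set \<Rightarrow> 'a poly ^ 6 \<Rightarrow> bool" where
  "good_generic F L c \<longleftrightarrow>
     good (Poly_Mapping.map generic_point F) (vec.span (vmap to_ac ` L)) (vmap generic_point c)"

text \<open>The reduction of \<open>c\<close> modulo \<open>\<pi>\<close> is non-zero and good over \<open>O/\<pi> O\<close> with respect to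
  \<open>\<Lambda>/\<pi> \<Lambda>\<close>, \<open>\<Lambda> = integral_points L\<close>. The roots \<open>\<theta>\<close> are conjugate, so the choice is immaterial.\<close>

definition good_mod ::
    "'a::field poly \<Rightarrow> (6, 'a poly) mpoly \<Rightarrow> ('a poly fract ^ 6) set \<Rightarrow> 'a poly ^ 6 \<Rightarrow> bool" where
  "good_mod \<pi> F L c \<longleftrightarrow>
     (\<forall>\<theta>. root_of \<theta> \<pi> \<longrightarrow>
        vmap (reduce_at \<theta>) c \<noteq> 0 \<and>
        good (Poly_Mapping.map (reduce_at \<theta>) F) (vec.span (vmap (reduce_at \<theta>) ` integral_points L))
          (vmap (reduce_at \<theta>) c))"

text \<open>\<open>B\<close> is a form in the coordinates \<open>z = Z *v c\<close> on \<open>orth L\<close>. The coordinates are integral on the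
  integral vectors, so that divisibility of \<open>B(c)\<close> makes sense. As \<open>integral_points (orth L)\<close> is a direct
  summand of \<open>O\<^sup>6\<close>, every system of linear coordinates that is integral on it has this shape.\<close>

definition B_value :: "(3, 'a::field poly) mpoly \<Rightarrow> 'a poly ^ 6 ^ 3 \<Rightarrow> 'a poly ^ 6 \<Rightarrow> 'a poly" where
  "B_value B Z c = mp_value B (Z *v c)"

definition detects_bad ::
    "(6, 'a::field poly) mpoly \<Rightarrow> ('a poly fract ^ 6) set \<Rightarrow> 'a poly ^ 6 ^ 3 \<Rightarrow>
     (3, 'a poly) mpoly \<Rightarrow> bool" where
  "detects_bad F L Z B \<longleftrightarrow>
     (\<forall>c\<in>integral_points (orth L). Z *v c = 0 \<longrightarrow> c = 0) \<and>
     B \<noteq> 0 \<and> (\<exists>d. form_of_degree d B) \<and>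
     (\<forall>c\<in>integral_points (orth L) - {0}.
        (B_value B Z c \<noteq> 0 \<longrightarrow> good_generic F L c) \<and>
        (\<forall>\<pi>. Factorial_Ring.irreducible \<pi> \<and> lead_coeff \<pi> = 1 \<and> \<not> \<pi> dvd B_value B Z c \<longrightarrow> good_mod \<pi> F L c))"


definition O_norm :: "'a::finite_field poly \<Rightarrow> real" where
  "O_norm a = (if a = 0 then 0 else real CARD('a) ^ degree a)"

text \<open>The trace to the prime field is the sum of the conjugates \<open>x\<^bsup>p^j\<^esup>\<close>, \<open>p^j < q\<close>.\<close>

definition abs_trace :: "'a::finite_field \<Rightarrow> 'a" where
  "abs_trace x = (\<Sum>j | CHAR('a) ^ j < CARD('a). x ^ (CHAR('a) ^ j))"

definition trace_rep :: "'a::finite_field \<Rightarrow> nat" where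
  "trace_rep x = (LEAST k. of_nat k = abs_trace x)"

text \<open>The field of Laurent series in \<open>1/t\<close> is \<open>'a fls\<close> with \<open>fls_X\<close> in the role of \<open>1/t\<close>; thus
  the coefficient of \<open>t^i\<close> is the one of index \<open>-i\<close>.\<close>

definition psi :: "'a::finite_field fls \<Rightarrow> complex" where
  "psi \<alpha> = exp (2 * pi * \<i> * of_nat (trace_rep (fls_nth \<alpha> 1)) / of_nat CHAR('a))"

definition to_laurent :: "'a::finite_field poly \<Rightarrow> 'a fls" where
  "to_laurent f = poly (map_poly fls_const f) fls_X_inv"

definition exp_sum :: "(6, 'a::finite_field poly) mpoly \<Rightarrow> 'a poly \<Rightarrow> 'a poly ^ 6 \<Rightarrow> complex" where
  "exp_sum F r c =
     (\<Sum>a | O_norm a < O_norm r \<and> coprime a r. \<Sum>x | \<forall>i. O_norm (x $ i) < O_norm r.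
        psi (to_laurent (a * mp_value F x - dot c x) / to_laurent r))"

definition S_nat :: "(6, 'a::finite_field poly) mpoly \<Rightarrow> 'a poly \<Rightarrow> 'a poly ^ 6 \<Rightarrow> complex" where
  "S_nat F r c = of_real (O_norm r powr (- 7 / 2)) * exp_sum F r c"

end

theory Submission
  imports Defs "HOL-Number_Theory.Cong"
begin

text \<open>
  Let \<open>k = O/\<pi> O\<close>, realised inside an algebraic closure, have \<open>Q\<close> elements. Summing over \<open>a\<close> and using
  homogeneity gives \<open>(Q - 1) S = Q (Q N(c) - N)\<close>, where \<open>N\<close> and \<open>N(c)\<close> count the solutions in \<open>k\<^sup>6\<close> of
  \<open>F = 0\<close> and of \<open>F = c \<cdot> x = 0\<close>; so the claim is \<open>Q N(c) - N = Q\<^sup>4 + O(Q\<^sup>7\<^sup>/\<^sup>2)\<close>.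

  In coordinates \<open>(x, y)\<close> in which \<open>L\<close> is \<open>x = 0\<close>, the solutions are fibred over the \<open>x\<close>-space in quadrics
  given by a \<open>4 \<times> 4\<close> symmetric matrix \<open>m(x)\<close>. Where \<open>m(x)\<close> has rank at least three, the deviation of
  the fibre count from its expected value is governed by the quadratic character of \<open>det m(x)\<close>. On a good
  line this determinant is a form of degree six without multiple factors, and a character sum bound proved
  by Stepanov's method saves \<open>Q\<^sup>1\<^sup>/\<^sup>2\<close>. This evaluates \<open>N(c)\<close>. For \<open>N\<close>, one averages over all lines: the
  lines that are not good are zeros of the reduction of \<open>B\<close>, hence few, and the points with \<open>m(x)\<close> of rank at
  most two lie only on such lines, so there are only \<open>O(Q)\<close> such vectors.

  The coordinates and \<open>B\<close> reduce well at all but finitely many \<open>\<pi>\<close>; for those the trivial bound suffices.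
\<close>

no_notation fps_nth (infixl "$" 75)

section \<open>Finite subfields and the quadratic character\<close>

text \<open>The main term is the share of the plane itself: over \<open>x = 0\<close> the cubic
  vanishes identically, both counts contain Q^3 points there, and Q N(c) keeps Q * Q^3. The expected
  contributions of the other fibres cancel up to O(Q^3). The deviations remain: over one projective
  point they are generically of order Q^2, so without cancellation N(c) would be off by Q^3 and N by
  Q^4. In both a saving of Q^(1/2) is needed, and averaging reduces N to lines because every point
  lies on equally many of them. The character sum bound needs Q as a product P P' of powers of the
  characteristic and has an error of order P'. When \<open>\<pi>\<close> has odd degree, P' is
  larger than P by the number of constants. This costs a factor that does not depend on
  \<open>\<pi>\<close>, so the implied constant absorbs it, as it absorbs the primes of small
  degree. Goodness is a geometric condition. The residue field is therefore taken as a subfield of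
  an algebraic closure, where rational points are counted and double roots excluded in one and the
  same type.\<close>

locale subfield_set =
  fixes K :: "'k::field set"
  assumes K_0: "0 \<in> K" and K_1: "1 \<in> K"
    and K_diff: "\<And>x y. x \<in> K \<Longrightarrow> y \<in> K \<Longrightarrow> x - y \<in> K"
    and K_mult: "\<And>x y. x \<in> K \<Longrightarrow> y \<in> K \<Longrightarrow> x * y \<in> K"
    and K_inverse: "\<And>x. x \<in> K \<Longrightarrow> inverse x \<in> K"
begin

lemma K_uminus: "x \<in> K \<Longrightarrow> - x \<in> K"
  using K_diff[OF K_0] by fastforce

lemma K_add: "x \<in> K \<Longrightarrow> y \<in> K \<Longrightarrow> x + y \<in> K"
  using K_diff[of x "- y"] K_uminus by simp

lemma K_divide: "x \<in> K \<Longrightarrow> y \<in> K \<Longrightarrow> x / y \<in> K"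
  by (simp add: divide_inverse K_mult K_inverse)

lemma K_power: "x \<in> K \<Longrightarrow> x ^ n \<in> K"
  by (induction n) (auto intro: K_1 K_mult)

lemma K_sum: "(\<And>i. i \<in> I \<Longrightarrow> f i \<in> K) \<Longrightarrow> sum f I \<in> K"
  by (induction I rule: infinite_finite_induct) (auto intro: K_0 K_add)

lemma K_prod: "(\<And>i. i \<in> I \<Longrightarrow> f i \<in> K) \<Longrightarrow> prod f I \<in> K"
  by (induction I rule: infinite_finite_induct) (auto intro: K_1 K_mult)

lemma K_of_nat: "of_nat n \<in> K"
  by (induction n) (auto intro: K_0 K_1 K_add)

lemma K_of_int: "of_int n \<in> K"
  by (cases n) (auto intro: K_of_nat K_uminus K_diff K_1)

lemma K_numeral: "numeral n \<in> K"
  using K_of_nat[of "numeral n"] by simp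

lemmas K_closed = K_0 K_1 K_add K_diff K_mult K_inverse K_divide K_uminus K_power K_sum K_prod
  K_numeral

definition KV :: "('k ^ 'n::finite) set" where
  "KV = {v. \<forall>i. v $ i \<in> K}"

lemma KV_iff: "v \<in> KV \<longleftrightarrow> (\<forall>i. v $ i \<in> K)"
  by (simp add: KV_def)

lemma KV_0 [simp]: "0 \<in> KV"
  by (simp add: KV_iff K_0)

lemma KV_add: "v \<in> KV \<Longrightarrow> w \<in> KV \<Longrightarrow> v + w \<in> KV"
  by (simp add: KV_iff K_add)

lemma KV_scale: "a \<in> K \<Longrightarrow> v \<in> KV \<Longrightarrow> a *s v \<in> KV"
  by (simp add: KV_iff K_mult)

lemma K_dot: "v \<in> KV \<Longrightarrow> w \<in> KV \<Longrightarrow> dot v w \<in> K"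
  by (auto simp: KV_iff dot_def intro: K_sum K_mult)

definition KM :: "('k ^ 'm ^ 'n) set" where
  "KM = {M. \<forall>i j. M $ i $ j \<in> K}"

lemma KM_iff: "M \<in> KM \<longleftrightarrow> (\<forall>i j. M $ i $ j \<in> K)"
  by (simp add: KM_def)

lemma KM_mult: "A \<in> KM \<Longrightarrow> B \<in> KM \<Longrightarrow> A ** B \<in> KM"
  by (simp add: KM_iff matrix_matrix_mult_def K_sum K_mult)

lemma KM_transpose: "A \<in> KM \<Longrightarrow> transpose A \<in> KM"
  by (auto simp: KM_iff transpose_def)

lemma KM_vec: "A \<in> KM \<Longrightarrow> v \<in> KV \<Longrightarrow> A *v v \<in> KV"
  by (simp add: KM_iff KV_iff matrix_vector_mult_def K_sum K_mult)

lemma K_det: "(A :: 'k ^ 'n::finite ^ 'n) \<in> KM \<Longrightarrow> det A \<in> K"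
  unfolding det_def by (intro K_sum K_mult K_of_int K_prod) (auto simp: KM_iff)

end

locale finite_subfield = subfield_set +
  assumes finite_K: "finite K"
begin

abbreviation q :: nat where "q \<equiv> card K"

lemma q_pos: "q > 1"
proof -
  have "card {0, 1::'a} \<le> q"
    using finite_K K_0 K_1 by (intro card_mono) auto
  then show ?thesis by simp
qed

text \<open>Multiplication by \<open>x\<close> permutes the non-zero elements of \<open>K\<close>,
  so it preserves their product while contributing the factor \<open>x ^ (q - 1)\<close>.\<close>

lemma power_q_minus_1:
  assumes "x \<in> K" "x \<noteq> 0"
  shows "x ^ (q - 1) = 1"
proof -
  have "bij_betw (\<lambda>y. x * y) (K - {0}) (K - {0})"
    by (rule bij_betwI[where g = "\<lambda>y. y / x"]) (use assms in \<open>auto intro: K_closed\<close>)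
  then have "(\<Prod>y\<in>K - {0}. x * y) = (\<Prod>y\<in>K - {0}. y)"
    by (rule prod.reindex_bij_betw)
  moreover have "(\<Prod>y\<in>K - {0}. x * y) = x ^ (q - 1) * (\<Prod>y\<in>K - {0}. y)"
    using finite_K K_0 by (simp add: prod.distrib card_Diff_singleton)
  moreover have "(\<Prod>y\<in>K - {0}. y) \<noteq> 0"
    using finite_K by simp
  ultimately show ?thesis by simp
qed

lemma power_q: "x \<in> K \<Longrightarrow> x ^ q = x"
  using power_q_minus_1[of x] q_pos
  by (cases "x = 0") (auto simp: power_eq_if[of _ q] power_0_left)

lemma card_roots_le:
  fixes p :: "'a poly"
  assumes "p \<noteq> 0" "\<And>x. x \<in> S \<Longrightarrow> poly p x = 0"
  shows "card S \<le> degree p"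
proof -
  have "card S \<le> card {x. poly p x = 0}"
    using assms by (intro card_mono poly_roots_finite) auto
  also have "\<dots> \<le> degree p"
    using assms(1) by (rule card_poly_roots_bound)
  finally show ?thesis .
qed

text \<open>The elements of \<open>K\<close> already provide q roots of X^q - X; a further root
  would exceed its degree.\<close>

lemma in_K_iff: "x \<in> K \<longleftrightarrow> x ^ q = x"
proof
  assume x: "x ^ q = x"
  show "x \<in> K"
  proof (rule ccontr)
    assume "x \<notin> K"
    let ?p = "monom 1 q - monom 1 1 :: 'a poly"
    have d: "degree ?p \<le> q"
      by (rule degree_diff_le) (use q_pos in \<open>auto simp: degree_monom_eq\<close>)
    have "coeff ?p q = 1" using q_pos by simp
    then have "?p \<noteq> 0" by (metis coeff_0 zero_neq_one)
    then have "card (insert x K) \<le> degree ?p"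
      by (rule card_roots_le) (use x power_q in \<open>auto simp: poly_monom\<close>)
    then show False using d finite_K \<open>x \<notin> K\<close> by simp
  qed
qed (rule power_q)

lemma bij_KV: "bij_betw (\<lambda>f. \<chi> i. f i) (PiE (UNIV :: 'n::finite set) (\<lambda>_. K)) KV"
  by (rule bij_betwI[where g = vec_nth]) (auto simp: KV_iff PiE_iff)

lemma finite_KV [simp]: "finite (KV :: ('a ^ 'n::finite) set)"
proof -
  have "bij_betw (\<lambda>f. \<chi> i. f i) (PiE (UNIV :: 'n set) (\<lambda>_. K)) KV" by (rule bij_KV)
  then show ?thesis using bij_betw_finite finite_K by (fastforce intro: finite_PiE)
qed

lemma card_KV: "card (KV :: ('a ^ 'n::finite) set) = q ^ CARD('n)"
proof -
  have "bij_betw (\<lambda>f. \<chi> i. f i) (PiE (UNIV :: 'n set) (\<lambda>_. K)) KV" by (rule bij_KV)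
  from bij_betw_same_card[OF this] show ?thesis by (simp add: card_PiE)
qed

text \<open>Surjectivity follows from injectivity on a finite set, which avoids a look at the
  entries of the inverse matrix.\<close>

lemma bij_betw_KM:
  fixes A :: "'a ^ 'n::finite ^ 'n"
  assumes "A \<in> KM" "det A \<noteq> 0"
  shows "bij_betw (\<lambda>v. A *v v) KV KV"
proof -
  have "inj (\<lambda>v. A *v v)"
    using assms(2) by (metis inj_matrix_vector_mult invertible_det_nz)
  then have i: "inj_on (\<lambda>v. A *v v) KV"
    by (rule inj_on_subset) simp
  have "(\<lambda>v. A *v v) ` KV = KV"
    by (rule endo_inj_surj[OF finite_KV _ i]) (use assms KM_vec in auto)
  with i show ?thesis by (simp add: bij_betw_def)
qed

end

section \<open>The quadratic character of a finite field of odd order\<close>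

locale odd_subfield = subfield_set +
  assumes two_nz: "(2 :: 'a) \<noteq> 0"

locale odd_finite_subfield = finite_subfield + odd_subfield
begin

text \<open>The square root is sought in \<open>K\<close>, since in the algebraically closed fields
  of the applications everything is a square. Integer values let the character be summed together
  with counting functions.\<close>

definition chi :: "'a \<Rightarrow> int" where
  "chi a = (if a = 0 then 0 else if \<exists>y\<in>K. y ^ 2 = a then 1 else - 1)"

lemma chi_0 [simp]: "chi 0 = 0"
  by (simp add: chi_def)

lemma card_sqrt:
  assumes "a \<in> K"
  shows "int (card {y\<in>K. y ^ 2 = a}) = 1 + chi a"
proof (cases "\<exists>y\<in>K. y ^ 2 = a")
  case True
  then obtain y where y: "y \<in> K" "y ^ 2 = a" by blast
  have eq: "{y\<in>K. y ^ 2 = a} = {y, - y}"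
    using y K_uminus by (auto simp: power2_eq_iff)
  show ?thesis
  proof (cases "a = 0")
    case True
    with y eq show ?thesis by simp
  next
    case False
    have "y \<noteq> - y"
    proof
      assume "y = - y"
      then have "2 * y = 0" by (metis add.right_inverse mult_2)
      then show False using two_nz y False by simp
    qed
    with eq y False True show ?thesis by (simp add: chi_def)
  qed
next
  case False
  then have "{y\<in>K. y ^ 2 = a} = {}" by blast
  moreover have "a \<noteq> 0" using False K_0 by force
  ultimately show ?thesis using False by (simp only: chi_def) simp
qed

text \<open>The \<open>y\<close> are grouped by their squares; by \<open>card_sqrt\<close> the group
  of \<open>a\<close> has \<open>1 + chi a\<close> elements. This turns diagonal equations into
  character sums.\<close>

lemma sum_sqrt:
  fixes f :: "'a \<Rightarrow> int"
  shows "(\<Sum>y\<in>K. f (y ^ 2)) = (\<Sum>a\<in>K. (1 + chi a) * f a)"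
proof -
  have "(\<Sum>y\<in>K. f (y ^ 2)) = (\<Sum>a\<in>K. \<Sum>y\<in>{y\<in>K. y ^ 2 = a}. f (y ^ 2))"
    by (rule sum.group[symmetric]) (auto simp: finite_K intro: K_power)
  also have "\<dots> = (\<Sum>a\<in>K. (1 + chi a) * f a)"
    by (rule sum.cong) (auto simp: card_sqrt)
  finally show ?thesis .
qed

lemma sum_chi: "(\<Sum>a\<in>K. chi a) = 0"
  using sum_sqrt[of "\<lambda>_. 1"] by (simp add: sum.distrib)

lemma chi_range: "chi a \<in> {-1, 0, 1}"
  by (simp add: chi_def)

text \<open>Sums over \<open>K\<close> of functions of \<open>chi a\<close> determine both
  cardinalities: the identity gives their difference, which is zero by \<open>sum_chi\<close>, and a
  constant gives their sum.\<close>

lemma card_chi: "card {a\<in>K. chi a = 1} = (q - 1) div 2"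
  and card_chi': "card {a\<in>K. chi a = - 1} = (q - 1) div 2"
  and odd_q: "odd q"
proof -
  let ?A = "{a\<in>K. chi a = 1}" and ?B = "{a\<in>K. chi a = - 1}"
  have "K = insert 0 (?A \<union> ?B)"
    using K_0 chi_range by (auto simp: chi_def)
  moreover have "(\<Sum>a\<in>insert 0 (?A \<union> ?B). f (chi a)) = f 0 + (\<Sum>a\<in>?A. f (chi a)) + (\<Sum>a\<in>?B. f (chi a))"
    for f :: "int \<Rightarrow> int"
    using finite_K by (simp add: sum.insert sum.union_disjoint disjoint_iff)
  ultimately have *: "(\<Sum>a\<in>K. f (chi a)) = f 0 + int (card ?A) * f 1 + int (card ?B) * f (- 1)"
    for f :: "int \<Rightarrow> int" by simp
  from *[of "\<lambda>x. x"] sum_chi have "card ?A = card ?B" by simp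
  with *[of "\<lambda>_. 1"] have "int q = 1 + 2 * int (card ?A)" by simp
  then have q: "q = 1 + 2 * card ?A" by linarith
  then have "(q - 1) div 2 = card ?A" by simp
  with \<open>card ?A = card ?B\<close> q
  show "card ?A = (q - 1) div 2" "card ?B = (q - 1) div 2" "odd q" by (auto simp del: Collect_case_prod)
qed

text \<open>For a non-square the power is a square root of one. It is not one itself, because the
  non-zero squares are already as many roots of X^((q-1)/2) - 1 as the degree allows.\<close>

lemma euler_criterion:
  assumes "a \<in> K"
  shows "a ^ ((q - 1) div 2) = of_int (chi a)"
proof (cases "a = 0")
  case True
  moreover have "(q - 1) div 2 > 0" using q_pos odd_q by presburger
  ultimately show ?thesis by (simp add: power_0_left)
next
  case a: False
  have h: "2 * ((q - 1) div 2) = q - 1" using odd_q q_pos by presburger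
  have sq: "b ^ ((q - 1) div 2) = 1" if "b \<in> K" "chi b = 1" for b
  proof -
    from that obtain y where y: "y \<in> K" "y ^ 2 = b" "b \<noteq> 0"
      unfolding chi_def by (auto split: if_splits)
    then have "y \<noteq> 0" by auto
    have "b ^ ((q - 1) div 2) = y ^ (2 * ((q - 1) div 2))"
      using y by (simp add: power_mult)
    then show ?thesis
      using h power_q_minus_1[of y] y \<open>y \<noteq> 0\<close> by simp
  qed
  show ?thesis
  proof (cases "chi a = 1")
    case False
    then have c: "chi a = - 1" using a by (simp add: chi_def split: if_splits)
    have "a ^ ((q - 1) div 2) * a ^ ((q - 1) div 2) = 1"
      using power_q_minus_1[OF assms a] h by (metis mult_2 power_add)
    then have "a ^ ((q - 1) div 2) = 1 \<or> a ^ ((q - 1) div 2) = - 1"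
      by (metis square_eq_1_iff)
    moreover have "a ^ ((q - 1) div 2) \<noteq> 1"
    proof
      assume 1: "a ^ ((q - 1) div 2) = 1"
      let ?n = "(q - 1) div 2"
      let ?p = "monom 1 ?n - 1 :: 'a poly"
      have pos: "?n > 0" using q_pos odd_q by presburger
      have d: "degree ?p \<le> ?n"
        by (rule degree_diff_le) (auto simp: degree_monom_eq)
      have "coeff ?p ?n = 1" using pos by simp
      then have "?p \<noteq> 0" by (metis coeff_0 zero_neq_one)
      then have "card (insert a {b\<in>K. chi b = 1}) \<le> degree ?p"
        by (rule card_roots_le) (use 1 sq in \<open>auto simp: poly_monom\<close>)
      moreover have "card (insert a {b\<in>K. chi b = 1}) = Suc ?n"
        using finite_K c card_chi by simp
      ultimately show False using d by simp
    qed
    ultimately show ?thesis using c by simp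
  qed (use sq assms in simp)
qed

lemma neg_one_neq_one: "(- 1 :: 'a) \<noteq> 1"
  using two_nz by (metis add.right_inverse one_add_one)

text \<open>As -1, 0 and 1 stay distinct in the field, identities between values of
  \<open>chi\<close> may be checked there, where \<open>euler_criterion\<close> makes them
  identities between powers.\<close>

lemma of_int_chi_inject:
  assumes "of_int x = (of_int y :: 'a)" "x \<in> {-1, 0, 1}" "y \<in> {-1, 0, 1}"
  shows "x = y"
  using assms neg_one_neq_one neg_one_neq_one[symmetric] by auto

lemma chi_mult:
  assumes "a \<in> K" "b \<in> K"
  shows "chi (a * b) = chi a * chi b"
proof (rule of_int_chi_inject)
  show "(of_int (chi (a * b)) :: 'a) = of_int (chi a * chi b)"
    using euler_criterion[OF K_mult[OF assms]] euler_criterion[OF assms(1)] euler_criterion[OF assms(2)]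
    by (simp add: power_mult_distrib)
  show "chi (a * b) \<in> {-1, 0, 1}" "chi a * chi b \<in> {-1, 0, 1}"
    using chi_range[of a] chi_range[of b] chi_range[of "a * b"] by auto
qed

lemma chi_square: "a \<in> K \<Longrightarrow> a \<noteq> 0 \<Longrightarrow> chi (a ^ 2) = 1"
  by (auto simp: chi_def)

lemma chi_1: "chi 1 = 1"
  using chi_square[of 1] K_1 by simp

lemma chi_inverse: "a \<in> K \<Longrightarrow> chi (inverse a) = chi a"
  using chi_mult[of a "inverse a"] chi_1 chi_range[of a] chi_range[of "inverse a"] K_inverse[of a]
  by (cases "a = 0") auto

lemma abs_chi: "\<bar>chi a\<bar> \<le> 1"
  using chi_range[of a] by auto

lemma exists_nonsquare: "\<exists>\<eta>\<in>K. chi \<eta> = - 1"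
proof -
  have "(q - 1) div 2 > 0" using q_pos odd_q by presburger
  then have "{a\<in>K. chi a = - 1} \<noteq> {}" using card_chi' by (metis card.empty less_numeral_extra(3))
  then show ?thesis by blast
qed

end

section \<open>Quadratic forms over a finite subfield\<close>

definition quad :: "'k::comm_ring_1 ^ 'n::finite ^ 'n \<Rightarrow> 'k ^ 'n \<Rightarrow> 'k" where
  "quad M v = dot v (M *v v)"

lemma dot_matrix_vector: "dot v (A *v w) = dot (v v* A) w"
proof -
  have "dot v (A *v w) = (\<Sum>i\<in>UNIV. \<Sum>j\<in>UNIV. v $ i * A $ i $ j * w $ j)"
    by (simp add: dot_def matrix_vector_mult_def sum_distrib_left mult.assoc)
  also have "\<dots> = (\<Sum>j\<in>UNIV. \<Sum>i\<in>UNIV. v $ i * A $ i $ j * w $ j)"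
    by (rule sum.swap)
  also have "\<dots> = dot (v v* A) w"
    by (simp add: dot_def vector_matrix_mult_def sum_distrib_left sum_distrib_right mult_ac)
  finally show ?thesis .
qed

lemma quad_congruence: "quad (transpose P ** M ** P) v = quad M (P *v v)"
proof -
  have "quad (transpose P ** M ** P) v = dot v (transpose P *v (M *v (P *v v)))"
    by (simp only: quad_def matrix_vector_mul_assoc matrix_mul_assoc)
  also have "\<dots> = dot (P *v v) (M *v (P *v v))"
    by (simp only: dot_matrix_vector[of v "transpose P"]) simp
  finally show ?thesis by (simp only: quad_def)
qed

definition diag :: "('n \<Rightarrow> 'k::zero) \<Rightarrow> 'k ^ 'n ^ 'n" where
  "diag d = (\<chi> i j. if i = j then d i else 0)"

lemma diag_nth: "diag d $ i $ j = (if i = j then d i else 0)"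
  by (simp add: diag_def)

lemma quad_diag: "quad (diag d) v = (\<Sum>i\<in>UNIV. d i * v $ i ^ 2)"
proof -
  have "(diag d *v v) $ i = d i * v $ i" for i
    by (simp add: matrix_vector_mult_def diag_nth if_distrib[of "\<lambda>x. x * _"] cong: if_cong)
  then show ?thesis
    by (simp add: quad_def dot_def power2_eq_square algebra_simps)
qed

lemma det_diag: "det (diag d) = (\<Prod>i\<in>UNIV. d i)"
  by (subst det_diagonal) (auto simp: diag_nth)

lemma mat_nth: "(A ** B) $ a $ b = (\<Sum>k\<in>UNIV. A $ a $ k * B $ k $ b)"
  by (simp add: matrix_matrix_mult_def)

section \<open>Diagonalisation of symmetric matrices by congruence\<close>

context odd_subfield
begin

text \<open>The basis vectors with index in \<open>S\<close> are orthogonal to all others: the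
  invariant under which \<open>S\<close> grows to the whole index set.\<close>

definition decoupled :: "'n set \<Rightarrow> 'a ^ 'n ^ 'n \<Rightarrow> bool" where
  "decoupled S N \<longleftrightarrow> (\<forall>i\<in>S. \<forall>j. i \<noteq> j \<longrightarrow> N $ i $ j = 0)"

lemma congruence_nth:
  fixes N :: "'a ^ 'n::finite ^ 'n"
  shows
  "(transpose E ** N ** E) $ i $ j = (\<Sum>a\<in>UNIV. \<Sum>b\<in>UNIV. E $ a $ i * N $ a $ b * E $ b $ j)"
proof -
  have "(transpose E ** N ** E) $ i $ j = (\<Sum>b\<in>UNIV. \<Sum>a\<in>UNIV. E $ a $ i * N $ a $ b * E $ b $ j)"
    by (simp add: matrix_matrix_mult_def transpose_def sum_distrib_right)
  also have "\<dots> = (\<Sum>a\<in>UNIV. \<Sum>b\<in>UNIV. E $ a $ i * N $ a $ b * E $ b $ j)"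
    by (rule sum.swap)
  finally show ?thesis .
qed

lemma congruence_symmetric:
  fixes N :: "'a ^ 'n::finite ^ 'n"
  shows "transpose N = N \<Longrightarrow> transpose (transpose E ** N ** E) = transpose E ** N ** E"
  by (simp add: matrix_transpose_mul matrix_mul_assoc transpose_transpose)

text \<open>Completing the square: column \<open>b\<close> of \<open>E\<close> is e_b - r_b e_i,
  which for \<open>b\<close> other than \<open>i\<close> is orthogonal to e_i. For \<open>b\<close>
  in \<open>S\<close> the coefficient r_b is zero, so what has been decoupled stays so.\<close>

lemma decouple_pivot:
  fixes N :: "'a ^ 'n::finite ^ 'n"
  assumes "N \<in> KM" "transpose N = N" "decoupled S N" "N $ i $ i \<noteq> 0" "i \<notin> S"
  shows "\<exists>E. E \<in> KM \<and> det E \<noteq> 0 \<and> decoupled (insert i S) (transpose E ** N ** E)"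
proof -
  have sym: "N $ a $ b = N $ b $ a" for a b
    using assms(2) by (metis transpose_def vec_lambda_beta)
  define r where "r b = (if b = i then 0 else N $ i $ b / N $ i $ i)" for b
  define E where "E = (\<chi> a b. (if a = b then 1 else 0) - (if a = i then r b else 0))"
  define E' where "E' = (\<chi> a b. (if a = b then 1 else 0) + (if a = i then r b else 0))"
  have ri: "r i = 0" by (simp add: r_def)
  have "r b \<in> K" for b
    using assms(1) by (auto simp: r_def KM_iff intro: K_closed)
  then have EK: "E \<in> KM"
    by (auto simp: E_def KM_iff intro: K_closed)
  have "(E ** E') $ a $ b = mat 1 $ a $ b" for a b
  proof -
    have "(E ** E') $ a $ b = (\<Sum>k\<in>UNIV. (if k = a then E' $ a $ b else 0) - (if k = b then (if a = i then r b else 0) else 0))"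
      unfolding mat_nth by (intro sum.cong) (auto simp: E_def E'_def ri algebra_simps)
    then show ?thesis
      by (auto simp: sum_subtractf ri E'_def mat_def)
  qed
  then have "E ** E' = mat 1" by (simp add: vec_eq_iff)
  then have "det E * det E' = 1" by (metis det_I det_mul)
  then have dE: "det E \<noteq> 0" by auto
  have Ei: "E $ a $ i = (if a = i then 1 else 0)" for a
    by (simp add: E_def ri)
  have NE: "(\<Sum>b\<in>UNIV. N $ a $ b * E $ b $ j) = N $ a $ j - N $ a $ i * r j" for a j
  proof -
    have "(\<Sum>b\<in>UNIV. N $ a $ b * E $ b $ j)
      = (\<Sum>b\<in>UNIV. (if b = j then N $ a $ b else 0) - (if b = i then N $ a $ b * r j else 0))"
      by (intro sum.cong) (auto simp: E_def algebra_simps)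
    then show ?thesis by (simp add: sum_subtractf)
  qed
  have cong: "(transpose E ** N ** E) $ s $ j = (\<Sum>a\<in>UNIV. E $ a $ s * (N $ a $ j - N $ a $ i * r j))" for s j
    by (simp add: congruence_nth mult.assoc sum_distrib_left[symmetric] NE)
  have "(transpose E ** N ** E) $ s $ j = 0" if "s \<in> insert i S" "s \<noteq> j" for s j
  proof (cases "s = i")
    case True
    then have "(transpose E ** N ** E) $ s $ j = (\<Sum>a\<in>UNIV. if a = i then N $ i $ j - N $ i $ i * r j else 0)"
      unfolding cong by (intro sum.cong) (auto simp: Ei)
    then show ?thesis using that True assms(4) by (simp add: r_def)
  next
    case False
    then have s: "s \<in> S" using that by simp
    then have N0: "N $ s $ b = 0" if "b \<noteq> s" for b
      using assms(3) that by (auto simp: decoupled_def)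
    then have "r s = 0" using False sym[of i s] by (simp add: r_def)
    then have Es: "E $ a $ s = (if a = s then 1 else 0)" for a
      by (simp add: E_def)
    have "(transpose E ** N ** E) $ s $ j = (\<Sum>a\<in>UNIV. if a = s then N $ s $ j - N $ s $ i * r j else 0)"
      unfolding cong by (intro sum.cong) (auto simp: Es)
    then show ?thesis using that False N0 by simp
  qed
  then have "decoupled (insert i S) (transpose E ** N ** E)"
    by (simp add: decoupled_def)
  with EK dE show ?thesis by blast
qed

text \<open>Replacing e_i by e_i + e_j turns the vanishing diagonal entry into
  \<open>2 * N $ i $ j\<close>. This is where characteristic two would be an obstruction.\<close>

lemma decouple_hyperbolic:
  fixes N :: "'a ^ 'n::finite ^ 'n"
  assumes "N \<in> KM" "transpose N = N" "decoupled S N" "i \<notin> S" "j \<notin> S"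
    "N $ i $ i = 0" "N $ j $ j = 0" "N $ i $ j \<noteq> 0"
  shows "\<exists>E. E \<in> KM \<and> det E \<noteq> 0 \<and> decoupled S (transpose E ** N ** E)
    \<and> (transpose E ** N ** E) $ i $ i \<noteq> 0"
proof -
  have sym: "N $ a $ b = N $ b $ a" for a b
    using assms(2) by (metis transpose_def vec_lambda_beta)
  have ij: "i \<noteq> j" using assms by auto
  define e where "e c = (\<chi> a b. (if a = b then 1 else 0) + (if a = j \<and> b = i then c else 0) :: 'a ^ 'n ^ 'n)" for c
  define E where "E = e 1"
  have EK: "E \<in> KM"
    by (auto simp: E_def e_def KM_iff intro: K_closed)
  have "(e 1 ** e (-1)) $ a $ b = mat 1 $ a $ b" for a b
  proof -
    have "(e 1 ** e (-1)) $ a $ b = (\<Sum>k\<in>UNIV. (if k = a then e (-1) $ a $ b else 0) + (if k = i then (if a = j then e (-1) $ i $ b else 0) else 0))"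
      unfolding mat_nth by (intro sum.cong) (use ij in \<open>auto simp: e_def algebra_simps\<close>)
    then show ?thesis
      using ij by (auto simp: sum.distrib e_def mat_def)
  qed
  then have "E ** e (-1) = mat 1" by (simp add: vec_eq_iff E_def)
  then have "det E * det (e (-1)) = 1" by (metis det_I det_mul)
  then have dE: "det E \<noteq> 0" by auto
  have NE: "(\<Sum>b\<in>UNIV. N $ a $ b * E $ b $ k) = N $ a $ k + (if k = i then N $ a $ j else 0)" for a k
  proof -
    have "(\<Sum>b\<in>UNIV. N $ a $ b * E $ b $ k)
      = (\<Sum>b\<in>UNIV. (if b = k then N $ a $ b else 0) + (if b = j then (if k = i then N $ a $ j else 0) else 0))"
      by (intro sum.cong) (auto simp: E_def e_def algebra_simps)
    then show ?thesis by (simp add: sum.distrib)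
  qed
  have cong: "(transpose E ** N ** E) $ s $ k = (\<Sum>a\<in>UNIV. E $ a $ s * (N $ a $ k + (if k = i then N $ a $ j else 0)))" for s k
    by (simp add: congruence_nth mult.assoc sum_distrib_left[symmetric] NE)
  have "(transpose E ** N ** E) $ s $ k = 0" if "s \<in> S" "s \<noteq> k" for s k
  proof -
    have "s \<noteq> i" "s \<noteq> j" using that assms by auto
    then have "(transpose E ** N ** E) $ s $ k = (\<Sum>a\<in>UNIV. if a = s then N $ s $ k + (if k = i then N $ s $ j else 0) else 0)"
      unfolding cong by (intro sum.cong) (auto simp: E_def e_def)
    then show ?thesis using that \<open>s \<noteq> j\<close> assms(3) by (simp add: decoupled_def)
  qed
  moreover have "(transpose E ** N ** E) $ i $ i = (\<Sum>a\<in>UNIV. (if a = i then N $ i $ i + N $ i $ j else 0) + (if a = j then N $ j $ i + N $ j $ j else 0))"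
    unfolding cong by (intro sum.cong) (use ij in \<open>auto simp: E_def e_def\<close>)
  then have "(transpose E ** N ** E) $ i $ i = 2 * N $ i $ j"
    using assms sym[of i j] by (simp add: sum.distrib)
  ultimately show ?thesis using EK dE two_nz assms(8)
    by (intro exI[of _ E]) (auto simp: decoupled_def)
qed

text \<open>If there is neither a diagonal pivot nor a hyperbolic pair outside \<open>S\<close>, the
  remaining block is zero, and any index can be added without a change of basis.\<close>

lemma decouple_more:
  fixes N :: "'a ^ 'n::finite ^ 'n"
  assumes "N \<in> KM" "transpose N = N" "decoupled S N" "S \<noteq> UNIV"
  shows "\<exists>E i. E \<in> KM \<and> det E \<noteq> 0 \<and> i \<notin> S \<and> decoupled (insert i S) (transpose E ** N ** E)"
proof -
  have sym: "N $ a $ b = N $ b $ a" for a b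
    using assms(2) by (metis transpose_def vec_lambda_beta)
  consider (piv) i where "i \<notin> S" "N $ i $ i \<noteq> 0"
    | (hyp) i j where "i \<notin> S" "j \<notin> S" "N $ i $ i = 0" "N $ j $ j = 0" "N $ i $ j \<noteq> 0"
    | (zero) "\<And>i j. i \<notin> S \<Longrightarrow> j \<notin> S \<Longrightarrow> N $ i $ j = 0"
    by blast
  then show ?thesis
  proof cases
    case piv
    then show ?thesis using decouple_pivot[OF assms(1-3)] by blast
  next
    case hyp
    from decouple_hyperbolic[OF assms(1-3) hyp(1,2) hyp(3-5)]
    obtain E where E: "E \<in> KM" "det E \<noteq> 0" "decoupled S (transpose E ** N ** E)"
      "(transpose E ** N ** E) $ i $ i \<noteq> 0" by blast
    have "transpose E ** N ** E \<in> KM" using E(1) assms(1) by (intro KM_mult KM_transpose)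
    from decouple_pivot[OF this congruence_symmetric[OF assms(2)] E(3,4) hyp(1)]
    obtain E' where E': "E' \<in> KM" "det E' \<noteq> 0"
      "decoupled (insert i S) (transpose E' ** (transpose E ** N ** E) ** E')" by blast
    have "transpose E' ** (transpose E ** N ** E) ** E' = transpose (E ** E') ** N ** (E ** E')"
      by (simp add: matrix_transpose_mul matrix_mul_assoc)
    with E E' hyp(1) show ?thesis
      by (intro exI[of _ "E ** E'"] exI[of _ i]) (auto simp: KM_mult det_mul)
  next
    case zero
    obtain i where i: "i \<notin> S" using assms(4) by blast
    have "decoupled (insert i S) N"
      unfolding decoupled_def
    proof (intro ballI allI impI)
      fix s j assume "s \<in> insert i S" "s \<noteq> j"
      then show "N $ s $ j = 0"
        using zero[of i j] i assms(3) sym[of s j] unfolding decoupled_def by (cases "s \<in> S"; cases "j \<in> S") auto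
    qed
    moreover have "mat 1 \<in> (KM :: ('a ^ 'n ^ 'n) set)"
      by (auto simp: KM_iff mat_def intro: K_closed)
    ultimately show ?thesis using i
      by (intro exI[of _ "mat 1"] exI[of _ i]) (simp add: transpose_mat)
  qed
qed

lemma decouple_card:
  fixes N :: "'a ^ 'n::finite ^ 'n"
  assumes "N \<in> KM" "transpose N = N" "n \<le> CARD('n)"
  shows "\<exists>P S. P \<in> KM \<and> det P \<noteq> 0 \<and> card S = n \<and> decoupled S (transpose P ** N ** P)"
  using assms(3)
proof (induction n)
  case 0
  have "mat 1 \<in> (KM :: ('a ^ 'n ^ 'n) set)"
    by (auto simp: KM_iff mat_def intro: K_closed)
  then show ?case
    by (intro exI[of _ "mat 1"] exI[of _ "{}"]) (simp add: decoupled_def)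
next
  case (Suc n)
  then obtain P S where P: "P \<in> KM" "det P \<noteq> 0" "card S = n" "decoupled S (transpose P ** N ** P)"
    by auto
  have "S \<noteq> UNIV" using P(3) Suc.prems by auto
  moreover have "transpose P ** N ** P \<in> KM" using P(1) assms(1) by (intro KM_mult KM_transpose)
  ultimately obtain E i where E: "E \<in> KM" "det E \<noteq> 0" "i \<notin> S"
    "decoupled (insert i S) (transpose E ** (transpose P ** N ** P) ** E)"
    using decouple_more[OF _ congruence_symmetric[OF assms(2)] P(4)] by blast
  have "transpose E ** (transpose P ** N ** P) ** E = transpose (P ** E) ** N ** (P ** E)"
    by (simp add: matrix_transpose_mul matrix_mul_assoc)
  with E P show ?case
    by (intro exI[of _ "P ** E"] exI[of _ "insert i S"]) (auto simp: KM_mult det_mul)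
qed

text \<open>Over the residue field this serves the point counts; with the whole algebraically closed
  field as \<open>K\<close> it serves \<open>two_quadrics_common_zero\<close>.\<close>

theorem diagonalize:
  fixes N :: "'a ^ 'n::finite ^ 'n"
  assumes "N \<in> KM" "transpose N = N"
  obtains P d where "P \<in> KM" "det P \<noteq> 0" "\<And>i. d i \<in> K" "transpose P ** N ** P = diag d"
proof -
  obtain P S where P: "P \<in> KM" "det P \<noteq> 0" "card S = CARD('n)" "decoupled S (transpose P ** N ** P)"
    using decouple_card[OF assms order.refl] by blast
  have "S = UNIV" using P(3) by (simp add: card_eq_UNIV_imp_eq_UNIV)
  define d where "d i = (transpose P ** N ** P) $ i $ i" for i
  have "transpose P ** N ** P = diag d"
    using P(4) \<open>S = UNIV\<close> by (auto simp: vec_eq_iff diag_nth d_def decoupled_def)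
  moreover have "transpose P ** N ** P \<in> KM" using P(1) assms(1) by (intro KM_mult KM_transpose)
  then have "d i \<in> K" for i by (simp add: d_def KM_iff)
  ultimately show ?thesis using that P by blast
qed

end

section \<open>Representation numbers of diagonal forms\<close>

context odd_finite_subfield
begin

definition zeros :: "'a ^ 'n::finite ^ 'n \<Rightarrow> nat" where
  "zeros M = card {v\<in>KV. quad M v = 0}"

lemma zeros_congruence:
  fixes M :: "'a ^ 'n::finite ^ 'n"
  assumes "P \<in> KM" "det P \<noteq> 0"
  shows "zeros (transpose P ** M ** P) = zeros M"
proof -
  have b: "bij_betw (\<lambda>v. P *v v) KV KV" by (rule bij_betw_KM[OF assms])
  have "bij_betw (\<lambda>v. P *v v) {v\<in>KV. quad M (P *v v) = 0} {v\<in>KV. quad M v = 0}"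
  proof -
    have "inj_on (\<lambda>v. P *v v) {v\<in>KV. quad M (P *v v) = 0}"
      using b by (auto simp: bij_betw_def intro: inj_on_subset)
    moreover have "(\<lambda>v. P *v v) ` {v\<in>KV. quad M (P *v v) = 0} = {v\<in>KV. quad M v = 0}"
      using b unfolding bij_betw_def by (auto simp: image_iff)
    ultimately show ?thesis by (simp add: bij_betw_def)
  qed
  then show ?thesis
    unfolding zeros_def quad_congruence by (rule bij_betw_same_card)
qed

text \<open>A cardinality, written as a double sum so that \<open>sum_sqrt\<close> can be applied to
  each variable.\<close>

definition rep2 :: "'a \<Rightarrow> 'a \<Rightarrow> 'a \<Rightarrow> int" where
  "rep2 a b c = (\<Sum>x\<in>K. \<Sum>y\<in>K. if a * x ^ 2 + b * y ^ 2 = c then 1 else 0)"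

lemma rep2_commute: "rep2 a b c = rep2 b a c"
  unfolding rep2_def by (subst sum.swap) (simp add: add.commute)

lemma sum_K_shift:
  "c \<in> K \<Longrightarrow> (\<Sum>x\<in>K. f (c - x)) = (\<Sum>x\<in>K. f x)"
  by (rule sum.reindex_bij_witness[of _ "\<lambda>x. c - x" "\<lambda>x. c - x"]) (auto intro: K_diff)

lemma sum_K_scale:
  "c \<in> K \<Longrightarrow> c \<noteq> 0 \<Longrightarrow> (\<Sum>x\<in>K. f (c * x)) = (\<Sum>x\<in>K. f x)"
  by (rule sum.reindex_bij_witness[of _ "\<lambda>x. x / c" "\<lambda>x. c * x"]) (auto intro: K_mult K_divide)

text \<open>This is the Jacobi sum of the quadratic character. As s (c - s) = s^2 (c/s - 1), the
  summand at a non-zero \<open>s\<close> is the character of c/s - 1; inverting \<open>s\<close>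
  leaves the character of a polynomial of degree at most one, with one term missing.\<close>

lemma sum_chi_pair:
  assumes "c \<in> K"
  shows "(\<Sum>s\<in>K. chi s * chi (c - s)) = (if c = 0 then int q - 1 else - 1) * chi (- 1)"
proof -
  have m1: "- 1 \<in> K" by (intro K_closed)
  have K: "K = insert 0 (K - {0})" using K_0 by blast
  have split: "(\<Sum>s\<in>K. g s) = g 0 + (\<Sum>s\<in>K - {0}. g s)" for g :: "'a \<Rightarrow> int"
    using finite_K K_0 by (simp add: sum.remove)
  have "(\<Sum>s\<in>K. chi s * chi (c - s)) = (\<Sum>s\<in>K - {0}. chi (c * inverse s + (- 1)))"
  proof -
    have "chi s * chi (c - s) = chi (c * inverse s + (- 1))" if "s \<in> K - {0}" for s
    proof -
      have "chi s * chi (c - s) = chi (s * (c - s))"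
        using that assms by (intro chi_mult[symmetric] K_diff) auto
      also have "s * (c - s) = s ^ 2 * (c * inverse s + (- 1))"
        using that by (simp add: field_simps power2_eq_square)
      also have "chi \<dots> = chi (s ^ 2) * chi (c * inverse s + (- 1))"
        using that assms m1 by (intro chi_mult) (auto intro: K_closed)
      finally show ?thesis using that by (simp add: chi_square)
    qed
    then show ?thesis by (simp add: split)
  qed
  also have "\<dots> = (\<Sum>t\<in>K - {0}. chi (c * t + (- 1)))"
    by (rule sum.reindex_bij_witness[of _ inverse inverse]) (auto intro: K_inverse)
  also have "\<dots> = (\<Sum>t\<in>K. chi (c * t + (- 1))) - chi (- 1)"
    by (simp add: split)
  also have "(\<Sum>t\<in>K. chi (c * t + (- 1))) = (if c = 0 then int q * chi (- 1) else 0)"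
  proof (cases "c = 0")
    case False
    have "(\<Sum>t\<in>K. chi (c * t + (- 1))) = (\<Sum>t\<in>K. chi t)"
      by (rule sum.reindex_bij_witness[of _ "\<lambda>t. (t + 1) / c" "\<lambda>t. c * t + (- 1)"])
        (use False assms m1 in \<open>auto intro: K_closed\<close>)
    with False show ?thesis by (simp add: sum_chi)
  qed simp
  finally show ?thesis by (cases "c = 0") (simp_all add: algebra_simps)
qed

text \<open>With squares replaced by the weights \<open>1 + chi\<close>, the constant term gives
  \<open>q\<close>, the linear terms vanish by \<open>sum_chi\<close>, and the product term is the
  Jacobi sum. The exceptional value at \<open>c = 0\<close> tells split forms from anisotropic
  ones.\<close>

lemma rep2_nondegenerate:
  assumes "a \<in> K" "b \<in> K" "c \<in> K" "a \<noteq> 0" "b \<noteq> 0"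
  shows "rep2 a b c = int q - chi (- (a * b)) + (if c = 0 then int q * chi (- (a * b)) else 0)"
proof -
  have m1: "- 1 \<in> K" by (intro K_closed)
  have cd: "chi (s / a) = chi s * chi a" if "s \<in> K" "a \<in> K" for s a
    using that by (simp add: divide_inverse chi_mult K_inverse chi_inverse)
  have "rep2 a b c = (\<Sum>s\<in>K. \<Sum>t\<in>K. (1 + chi s) * (1 + chi t) * (if a * s + b * t = c then 1 else 0))"
    unfolding rep2_def
    by (simp add: sum_sqrt[of "\<lambda>s. if _ + _ * s = _ then 1 else 0"] sum_distrib_left mult.assoc
        sum_sqrt[of "\<lambda>s. \<Sum>t\<in>K. (1 + chi t) * (if _ * s + _ * t = _ then 1 else 0)"])
  also have "\<dots> = (\<Sum>s\<in>K. \<Sum>t\<in>K. if t = (c - a * s) / b then (1 + chi s) * (1 + chi ((c - a * s) / b)) else 0)"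
    by (intro sum.cong refl) (use assms in \<open>auto simp: field_simps\<close>)
  also have "\<dots> = (\<Sum>s\<in>K. (1 + chi s) * (1 + chi ((c - a * s) / b)))"
    by (intro sum.cong refl) (use assms finite_K in \<open>auto intro: K_closed\<close>)
  also have "\<dots> = (\<Sum>s\<in>K. (1 + chi (a * s / a)) * (1 + chi ((c - a * s) / b)))"
    using assms by simp
  also have "\<dots> = (\<Sum>s\<in>K. (1 + chi (s / a)) * (1 + chi ((c - s) / b)))"
    by (rule sum_K_scale) fact+
  also have "\<dots> = (\<Sum>s\<in>K. (1 + chi s * chi a) * (1 + chi (c - s) * chi b))"
    by (intro sum.cong refl) (use assms in \<open>auto simp: cd K_diff\<close>)
  also have "\<dots> = (\<Sum>s\<in>K. 1 + chi s * chi a + chi (c - s) * chi b + chi a * chi b * (chi s * chi (c - s)))"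
    by (intro sum.cong refl) (simp add: algebra_simps)
  also have "\<dots> = int q + chi a * chi b * (\<Sum>s\<in>K. chi s * chi (c - s))"
    using sum_K_shift[of c chi] assms(3)
    by (simp add: sum.distrib sum_distrib_right[symmetric] sum_distrib_left[symmetric] sum_chi)
  also have "\<dots> = int q + chi a * chi b * ((if c = 0 then int q - 1 else - 1) * chi (- 1))"
    by (simp only: sum_chi_pair[OF assms(3)])
  also have "chi a * chi b * ((if c = 0 then int q - 1 else - 1) * chi (- 1))
      = (if c = 0 then int q - 1 else - 1) * chi (- 1 * (a * b))"
    using assms m1 by (simp only: chi_mult K_mult) (simp add: algebra_simps)
  finally show ?thesis by (auto simp: algebra_simps)
qed

lemma rep2_degenerate:
  assumes "a \<in> K" "c \<in> K" "a \<noteq> 0"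
  shows "rep2 a 0 c = int q * (1 + chi (c * a))"
proof -
  have "rep2 a 0 c = int q * (\<Sum>x\<in>K. if a * x ^ 2 = c then 1 else 0)"
    by (simp add: rep2_def sum_distrib_left)
  also have "(\<Sum>x\<in>K. if a * x ^ 2 = c then 1 else 0) = (\<Sum>s\<in>K. (1 + chi s) * (if a * s = c then 1 else 0))"
    by (rule sum_sqrt)
  also have "\<dots> = (\<Sum>s\<in>K. if s = c / a then 1 + chi (c / a) else 0)"
    by (intro sum.cong) (use assms in \<open>auto simp: field_simps\<close>)
  also have "\<dots> = 1 + chi (c / a)"
    using assms finite_K by (simp add: K_divide)
  also have "chi (c / a) = chi (c * a)"
    using assms by (simp add: divide_inverse chi_mult K_inverse chi_inverse)
  finally show ?thesis by simp
qed

text \<open>The zeros of a diagonal form in four variables, sorted by the value \<open>g\<close> of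
  its first half.\<close>

definition rep4 :: "'a \<Rightarrow> 'a \<Rightarrow> 'a \<Rightarrow> 'a \<Rightarrow> int" where
  "rep4 a b c d = (\<Sum>g\<in>K. rep2 a b g * rep2 c d (- g))"

text \<open>These permutations can move any coefficient to the second place, where
  \<open>rep4_corank_1\<close> expects the zero.\<close>

lemma rep4_sym: "rep4 a b c d = rep4 b a c d" "rep4 a b c d = rep4 c d a b"
  "rep4 a b c d = rep4 a b d c"
proof -
  show "rep4 a b c d = rep4 b a c d" by (simp add: rep4_def rep2_commute)
  show "rep4 a b c d = rep4 a b d c" by (simp add: rep4_def rep2_commute[of c d])
  show "rep4 a b c d = rep4 c d a b"
    unfolding rep4_def
    by (rule sum.reindex_bij_witness[of _ uminus uminus]) (auto intro: K_uminus)
qed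

lemma sum_K_delta0: "(\<Sum>g\<in>K. if g = 0 then x else 0) = (x :: int)"
  using finite_K K_0 by simp

text \<open>Each half is constant in \<open>g\<close> except for a jump at \<open>g = 0\<close>. In
  the result the characters of the two half discriminants occur only through their product, the
  character of the whole discriminant.\<close>

lemma rep4_nondegenerate:
  assumes "{a, b, c, d} \<subseteq> K - {0}"
  shows "rep4 a b c d = int q ^ 3 + chi (a * b * c * d) * int q * (int q - 1)"
proof -
  define e where "e = chi (- (a * b))"
  define e' where "e' = chi (- (c * d))"
  have "chi (a * b * c * d) = chi (- (a * b) * - (c * d))" by (simp add: mult.assoc)
  also have "\<dots> = e * e'"
    unfolding e_def e'_def using assms by (intro chi_mult) (auto intro: K_closed)
  finally have 1: "chi (a * b * c * d) = e * e'" .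
  have "rep4 a b c d = (\<Sum>g\<in>K. (int q - e) * (int q - e')
      + (if g = 0 then (int q - e) * int q * e' + int q * e * (int q - e') + int q * int q * e * e' else 0))"
    unfolding rep4_def
    by (intro sum.cong refl) (use assms in \<open>auto simp: rep2_nondegenerate e_def e'_def K_uminus algebra_simps\<close>)
  also have "\<dots> = int q * ((int q - e) * (int q - e'))
      + ((int q - e) * int q * e' + int q * e * (int q - e') + int q * int q * e * e')"
    by (simp add: sum.distrib sum_K_delta0)
  also have "\<dots> = int q ^ 3 + e * e' * int q * (int q - 1)"
    by (simp add: algebra_simps power3_eq_cube)
  finally show ?thesis by (simp add: 1)
qed

text \<open>A cone over a smooth conic: the degenerate half involves \<open>chi (a * g)\<close>,
  whose sum over \<open>K\<close> is zero, and the remaining character terms cancel.\<close>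

lemma rep4_corank_1:
  assumes "{a, c, d} \<subseteq> K - {0}"
  shows "rep4 a 0 c d = int q ^ 3"
proof -
  define e where "e = chi (- (c * d))"
  have "rep4 a 0 c d = (\<Sum>g\<in>K. int q * (int q - e) * (1 + chi (a * g)) + (if g = 0 then int q * int q * e else 0))"
    unfolding rep4_def
    by (intro sum.cong refl) (use assms in \<open>auto simp: rep2_nondegenerate rep2_degenerate e_def K_uminus algebra_simps\<close>)
  also have "\<dots> = int q * (int q - e) * (int q + (\<Sum>g\<in>K. chi (a * g))) + int q * int q * e"
    by (simp only: sum.distrib sum_K_delta0 sum_distrib_left[symmetric]) simp
  also have "(\<Sum>g\<in>K. chi (a * g)) = 0"
    using assms sum_K_scale[of a chi] by (simp add: sum_chi)
  finally show ?thesis by (simp add: algebra_simps power3_eq_cube)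
qed

end

section \<open>Zeros of quadratic forms in three and four variables\<close>

lemma UNIV_3_option: "(UNIV :: 3 option set) = {None, Some 1, Some 2, Some 3}"
  by (auto simp: UNIV_option_conv UNIV_3)

context odd_finite_subfield
begin

lemma sum_KV_3_option:
  fixes f :: "'a ^ 3 option \<Rightarrow> int"
  defines "mk \<equiv> \<lambda>w x y z. \<chi> i. case i of None \<Rightarrow> w | Some j \<Rightarrow> if j = 1 then x else if j = 2 then y else z"
  shows "(\<Sum>v\<in>KV. f v) = (\<Sum>w\<in>K. \<Sum>x\<in>K. \<Sum>y\<in>K. \<Sum>z\<in>K. f (mk w x y z))"
proof -
  have mk: "mk (v $ None) (v $ Some 1) (v $ Some 2) (v $ Some 3) = v" for v
    unfolding vec_eq_iff mk_def
  proof
    fix i :: "3 option"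
    show "(\<chi> i. case i of None \<Rightarrow> v $ None | Some j \<Rightarrow> if j = 1 then v $ Some 1 else if j = 2 then v $ Some 2 else v $ Some 3) $ i = v $ i"
    proof (cases i)
      case (Some j)
      then show ?thesis using exhaust_3[of j] by auto
    qed simp
  qed
  have nth: "mk w x y z $ None = w" "mk w x y z $ Some 1 = x" "mk w x y z $ Some 2 = y" "mk w x y z $ Some 3 = z"
    for w x y z
    by (simp_all add: mk_def)
  have KV: "mk w x y z \<in> KV" if "w \<in> K" "x \<in> K" "y \<in> K" "z \<in> K" for w x y z
    using that by (auto simp: KV_iff mk_def split: option.splits)
  have "(\<Sum>v\<in>KV. f v) = (\<Sum>(w, x, y, z)\<in>K \<times> K \<times> K \<times> K. f (mk w x y z))"
    by (rule sum.reindex_bij_witness[of _ "\<lambda>(w, x, y, z). mk w x y z"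
          "\<lambda>v. (v $ None, v $ Some 1, v $ Some 2, v $ Some 3)"])
      (auto simp only: mk nth KV split: prod.splits, auto simp: KV_iff)
  then show ?thesis by (simp add: sum.cartesian_product)
qed

lemma vector_3_nth: "vector [v $ 1, v $ 2, v $ 3] = (v :: 'b::zero ^ 3)"
  by (simp add: vec_eq_iff forall_3)

lemma sum_KV_3:
  fixes f :: "'a ^ 3 \<Rightarrow> int"
  shows "(\<Sum>v\<in>KV. f v) = (\<Sum>x\<in>K. \<Sum>y\<in>K. \<Sum>z\<in>K. f (vector [x, y, z]))"
proof -
  have "(\<Sum>v\<in>KV. f v) = (\<Sum>(x, y, z)\<in>K \<times> K \<times> K. f (vector [x, y, z]))"
    by (rule sum.reindex_bij_witness[of _ "\<lambda>(x, y, z). vector [x, y, z]" "\<lambda>v :: 'a ^ 3. (v $ 1, v $ 2, v $ 3)"])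
      (auto simp: KV_iff vector_3_nth forall_3)
  then show ?thesis by (simp add: sum.cartesian_product)
qed

lemma zeros_sum: "int (zeros M) = (\<Sum>v\<in>KV. if quad M v = 0 then 1 else 0)"
  by (simp add: zeros_def sum.If_cases Int_def)

lemma zeros_diag_4:
  fixes d :: "3 option \<Rightarrow> 'a"
  assumes "\<And>i. d i \<in> K"
  shows "int (zeros (diag d)) = rep4 (d None) (d (Some 1)) (d (Some 2)) (d (Some 3))"
proof -
  have "int (zeros (diag d)) = (\<Sum>w\<in>K. \<Sum>x\<in>K. rep2 (d (Some 2)) (d (Some 3)) (- (d None * w ^ 2 + d (Some 1) * x ^ 2)))"
    unfolding zeros_sum sum_KV_3_option quad_diag rep2_def
  proof (intro sum.cong refl)
    fix w x y z
    show "(if (\<Sum>i\<in>UNIV. d i * (\<chi> i. case i of None \<Rightarrow> w | Some j \<Rightarrow> if j = 1 then x else if j = 2 then y else z) $ i ^ 2) = 0 then 1 else 0)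
      = (if d (Some 2) * y ^ 2 + d (Some 3) * z ^ 2 = - (d None * w ^ 2 + d (Some 1) * x ^ 2) then 1 else (0::int))"
      unfolding eq_neg_iff_add_eq_0 by (simp add: UNIV_3_option add_ac)
  qed
  also have "\<dots> = (\<Sum>w\<in>K. \<Sum>x\<in>K. \<Sum>g\<in>K. (if d None * w ^ 2 + d (Some 1) * x ^ 2 = g then 1 else 0)
      * rep2 (d (Some 2)) (d (Some 3)) (- g))"
  proof (intro sum.cong refl)
    fix w x assume "w \<in> K" "x \<in> K"
    then have "d None * w ^ 2 + d (Some 1) * x ^ 2 \<in> K"
      using assms by (intro K_closed)
    then show "rep2 (d (Some 2)) (d (Some 3)) (- (d None * w ^ 2 + d (Some 1) * x ^ 2))
      = (\<Sum>g\<in>K. (if d None * w ^ 2 + d (Some 1) * x ^ 2 = g then 1 else 0) * rep2 (d (Some 2)) (d (Some 3)) (- g))"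
      using finite_K by (simp add: if_distrib[of "\<lambda>x. x * _"] cong: if_cong)
  qed
  also have "\<dots> = (\<Sum>w\<in>K. \<Sum>g\<in>K. \<Sum>x\<in>K. (if d None * w ^ 2 + d (Some 1) * x ^ 2 = g then 1 else 0)
      * rep2 (d (Some 2)) (d (Some 3)) (- g))"
    by (rule sum.cong[OF refl], rule sum.swap)
  also have "\<dots> = (\<Sum>g\<in>K. \<Sum>w\<in>K. \<Sum>x\<in>K. (if d None * w ^ 2 + d (Some 1) * x ^ 2 = g then 1 else 0)
      * rep2 (d (Some 2)) (d (Some 3)) (- g))"
    by (rule sum.swap)
  also have "\<dots> = rep4 (d None) (d (Some 1)) (d (Some 2)) (d (Some 3))"
    unfolding rep4_def rep2_def[of "d None"] sum_distrib_right by (rule refl)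
  finally show ?thesis .
qed

lemma zeros_diag_3:
  assumes "\<And>i. d i \<in> K" "\<And>i. d i \<noteq> 0"
  shows "int (zeros (diag (d :: 3 \<Rightarrow> 'a))) = int q ^ 2"
proof -
  define e where "e = chi (- (d 2 * d 3))"
  have "int (zeros (diag d)) = (\<Sum>x\<in>K. rep2 (d 2) (d 3) (- (d 1 * x ^ 2)))"
    unfolding zeros_sum sum_KV_3 quad_diag rep2_def
  proof (intro sum.cong refl)
    fix x y z
    show "(if (\<Sum>i\<in>UNIV. d i * vector [x, y, z] $ i ^ 2) = 0 then 1 else 0)
      = (if d 2 * y ^ 2 + d 3 * z ^ 2 = - (d 1 * x ^ 2) then 1 else (0::int))"
      unfolding eq_neg_iff_add_eq_0 by (simp add: sum_3 add_ac)
  qed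
  also have "\<dots> = (\<Sum>x\<in>K. int q - e + (if x = 0 then int q * e else 0))"
    by (intro sum.cong refl, subst rep2_nondegenerate) (use assms in \<open>auto simp: e_def intro: K_closed\<close>)
  also have "\<dots> = int q ^ 2"
    by (simp only: sum.distrib sum_K_delta0) (simp add: algebra_simps power2_eq_square)
  finally show ?thesis .
qed

lemma card_KV_coordinate_0: "q * card {w \<in> (KV :: ('a ^ 'n::finite) set). w $ i = 0} = q ^ CARD('n)"
proof -
  have "bij_betw (\<lambda>(a, w). \<chi> j. if j = i then a else w $ j) (K \<times> {w \<in> (KV :: ('a ^ 'n) set). w $ i = 0}) KV"
    by (rule bij_betwI[where g = "\<lambda>v. (v $ i, \<chi> j. if j = i then 0 else v $ j)"])
      (auto simp: KV_iff vec_eq_iff K_0)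
  from bij_betw_same_card[OF this] show ?thesis by (simp add: card_cartesian_product card_KV)
qed

text \<open>After diagonalisation some \<open>d i\<close> is non-zero, and fixing all other
  coordinates leaves a quadratic equation for the i-th, with at most two solutions. The factor
  \<open>q\<close> on the left stands for an exponent lower by one on the right.\<close>

lemma zeros_le:
  fixes M :: "'a ^ 'n::finite ^ 'n"
  assumes "M \<in> KM" "transpose M = M" "M \<noteq> 0"
  shows "q * zeros M \<le> 2 * q ^ CARD('n)"
proof -
  obtain P d where P: "P \<in> KM" "det P \<noteq> 0" "\<And>i. d i \<in> K" "transpose P ** M ** P = diag d"
    using diagonalize[OF assms(1,2)] by blast
  have "\<exists>i. d i \<noteq> 0"
  proof (rule ccontr)
    assume "\<not> (\<exists>i. d i \<noteq> 0)"
    then have 0: "transpose P ** M ** P = 0" using P(4) by (simp add: diag_def vec_eq_iff)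
    obtain R where R: "P ** R = mat 1" "R ** P = mat 1"
      using P(2) invertible_det_nz unfolding invertible_def by metis
    have "M = transpose (P ** R) ** M ** (P ** R)" by (simp add: R)
    also have "\<dots> = transpose R ** (transpose P ** M ** P) ** R"
      by (simp only: matrix_transpose_mul matrix_mul_assoc)
    finally have "M = 0" unfolding 0
      by (simp add: vec_eq_iff mat_nth)
    with assms(3) show False by simp
  qed
  then obtain i where i: "d i \<noteq> 0" by blast
  let ?W = "{w \<in> (KV :: ('a ^ 'n) set). w $ i = 0}"
  let ?S = "{v\<in>KV. quad (diag d) v = 0}"
  let ?f = "\<lambda>v. \<chi> j. if j = i then 0 else v $ j"
  have fW: "?f ` ?S \<subseteq> ?W" by (auto simp: KV_iff K_0)
  have "card {v\<in>?S. ?f v = w} \<le> 2" if w: "w \<in> ?W" for w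
  proof -
    define c where "c = - (\<Sum>j\<in>UNIV - {i}. d j * w $ j ^ 2) / d i"
    have cK: "c \<in> K" unfolding c_def
      by (intro K_closed P(3)) (use w in \<open>auto simp: KV_iff\<close>)
    have "(\<lambda>v :: 'a ^ 'n. v $ i) ` {v\<in>?S. ?f v = w} \<subseteq> {y\<in>K. y ^ 2 = c}"
    proof safe
      fix v assume v: "v \<in> KV" "quad (diag d) v = 0" "w = ?f v"
      show "v $ i \<in> K" using v by (simp add: KV_iff)
      have "d i * v $ i ^ 2 + (\<Sum>j\<in>UNIV - {i}. d j * v $ j ^ 2) = 0"
        using v(2) unfolding quad_diag by (simp add: sum.remove[of _ i])
      moreover have "(\<Sum>j\<in>UNIV - {i}. d j * v $ j ^ 2) = (\<Sum>j\<in>UNIV - {i}. d j * w $ j ^ 2)"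
        using v(3) by (intro sum.cong) auto
      ultimately have "d i * v $ i ^ 2 = - (\<Sum>j\<in>UNIV - {i}. d j * w $ j ^ 2)"
        by (simp add: eq_neg_iff_add_eq_0)
      then show "(v $ i) ^ 2 = c" using i by (simp add: c_def field_simps)
    qed
    moreover have "inj_on (\<lambda>v :: 'a ^ 'n. v $ i) {v\<in>?S. ?f v = w}"
    proof (rule inj_onI)
      fix v v' assume "v \<in> {v\<in>?S. ?f v = w}" "v' \<in> {v\<in>?S. ?f v = w}" and e: "v $ i = v' $ i"
      then have "?f v = ?f v'" by simp
      then have "v $ j = v' $ j" for j
        using e by (cases "j = i") (auto simp: vec_eq_iff split: if_splits)
      then show "v = v'" by (simp add: vec_eq_iff)
    qed
    ultimately have "card {v\<in>?S. ?f v = w} \<le> card {y\<in>K. y ^ 2 = c}"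
      using finite_K by (intro card_inj_on_le[of "\<lambda>v :: 'a ^ 'n. v $ i"]) auto
    then show ?thesis using card_sqrt[OF cK] abs_chi[of c] by linarith
  qed
  then have "(\<Sum>w\<in>?W. card {v\<in>?S. ?f v = w}) \<le> (\<Sum>w\<in>?W. 2)"
    by (intro sum_mono) auto
  moreover have "(\<Sum>w\<in>?W. card {v\<in>?S. ?f v = w}) = card ?S"
    using sum.group[of ?S ?W ?f "\<lambda>_. 1 :: nat"] fW by simp
  moreover have "zeros M = zeros (diag d)"
    using zeros_congruence[OF P(1,2), of M] P(4) by simp
  ultimately have "zeros M \<le> 2 * card ?W" by (simp add: zeros_def)
  then have "q * zeros M \<le> q * (2 * card ?W)" by (rule mult_le_mono2)
  then have "q * zeros M \<le> 2 * (q * card ?W)" by (simp only: mult.left_commute)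
  then show ?thesis by (simp only: card_KV_coordinate_0)
qed

text \<open>Rank at least n - 1, put in terms of a diagonalisation over \<open>K\<close>: the point
  counts use it in this form, and its negation provides a diagonal form with two zero
  entries.\<close>

definition corank_le_1 :: "'a ^ 'n::finite ^ 'n \<Rightarrow> bool" where
  "corank_le_1 M \<longleftrightarrow> (\<exists>P d i. P \<in> KM \<and> det P \<noteq> 0 \<and> (\<forall>j. d j \<in> K) \<and> transpose P ** M ** P = diag d
     \<and> (\<forall>j. j \<noteq> i \<longrightarrow> d j \<noteq> 0))"

lemma not_corank_le_1E:
  fixes M :: "'a ^ 'n::finite ^ 'n"
  assumes "M \<in> KM" "transpose M = M" "\<not> corank_le_1 M"
  obtains P d i j where "P \<in> KM" "det P \<noteq> 0" "transpose P ** M ** P = diag d" "i \<noteq> j" "d i = 0" "d j = 0"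
proof -
  obtain P d where P: "P \<in> KM" "det P \<noteq> 0" "\<And>i. d i \<in> K" "transpose P ** M ** P = diag d"
    using diagonalize[OF assms(1,2)] by blast
  with assms(3) have *: "\<exists>j. j \<noteq> i \<and> d j = 0" for i
    unfolding corank_le_1_def by blast
  then obtain i where "d i = 0" by blast
  with *[of i] P that show ?thesis by metis
qed

lemma chi_det_congruence:
  assumes "M \<in> KM" "P \<in> KM" "det P \<noteq> 0"
  shows "chi (det (transpose P ** M ** P)) = chi (det M)"
proof -
  have "det (transpose P ** M ** P) = det P ^ 2 * det M"
    by (simp add: det_mul power2_eq_square)
  then show ?thesis
    using assms by (simp add: chi_mult K_det K_power chi_square)
qed

text \<open>Smooth quadrics and cones obey one formula, since in corank one the determinant is zero
  and the character term disappears.\<close>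

lemma zeros_corank_le_1:
  fixes M :: "'a ^ 3 option ^ 3 option"
  assumes "M \<in> KM" "corank_le_1 M"
  shows "int (zeros M) = int q ^ 3 + chi (det M) * int q * (int q - 1)"
proof -
  obtain P d i where P: "P \<in> KM" "det P \<noteq> 0" "\<And>i. d i \<in> K" "transpose P ** M ** P = diag d"
    and i: "\<And>j. j \<noteq> i \<Longrightarrow> d j \<noteq> 0"
    using assms(2) unfolding corank_le_1_def by blast
  have z: "zeros M = zeros (diag d)"
    using zeros_congruence[OF P(1,2), of M] P(4) by simp
  have c: "chi (det M) = chi (d None * d (Some 1) * d (Some 2) * d (Some 3))"
    using chi_det_congruence[OF assms(1) P(1,2)] unfolding P(4) det_diag
    by (simp add: UNIV_3_option mult.assoc)
  show ?thesis
  proof (cases "d i = 0")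
    case False
    then have nz: "d j \<noteq> 0" for j using i by metis
    then show ?thesis unfolding z c zeros_diag_4[OF P(3)]
      by (intro rep4_nondegenerate) (use P(3) in auto)
  next
    case True
    then have "det (diag d) = 0" unfolding det_diag by auto
    then have c0: "chi (det M) = 0"
      using chi_det_congruence[OF assms(1) P(1,2)] unfolding P(4) by simp
    have "i \<in> {None, Some 1, Some 2, Some 3}" using UNIV_3_option by auto
    then consider "i = Some 1" | "i = None" | "i = Some 2" | "i = Some 3" by auto
    then have "rep4 (d None) (d (Some 1)) (d (Some 2)) (d (Some 3)) = int q ^ 3"
    proof cases
      case 1
      then show ?thesis using True i P(3) by (auto intro!: rep4_corank_1)
    next
      case 2
      then show ?thesis using True i P(3) by (subst rep4_sym(1)) (auto intro!: rep4_corank_1)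
    next
      case 3
      then show ?thesis using True i P(3) by (subst rep4_sym(2), subst rep4_sym(1)) (auto intro!: rep4_corank_1)
    next
      case 4
      then show ?thesis using True i P(3) by (subst rep4_sym(2)) (auto intro!: rep4_corank_1)
    qed
    then show ?thesis unfolding z c0 zeros_diag_4[OF P(3)] by simp
  qed
qed

lemma zeros_3_nondegenerate:
  fixes M :: "'a ^ 3 ^ 3"
  assumes "M \<in> KM" "transpose M = M" "det M \<noteq> 0"
  shows "zeros M = q ^ 2"
proof -
  obtain P d where P: "P \<in> KM" "det P \<noteq> 0" "\<And>i. d i \<in> K" "transpose P ** M ** P = diag d"
    using diagonalize[OF assms(1,2)] by blast
  have "det (transpose P ** M ** P) \<noteq> 0" using P(2) assms(3) by (simp add: det_mul)
  then have "d i \<noteq> 0" for i unfolding P(4) det_diag by auto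
  from zeros_diag_3[of d, OF P(3) this]
  have "int (zeros (diag d)) = int (q ^ 2)" by simp
  then show ?thesis
    using zeros_congruence[OF P(1,2), of M] P(4) by (metis of_nat_eq_iff)
qed

end

section \<open>Multivariate polynomials\<close>

text \<open>A predicate on plain functions, because coefficient embeddings, reductions, evaluations
  and substitutions all have to be composed and pushed through \<open>mp_eval\<close> and
  \<open>det\<close>.\<close>

definition ring_hom_fun :: "('r::comm_ring_1 \<Rightarrow> 's::comm_ring_1) \<Rightarrow> bool" where
  "ring_hom_fun h \<longleftrightarrow> h 1 = 1 \<and> (\<forall>a b. h (a + b) = h a + h b) \<and> (\<forall>a b. h (a * b) = h a * h b)"

context
  fixes h :: "'r::comm_ring_1 \<Rightarrow> 's::comm_ring_1"
  assumes h: "ring_hom_fun h"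
begin

lemma hom_1: "h 1 = 1" and hom_add: "h (a + b) = h a + h b" and hom_mult: "h (a * b) = h a * h b"
  using h by (auto simp: ring_hom_fun_def)

lemma hom_0: "h 0 = 0"
  using hom_add[of 0 0] by simp

lemma hom_uminus: "h (- a) = - h a"
  using hom_add[of a "- a"] by (simp add: hom_0 eq_neg_iff_add_eq_0 add.commute)

lemma hom_diff: "h (a - b) = h a - h b"
  using hom_add[of a "- b"] by (simp add: hom_uminus)

lemma hom_sum: "h (sum f A) = (\<Sum>i\<in>A. h (f i))"
  by (induction A rule: infinite_finite_induct) (auto simp: hom_0 hom_add)

lemma hom_prod: "h (prod f A) = (\<Prod>i\<in>A. h (f i))"
  by (induction A rule: infinite_finite_induct) (auto simp: hom_1 hom_mult)

lemma hom_power: "h (a ^ n) = h a ^ n"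
  by (induction n) (auto simp: hom_1 hom_mult)

lemma hom_of_nat: "h (of_nat n) = of_nat n"
  by (induction n) (auto simp: hom_0 hom_1 hom_add)

lemma hom_of_int: "h (of_int n) = of_int n"
  by (cases n) (auto simp: hom_of_nat hom_uminus hom_diff hom_1)

lemma hom_det: "h (det A) = det (\<chi> i j. h (A $ i $ j))"
  unfolding det_def hom_sum by (simp add: hom_mult hom_of_int hom_prod)

end

lemma hom_id: "ring_hom_fun (\<lambda>a. a)"
  by (simp add: ring_hom_fun_def)

lemma hom_pCons: "ring_hom_fun (\<lambda>a. [:a:])"
  by (simp add: ring_hom_fun_def one_pCons)

lemma hom_poly: "ring_hom_fun (\<lambda>p. poly p a)"
  by (simp add: ring_hom_fun_def)

lemma poly_mapping_sum_single:
  "f = (\<Sum>m\<in>Poly_Mapping.keys f. Poly_Mapping.single m (Poly_Mapping.lookup f m))"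
  by (rule poly_mapping_eqI)
    (auto simp: lookup_sum lookup_single when_def in_keys_iff)

definition mono_val :: "('n::finite \<Rightarrow> 's::comm_ring_1) \<Rightarrow> ('n \<Rightarrow>\<^sub>0 nat) \<Rightarrow> 's" where
  "mono_val x m = (\<Prod>i\<in>UNIV. x i ^ Poly_Mapping.lookup m i)"

lemma mono_val_0 [simp]: "mono_val x 0 = 1"
  by (simp add: mono_val_def)

lemma mono_val_add: "mono_val x (m + m') = mono_val x m * mono_val x m'"
  by (simp add: mono_val_def lookup_add power_add prod.distrib)

lemma mono_val_single: "mono_val x (Poly_Mapping.single i n) = x i ^ n"
proof -
  have "mono_val x (Poly_Mapping.single i n) = (\<Prod>j\<in>UNIV. if j = i then x i ^ n else 1)"
    unfolding mono_val_def by (rule prod.cong) (auto simp: lookup_single when_def)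
  then show ?thesis by simp
qed

lemma mp_eval_superset:
  assumes "finite A" "Poly_Mapping.keys f \<subseteq> A" "h 0 = 0"
  shows "mp_eval h x f = (\<Sum>m\<in>A. h (Poly_Mapping.lookup f m) * mono_val x m)"
  unfolding mp_eval_def mono_val_def
  by (rule sum.mono_neutral_left) (use assms in \<open>auto simp: in_keys_iff\<close>)

lemma mp_eval_single:
  assumes "h 0 = 0"
  shows "mp_eval h x (Poly_Mapping.single m c) = h c * mono_val x m"
  by (subst mp_eval_superset[where A = "{m}"]) (use assms in \<open>auto\<close>)

lemma mp_eval_0 [simp]: "mp_eval h x 0 = 0"
  by (simp add: mp_eval_def)

context
  fixes h :: "'r::comm_ring_1 \<Rightarrow> 's::comm_ring_1" and x :: "'n::finite \<Rightarrow> 's"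
  assumes h: "ring_hom_fun h"
begin

lemma mp_eval_add: "mp_eval h x (f + g) = mp_eval h x f + mp_eval h x g"
proof -
  let ?A = "Poly_Mapping.keys f \<union> Poly_Mapping.keys g"
  have "mp_eval h x p = (\<Sum>m\<in>?A. h (Poly_Mapping.lookup p m) * mono_val x m)"
    if "Poly_Mapping.keys p \<subseteq> ?A" for p
    by (rule mp_eval_superset) (use that hom_0[OF h] in auto)
  then show ?thesis
    using Poly_Mapping.keys_add[of f g] by (simp add: lookup_add hom_add[OF h] distrib_right sum.distrib)
qed

lemma mp_eval_sum: "mp_eval h x (sum f A) = (\<Sum>i\<in>A. mp_eval h x (f i))"
  by (induction A rule: infinite_finite_induct) (auto simp: mp_eval_add)

lemma mp_eval_mult: "mp_eval h x (f * g) = mp_eval h x f * mp_eval h x g"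
proof -
  let ?s = "\<lambda>f m. Poly_Mapping.single m (Poly_Mapping.lookup f m)"
  have "f * g = (\<Sum>m\<in>Poly_Mapping.keys f. ?s f m) * (\<Sum>m\<in>Poly_Mapping.keys g. ?s g m)"
    using poly_mapping_sum_single[of f] poly_mapping_sum_single[of g] by simp
  also have "\<dots> = (\<Sum>m\<in>Poly_Mapping.keys f. \<Sum>m'\<in>Poly_Mapping.keys g.
      Poly_Mapping.single (m + m') (Poly_Mapping.lookup f m * Poly_Mapping.lookup g m'))"
    by (simp add: sum_product mult_single)
  finally have "mp_eval h x (f * g) = (\<Sum>m\<in>Poly_Mapping.keys f. \<Sum>m'\<in>Poly_Mapping.keys g.
      (h (Poly_Mapping.lookup f m) * mono_val x m) * (h (Poly_Mapping.lookup g m') * mono_val x m'))"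
    by (simp add: mp_eval_sum mp_eval_single hom_0[OF h] hom_mult[OF h] mono_val_add mult_ac)
  also have "\<dots> = mp_eval h x f * mp_eval h x g"
    by (simp add: sum_product mp_eval_def mono_val_def)
  finally show ?thesis .
qed

lemma mp_eval_Const [simp]: "mp_eval h x (Const c) = h c"
  by (simp add: Const_def mp_eval_single hom_0[OF h])

lemma mp_eval_Var [simp]: "mp_eval h x (Var i) = x i"
  by (simp add: Var_def mp_eval_single hom_0[OF h] hom_1[OF h] mono_val_single)

lemma mp_eval_1 [simp]: "mp_eval h x 1 = 1"
proof -
  have "(1 :: ('n, 'r) mpoly) = Const 1" by (simp add: Const_def)
  then show ?thesis using hom_1[OF h] by (metis mp_eval_Const)
qed

lemma hom_mp_eval: "ring_hom_fun (mp_eval h x)"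
  by (simp add: ring_hom_fun_def mp_eval_add mp_eval_mult)

lemma mp_eval_linear_form: "mp_eval h x (linear_form a) = (\<Sum>i\<in>UNIV. h (a $ i) * x i)"
  by (simp add: linear_form_def mp_eval_sum mp_eval_mult)

end

lemma hom_of_mp_eval:
  assumes "ring_hom_fun \<Phi>"
  shows "\<Phi> (mp_eval h y f) = mp_eval (\<lambda>a. \<Phi> (h a)) (\<lambda>i. \<Phi> (y i)) f"
  by (simp add: mp_eval_def hom_sum[OF assms] hom_mult[OF assms] hom_prod[OF assms] hom_power[OF assms])

lemma lookup_map: "h 0 = 0 \<Longrightarrow> Poly_Mapping.lookup (Poly_Mapping.map h f) m = h (Poly_Mapping.lookup f m)"
  by (simp add: Poly_Mapping.map.rep_eq when_def)

lemma mp_eval_map: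
  assumes "h 0 = 0" "k 0 = 0"
  shows "mp_eval k x (Poly_Mapping.map h f) = mp_eval (\<lambda>a. k (h a)) x f"
proof -
  have "Poly_Mapping.keys (Poly_Mapping.map h f) \<subseteq> Poly_Mapping.keys f"
    using assms by (auto simp: in_keys_iff lookup_map)
  then have "mp_eval k x (Poly_Mapping.map h f)
    = (\<Sum>m\<in>Poly_Mapping.keys f. k (Poly_Mapping.lookup (Poly_Mapping.map h f) m) * mono_val x m)"
    by (intro mp_eval_superset) (use assms in auto)
  then show ?thesis using assms by (simp add: lookup_map mp_eval_def mono_val_def)
qed

lemma mp_value_map: "h 0 = 0 \<Longrightarrow> mp_value (Poly_Mapping.map h f) x = mp_eval h (($) x) f"
  by (simp add: mp_value_def mp_eval_map)

lemma form_of_degree_map: "h 0 = 0 \<Longrightarrow> form_of_degree d f \<Longrightarrow> form_of_degree d (Poly_Mapping.map h f)"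
  by (auto simp: form_of_degree_def in_keys_iff lookup_map)

lemma mp_value_hom: "ring_hom_fun (\<lambda>f. mp_value f x)"
  unfolding mp_value_def by (rule hom_mp_eval[OF hom_id])

lemma mp_eval_Const_Var:
  fixes f :: "('n::finite, 'r::comm_ring_1) mpoly"
  shows "mp_eval Const Var f = f"
proof -
  have "mono_val Var m = (Poly_Mapping.single m 1 :: ('n, 'r) mpoly)" for m
  proof -
    have pw: "Var i ^ n = (Poly_Mapping.single (Poly_Mapping.single i n) 1 :: ('n, 'r) mpoly)" for i n
      by (induction n) (auto simp: Var_def mult_single single_add[symmetric])
    have "(\<Prod>i\<in>A. Poly_Mapping.single (Poly_Mapping.single i (Poly_Mapping.lookup m i)) 1)
      = (Poly_Mapping.single (\<Sum>i\<in>A. Poly_Mapping.single i (Poly_Mapping.lookup m i)) 1 :: ('n, 'r) mpoly)"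
      if "finite A" for A
      using that by induction (auto simp: mult_single)
    moreover have "(\<Sum>i\<in>UNIV. Poly_Mapping.single i (Poly_Mapping.lookup m i)) = m"
      by (rule poly_mapping_eqI) (auto simp: lookup_sum lookup_single when_def)
    ultimately show ?thesis by (simp add: mono_val_def pw)
  qed
  then have "mp_eval Const Var f
    = (\<Sum>m\<in>Poly_Mapping.keys f. Poly_Mapping.single m (Poly_Mapping.lookup f m))"
    unfolding mp_eval_def mono_val_def[symmetric] by (simp add: Const_def mult_single)
  then show ?thesis using poly_mapping_sum_single[of f] by simp
qed

subsection \<open>Homogeneous forms\<close>

lemma mono_val_scale:
  "mono_val (\<lambda>i. c * x i) m = c ^ (\<Sum>i\<in>UNIV. Poly_Mapping.lookup m i) * mono_val x m"
  by (simp add: mono_val_def power_mult_distrib prod.distrib power_sum)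

lemma mp_eval_scale:
  assumes "form_of_degree d f"
  shows "mp_eval h (\<lambda>i. c * x i) f = c ^ d * mp_eval h x f"
  unfolding mp_eval_def mono_val_def[symmetric] sum_distrib_left
  by (rule sum.cong) (use assms in \<open>auto simp: mono_val_scale form_of_degree_def\<close>)

lemma mp_value_scale:
  assumes "form_of_degree d f"
  shows "mp_value f (c *s x) = c ^ d * mp_value f x"
proof -
  have "vec_nth (c *s x) = (\<lambda>i. c * x $ i)" by (simp add: fun_eq_iff)
  then show ?thesis
    using mp_eval_scale[OF assms, of "\<lambda>a. a" c "vec_nth x"] by (simp only: mp_value_def)
qed

lemma form_0 [simp]: "form_of_degree d 0"
  by (simp add: form_of_degree_def)

lemma form_add: "form_of_degree d f \<Longrightarrow> form_of_degree d g \<Longrightarrow> form_of_degree d (f + g)"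
  using Poly_Mapping.keys_add[of f g] by (auto simp: form_of_degree_def)

lemma form_sum: "(\<And>i. i \<in> A \<Longrightarrow> form_of_degree d (f i)) \<Longrightarrow> form_of_degree d (sum f A)"
  by (induction A rule: infinite_finite_induct) (auto intro: form_add)

lemma form_mult: "form_of_degree d f \<Longrightarrow> form_of_degree e g \<Longrightarrow> form_of_degree (d + e) (f * g)"
  using Poly_Mapping.keys_mult[of f g] by (fastforce simp: form_of_degree_def lookup_add sum.distrib)

lemma form_1: "form_of_degree 0 1"
  by (simp add: form_of_degree_def)

lemma form_Const: "form_of_degree 0 (Const c)"
  by (auto simp: form_of_degree_def Const_def split: if_splits)

lemma form_Var: "form_of_degree 1 (Var i)"
  by (auto simp: form_of_degree_def Var_def lookup_single when_def)

lemma form_power: "form_of_degree d f \<Longrightarrow> form_of_degree (n * d) (f ^ n)"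
  by (induction n) (auto intro: form_1 form_mult)

lemma form_prod:
  assumes "finite A" "\<And>i. i \<in> A \<Longrightarrow> form_of_degree (d i) (f i)"
  shows "form_of_degree (sum d A) (prod f A)"
  using assms by induction (auto intro: form_1 form_mult)

lemma form_mp_eval:
  assumes "form_of_degree d f" "\<And>a. form_of_degree 0 (h a)" "\<And>i. form_of_degree 1 (y i)"
  shows "form_of_degree d (mp_eval h y f)"
  unfolding mp_eval_def
proof (rule form_sum)
  fix m assume "m \<in> Poly_Mapping.keys f"
  then have d: "(\<Sum>i\<in>UNIV. Poly_Mapping.lookup m i) = d"
    using assms(1) by (simp add: form_of_degree_def)
  have "form_of_degree (\<Sum>i\<in>UNIV. Poly_Mapping.lookup m i * 1) (\<Prod>i\<in>UNIV. y i ^ Poly_Mapping.lookup m i)"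
    by (intro form_prod form_power assms) auto
  from form_mult[OF assms(2) this] d
  show "form_of_degree d (h (Poly_Mapping.lookup f m) * (\<Prod>i\<in>UNIV. y i ^ Poly_Mapping.lookup m i))"
    by simp
qed

lemma form_deriv:
  assumes "form_of_degree d f"
  shows "form_of_degree (d - 1) (mp_deriv i f)"
  unfolding mp_deriv_def
proof (rule form_sum)
  fix m assume m: "m \<in> Poly_Mapping.keys f"
  then have d: "(\<Sum>i\<in>UNIV. Poly_Mapping.lookup m i) = d"
    using assms(1) by (simp add: form_of_degree_def)
  show "form_of_degree (d - 1) (Poly_Mapping.single (m - Poly_Mapping.single i 1)
          (of_nat (Poly_Mapping.lookup m i) * Poly_Mapping.lookup f m))"
  proof (cases "Poly_Mapping.lookup m i = 0")
    case False
    have "(\<Sum>j\<in>UNIV. Poly_Mapping.lookup (m - Poly_Mapping.single i 1) j) = d - 1"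
      using False d by (simp add: lookup_minus lookup_single when_def sum.remove[of UNIV i])
    then show ?thesis by (auto simp: form_of_degree_def split: if_splits)
  qed simp
qed

text \<open>The sum over ordered pairs (i, j) is regrouped by the monomial x_i x_j. A mixed monomial
  comes from two pairs of weight \<open>h\<close>, a square from one pair of weight one; by
  \<open>h + h = 1\<close> every monomial has total weight one.\<close>

lemma quad_form_expand:
  assumes q: "form_of_degree 2 q" and h: "h + h = 1"
  shows "mp_value q v = quad (quad_matrix h q) v"
proof -
  let ?e = "\<lambda>i. Poly_Mapping.single i (1::nat)"
  let ?p = "\<lambda>(i, j). ?e i + ?e j"
  let ?M = "range ?p :: ('a \<Rightarrow>\<^sub>0 nat) set"
  let ?c = "\<lambda>(i, j). (if i = j then 1 else h)"
  have deg2: "m \<in> ?M" if "(\<Sum>i\<in>UNIV. Poly_Mapping.lookup m i) = 2" for m :: "'a \<Rightarrow>\<^sub>0 nat"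
  proof -
    have "\<exists>i. Poly_Mapping.lookup m i > 0"
      using that by (metis gr0I sum.neutral zero_neq_numeral)
    then obtain i where i: "Poly_Mapping.lookup m i > 0" by blast
    define m' where "m' = m - ?e i"
    have mm: "m = ?e i + m'"
      using i by (intro poly_mapping_eqI) (auto simp: m'_def lookup_add lookup_minus lookup_single when_def)
    have "(\<Sum>j\<in>UNIV. Poly_Mapping.lookup m' j) = 1"
      using that unfolding mm by (simp add: lookup_add sum.distrib lookup_single when_def)
    then obtain j where j: "Poly_Mapping.lookup m' j = 1" "\<And>k. k \<noteq> j \<Longrightarrow> Poly_Mapping.lookup m' k = 0"
      by (auto simp: sum_eq_Suc0_iff)
    then have "m' = ?e j" by (intro poly_mapping_eqI) (auto simp: lookup_single when_def)
    then show ?thesis using mm by auto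
  qed
  have fib: "(\<Sum>p\<in>{p. ?p p = m}. ?c p) = 1" if "m \<in> ?M" for m
  proof -
    from that obtain p where "m = ?p p" by blast
    then obtain i j where m: "m = ?e i + ?e j" by (cases p) simp
    have "?p (a, b) = m \<longleftrightarrow> (a, b) = (i, j) \<or> (a, b) = (j, i)" for a b
    proof
      assume "?p (a, b) = m"
      then have k0: "Poly_Mapping.lookup (?e a + ?e b) k = Poly_Mapping.lookup (?e i + ?e j) k" for k
        using m by simp
      have *: "(if a = k then 1 else 0) + (if b = k then 1 else 0)
          = (if i = k then 1 else 0) + (if j = k then 1 else (0::nat))" for k
        using k0[of k] unfolding lookup_add lookup_single when_def .
      show "(a, b) = (i, j) \<or> (a, b) = (j, i)"
        using *[of a] *[of b] *[of i] by (cases "a = i"; cases "a = j"; cases "b = i"; cases "b = j"; cases "a = b"; cases "i = j") simp_all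
    qed (auto simp: m add.commute)
    then have "{p. ?p p = m} = {(i, j), (j, i)}" by auto
    then show ?thesis using h by (cases "i = j") auto
  qed
  have "mp_value q v = (\<Sum>m\<in>?M. Poly_Mapping.lookup q m * mono_val (($) v) m)"
    unfolding mp_value_def
    by (rule mp_eval_superset) (use q deg2 in \<open>auto simp: form_of_degree_def\<close>)
  also have "\<dots> = (\<Sum>m\<in>?M. \<Sum>p\<in>{p\<in>UNIV. ?p p = m}. ?c p * (Poly_Mapping.lookup q (?p p) * mono_val (($) v) (?p p)))"
  proof (rule sum.cong)
    fix m assume "m \<in> ?M"
    have "(\<Sum>p\<in>{p\<in>UNIV. ?p p = m}. ?c p * (Poly_Mapping.lookup q (?p p) * mono_val (($) v) (?p p)))
      = (\<Sum>p\<in>{p. ?p p = m}. ?c p) * (Poly_Mapping.lookup q m * mono_val (($) v) m)"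
      unfolding sum_distrib_right by (rule sum.cong) auto
    then show "Poly_Mapping.lookup q m * mono_val (($) v) m =
      (\<Sum>p\<in>{p\<in>UNIV. ?p p = m}. ?c p * (Poly_Mapping.lookup q (?p p) * mono_val (($) v) (?p p)))"
      using fib[OF \<open>m \<in> ?M\<close>] by simp
  qed simp
  also have "\<dots> = (\<Sum>p\<in>UNIV. ?c p * (Poly_Mapping.lookup q (?p p) * mono_val (($) v) (?p p)))"
    by (rule sum.group) auto
  also have "\<dots> = (\<Sum>i\<in>UNIV. \<Sum>j\<in>UNIV. (if i = j then 1 else h) * (Poly_Mapping.lookup q (?e i + ?e j) * (v $ i * v $ j)))"
    unfolding sum.cartesian_product UNIV_Times_UNIV
    by (rule sum.cong) (auto simp: mono_val_add mono_val_single)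
  also have "\<dots> = quad (quad_matrix h q) v"
    by (simp add: quad_def dot_def matrix_vector_mult_def quad_matrix_def sum_distrib_left mult_ac)
  finally show ?thesis .
qed

lemma quad_matrix_symmetric: "transpose (quad_matrix h q) = quad_matrix h q"
  by (simp add: transpose_def quad_matrix_def vec_eq_iff add.commute)

subsection \<open>Directional derivatives\<close>

text \<open>The restriction of \<open>f\<close> to the line p + t v. Tangency and multiplicity are
  expressed through its derivative at zero, which \<open>pderiv_line_poly\<close> relates to the
  formal gradient.\<close>

definition line_poly :: "('n::finite, 'k::comm_ring_1) mpoly \<Rightarrow> 'k ^ 'n \<Rightarrow> 'k ^ 'n \<Rightarrow> 'k poly" where
  "line_poly f p v = mp_eval (\<lambda>a. [:a:]) (\<lambda>i. [:p $ i, v $ i:]) f"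

lemma poly_line_poly: "poly (line_poly f p v) t = mp_value f (p + t *s v)"
proof -
  have "vec_nth (p + t *s v) = (\<lambda>i. p $ i + t * v $ i)" by (simp add: fun_eq_iff)
  then show ?thesis
    unfolding line_poly_def mp_value_def by (subst hom_of_mp_eval[OF hom_poly]) simp
qed

lemma pderiv_prod_power:
  fixes y :: "'n \<Rightarrow> 'k::idom poly"
  assumes "finite A"
  shows "pderiv (\<Prod>i\<in>A. y i ^ e i) = (\<Sum>i\<in>A. of_nat (e i) * pderiv (y i) * y i ^ (e i - 1) * (\<Prod>j\<in>A - {i}. y j ^ e j))"
proof -
  have p: "pderiv (y i ^ e i) = of_nat (e i) * pderiv (y i) * y i ^ (e i - 1)" for i
  proof (cases "e i")
    case (Suc n)
    have "pderiv (y i ^ Suc n) = smult (of_nat (Suc n)) (y i ^ n) * pderiv (y i)"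
      by (rule pderiv_power_Suc)
    then show ?thesis unfolding Suc by (simp add: of_nat_poly mult_ac del: of_nat_Suc power_Suc)
  qed simp
  have "pderiv (\<Prod>i\<in>A. y i ^ e i) = (\<Sum>i\<in>A. (\<Prod>j\<in>A - {i}. y j ^ e j) * pderiv (y i ^ e i))"
    by (rule pderiv_prod)
  then show ?thesis by (simp add: p mult_ac)
qed

lemma pderiv_line_poly:
  fixes f :: "('n::finite, 'k::idom) mpoly"
  shows "poly (pderiv (line_poly f p v)) 0 = dot v (mp_gradient f p)"
proof -
  let ?y = "\<lambda>i. [:p $ i, v $ i:]"
  have "mp_value (mp_deriv i f) p = (\<Sum>m\<in>Poly_Mapping.keys f. of_nat (Poly_Mapping.lookup m i) * Poly_Mapping.lookup f m
      * (p $ i ^ (Poly_Mapping.lookup m i - 1) * (\<Prod>j\<in>UNIV - {i}. p $ j ^ Poly_Mapping.lookup m j)))" for i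
  proof -
    have "mono_val (($) p) (m - Poly_Mapping.single i 1)
      = p $ i ^ (Poly_Mapping.lookup m i - 1) * (\<Prod>j\<in>UNIV - {i}. p $ j ^ Poly_Mapping.lookup m j)" for m
      unfolding mono_val_def by (simp add: prod.remove[of UNIV i] lookup_minus lookup_single when_def)
    then show ?thesis
      unfolding mp_value_def mp_deriv_def by (simp add: mp_eval_sum[OF hom_id] mp_eval_single)
  qed
  then have "dot v (mp_gradient f p) = (\<Sum>i\<in>UNIV. \<Sum>m\<in>Poly_Mapping.keys f. v $ i * (of_nat (Poly_Mapping.lookup m i) * Poly_Mapping.lookup f m
      * (p $ i ^ (Poly_Mapping.lookup m i - 1) * (\<Prod>j\<in>UNIV - {i}. p $ j ^ Poly_Mapping.lookup m j))))"
    by (simp add: dot_def mp_gradient_def sum_distrib_left)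
  also have "\<dots> = (\<Sum>m\<in>Poly_Mapping.keys f. \<Sum>i\<in>UNIV. v $ i * (of_nat (Poly_Mapping.lookup m i) * Poly_Mapping.lookup f m
      * (p $ i ^ (Poly_Mapping.lookup m i - 1) * (\<Prod>j\<in>UNIV - {i}. p $ j ^ Poly_Mapping.lookup m j))))"
    by (rule sum.swap)
  also have "\<dots> = (\<Sum>m\<in>Poly_Mapping.keys f. poly (pderiv ([:Poly_Mapping.lookup f m:] * (\<Prod>i\<in>UNIV. ?y i ^ Poly_Mapping.lookup m i))) 0)"
  proof (rule sum.cong)
    fix m
    show "(\<Sum>i\<in>UNIV. v $ i * (of_nat (Poly_Mapping.lookup m i) * Poly_Mapping.lookup f m
      * (p $ i ^ (Poly_Mapping.lookup m i - 1) * (\<Prod>j\<in>UNIV - {i}. p $ j ^ Poly_Mapping.lookup m j))))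
     = poly (pderiv ([:Poly_Mapping.lookup f m:] * (\<Prod>i\<in>UNIV. ?y i ^ Poly_Mapping.lookup m i))) 0"
      by (simp add: pderiv_smult pderiv_prod_power poly_sum poly_prod pderiv_pCons sum_distrib_left mult_ac)
  qed simp
  also have "\<dots> = poly (pderiv (line_poly f p v)) 0"
  proof -
    have "pderiv (sum F A) = (\<Sum>m\<in>A. pderiv (F m))" if "finite A" for A :: "('n \<Rightarrow>\<^sub>0 nat) set" and F :: "_ \<Rightarrow> 'k poly"
      using that by induction (auto simp: pderiv_add)
    then show ?thesis by (simp add: line_poly_def mp_eval_def poly_sum)
  qed
  finally show ?thesis by simp
qed

subsection \<open>Zeros of polynomials\<close>

lemma fun_upd_in_PiE_aux: "y \<in> PiE I (\<lambda>_. S) \<Longrightarrow> a \<in> S \<Longrightarrow> y(i := a) \<in> PiE (insert i I) (\<lambda>_. S)"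
  by (auto simp: PiE_iff extensional_def)

lemma card_vec_insert:
  fixes S :: "'k set"
  assumes "finite S" "finite I" "i \<notin> I"
  shows "card {x\<in>PiE (insert i I) (\<lambda>_. S). R (x i) (restrict x I)} = (\<Sum>y\<in>PiE I (\<lambda>_. S). card {a\<in>S. R a y})"
proof -
  have "card {x\<in>PiE (insert i I) (\<lambda>_. S). R (x i) (restrict x I)}
    = card (SIGMA y:PiE I (\<lambda>_. S). {a\<in>S. R a y})"
  proof (rule bij_betw_same_card[of "\<lambda>x. (restrict x I, x i)"], rule bij_betwI[where g = "\<lambda>(y, a). y(i := a)"])
    show "(\<lambda>x. (restrict x I, x i)) \<in> {x\<in>PiE (insert i I) (\<lambda>_. S). R (x i) (restrict x I)} \<rightarrow> (SIGMA y:PiE I (\<lambda>_. S). {a\<in>S. R a y})"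
      by (auto simp: PiE_iff)
    have r: "restrict (y(i := a)) I = y" if "y \<in> PiE I (\<lambda>_. S)" for y a
      using that assms(3) by (auto simp: fun_eq_iff PiE_iff extensional_def restrict_def)
    show "(\<lambda>(y, a). y(i := a)) \<in> (SIGMA y:PiE I (\<lambda>_. S). {a\<in>S. R a y}) \<rightarrow> {x\<in>PiE (insert i I) (\<lambda>_. S). R (x i) (restrict x I)}"
    proof (rule Pi_I, clarsimp simp: r)
      fix y a assume "y \<in> PiE I (\<lambda>_. S)" "a \<in> S"
      then show "y(i := a) \<in> PiE (insert i I) (\<lambda>_. S)"
        by (rule fun_upd_in_PiE_aux)
    qed
    show "(\<lambda>(y, a). y(i := a)) (restrict x I, x i) = x" if "x \<in> {x\<in>PiE (insert i I) (\<lambda>_. S). R (x i) (restrict x I)}" for x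
      using that by (auto simp: fun_eq_iff PiE_iff extensional_def)
    show "(\<lambda>x. (restrict x I, x i)) ((\<lambda>(y, a). y(i := a)) z) = z" if "z \<in> (SIGMA y:PiE I (\<lambda>_. S). {a\<in>S. R a y})" for z
      using that by (auto simp: r)
  qed
  also have "\<dots> = (\<Sum>y\<in>PiE I (\<lambda>_. S). card {a\<in>S. R a y})"
    using assms by (intro card_SigmaI finite_PiE) auto
  finally show ?thesis .
qed

text \<open>Induction on the variables. With \<open>e\<close> the largest exponent of the new
  variable, its leading coefficient is a non-zero polynomial in the others of degree at most
  \<open>d - e\<close>. Where it vanishes all of \<open>S\<close> is allowed, elsewhere at most
  \<open>e\<close> values. Exponents as plain functions keep their type while the set of variables
  grows.\<close>

lemma schwartz_zippel_PiE:
  fixes S :: "'k::idom set" and c :: "('n \<Rightarrow> nat) \<Rightarrow> 'k"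
  assumes S: "finite S" "S \<noteq> {}" and "finite I"
    and "finite M" "M \<noteq> {}" "\<And>m. m \<in> M \<Longrightarrow> c m \<noteq> 0"
    and "\<And>m i. m \<in> M \<Longrightarrow> i \<notin> I \<Longrightarrow> m i = 0"
    and "\<And>m. m \<in> M \<Longrightarrow> (\<Sum>i\<in>I. m i) \<le> d"
  shows "card S * card {x\<in>PiE I (\<lambda>_. S). (\<Sum>m\<in>M. c m * (\<Prod>i\<in>I. x i ^ m i)) = 0} \<le> d * card S ^ card I"
  using assms(3-)
proof (induction I arbitrary: M c d)
  case empty
  have "m = (\<lambda>_. 0)" if "m \<in> M" for m using empty(4)[OF that] by auto
  with empty(2) have "M = {\<lambda>_. 0}" by blast
  with empty show ?case by simp
next
  case (insert i I)
  let ?P = "PiE I (\<lambda>_. S)"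
  define e where "e = Max ((\<lambda>m. m i) ` M)"
  have e: "m i \<le> e" if "m \<in> M" for m
    unfolding e_def using that insert.prems(1) by auto
  have "e \<in> (\<lambda>m. m i) ` M"
    unfolding e_def using insert.prems(1,2) by (intro Max_in) auto
  then obtain m0 where m0: "m0 \<in> M" "m0 i = e" by auto
  define L where "L = {m\<in>M. m i = e}"
  \<comment> \<open>\<open>pr\<close> erases the exponent of \<open>i\<close> and \<open>up\<close>
    restores it to \<open>e\<close>, so that the leading coefficient is indexed by exponents
    supported in \<open>I\<close>, as the induction hypothesis demands.\<close>
  define pr where "pr m = m(i := 0)" for m :: "'n \<Rightarrow> nat"
  define up where "up m = m(i := e)" for m :: "'n \<Rightarrow> nat"
  have upr: "up (pr m) = m" if "m \<in> L" for m
    using that by (auto simp: up_def pr_def L_def fun_eq_iff)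
  define a where "a k y = (\<Sum>m\<in>{m\<in>M. m i = k}. c m * (\<Prod>j\<in>I. y j ^ m j))" for k y
  have a_e: "a e y = (\<Sum>m\<in>pr ` L. c (up m) * (\<Prod>j\<in>I. y j ^ m j))" for y
  proof -
    have "inj_on pr L" using upr by (metis inj_onI)
    then have "(\<Sum>m\<in>pr ` L. c (up m) * (\<Prod>j\<in>I. y j ^ m j)) = (\<Sum>m\<in>L. c m * (\<Prod>j\<in>I. y j ^ pr m j))"
      by (subst sum.reindex) (auto simp: upr)
    also have "\<dots> = (\<Sum>m\<in>L. c m * (\<Prod>j\<in>I. y j ^ m j))"
      using insert.hyps by (intro sum.cong refl arg_cong2[of _ _ _ _ "(*)"] prod.cong) (auto simp: pr_def)
    finally show ?thesis by (simp add: a_def L_def)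
  qed
  have ed: "e \<le> d" using insert.prems(5)[OF m0(1)] insert.hyps m0(2) by simp
  have IH: "card S * card {y\<in>?P. a e y = 0} \<le> (d - e) * card S ^ card I"
    unfolding a_e
  proof (rule insert.IH)
    show "finite (pr ` L)" "pr ` L \<noteq> {}" using insert.prems(1) m0 by (auto simp: L_def)
    fix m assume "m \<in> pr ` L"
    then obtain m' where m': "m' \<in> L" "m = pr m'" by auto
    show "c (up m) \<noteq> 0" using insert.prems(3) m' upr by (auto simp: L_def)
    show "m j = 0" if "j \<notin> I" for j
      using insert.prems(4)[of m' j] m' that by (auto simp: L_def pr_def)
    have "(\<Sum>j\<in>I. m j) = (\<Sum>j\<in>I. m' j)"
      using insert.hyps m' by (intro sum.cong) (auto simp: pr_def)
    then show "(\<Sum>j\<in>I. m j) \<le> d - e"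
      using insert.prems(5)[of m'] m' insert.hyps by (auto simp: L_def)
  qed
  have val: "(\<Sum>m\<in>M. c m * (\<Prod>j\<in>insert i I. x j ^ m j)) = (\<Sum>k\<le>e. a k (restrict x I) * x i ^ k)" for x
  proof -
    have "(\<Sum>k\<le>e. a k (restrict x I) * x i ^ k) = (\<Sum>k\<le>e. \<Sum>m\<in>{m\<in>M. m i = k}. c m * (\<Prod>j\<in>insert i I. x j ^ m j))"
      unfolding a_def sum_distrib_right
    proof (intro sum.cong refl)
      fix k m assume "m \<in> {m\<in>M. m i = k}"
      then show "c m * (\<Prod>j\<in>I. restrict x I j ^ m j) * x i ^ k = c m * (\<Prod>j\<in>insert i I. x j ^ m j)"
        using insert.hyps by (simp add: mult_ac)
    qed
    also have "\<dots> = (\<Sum>m\<in>M. c m * (\<Prod>j\<in>insert i I. x j ^ m j))"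
      by (rule sum.group) (use insert.prems(1) e in auto)
    finally show ?thesis by simp
  qed
  define R where "R t y \<longleftrightarrow> (\<Sum>k\<le>e. a k y * t ^ k) = 0" for t y
  have bound: "card {t\<in>S. R t y} \<le> (if a e y = 0 then card S else e)" for y
  proof (cases "a e y = 0")
    case True
    then show ?thesis using S by (simp add: card_mono)
  next
    case False
    define p where "p = (\<Sum>k\<le>e. monom (a k y) k)"
    have "coeff p e = a e y" by (simp add: p_def coeff_sum)
    then have "p \<noteq> 0" using False by auto
    have "{t\<in>S. R t y} \<subseteq> {t. poly p t = 0}"
      by (auto simp: R_def p_def poly_sum poly_monom)
    then have "card {t\<in>S. R t y} \<le> card {t. poly p t = 0}"
      using \<open>p \<noteq> 0\<close> by (intro card_mono poly_roots_finite)
    also have "\<dots> \<le> degree p" using \<open>p \<noteq> 0\<close> by (rule card_poly_roots_bound)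
    also have "\<dots> \<le> e" unfolding p_def
      by (rule degree_sum_le) (auto intro: order.trans[OF degree_monom_le])
    finally show ?thesis using False by simp
  qed
  have finP: "finite ?P" using insert.hyps S by (intro finite_PiE) auto
  have cP: "card ?P = card S ^ card I" using insert.hyps by (simp add: card_PiE)
  have "card {x\<in>PiE (insert i I) (\<lambda>_. S). (\<Sum>m\<in>M. c m * (\<Prod>j\<in>insert i I. x j ^ m j)) = 0}
    = (\<Sum>y\<in>?P. card {t\<in>S. R t y})"
    unfolding val R_def[symmetric] using S(1) insert.hyps by (intro card_vec_insert) auto
  also have "\<dots> \<le> (\<Sum>y\<in>?P. (if a e y = 0 then card S else 0) + e)"
    by (intro sum_mono order.trans[OF bound]) auto
  also have "\<dots> = card S * card {y\<in>?P. a e y = 0} + e * card S ^ card I"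
    using finP by (simp add: sum.distrib sum.If_cases cP Int_def mult.commute)
  also have "\<dots> \<le> d * card S ^ card I"
  proof -
    have "d * card S ^ card I = (d - e) * card S ^ card I + e * card S ^ card I"
      using ed by (simp add: distrib_right[symmetric])
    then show ?thesis using IH by linarith
  qed
  finally have "card S * card {x\<in>PiE (insert i I) (\<lambda>_. S). (\<Sum>m\<in>M. c m * (\<Prod>j\<in>insert i I. x j ^ m j)) = 0}
    \<le> card S * (d * card S ^ card I)" by (rule mult_le_mono2)
  then show ?case using insert.hyps by (simp add: mult_ac)
qed

lemma schwartz_zippel:
  fixes f :: "('n::finite, 'k::idom) mpoly"
  assumes "f \<noteq> 0" "finite S" "S \<noteq> {}"
    and "\<And>m. m \<in> Poly_Mapping.keys f \<Longrightarrow> (\<Sum>i\<in>UNIV. Poly_Mapping.lookup m i) \<le> d"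
  shows "card S * card {x. (\<forall>i. x $ i \<in> S) \<and> mp_value f x = 0} \<le> d * card S ^ CARD('n)"
proof -
  let ?M = "Poly_Mapping.lookup ` Poly_Mapping.keys f"
  define c where "c m = Poly_Mapping.lookup f (Abs_poly_mapping m)" for m
  have inj: "inj_on (Poly_Mapping.lookup :: ('n \<Rightarrow>\<^sub>0 nat) \<Rightarrow> _) A" for A
    by (auto intro!: inj_onI poly_mapping_eqI)
  have val: "mp_value f x = (\<Sum>m\<in>?M. c m * (\<Prod>i\<in>UNIV. (x $ i) ^ m i))" for x
    by (simp add: mp_value_def mp_eval_def sum.reindex[OF inj] c_def)
  have "?M \<noteq> {}" using assms(1) by auto
  then have "card S * card {x\<in>PiE UNIV (\<lambda>_. S). (\<Sum>m\<in>?M. c m * (\<Prod>i\<in>UNIV. x i ^ m i)) = 0} \<le> d * card S ^ card (UNIV :: 'n set)"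
    using assms by (intro schwartz_zippel_PiE) (auto simp: c_def in_keys_iff)
  also have "card {x\<in>PiE UNIV (\<lambda>_. S). (\<Sum>m\<in>?M. c m * (\<Prod>i\<in>UNIV. x i ^ m i)) = 0}
    = card {x. (\<forall>i. x $ i \<in> S) \<and> mp_value f x = 0}"
    unfolding val
    by (rule bij_betw_same_card[of vec_lambda], rule bij_betwI[where g = vec_nth]) (auto simp: PiE_iff)
  finally show ?thesis .
qed

text \<open>For a set \<open>S\<close> with one element more than the total degree,
  \<open>schwartz_zippel\<close> leaves no room for \<open>f\<close> to vanish at all points with
  coordinates in \<open>S\<close>.\<close>

lemma mpoly_eq_0I:
  fixes f :: "('n::finite, 'k::idom) mpoly"
  assumes "infinite (UNIV :: 'k set)" "\<And>x. mp_value f x = 0"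
  shows "f = 0"
proof (rule ccontr)
  assume "f \<noteq> 0"
  define d where "d = Max ((\<lambda>m. \<Sum>i\<in>UNIV. Poly_Mapping.lookup m i) ` Poly_Mapping.keys f)"
  obtain S :: "'k set" where S: "finite S" "card S = Suc d"
    using assms(1) infinite_arbitrarily_large by blast
  have "card S * card {x. (\<forall>i. x $ i \<in> S) \<and> mp_value f x = 0} \<le> d * card S ^ CARD('n)"
    by (rule schwartz_zippel) (use S \<open>f \<noteq> 0\<close> in \<open>auto simp: d_def\<close>)
  moreover have "card {x. (\<forall>i. x $ i \<in> S) \<and> mp_value f x = 0} = card S ^ CARD('n)"
  proof -
    have "card {x :: 'k ^ 'n. \<forall>i. x $ i \<in> S} = card (PiE (UNIV :: 'n set) (\<lambda>_. S))"
      by (rule bij_betw_same_card[of vec_nth], rule bij_betwI[where g = vec_lambda]) (auto simp: PiE_iff)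
    then show ?thesis using assms(2) by (simp add: card_PiE)
  qed
  ultimately show False using S by simp
qed

lemma dvd_mp_eval_diff:
  fixes x y :: "'n::finite \<Rightarrow> 's::comm_ring_1"
  assumes "\<And>i. l dvd x i - y i"
  shows "l dvd mp_eval h x f - mp_eval h y f"
proof -
  have pw: "l dvd a ^ n - b ^ n" if "l dvd a - b" for a b :: 's and n
    using that by (simp add: power_diff_sumr2)
  have pr: "l dvd (\<Prod>i\<in>A. u i) - (\<Prod>i\<in>A. w i)" if "finite A" "\<And>i. l dvd u i - w i" for A and u w :: "'n \<Rightarrow> 's"
    using that(1)
  proof induction
    case (insert i A)
    have "u i * prod u A - w i * prod w A = (u i - w i) * prod u A + w i * (prod u A - prod w A)"
      by (simp add: algebra_simps)
    then show ?case using insert that(2)[of i] by simp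
  qed simp
  have "mp_eval h x f - mp_eval h y f = (\<Sum>m\<in>Poly_Mapping.keys f. h (Poly_Mapping.lookup f m) *
      ((\<Prod>i\<in>UNIV. x i ^ Poly_Mapping.lookup m i) - (\<Prod>i\<in>UNIV. y i ^ Poly_Mapping.lookup m i)))"
    by (simp add: mp_eval_def sum_subtractf algebra_simps)
  also have "l dvd \<dots>"
    by (intro dvd_sum dvd_mult pr pw assms) simp
  finally show ?thesis .
qed

text \<open>Subtracting a multiple of the linear form from the k-th variable projects onto the
  hyperplane. This substitution changes \<open>f\<close> only modulo the linear form, and the
  outcome vanishes at every point, hence is zero.\<close>

lemma linear_form_dvd:
  fixes f :: "('n::finite, 'k::field) mpoly"
  assumes "infinite (UNIV :: 'k set)" "a \<noteq> 0"
    and "\<And>x. dot a x = 0 \<Longrightarrow> mp_value f x = 0"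
  shows "linear_form a dvd f"
proof -
  obtain k where k: "a $ k \<noteq> 0" using assms(2) by (auto simp: vec_eq_iff)
  define y where "y i = Var i - (if i = k then Const (1 / a $ k) * linear_form a else 0)" for i
  have "linear_form a dvd mp_eval Const Var f - mp_eval Const y f"
    by (rule dvd_mp_eval_diff) (auto simp: y_def)
  moreover have "mp_eval Const y f = 0"
  proof (rule mpoly_eq_0I[OF assms(1)])
    fix x
    define w where "w = (\<chi> i. mp_value (y i) x)"
    have "mp_value (linear_form a) x = dot a x"
      by (simp add: mp_value_def mp_eval_linear_form[OF hom_id] dot_def)
    then have w: "w $ i = x $ i - (if i = k then dot a x / a $ k else 0)" for i
      unfolding w_def y_def
      by (simp add: hom_diff[OF mp_value_hom] hom_0[OF mp_value_hom] hom_mult[OF mp_value_hom])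
        (simp add: mp_value_def hom_id)
    have "dot a w = (\<Sum>i\<in>UNIV. a $ i * x $ i - (if i = k then dot a x else 0))"
      unfolding dot_def w by (intro sum.cong) (use k in \<open>auto simp: algebra_simps dot_def\<close>)
    then have "dot a w = 0" by (simp add: sum_subtractf dot_def)
    moreover have "vec_nth w = (\<lambda>i. mp_value (y i) x)" by (simp add: w_def fun_eq_iff)
    then have "mp_value (mp_eval Const y f) x = mp_value f w"
      unfolding mp_value_def[of f]
      by (subst hom_of_mp_eval[OF mp_value_hom]) (simp add: mp_value_def hom_id)
    ultimately show "mp_value (mp_eval Const y f) x = 0" using assms(3) by simp
  qed
  ultimately show ?thesis by (simp add: mp_eval_Const_Var)
qed

section \<open>Character sums of polynomials\<close>

text \<open>As with digits in base \<open>N\<close>: once the outer variable becomes x^N,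
  coefficients of degree below \<open>N\<close> occupy disjoint ranges of exponents, and the top
  term cannot cancel.\<close>

lemma poly_poly_monom_eq_0:
  fixes G :: "'a::field poly poly"
  assumes "\<And>i. degree (coeff G i) < N" "poly G (monom 1 N) = 0"
  shows "G = 0"
proof (rule ccontr)
  assume "G \<noteq> 0"
  define n where "n = degree G"
  define g where "g = coeff G n"
  have "g \<noteq> 0" using \<open>G \<noteq> 0\<close> by (simp add: g_def n_def)
  define k where "k = degree g"
  have k: "k < N" using assms(1)[of n] by (simp add: k_def g_def)
  have c: "coeff (coeff G i * monom 1 N ^ i) (n * N + k) = (if i = n then coeff g k else 0)" if "i \<le> n" for i
  proof -
    have "\<not> n * N + k < i * N" using mult_le_mono1[OF that, of N] by linarith
    then have "coeff (coeff G i * monom 1 N ^ i) (n * N + k) = coeff (coeff G i) (n * N + k - i * N)"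
      by (simp add: monom_power coeff_monom_mult mult.commute[of "coeff G i"] mult.commute[of N])
    also have "\<dots> = (if i = n then coeff g k else 0)"
    proof (cases "i = n")
      case False
      then have "Suc i * N \<le> n * N" using that by (intro mult_le_mono1) simp
      then have "N \<le> n * N + k - i * N" by simp
      then have "degree (coeff G i) < n * N + k - i * N" using assms(1)[of i] by linarith
      then show ?thesis using False by (simp add: coeff_eq_0)
    qed (simp add: g_def)
    finally show ?thesis .
  qed
  have "coeff (poly G (monom 1 N)) (n * N + k) = (\<Sum>i\<le>n. coeff (coeff G i * monom 1 N ^ i) (n * N + k))"
    by (simp add: poly_altdef n_def coeff_sum)
  also have "\<dots> = (\<Sum>i\<le>n. if i = n then coeff g k else 0)"
    by (intro sum.cong refl c) simp
  also have "\<dots> = coeff g k" by simp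
  finally show False using assms(2) \<open>g \<noteq> 0\<close> by (simp add: k_def)
qed

lemma degree_coeff_mult_le:
  fixes A B :: "'a::comm_ring_1 poly poly"
  assumes "\<And>i. degree (coeff A i) \<le> a" "\<And>i. degree (coeff B i) \<le> b"
  shows "degree (coeff (A * B) n) \<le> a + b"
  unfolding coeff_mult
  by (intro degree_sum_le order.trans[OF degree_mult_le] add_mono assms) simp

lemma CHAR_poly_eq: "CHAR('a::idom poly) = CHAR('a)"
  by (rule CHAR_eqI) (auto simp: of_nat_poly of_nat_eq_0_iff_char_dvd)

context odd_finite_subfield
begin

definition PK :: "nat \<Rightarrow> 'a poly set" where
  "PK n = {p. (\<forall>k. coeff p k \<in> K) \<and> (\<forall>k\<ge>n. coeff p k = 0)}"

lemma PK_finite: "finite (PK n)" and card_PK: "card (PK n) = q ^ n"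
proof -
  have b: "bij_betw (\<lambda>f. \<Sum>k<n. monom (f k) k) (PiE {..<n} (\<lambda>_. K)) (PK n)"
  proof (rule bij_betwI[where g = "\<lambda>p. restrict (coeff p) {..<n}"])
    show "(\<lambda>f. \<Sum>k<n. monom (f k) k) \<in> PiE {..<n} (\<lambda>_. K) \<rightarrow> PK n"
      by (auto simp: PK_def coeff_sum PiE_iff K_0)
    show "(\<lambda>p. restrict (coeff p) {..<n}) \<in> PK n \<rightarrow> PiE {..<n} (\<lambda>_. K)"
      by (auto simp: PK_def)
    show "restrict (coeff (\<Sum>k<n. monom (f k) k)) {..<n} = f" if "f \<in> PiE {..<n} (\<lambda>_. K)" for f
      using that by (auto simp: fun_eq_iff coeff_sum PiE_iff extensional_def)
    show "(\<Sum>k<n. monom (restrict (coeff p) {..<n} k) k) = p" if "p \<in> PK n" for p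
      using that by (auto simp: poly_eq_iff coeff_sum PK_def)
  qed
  show "finite (PK n)" using bij_betw_finite[OF b] finite_K by (simp add: finite_PiE)
  show "card (PK n) = q ^ n" using bij_betw_same_card[OF b] by (simp add: card_PiE)
qed

lemma PK_I:
  assumes "\<And>k. coeff p k \<in> K" "degree p < n"
  shows "p \<in> PK n"
  using assms by (auto simp: PK_def coeff_eq_0)

lemma PK_degree: "p \<in> PK (Suc n) \<Longrightarrow> degree p \<le> n"
  by (auto simp: PK_def intro: degree_le)

lemma PK_diff: "p \<in> PK n \<Longrightarrow> p' \<in> PK n \<Longrightarrow> p - p' \<in> PK n"
  by (auto simp: PK_def intro: K_diff)

lemma K_coeff_mult: "(\<And>k. coeff f k \<in> K) \<Longrightarrow> (\<And>k. coeff g k \<in> K) \<Longrightarrow> coeff (f * g) k \<in> K"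
  unfolding coeff_mult by (intro K_sum K_mult)

lemma K_coeff_power: "(\<And>k. coeff f k \<in> K) \<Longrightarrow> coeff (f ^ n) k \<in> K"
  by (induction n arbitrary: k) (auto simp: K_0 K_1 intro: K_coeff_mult)

lemma K_coeff_monom: "coeff (monom 1 n) k \<in> K"
  by (simp add: K_0 K_1)

lemma K_poly: "(\<And>k. coeff f k \<in> K) \<Longrightarrow> x \<in> K \<Longrightarrow> poly f x \<in> K"
  unfolding poly_altdef by (intro K_sum K_mult K_power) auto

text \<open>Stepanov's method with \<open>q = P P'\<close>. Counting coefficients yields \<open>a\<^sub>i\<close>, \<open>b\<^sub>i\<close> over \<open>K\<close>, not all zero and of
  degree less than \<open>P'/2\<close>, such that \<open>\<Sum> a\<^sub>i\<^sup>P x\<^sup>i + f\<^bsup>(P+1)/2\<^esup> \<Sum> b\<^sub>i\<^sup>P x\<^sup>i = 0\<close>. The \<open>P\<close>-th power of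
  \<open>\<rho> = \<Sum> a\<^sub>i x\<^bsup>P'i\<^esup> + f\<^bsup>(P'+1)/2\<^esup> \<Sum> b\<^sub>i x\<^bsup>P'i\<^esup>\<close> agrees with the left hand side at the points of \<open>K\<close>
  where \<open>f\<close> is a non-zero square, so \<open>\<rho>\<close> vanishes there; it is not zero because a root of \<open>f\<close> of odd
  order keeps the two sums from cancelling.\<close>

lemma card_chi_1_le:
  fixes f :: "'a poly"
  assumes char: "prime CHAR('a)" and P: "2 * u + 1 = CHAR('a) ^ i" and P': "2 * v + 1 = CHAR('a) ^ j"
    and q: "q = (2 * u + 1) * (2 * v + 1)" and uv: "u \<le> v" "u \<ge> 3"
    and f: "\<And>k. coeff f k \<in> K" "degree f \<le> 6" and r: "f \<noteq> 0" "odd (order r f)"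
  shows "card {x\<in>K. chi (poly f x) = 1} \<le> v + (2 * v + 1) * (u + 3)"
proof -
  let ?P = "2 * u + 1" and ?P' = "2 * v + 1" and ?e = "u + 3"
  have chp: "prime CHAR('a poly)" using char by (simp only: CHAR_poly_eq)
  note frob_sum = freshmans_dream_sum'[OF chp, unfolded CHAR_poly_eq]
  have frob_diff: "(a - b) ^ ?P = a ^ ?P - b ^ ?P" for a b :: "'a poly"
  proof -
    have "a ^ ?P = ((a - b) + b) ^ ?P" by simp
    also have "\<dots> = (a - b) ^ ?P + b ^ ?P"
      unfolding P by (subst freshmans_dream'[OF chp, unfolded CHAR_poly_eq]) (auto simp: CHAR_poly_eq)
    finally show ?thesis by simp
  qed
  \<comment> \<open>There are \<open>u + 4\<close> unknown \<open>a i\<close> of degree at most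
    \<open>v\<close> and \<open>u + 1\<close> unknown \<open>b i\<close> of degree at most
    \<open>v - 3\<close>. The three degrees less compensate for the factor
    \<open>f ^ (u + 1)\<close>: both sums in \<open>T\<close> have degree at most
    \<open>v * (2 * u + 1) + u + 3\<close>.\<close>
  define X1 where "X1 = PiE {..?e} (\<lambda>_. PK (Suc v))"
  define X2 where "X2 = PiE {..u} (\<lambda>_. PK (v - 2))"
  define AB where "AB = Sigma X1 (\<lambda>_. X2)"
  define T where "T = (\<lambda>(a, b). (\<Sum>i\<le>?e. (a i :: 'a poly) ^ ?P * monom 1 i) + f ^ (u + 1) * (\<Sum>i\<le>u. (b i :: 'a poly) ^ ?P * monom 1 i))"
  have cAB: "card AB = q ^ (Suc v * (u + 4) + (v - 2) * (u + 1))"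
  proof -
    have "card AB = (q ^ Suc v) ^ card {..?e} * (q ^ (v - 2)) ^ card {..u}"
      by (simp add: AB_def X1_def X2_def card_cartesian_product card_PiE card_PK del: power_Suc)
    also have "\<dots> = q ^ (Suc v * card {..?e} + (v - 2) * card {..u})"
      by (simp only: power_mult power_add)
    finally show ?thesis by (simp add: algebra_simps)
  qed
  have TAB: "T ` AB \<subseteq> PK (v * ?P + ?e + 1)"
  proof safe
    fix a b assume "(a, b) \<in> AB"
    then have a: "a i \<in> PK (Suc v)" if "i \<le> ?e" for i
      using that by (auto simp: AB_def X1_def X2_def PiE_iff)
    have b: "b i \<in> PK (v - 2)" if "i \<le> u" for i
      using that \<open>(a, b) \<in> AB\<close> by (auto simp: AB_def X1_def X2_def PiE_iff)
    have dega: "degree (a i) \<le> v" if "i \<le> ?e" for i using a[OF that] by (rule PK_degree)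
    have "v - 2 = Suc (v - 3)" using uv by simp
    then have degb: "degree (b i) \<le> v - 3" if "i \<le> u" for i using b[OF that] by (metis PK_degree)
    show "T (a, b) \<in> PK (v * ?P + ?e + 1)"
    proof (rule PK_I)
      fix k
      have "coeff (a i ^ ?P * monom 1 i) k \<in> K" if "i \<le> ?e" for i k
        using a[OF that] by (intro K_coeff_mult K_coeff_power K_coeff_monom) (auto simp: PK_def)
      moreover have bb: "coeff (b i ^ ?P * monom 1 i) k \<in> K" if "i \<le> u" for i k
        using b[OF that] by (intro K_coeff_mult K_coeff_power K_coeff_monom) (auto simp: PK_def)
      then have "coeff (f ^ (u + 1) * (\<Sum>i\<le>u. b i ^ ?P * monom 1 i)) k \<in> K"
        by (intro K_coeff_mult K_coeff_power f) (auto simp: coeff_sum intro: K_sum)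
      ultimately show "coeff (T (a, b)) k \<in> K"
        unfolding T_def case_prod_conv coeff_add coeff_sum by (intro K_add K_sum) auto
    next
      have "degree (a i ^ ?P * monom 1 i) \<le> v * ?P + ?e" if "i \<le> ?e" for i
        using that mult_le_mono1[OF dega[OF that], of ?P]
        by (intro order.trans[OF degree_mult_le] add_mono order.trans[OF degree_power_le] order.trans[OF degree_monom_le]) auto
      then have 1: "degree (\<Sum>i\<le>?e. a i ^ ?P * monom 1 i) \<le> v * ?P + ?e"
        by (intro degree_sum_le) auto
      have "degree (b i ^ ?P * monom 1 i) \<le> (v - 3) * ?P + u" if "i \<le> u" for i
        using that mult_le_mono1[OF degb[OF that], of ?P]
        by (intro order.trans[OF degree_mult_le] add_mono order.trans[OF degree_power_le] order.trans[OF degree_monom_le]) auto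
      then have 2: "degree (\<Sum>i\<le>u. b i ^ ?P * monom 1 i) \<le> (v - 3) * ?P + u"
        by (intro degree_sum_le) auto
      have "degree (f ^ (u + 1) * (\<Sum>i\<le>u. b i ^ ?P * monom 1 i)) \<le> 6 * (u + 1) + ((v - 3) * ?P + u)"
        using 2 mult_le_mono1[OF f(2), of "u + 1"]
        by (intro order.trans[OF degree_mult_le] add_mono order.trans[OF degree_power_le]) auto
      also have "\<dots> = v * ?P + ?e"
      proof -
        obtain w where "v = w + 3" using uv by (metis le_trans le_Suc_ex add.commute)
        then show ?thesis by (simp add: algebra_simps)
      qed
      finally have "degree (T (a, b)) \<le> v * ?P + ?e"
        unfolding T_def case_prod_conv by (intro degree_add_le 1)
      then show "degree (T (a, b)) < v * ?P + ?e + 1" by simp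
    qed
  qed
  have "card (T ` AB) \<le> q ^ (v * ?P + ?e + 1)"
    using card_mono[OF PK_finite TAB] by (simp add: card_PK)
  \<comment> \<open>Pigeonhole: the unknown coefficients outnumber those of the image by
    \<open>4 * v - 2 * u - 2\<close>, which is positive as \<open>u \<le> v\<close> and
    \<open>u \<ge> 3\<close>.\<close>
  also have "\<dots> < card AB"
    unfolding cAB
  proof (rule power_strict_increasing)
    obtain w where w: "v = w + u" using uv by (metis le_Suc_ex add.commute)
    obtain z where z: "u = z + 3" using uv by (metis le_Suc_ex add.commute)
    show "v * ?P + ?e + 1 < Suc v * (u + 4) + (v - 2) * (u + 1)"
      unfolding w z by (simp add: algebra_simps)
  qed (rule q_pos)
  finally have "\<not> inj_on T AB" using card_image[of T AB] by auto
  then obtain a b a' b' where ab: "(a, b) \<in> AB" "(a', b') \<in> AB" "T (a, b) = T (a', b')" "(a, b) \<noteq> (a', b')"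
    unfolding inj_on_def by (metis surj_pair)
  define A where "A i = a i - a' i" for i
  define B where "B i = b i - b' i" for i
  have v2: "v - 2 = Suc (v - 3)" using uv by simp
  have degA: "degree (A i) \<le> v" if "i \<le> ?e" for i
    unfolding A_def by (rule PK_degree, rule PK_diff) (use ab that in \<open>auto simp: AB_def X1_def X2_def PiE_iff\<close>)
  have degB: "degree (B i) \<le> v - 3" if "i \<le> u" for i
    unfolding B_def by (rule PK_degree, rule PK_diff) (use ab that v2 in \<open>auto simp: AB_def X1_def X2_def PiE_iff\<close>)
  have nz: "(\<exists>i\<le>?e. A i \<noteq> 0) \<or> (\<exists>i\<le>u. B i \<noteq> 0)"
  proof (rule ccontr)
    assume nz: "\<not> ?thesis"
    then have "a i = a' i" if "i \<le> ?e" for i using that by (auto simp: A_def)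
    moreover have "b i = b' i" if "i \<le> u" for i using that nz by (auto simp: B_def)
    moreover have "a \<in> X1" "a' \<in> X1" "b \<in> X2" "b' \<in> X2" using ab(1,2) by (auto simp: AB_def)
    ultimately have "a = a'" "b = b'" unfolding X1_def X2_def by (auto intro: PiE_ext)
    then show False using ab(4) by simp
  qed
  \<comment> \<open>\<open>T\<close> is additive because its exponent is a power of the
    characteristic, so a collision of two arguments becomes a relation for their difference.\<close>
  have T0: "(\<Sum>i\<le>?e. A i ^ ?P * monom 1 i) + f ^ (u + 1) * (\<Sum>i\<le>u. B i ^ ?P * monom 1 i) = 0"
    using ab(3) unfolding A_def B_def frob_diff T_def
    by (simp only: left_diff_distrib right_diff_distrib sum_subtractf case_prod_conv) (simp add: algebra_simps)
  define \<rho> where "\<rho> = (\<Sum>i\<le>?e. A i * monom 1 (?P' * i)) + f ^ (v + 1) * (\<Sum>i\<le>u. B i * monom 1 (?P' * i))"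
  have zero: "poly \<rho> x = 0" if x: "x \<in> K" "chi (poly f x) = 1" for x
  proof -
    have chp': "prime CHAR('a)" by fact
    have fx: "poly f x \<in> K" by (rule K_poly) (use f x in auto)
    have xq: "x ^ (?P' * i * ?P) = x ^ i" for i
    proof -
      have "x ^ (?P' * i * ?P) = (x ^ q) ^ i" by (simp only: q power_mult[symmetric] mult_ac)
      then show ?thesis using power_q[OF x(1)] by simp
    qed
    have "(q - 1) div 2 = u * ?P' + v"
      unfolding q by (simp add: algebra_simps)
    then have fe: "poly f x ^ (u * ?P' + v) = 1"
      using euler_criterion[OF fx] x(2) by simp
    \<comment> \<open>The right hand side splits off \<open>(q - 1) div 2\<close>, the exponent at
      which \<open>poly f x\<close> takes the value one.\<close>
    have "(v + 1) * ?P = (u * ?P' + v) + (u + 1)" by (simp add: algebra_simps)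
    then have fP: "(poly f x ^ (v + 1)) ^ ?P = poly f x ^ (u + 1)"
      using fe by (metis (no_types) mult_1 power_add power_mult)
    have "poly \<rho> x ^ ?P = (\<Sum>i\<le>?e. poly (A i) x * x ^ (?P' * i)) ^ ?P
        + (poly f x ^ (v + 1)) ^ ?P * (\<Sum>i\<le>u. poly (B i) x * x ^ (?P' * i)) ^ ?P"
      unfolding \<rho>_def P
      by (subst power_mult_distrib[symmetric], subst freshmans_dream'[OF chp', symmetric])
        (auto simp: poly_sum poly_monom)
    also have "\<dots> = (\<Sum>i\<le>?e. poly (A i) x ^ ?P * x ^ i) + poly f x ^ (u + 1) * (\<Sum>i\<le>u. poly (B i) x ^ ?P * x ^ i)"
      unfolding fP unfolding P freshmans_dream_sum'[OF chp' refl]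
      unfolding P[symmetric] power_mult_distrib power_mult[symmetric] xq by (rule refl)
    also have "\<dots> = poly ((\<Sum>i\<le>?e. A i ^ ?P * monom 1 i) + f ^ (u + 1) * (\<Sum>i\<le>u. B i ^ ?P * monom 1 i)) x"
      by (simp add: poly_sum poly_monom)
    finally show ?thesis unfolding T0 by auto
  qed
  have "\<rho> \<noteq> 0"
  proof
    assume "\<rho> = 0"
    \<comment> \<open>The power x^P' is treated as a second variable. In it \<open>AX\<close> and
      \<open>BX\<close> are the two sums of \<open>\<rho>\<close>, and \<open>FX\<close> turns into
      f^P' on substitution, since Frobenius is additive.\<close>
    define AX where "AX = (\<Sum>i\<le>?e. monom (A i) i)"
    define BX where "BX = (\<Sum>i\<le>u. monom (B i) i)"
    define FX where "FX = (\<Sum>i\<le>degree f. monom [:coeff f i ^ ?P':] i)"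
    let ?x = "monom 1 ?P' :: 'a poly"
    have cA: "coeff AX i = (if i \<le> ?e then A i else 0)" for i by (simp add: AX_def coeff_sum)
    have cB: "coeff BX i = (if i \<le> u then B i else 0)" for i by (simp add: BX_def coeff_sum)
    have cF: "coeff FX i = (if i \<le> degree f then [:coeff f i ^ ?P':] else 0)" for i by (simp add: FX_def coeff_sum)
    have pA: "poly AX ?x = (\<Sum>i\<le>?e. A i * monom 1 (?P' * i))"
      by (simp add: AX_def poly_sum poly_monom monom_power)
    have pB: "poly BX ?x = (\<Sum>i\<le>u. B i * monom 1 (?P' * i))"
      by (simp add: BX_def poly_sum poly_monom monom_power)
    have pF: "poly FX ?x = f ^ ?P'"
    proof -
      have "f ^ ?P' = (\<Sum>i\<le>degree f. monom (coeff f i) i) ^ ?P'" by (simp add: poly_as_sum_of_monoms)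
      also have "\<dots> = (\<Sum>i\<le>degree f. monom (coeff f i) i ^ ?P')"
        unfolding P' by (rule frob_sum) (rule refl)
      also have "\<dots> = (\<Sum>i\<le>degree f. [:coeff f i ^ ?P':] * monom 1 (?P' * i))"
        by (intro sum.cong refl) (simp only: monom_power mult_pCons_left smult_monom mult_zero_left pCons_0_0
            add_0_right mult_1_right mult.commute[of _ ?P'])
      also have "\<dots> = poly FX ?x"
        by (simp add: FX_def poly_sum poly_monom monom_power)
      finally show ?thesis by simp
    qed
    have "poly AX ?x = - (f ^ (v + 1) * poly BX ?x)"
      using \<open>\<rho> = 0\<close> unfolding \<rho>_def pA pB by (simp add: eq_neg_iff_add_eq_0)
    \<comment> \<open>Squaring makes the exponent of \<open>f\<close> equal to 2 v + 2 = P' + 1, of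
      which P' is absorbed by \<open>FX\<close>.\<close>
    then have "poly AX ?x ^ 2 = (f ^ (v + 1)) ^ 2 * poly BX ?x ^ 2"
      by (simp add: power_mult_distrib)
    also have "(f ^ (v + 1)) ^ 2 = f * f ^ ?P'"
      by (simp add: power_mult[symmetric] mult.commute flip: power_Suc)
    finally have ev: "poly (AX * AX - [:f:] * (FX * (BX * BX))) ?x = 0"
      by (simp only: poly_diff poly_mult pF poly_pCons poly_0 mult_zero_right add_0_right power2_eq_square
          mult.assoc diff_self)
    \<comment> \<open>All coefficients have degree at most 2 v = P' - 1, again because 6 + 2 (v - 3)
      = 2 v. The substitution therefore loses nothing, and the relation holds with two independent
      variables.\<close>
    have "AX * AX - [:f:] * (FX * (BX * BX)) = 0"
    proof (rule poly_poly_monom_eq_0[OF _ ev])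
      fix i
      have "degree (coeff (AX * AX) i) \<le> v + v"
        by (rule degree_coeff_mult_le) (auto simp: cA degA)
      moreover have "degree (coeff ([:f:] * (FX * (BX * BX))) i) \<le> 6 + (0 + ((v - 3) + (v - 3)))"
        by (intro degree_coeff_mult_le) (use f(2) degB in \<open>auto simp: cF cB coeff_pCons split: nat.splits\<close>)
      moreover have "6 + (0 + ((v - 3) + (v - 3))) = v + v" using uv by simp
      ultimately have "degree (coeff (AX * AX - [:f:] * (FX * (BX * BX))) i) \<le> v + v"
        unfolding coeff_diff by (intro degree_diff_le) simp_all
      then show "degree (coeff (AX * AX - [:f:] * (FX * (BX * BX))) i) < ?P'" by simp
    qed
    then have eq: "AX * AX = [:f:] * (FX * (BX * BX))" by simp
    show False
    proof (cases "BX = 0")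
      case True
      then have "AX = 0" using eq by simp
      have "A i = 0" if "i \<le> ?e" for i using cA[of i] that \<open>AX = 0\<close> by simp
      moreover have "B i = 0" if "i \<le> u" for i using cB[of i] that True by simp
      ultimately show False using nz by blast
    next
      case False
      define c where "c = lead_coeff f ^ ?P'"
      have "c \<noteq> 0" using r(1) by (simp add: c_def)
      have "degree FX = degree f"
      proof (rule antisym)
        show "degree FX \<le> degree f" by (rule degree_le) (simp add: cF)
        show "degree f \<le> degree FX" by (rule le_degree) (use \<open>c \<noteq> 0\<close> in \<open>simp add: cF c_def\<close>)
      qed
      then have lF: "lead_coeff FX = [:c:]" by (simp add: cF c_def)
      \<comment> \<open>Leading coefficients in the second variable satisfy \<alpha>^2 = c f
        \<beta>^2; the order at \<open>r\<close> is even on the left and odd on the right.\<close>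
      have "lead_coeff AX * lead_coeff AX = f * ([:c:] * (lead_coeff BX * lead_coeff BX))"
        using arg_cong[OF eq, of lead_coeff] by (simp only: lead_coeff_mult lF) simp
      moreover define \<alpha> where "\<alpha> = lead_coeff AX"
      moreover define \<beta> where "\<beta> = lead_coeff BX"
      ultimately have e: "\<alpha> * \<alpha> = f * ([:c:] * (\<beta> * \<beta>))" by simp
      have "\<beta> \<noteq> 0" using False by (simp add: \<beta>_def)
      then have n: "f * ([:c:] * (\<beta> * \<beta>)) \<noteq> 0" using r(1) \<open>c \<noteq> 0\<close> by simp
      then have "\<alpha> * \<alpha> \<noteq> 0" using e by simp
      then have "2 * order r \<alpha> = order r (f * ([:c:] * (\<beta> * \<beta>)))"
        using e by (metis mult_2 order_mult)
      also have "\<dots> = order r f + order r ([:c:] * (\<beta> * \<beta>))" using n by (rule order_mult)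
      also have "order r ([:c:] * (\<beta> * \<beta>)) = order r [:c:] + 2 * order r \<beta>"
        using n by (simp add: order_mult \<open>\<beta> \<noteq> 0\<close> del: mult_pCons_left)
      also have "order r [:c:] = 0" using \<open>c \<noteq> 0\<close> by (simp add: order_0I)
      finally show False using r(2) by presburger
    qed
  qed
  then have "card {x\<in>K. chi (poly f x) = 1} \<le> degree \<rho>"
    by (rule card_roots_le) (use zero in auto)
  also have "degree \<rho> \<le> v + ?P' * ?e"
    unfolding \<rho>_def
  proof (rule degree_add_le)
    have m: "degree (monom 1 (?P' * i) :: 'a poly) \<le> ?P' * n" if "i \<le> n" for i n
      using mult_le_mono2[OF that, of ?P'] by (intro order.trans[OF degree_monom_le])
    show "degree (\<Sum>i\<le>?e. A i * monom 1 (?P' * i)) \<le> v + ?P' * ?e"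
      by (intro degree_sum_le order.trans[OF degree_mult_le] add_mono m degA) auto
    have 2: "degree (\<Sum>i\<le>u. B i * monom 1 (?P' * i)) \<le> (v - 3) + ?P' * u"
      by (intro degree_sum_le order.trans[OF degree_mult_le] add_mono m degB) auto
    have "degree (f ^ (v + 1) * (\<Sum>i\<le>u. B i * monom 1 (?P' * i))) \<le> 6 * (v + 1) + ((v - 3) + ?P' * u)"
      using 2 mult_le_mono1[OF f(2), of "v + 1"]
      by (intro order.trans[OF degree_mult_le] add_mono order.trans[OF degree_power_le]) auto
    also have "\<dots> = v + ?P' * ?e"
      using uv by (simp add: algebra_simps)
    finally show "degree (f ^ (v + 1) * (\<Sum>i\<le>u. B i * monom 1 (?P' * i))) \<le> v + ?P' * ?e" .
  qed
  finally show ?thesis by simp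
qed

text \<open>\<open>card_chi_1_le\<close> applies to \<open>f\<close> and to its multiple by a
  non-square, which exchanges the values 1 and -1. Both numbers are at most \<open>z\<close>, where
  2 z exceeds \<open>q\<close> by less than 6 (2 v + 1); as all but at most six points take one of
  these values, neither number can be small.\<close>

theorem sum_chi_poly_le:
  fixes f :: "'a poly"
  assumes char: "prime CHAR('a)" and P: "2 * u + 1 = CHAR('a) ^ i" and P': "2 * v + 1 = CHAR('a) ^ j"
    and q: "q = (2 * u + 1) * (2 * v + 1)" and uv: "u \<le> v" "u \<ge> 3"
    and f: "\<And>k. coeff f k \<in> K" "degree f \<le> 6" and r: "f \<noteq> 0" "odd (order r f)"
  shows "\<bar>\<Sum>x\<in>K. chi (poly f x)\<bar> \<le> 6 * int (2 * v + 1) + 6"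
proof -
  let ?n = "\<lambda>e. int (card {x\<in>K. chi (poly f x) = e})"
  obtain \<eta> where \<eta>: "\<eta> \<in> K" "chi \<eta> = - 1" using exists_nonsquare by blast
  then have "\<eta> \<noteq> 0" by auto
  have b1: "card {x\<in>K. chi (poly f x) = 1} \<le> v + (2 * v + 1) * (u + 3)"
    using assms by (rule card_chi_1_le)
  have "card {x\<in>K. chi (poly (smult \<eta> f) x) = 1} \<le> v + (2 * v + 1) * (u + 3)"
    by (rule card_chi_1_le[OF char P P' q uv, where r = r])
      (use f r \<eta> \<open>\<eta> \<noteq> 0\<close> in \<open>auto intro: K_mult simp: order_smult\<close>)
  moreover have "chi (poly (smult \<eta> f) x) = - chi (poly f x)" if "x \<in> K" for x
    using that \<eta> f K_poly[of f x] by (simp add: chi_mult)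
  then have "{x\<in>K. chi (poly (smult \<eta> f) x) = 1} = {x\<in>K. chi (poly f x) = - 1}" by force
  ultimately have b2: "card {x\<in>K. chi (poly f x) = - 1} \<le> v + (2 * v + 1) * (u + 3)" by simp
  have "card {x\<in>K. chi (poly f x) = 0} \<le> degree f"
    by (rule card_roots_le[OF r(1)]) (auto simp: chi_def split: if_splits)
  then have b0: "?n 0 \<le> 6" using f(2) by simp
  have un: "K = {x\<in>K. chi (poly f x) = 1} \<union> ({x\<in>K. chi (poly f x) = - 1} \<union> {x\<in>K. chi (poly f x) = 0})"
    using chi_range by auto
  have tot: "(\<Sum>x\<in>K. g (chi (poly f x))) = g 1 * ?n 1 + (g (- 1) * ?n (- 1) + g 0 * ?n 0)" for g :: "int \<Rightarrow> int"
  proof -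
    have "(\<Sum>x\<in>K. g (chi (poly f x))) = (\<Sum>x\<in>{x\<in>K. chi (poly f x) = 1} \<union> ({x\<in>K. chi (poly f x) = - 1} \<union> {x\<in>K. chi (poly f x) = 0}). g (chi (poly f x)))"
      using un by simp
    also have "\<dots> = (\<Sum>x\<in>{x\<in>K. chi (poly f x) = 1}. g (chi (poly f x)))
       + ((\<Sum>x\<in>{x\<in>K. chi (poly f x) = - 1}. g (chi (poly f x))) + (\<Sum>x\<in>{x\<in>K. chi (poly f x) = 0}. g (chi (poly f x))))"
      using finite_K by (subst sum.union_disjoint, simp, simp, force, subst sum.union_disjoint) auto
    finally show ?thesis by (simp add: mult.commute)
  qed
  have s: "(\<Sum>x\<in>K. chi (poly f x)) = ?n 1 - ?n (- 1)" using tot[of "\<lambda>x. x"] by simp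
  have t: "int q = ?n 1 + ?n (- 1) + ?n 0" using tot[of "\<lambda>x. 1"] by simp
  define z where "z = int (v + (2 * v + 1) * (u + 3))"
  have "2 * z \<le> int q + 6 * int (2 * v + 1)"
    unfolding q z_def by (simp add: algebra_simps)
  moreover have "?n 1 \<le> z" "?n (- 1) \<le> z"
    using b1 b2 unfolding z_def of_nat_le_iff by auto
  ultimately show ?thesis using s t b0 by linarith
qed

end

section \<open>Counting points on a cubic fibred in quadric surfaces\<close>

lemma quad_add: "quad M (v + w) = quad M v + quad M w + (dot v (M *v w) + dot w (M *v v))"
  by (simp add: quad_def dot_def matrix_vector_right_distrib algebra_simps sum.distrib)

lemma quad_uminus: "quad M (- v) = quad M (v :: 'k::comm_ring_1 ^ 'n::finite)"
proof -
  have "M *v (- v) = - (M *v v)"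
    by (simp add: vec_eq_iff matrix_vector_mult_def sum_negf)
  then show ?thesis by (simp add: quad_def dot_def)
qed

lemma quad_parallelogram:
  fixes v w :: "'k::comm_ring_1 ^ 'n::finite"
  shows "quad M (v + w) + quad M (w - v) = 2 * quad M v + 2 * quad M w"
proof -
  have "M *v (- v) = - (M *v v)"
    by (simp add: vec_eq_iff matrix_vector_mult_def sum_negf)
  moreover have "dot w (- x) = - dot w x" "dot (- x) w = - dot x w" for w x :: "'k ^ 'n"
    by (simp_all add: dot_def sum_negf)
  ultimately have "quad M (w + - v) = quad M w + quad M v + (- dot w (M *v v) + - dot v (M *v w))"
    unfolding quad_add[of M w "- v"] quad_uminus by metis
  then show ?thesis unfolding quad_add[of M v w] by (simp add: algebra_simps)
qed

lemma symmetric_nth: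
  assumes "transpose M = M"
  shows "M $ a $ b = (M :: 'k ^ 'n ^ 'n) $ b $ a"
proof -
  have "M $ a $ b = transpose M $ b $ a" by (simp add: transpose_def)
  also have "\<dots> = M $ b $ a" by (simp only: assms)
  finally show ?thesis .
qed

lemma quad_polar:
  fixes M :: "'k::comm_ring_1 ^ 'n::finite ^ 'n"
  assumes "transpose M = M"
  shows "2 * M $ i $ j = quad M (axis i 1 + axis j 1) - quad M (axis i 1) - quad M (axis j 1)"
proof -
  have sym: "M $ a $ b = M $ b $ a" for a b
    by (rule symmetric_nth[OF assms])
  have "dot (axis a 1) (M *v axis b 1) = M $ a $ b" for a b
  proof -
    have "(M *v axis b 1) $ c = M $ c $ b" for c
      by (simp add: matrix_vector_mult_def axis_def if_distrib[of "\<lambda>x. _ * x"] cong: if_cong)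
    then show ?thesis
      by (simp add: dot_def axis_def if_distrib[of "\<lambda>x. x * _"] cong: if_cong)
  qed
  then have d: "dot (axis a 1) (M *v axis b 1) = M $ a $ b" for a b .
  show ?thesis
    unfolding quad_add d sym[of j i] by (simp add: algebra_simps)
qed

lemma symmetric_quad_eq:
  fixes M N :: "'k::field ^ 'n::finite ^ 'n"
  assumes "transpose M = M" "transpose N = N" "(2 :: 'k) \<noteq> 0" "\<And>v. quad M v = quad N v"
  shows "M = N"
proof -
  have "2 * M $ i $ j = 2 * N $ i $ j" for i j
    by (simp only: quad_polar[OF assms(1)] quad_polar[OF assms(2)] assms(4))
  then show ?thesis using assms(3) by (simp add: vec_eq_iff)
qed

definition cons4 :: "'k \<Rightarrow> 'k ^ 3 \<Rightarrow> 'k ^ 3 option" where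
  "cons4 u y = (\<chi> i. case i of None \<Rightarrow> u | Some j \<Rightarrow> y $ j)"

lemma cons4_nth [simp]: "cons4 u y $ None = u" "cons4 u y $ Some j = y $ j"
  by (simp_all add: cons4_def)

lemma forall_option: "(\<forall>i. P i) \<longleftrightarrow> P None \<and> (\<forall>j. P (Some j))"
  by (metis option.exhaust)

lemma cons4_collapse: "cons4 (v $ None) (\<chi> j. v $ Some j) = v"
  by (simp add: vec_eq_iff forall_option)

lemma cons4_eq_iff: "cons4 u y = cons4 u' y' \<longleftrightarrow> u = u' \<and> y = y'"
  by (auto simp: vec_eq_iff forall_option)

text \<open>The block in the variables y, that is, the restriction of the fibre form to u = 0. Its
  determinant is the equation of the curve D, see \<open>D_form_value\<close>.\<close>

definition low :: "'k ^ 3 option ^ 3 option \<Rightarrow> 'k ^ 3 ^ 3" where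
  "low M = (\<chi> a b. M $ Some a $ Some b)"

lemma sum_option: "(\<Sum>i\<in>UNIV. f i) = f None + (\<Sum>j\<in>UNIV. f (Some (j :: 'n::finite)))"
  by (simp add: UNIV_option_conv sum.reindex)

lemma quad_cons4_0: "quad M (cons4 0 y) = quad (low M) y"
  by (simp add: quad_def dot_def matrix_vector_mult_def sum_option low_def)

subsection \<open>Linear algebra in dimension three\<close>

definition indep3 :: "'k::field ^ 3 \<Rightarrow> 'k ^ 3 \<Rightarrow> bool" where
  "indep3 x w \<longleftrightarrow> (\<exists>i j. x $ i * w $ j - x $ j * w $ i \<noteq> 0)"

lemma other_indices: "\<exists>i j :: 3. i \<noteq> j \<and> i \<noteq> k \<and> j \<noteq> k \<and> (\<forall>l. l = i \<or> l = j \<or> l = k)"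
proof -
  have ne: "(1::3) \<noteq> 2" "(1::3) \<noteq> 3" "(2::3) \<noteq> 3" by auto
  consider "k = 1" | "k = 2" | "k = 3" using exhaust_3[of k] by auto
  then show ?thesis
  proof cases
    case 1
    show ?thesis by (rule exI[of _ 2], rule exI[of _ 3]) (use 1 ne exhaust_3 in auto)
  next
    case 2
    show ?thesis by (rule exI[of _ 1], rule exI[of _ 3]) (use 2 ne exhaust_3 in auto)
  next
    case 3
    show ?thesis by (rule exI[of _ 1], rule exI[of _ 2]) (use 3 ne exhaust_3 in auto)
  qed
qed

lemma sum_indices:
  assumes "i \<noteq> j" "i \<noteq> k" "j \<noteq> (k :: 3)" "\<And>l. l = i \<or> l = j \<or> l = k"
  shows "(\<Sum>l\<in>UNIV. f l) = f i + f j + f k"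
proof -
  have "UNIV = {i, j, k}" using assms(4) by auto
  moreover have "sum f {i, j, k} = f i + f j + f k" using assms(1-3) by (simp add: add.assoc)
  ultimately show ?thesis by simp
qed

text \<open>For \<open>k\<close> outside the indices of a non-vanishing minor of \<open>x\<close>
  and \<open>w\<close>, Cramer's rule recovers a vector orthogonal to both from its k-th
  coordinate.\<close>

lemma indep3_third:
  fixes x w :: "'k::field ^ 3"
  assumes "indep3 x w"
  obtains k where "\<And>d. dot d x = 0 \<Longrightarrow> dot d w = 0 \<Longrightarrow> d $ k = 0 \<Longrightarrow> d = 0"
proof -
  obtain i j where m: "x $ i * w $ j - x $ j * w $ i \<noteq> 0"
    using assms by (auto simp: indep3_def)
  then have "i \<noteq> j" by auto
  have "\<exists>k. k \<noteq> i \<and> k \<noteq> j"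
  proof (rule ccontr)
    assume "\<nexists>k. k \<noteq> i \<and> k \<noteq> j"
    then have "1 = i \<or> 1 = j" "2 = i \<or> 2 = j" "3 = i \<or> 3 = j" by blast+
    then show False by auto
  qed
  then obtain k where k: "k \<noteq> i" "k \<noteq> j" by blast
  from other_indices[of k] obtain a b where ab0: "a \<noteq> b \<and> a \<noteq> k \<and> b \<noteq> k \<and> (\<forall>l. l = a \<or> l = b \<or> l = k)"
    by (elim exE)
  note ab = ab0[THEN conjunct1] ab0[THEN conjunct2, THEN conjunct1]
    ab0[THEN conjunct2, THEN conjunct2, THEN conjunct1] ab0[THEN conjunct2, THEN conjunct2, THEN conjunct2, rule_format]
  have all: "l = i \<or> l = j \<or> l = k" for l
    using ab(4)[of l] ab(4)[of i] ab(4)[of j] k \<open>i \<noteq> j\<close> by auto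
  have ij: "(\<Sum>l\<in>UNIV. f l) = f i + f j + f k" for f :: "3 \<Rightarrow> 'k"
    by (rule sum_indices) (use k \<open>i \<noteq> j\<close> all in auto)
  show ?thesis
  proof (rule that)
    fix d assume d: "dot d x = 0" "dot d w = 0" "d $ k = 0"
    then have e: "d $ i * x $ i + d $ j * x $ j = 0" "d $ i * w $ i + d $ j * w $ j = 0"
      by (auto simp: dot_def ij)
    have "d $ i * (x $ i * w $ j - x $ j * w $ i) = w $ j * (d $ i * x $ i + d $ j * x $ j) - x $ j * (d $ i * w $ i + d $ j * w $ j)"
      by (simp add: algebra_simps)
    then have "d $ i = 0" using e m by simp
    have "d $ j * (x $ i * w $ j - x $ j * w $ i) = x $ i * (d $ i * w $ i + d $ j * w $ j) - w $ i * (d $ i * x $ i + d $ j * x $ j)"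
      by (simp add: algebra_simps)
    then have "d $ j = 0" using e m by simp
    show "d = 0"
      unfolding vec_eq_iff
    proof
      fix l show "d $ l = 0 $ l"
        using all[of l] \<open>d $ i = 0\<close> \<open>d $ j = 0\<close> d(3) by auto
    qed
  qed
qed

lemma indep3_annihilator:
  fixes x w a b :: "'k::field ^ 3"
  assumes "indep3 x w" "dot a x = 0" "dot a w = 0" "dot b x = 0" "dot b w = 0" "b \<noteq> 0"
  obtains \<mu> where "a = \<mu> *s b"
proof -
  obtain k where k: "\<And>d. dot d x = 0 \<Longrightarrow> dot d w = 0 \<Longrightarrow> d $ k = 0 \<Longrightarrow> d = 0"
    using indep3_third[OF assms(1)] by metis
  have "b $ k \<noteq> 0" using k assms by blast
  define d where "d = a - (a $ k / b $ k) *s b"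
  have dd: "dot d v = dot a v - a $ k / b $ k * dot b v" for v
    by (simp add: d_def dot_def sum_subtractf sum_distrib_left algebra_simps)
  have "d $ k = 0" using \<open>b $ k \<noteq> 0\<close> by (simp add: d_def)
  then have "d = 0" using k[of d] dd assms by simp
  then show ?thesis using that by (simp add: d_def)
qed

lemma not_indep3:
  fixes x w :: "'k::field ^ 3"
  assumes "\<not> indep3 x w" "x $ i \<noteq> 0"
  shows "w = (w $ i / x $ i) *s x"
proof -
  have "x $ i * w $ j = x $ j * w $ i" for j using assms(1) by (auto simp: indep3_def)
  then show ?thesis using assms(2) by (simp add: vec_eq_iff field_simps)
qed

lemma indep3_sym: "indep3 x w \<Longrightarrow> indep3 w x"
proof -
  assume "indep3 x w"
  then obtain i j where "x $ i * w $ j - x $ j * w $ i \<noteq> 0" by (auto simp: indep3_def)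
  then have "w $ j * x $ i - w $ i * x $ j \<noteq> 0" by (simp add: mult.commute)
  then show "indep3 w x" unfolding indep3_def by blast
qed

lemma indep3_add: "indep3 x w \<Longrightarrow> indep3 (x + t *s w) w"
proof -
  assume "indep3 x w"
  then obtain i j where "x $ i * w $ j - x $ j * w $ i \<noteq> 0" by (auto simp: indep3_def)
  moreover have "(x + t *s w) $ i * w $ j - (x + t *s w) $ j * w $ i = x $ i * w $ j - x $ j * w $ i"
    by (simp add: algebra_simps)
  ultimately show "indep3 (x + t *s w) w" unfolding indep3_def by metis
qed

lemma indep3_nonzero: "indep3 x w \<Longrightarrow> x \<noteq> 0" "indep3 x w \<Longrightarrow> w \<noteq> 0"
  by (auto simp: indep3_def)

lemma dot_right_add: "dot z (x + y) = dot z x + dot z y"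
  by (simp add: dot_def algebra_simps sum.distrib)

lemma dot_right_scale: "dot z (c *s x) = c * dot z x"
  by (simp add: dot_def sum_distrib_left mult_ac)

lemma dot_commute: "dot x y = dot y x"
  by (simp add: dot_def mult.commute)

text \<open>Where \<open>z $ k\<close> is non-zero the other two coordinates are free. The basis
  vectors have entries in \<open>K\<close> and so parametrise the points over \<open>K\<close>; the
  last clause says that they span the plane over the whole field as well.\<close>

lemma (in finite_subfield) plane_parametrisation:
  fixes z :: "'a ^ 3"
  assumes z: "z \<in> KV" "z \<noteq> 0"
  obtains x w where "x \<in> KV" "w \<in> KV" "indep3 x w" "dot z x = 0" "dot z w = 0"
    "bij_betw (\<lambda>(a, b). a *s x + b *s w) (K \<times> K) {x\<in>KV. dot z x = 0}"
    "\<And>y. dot z y = 0 \<Longrightarrow> \<exists>a b. y = a *s x + b *s w"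
proof -
  obtain k where k: "z $ k \<noteq> 0" using z(2) by (auto simp: vec_eq_iff)
  from other_indices[of k] obtain i j where ij0: "i \<noteq> j \<and> i \<noteq> k \<and> j \<noteq> k \<and> (\<forall>l. l = i \<or> l = j \<or> l = k)"
    by (elim exE)
  note ij = ij0[THEN conjunct1] ij0[THEN conjunct2, THEN conjunct1]
    ij0[THEN conjunct2, THEN conjunct2, THEN conjunct1] ij0[THEN conjunct2, THEN conjunct2, THEN conjunct2, rule_format]
  note sum_ijk = sum_indices[OF ij]
  define x where "x = z $ k *s axis i 1 - z $ i *s axis k 1"
  define w where "w = z $ k *s axis j 1 - z $ j *s axis k 1"
  have x: "x $ i = z $ k" "x $ j = 0" "x $ k = - z $ i"
    using ij(1-3) by (auto simp: axis_def x_def)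
  have w: "w $ i = 0" "w $ j = z $ k" "w $ k = - z $ j"
    using ij(1-3) by (auto simp: axis_def w_def)
  have zK: "z $ l \<in> K" for l using z by (simp add: KV_iff)
  have KV: "x \<in> KV" "w \<in> KV"
    using zK by (auto simp: x_def w_def KV_iff axis_def intro: K_closed)
  have ind: "indep3 x w"
    unfolding indep3_def by (rule exI[of _ i], rule exI[of _ j]) (simp add: x w k)
  have zxw: "dot z x = 0" "dot z w = 0"
    by (simp_all add: dot_def sum_ijk x w)
  have decomp: "y = (y $ i / z $ k) *s x + (y $ j / z $ k) *s w" if "dot z y = 0" for y
    unfolding vec_eq_iff
  proof
    fix l
    have "z $ i * y $ i + z $ j * y $ j + z $ k * y $ k = 0" using that by (simp add: dot_def sum_ijk)
    then have "y $ k * z $ k = - (z $ i * y $ i) - z $ j * y $ j"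
      by (simp add: algebra_simps eq_neg_iff_add_eq_0)
    then have yk: "y $ k = (- (z $ i * y $ i) - z $ j * y $ j) / z $ k"
      using k by (simp add: nonzero_eq_divide_eq)
    consider "l = i" | "l = j" | "l = k" using ij(4)[of l] by auto
    then show "y $ l = ((y $ i / z $ k) *s x + (y $ j / z $ k) *s w) $ l"
    proof cases
      case 1
      then show ?thesis using k by (simp add: x w)
    next
      case 2
      then show ?thesis using k by (simp add: x w)
    next
      case 3
      then show ?thesis unfolding 3 yk using k by (simp add: x w diff_divide_distrib mult.commute)
    qed
  qed
  have hi: "(a *s x + b *s w) $ i = a * z $ k" and hj: "(a *s x + b *s w) $ j = b * z $ k" for a b
    by (simp_all add: x w)
  have bij: "bij_betw (\<lambda>(a, b). a *s x + b *s w) (K \<times> K) {x\<in>KV. dot z x = 0}"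
  proof (rule bij_betwI[where g = "\<lambda>y. (y $ i / z $ k, y $ j / z $ k)"])
    show "(\<lambda>(a, b). a *s x + b *s w) \<in> K \<times> K \<rightarrow> {x\<in>KV. dot z x = 0}"
      using KV zxw by (auto simp: dot_right_add dot_right_scale intro: KV_add KV_scale)
    show "(\<lambda>y. (y $ i / z $ k, y $ j / z $ k)) \<in> {x\<in>KV. dot z x = 0} \<rightarrow> K \<times> K"
      using zK by (auto simp: KV_iff intro: K_divide)
    show "(\<lambda>y. (y $ i / z $ k, y $ j / z $ k)) ((\<lambda>(a, b). a *s x + b *s w) p) = p" for p
      using k by (cases p) (simp only: prod.case hi hj, simp)
    show "(\<lambda>(a, b). a *s x + b *s w) ((\<lambda>y. (y $ i / z $ k, y $ j / z $ k)) y) = y" if "y \<in> {x\<in>KV. dot z x = 0}" for y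
      using decomp[of y] that by simp
  qed
  show ?thesis
    by (rule that[OF KV ind zxw bij]) (use decomp in blast)
qed

lemma (in finite_subfield) card_plane:
  assumes "z \<in> KV" "z \<noteq> (0 :: 'a ^ 3)"
  shows "card {x\<in>KV. dot z x = 0} = q ^ 2"
proof (rule plane_parametrisation[OF assms])
  fix x w assume "bij_betw (\<lambda>(a, b). a *s x + b *s w) (K \<times> K) {x\<in>KV. dot z x = 0}"
  from bij_betw_same_card[OF this] show ?thesis
    by (simp add: card_cartesian_product power2_eq_square)
qed

lemma (in finite_subfield) card_line:
  assumes "indep3 x (w :: 'a ^ 3)"
  shows "card {z\<in>KV. dot z x = 0 \<and> dot z w = 0} \<le> q"
proof -
  obtain k where k: "\<And>d. dot d x = 0 \<Longrightarrow> dot d w = 0 \<Longrightarrow> d $ k = 0 \<Longrightarrow> d = 0"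
    using indep3_third[OF assms] by metis
  have "inj_on (\<lambda>z :: 'a ^ 3. z $ k) {z\<in>KV. dot z x = 0 \<and> dot z w = 0}"
  proof (rule inj_onI)
    fix z z' assume *: "z \<in> {z\<in>KV. dot z x = 0 \<and> dot z w = 0}" "z' \<in> {z\<in>KV. dot z x = 0 \<and> dot z w = 0}" "z $ k = z' $ k"
    have "dot (z - z') v = dot z v - dot z' v" for v
      by (simp add: dot_def sum_subtractf algebra_simps)
    then have "z - z' = 0" using * by (intro k) auto
    then show "z = z'" by simp
  qed
  then show ?thesis
    by (rule card_inj_on_le) (use finite_K in \<open>auto simp: KV_iff\<close>)
qed

section \<open>Polynomials over an algebraically closed field\<close>

lemma infinite_alg_closed: "infinite (UNIV :: 'a::alg_closed_field set)"
proof
  assume fin: "finite (UNIV :: 'a set)"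
  \<comment> \<open>Over a finite field this polynomial takes the value one everywhere, so it has no
    root.\<close>
  define p where "p = (\<Prod>a\<in>(UNIV :: 'a set). [:- a, 1:]) + 1"
  have "poly (\<Prod>a\<in>(UNIV :: 'a set). [:- a, 1:]) x = 0" for x
    using fin by (simp add: poly_prod)
  then have nr: "poly p x = 1" for x by (simp add: p_def)
  have "degree (\<Prod>a\<in>(UNIV :: 'a set). [:- a, 1:]) = card (UNIV :: 'a set)"
    using fin by (subst degree_prod_eq_sum_degree) auto
  moreover have "card (UNIV :: 'a set) > 0" using fin by (simp add: card_gt_0_iff)
  ultimately have "degree p > 0" unfolding p_def by (subst degree_add_eq_left) auto
  then show False using alg_closed_imp_poly_has_root[of p] nr by simp
qed

lemma poly_eq_if_nonzero_eq:
  fixes p r :: "'a::alg_closed_field poly"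
  assumes "\<And>t. t \<noteq> 0 \<Longrightarrow> poly p t = poly r t"
  shows "p = r"
proof (rule ccontr)
  assume "p \<noteq> r"
  then have "finite {t. poly (p - r) t = 0}" by (intro poly_roots_finite) simp
  moreover have "UNIV - {0} \<subseteq> {t. poly (p - r) t = 0}" using assms by auto
  ultimately have "finite (UNIV - {0 :: 'a})" by (rule finite_subset[rotated])
  then show False using infinite_alg_closed[where 'a = 'a] by simp
qed

text \<open>\<open>f\<close> and \<open>g\<close> are the two affine charts of a binary form of
  degree \<open>n\<close>. Multiplied by the power of \<open>t\<close> of exponent
  \<open>degree g\<close>, the hypothesis becomes an identity of polynomials in which that degree
  cancels.\<close>

lemma degree_le_of_reversal:
  fixes f g :: "'a::alg_closed_field poly"
  assumes "\<And>t. t \<noteq> 0 \<Longrightarrow> poly f t = t ^ n * poly g (1 / t)"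
  shows "degree f \<le> n"
proof (cases "f = 0")
  case False
  have "monom 1 (degree g) * f = monom 1 n * reflect_poly g"
    by (rule poly_eq_if_nonzero_eq)
      (simp add: poly_monom assms poly_reflect_poly_nz inverse_eq_divide mult_ac)
  then have "degree (monom 1 (degree g) * f) = degree (monom 1 n * reflect_poly g)" by simp
  moreover have "degree (monom 1 (degree g) * f) = degree g + degree f"
    using False by (subst degree_mult_eq) (auto simp: degree_monom_eq monom_eq_0_iff)
  moreover have "degree (monom 1 n * reflect_poly g) \<le> n + degree g"
    by (rule order.trans[OF degree_mult_le]) (intro add_mono degree_monom_le degree_reflect_poly_le)
  ultimately show ?thesis by linarith
qed simp

text \<open>Polynomial dependence without a chosen polynomial: the fibre matrices are given by the
  values of their forms, and closure rules carry the property to entries and determinants.\<close>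

definition polyfun :: "('a::comm_ring_1 \<Rightarrow> 'a) \<Rightarrow> bool" where
  "polyfun h \<longleftrightarrow> (\<exists>p. \<forall>t. h t = poly p t)"

lemma polyfunI: "(\<And>t. h t = poly p t) \<Longrightarrow> polyfun h"
  by (auto simp: polyfun_def)

lemma polyfun_const: "polyfun (\<lambda>t. c)"
  by (rule polyfunI[of _ "[:c:]"]) simp

lemma polyfun_ident: "polyfun (\<lambda>t. t)"
  by (rule polyfunI[of _ "[:0, 1:]"]) simp

lemma polyfun_add: "polyfun f \<Longrightarrow> polyfun g \<Longrightarrow> polyfun (\<lambda>t. f t + g t)"
  unfolding polyfun_def by (metis poly_add)

lemma polyfun_diff: "polyfun f \<Longrightarrow> polyfun g \<Longrightarrow> polyfun (\<lambda>t. f t - g t)"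
  unfolding polyfun_def by (metis poly_diff)

lemma polyfun_mult: "polyfun f \<Longrightarrow> polyfun g \<Longrightarrow> polyfun (\<lambda>t. f t * g t)"
  unfolding polyfun_def by (metis poly_mult)

lemma polyfun_sum: "(\<And>i. i \<in> A \<Longrightarrow> polyfun (f i)) \<Longrightarrow> polyfun (\<lambda>t. \<Sum>i\<in>A. f i t)"
  by (induction A rule: infinite_finite_induct) (auto intro: polyfun_const polyfun_add)

lemma polyfun_prod: "(\<And>i. i \<in> A \<Longrightarrow> polyfun (f i)) \<Longrightarrow> polyfun (\<lambda>t. \<Prod>i\<in>A. f i t)"
  by (induction A rule: infinite_finite_induct) (auto intro: polyfun_const polyfun_mult)

lemma polyfun_divide:
  fixes f :: "'a::field \<Rightarrow> 'a"
  shows "polyfun f \<Longrightarrow> polyfun (\<lambda>t. f t / c)"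
  using polyfun_mult[of f "\<lambda>_. 1 / c"] polyfun_const[of "1 / c"] by simp

lemma polyfun_det: "(\<And>i j. polyfun (\<lambda>t. M t $ i $ j)) \<Longrightarrow> polyfun (\<lambda>t. det (M t))"
  unfolding det_def by (intro polyfun_sum polyfun_mult polyfun_const polyfun_prod)

text \<open>The parallelogram law expresses the form at u = 0 by its values at u = 1 and u = -1,
  where one can divide by u.\<close>

lemma quad_cons4_0_eq: "quad M (cons4 0 y) + quad M (cons4 0 y)
    = quad M (cons4 1 y) + quad M (cons4 (- 1) y) - 2 * quad M (cons4 1 (0 :: 'k::comm_ring_1 ^ 3))"
proof -
  have e: "cons4 1 0 + cons4 0 y = cons4 1 y" "cons4 0 y - cons4 1 (0 :: 'k ^ 3) = cons4 (- 1) y"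
    by (simp_all add: vec_eq_iff forall_option)
  show ?thesis
    using quad_parallelogram[of M "cons4 1 0" "cons4 0 y"] unfolding e by simp
qed

definition mscale :: "'k::comm_ring_1 \<Rightarrow> 'k ^ 'n ^ 'm \<Rightarrow> 'k ^ 'n ^ 'm" where
  "mscale l M = (\<chi> i j. l * M $ i $ j)"

lemma mscale_nth: "mscale l M $ i $ j = l * M $ i $ j"
  by (simp add: mscale_def)

lemma det_mscale: "det (mscale l (M :: 'b::comm_ring_1 ^ 'n::finite ^ 'n)) = l ^ CARD('n) * det M"
  by (simp add: det_def mscale_nth prod.distrib sum_distrib_left mult_ac)

text \<open>\<open>qm x\<close> is the matrix of the fibre over \<open>x\<close>, a quadratic form in \<open>cons4 u y\<close>. As \<open>phi 0 y = 0\<close>, the form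
  \<open>phi (u x) y\<close> is divisible by \<open>u\<close>; stating \<open>qm_quad\<close> without the division also covers \<open>u = 0\<close> once
  polynomial dependence on \<open>u\<close> is known.\<close>

locale cubic_fibration = odd_finite_subfield K for K :: "'a::alg_closed_field set" +
  fixes phi :: "'a ^ 3 \<Rightarrow> 'a ^ 3 \<Rightarrow> 'a"
    and qm :: "'a ^ 3 \<Rightarrow> 'a ^ 3 option ^ 3 option"
  assumes qm_sym: "transpose (qm x) = qm x"
    and qm_quad: "c * quad (qm x) (cons4 c y) = phi (c *s x) y"
    and phi_K: "x \<in> KV \<Longrightarrow> y \<in> KV \<Longrightarrow> phi x y \<in> K"
    and phi_poly: "polyfun (\<lambda>t. phi (x + t *s w) y)"
    and qm_nz: "x \<in> KV \<Longrightarrow> x \<noteq> 0 \<Longrightarrow> qm x \<noteq> 0"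
begin

lemma phi_0: "phi 0 y = 0"
  using qm_quad[of 0 x y] by simp

text \<open>An explicit formula in terms of \<open>phi\<close>, from which the fibre matrix inherits
  rationality over \<open>K\<close> and polynomial dependence on \<open>x\<close>.\<close>

lemma quad_qm: "quad (qm x) (cons4 c y) =
    (if c = 0 then (phi x y - phi (- 1 *s x) y - 2 * phi x 0) / 2 else phi (c *s x) y / c)"
proof (cases "c = 0")
  case True
  have "quad (qm x) (cons4 0 y) + quad (qm x) (cons4 0 y)
    = quad (qm x) (cons4 1 y) + quad (qm x) (cons4 (- 1) y) - 2 * quad (qm x) (cons4 1 0)"
    by (rule quad_cons4_0_eq)
  also have "\<dots> = phi x y - phi (- 1 *s x) y - 2 * phi x 0"
  proof -
    have "quad (qm x) (cons4 1 y) = phi x y" for y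
      using qm_quad[of 1 x y] by simp
    moreover have "quad (qm x) (cons4 (- 1) y) = - phi (- 1 *s x) y"
      using qm_quad[of "- 1" x y] by (metis mult_minus1 minus_minus)
    ultimately show ?thesis by simp
  qed
  finally have "2 * quad (qm x) (cons4 0 y) = phi x y - phi (- 1 *s x) y - 2 * phi x 0"
    by simp
  then show ?thesis using True two_nz by (simp add: nonzero_eq_divide_eq mult.commute)
next
  case False
  then show ?thesis using qm_quad[of c x y] by (simp add: nonzero_eq_divide_eq mult.commute)
qed

lemma quad_qm_K: "x \<in> KV \<Longrightarrow> v \<in> KV \<Longrightarrow> quad (qm x) v \<in> K"
proof -
  assume xv: "x \<in> KV" "v \<in> KV"
  then have "v $ None \<in> K" "(\<chi> j. v $ Some j) \<in> KV" by (simp_all add: KV_iff)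
  moreover have "- 1 *s x \<in> KV" using xv(1) by (intro KV_scale K_closed)
  ultimately have "quad (qm x) (cons4 (v $ None) (\<chi> j. v $ Some j)) \<in> K"
    unfolding quad_qm using xv(1) by (auto intro!: phi_K K_closed KV_scale)
  then show ?thesis by (simp only: cons4_collapse)
qed

lemma quad_qm_poly: "polyfun (\<lambda>t. quad (qm (x + t *s w)) v)"
proof -
  have "polyfun (\<lambda>t. phi (c *s (x + t *s w)) y)" for c y
  proof -
    have eq: "c *s (x + t *s w) = c *s x + t *s (c *s w)" for t
      by (simp add: vec_eq_iff algebra_simps)
    show ?thesis unfolding eq by (rule phi_poly)
  qed
  note p = this this[of 1, simplified]
  have "polyfun (\<lambda>t. quad (qm (x + t *s w)) (cons4 (v $ None) (\<chi> j. v $ Some j)))"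
    unfolding quad_qm
    by (cases "v $ None = 0")
      (simp_all only: if_True if_False simp_thms, (intro polyfun_divide polyfun_diff polyfun_mult polyfun_const p)+)
  then show ?thesis by (simp only: cons4_collapse)
qed

lemma qm_nth: "qm x $ i $ j = (quad (qm x) (axis i 1 + axis j 1) - quad (qm x) (axis i 1) - quad (qm x) (axis j 1)) / 2"
  using quad_polar[OF qm_sym[of x], of i j] two_nz by (simp add: nonzero_eq_divide_eq mult.commute)

lemma qm_KM: "x \<in> KV \<Longrightarrow> qm x \<in> KM"
proof -
  assume "x \<in> KV"
  moreover have "axis i 1 \<in> (KV :: ('a ^ 3 option) set)" for i
    by (auto simp: KV_iff axis_def intro: K_closed)
  ultimately show ?thesis
    unfolding KM_iff qm_nth[of x] by (auto intro!: quad_qm_K K_closed KV_add)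
qed

lemma qm_poly: "polyfun (\<lambda>t. qm (x + t *s w) $ i $ j)"
  unfolding qm_nth[of "x + _ *s w"] by (intro polyfun_divide polyfun_diff quad_qm_poly)

text \<open>The values at non-zero \<open>c\<close> determine the form, and the form determines its
  symmetric matrix. Fibre matrices obtained from other coordinates are recognised in this
  way.\<close>

lemma qm_unique:
  assumes "transpose N = N" "\<And>c y. c \<noteq> 0 \<Longrightarrow> c * quad N (cons4 c y) = phi (c *s x) y"
  shows "N = qm x"
proof (rule symmetric_quad_eq[OF assms(1) qm_sym two_nz])
  fix v
  have nz: "quad N (cons4 c y) = quad (qm x) (cons4 c y)" if "c \<noteq> 0" for c y
    using that assms(2)[of c y] qm_quad[of c x y] by (metis mult_cancel_left)
  have m1: "(- 1 :: 'a) \<noteq> 0" by simp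
  have "2 * quad N (cons4 0 y) = 2 * quad (qm x) (cons4 0 y)" for y
    using quad_cons4_0_eq[of N y] quad_cons4_0_eq[of "qm x" y] nz[of 1] nz[of "- 1"] by simp
  then have "quad N (cons4 c y) = quad (qm x) (cons4 c y)" for c y
    using two_nz nz[of c y] by (cases "c = 0") auto
  then show "quad N v = quad (qm x) v" using cons4_collapse[of v] by metis
qed

lemma qm_scale:
  assumes "l \<noteq> 0"
  defines "D \<equiv> diag (\<lambda>i. case i of None \<Rightarrow> l | Some _ \<Rightarrow> 1)"
  shows "qm (l *s x) = mscale l (D ** qm x ** D)"
proof -
  have nth: "(D ** M ** D) $ i $ j = D $ i $ i * M $ i $ j * D $ j $ j" for M :: "'a ^ 3 option ^ 3 option" and i j
    by (simp add: mat_nth D_def diag_nth if_distrib[of "\<lambda>x. x * _"] if_distrib[of "\<lambda>x. _ * x"] cong: if_cong)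
  have "(mscale l (D ** qm x ** D)) = qm (l *s x)"
  proof (rule qm_unique)
    show "transpose (mscale l (D ** qm x ** D)) = mscale l (D ** qm x ** D)"
      by (simp add: vec_eq_iff transpose_def mscale_nth nth symmetric_nth[OF qm_sym, of x] mult_ac)
    fix c y assume "c \<noteq> (0 :: 'a)"
    have t: "transpose D = D" by (simp add: vec_eq_iff transpose_def D_def diag_nth)
    have "quad (mscale l (D ** qm x ** D)) v = l * quad (D ** qm x ** D) v" for v
      by (simp add: quad_def dot_def matrix_vector_mult_def mscale_nth sum_distrib_left mult_ac)
    also have "quad (D ** qm x ** D) v = quad (qm x) (D *v v)" for v
      using quad_congruence[of D "qm x" v] by (simp only: t)
    finally have "quad (mscale l (D ** qm x ** D)) (cons4 c y) = l * quad (qm x) (D *v cons4 c y)" .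
    also have "D *v cons4 c y = cons4 (l * c) y"
      by (simp add: vec_eq_iff forall_option matrix_vector_mult_def D_def diag_nth if_distrib[of "\<lambda>x. x * _"] cong: if_cong)
    finally have "c * quad (mscale l (D ** qm x ** D)) (cons4 c y) = (l * c) * quad (qm x) (cons4 (l * c) y)"
      by simp
    also have "\<dots> = phi (c *s (l *s x)) y"
      unfolding qm_quad by (simp add: mult.commute)
    finally show "c * quad (mscale l (D ** qm x ** D)) (cons4 c y) = phi (c *s (l *s x)) y" .
  qed
  then show ?thesis by simp
qed

text \<open>Scaling \<open>x\<close> by \<open>l\<close> multiplies a 4 x 4 matrix by
  \<open>l\<close> and also rescales u by \<open>l\<close>. The exponent is 4 + 2, as befits a
  discriminant curve of degree six.\<close>

lemma det_qm_scale: "l \<noteq> 0 \<Longrightarrow> det (qm (l *s x)) = l ^ 6 * det (qm x)"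
  unfolding qm_scale
  by (simp add: det_mscale det_mul det_diag UNIV_3_option power_numeral_reduce card_UNIV_option)

lemma low_qm_scale: "l \<noteq> 0 \<Longrightarrow> low (qm (l *s x)) = mscale l (low (qm x))"
proof -
  assume l: "l \<noteq> 0"
  show ?thesis
    unfolding qm_scale[OF l]
    by (simp add: vec_eq_iff low_def mscale_nth mat_nth diag_nth if_distrib[of "\<lambda>x. x * _"] if_distrib[of "\<lambda>x. _ * x"] cong: if_cong)
qed

lemma det_low_scale: "l \<noteq> 0 \<Longrightarrow> det (low (qm (l *s x))) = l ^ 3 * det (low (qm x))"
  by (simp add: low_qm_scale det_mscale)

lemma low_sym: "transpose (low (qm x)) = low (qm x)"
  by (simp add: vec_eq_iff transpose_def low_def symmetric_nth[OF qm_sym, of x])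

lemma low_KM: "x \<in> KV \<Longrightarrow> low (qm x) \<in> KM"
  using qm_KM[of x] by (simp add: KM_iff low_def)

lemma cons4_KV: "c \<in> K \<Longrightarrow> y \<in> KV \<Longrightarrow> cons4 c y \<in> KV"
  by (auto simp: KV_iff cons4_def split: option.splits)

subsection \<open>Fibre counts\<close>

definition hc :: "'a ^ 3 \<Rightarrow> int" where
  "hc x = int (card {y\<in>KV. phi x y = 0})"

text \<open>Collecting the counts over all non-zero multiples of \<open>x\<close> gives a quantity
  that depends on the projective point only.\<close>

definition G :: "'a ^ 3 \<Rightarrow> int" where
  "G x = (\<Sum>l\<in>K - {0}. hc (l *s x))"

text \<open>A zero (u, y) of the fibre form with u non-zero is the same as a point y over the
  multiple u x; the zeros with u = 0 are those of the block \<open>low\<close>.\<close>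

lemma G_eq: "G x = int (zeros (qm x)) - int (zeros (low (qm x)))"
proof -
  let ?Z = "{v\<in>KV. quad (qm x) v = 0}"
  have fin: "finite ?Z" by (rule finite_subset[OF _ finite_KV]) auto
  have "card ?Z = card {v\<in>?Z. v $ None \<noteq> 0} + card {v\<in>?Z. v $ None = 0}"
    using fin by (subst card_Un_disjoint[symmetric]) (auto intro!: arg_cong[of _ _ card])
  moreover have "card {v\<in>?Z. v $ None = 0} = zeros (low (qm x))"
    unfolding zeros_def
  proof (rule bij_betw_same_card[symmetric, of "cons4 0"], rule bij_betwI[where g = "\<lambda>v. \<chi> j. v $ Some j"])
    show "cons4 0 \<in> {v \<in> KV. quad (low (qm x)) v = 0} \<rightarrow> {v\<in>?Z. v $ None = 0}"
      by (auto simp: quad_cons4_0 intro: cons4_KV K_0)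
    show "(\<lambda>v. \<chi> j. v $ Some j) \<in> {v\<in>?Z. v $ None = 0} \<rightarrow> {v \<in> KV. quad (low (qm x)) v = 0}"
    proof safe
      fix v assume v: "v \<in> KV" "quad (qm x) v = 0" "v $ None = 0"
      then show "(\<chi> j. v $ Some j) \<in> KV" by (simp add: KV_iff)
      show "quad (low (qm x)) (\<chi> j. v $ Some j) = 0"
        using v(2) cons4_collapse[of v] unfolding v(3) by (simp add: quad_cons4_0[symmetric])
    qed
    show "(\<chi> j. cons4 0 y $ Some j) = y" for y :: "'a ^ 3" by (simp add: vec_eq_iff)
    show "cons4 0 (\<chi> j. v $ Some j) = v" if "v \<in> {v\<in>?Z. v $ None = 0}" for v
      using that cons4_collapse[of v] by simp
  qed
  moreover have "int (card {v\<in>?Z. v $ None \<noteq> 0}) = G x"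
  proof -
    have "card {v\<in>?Z. v $ None \<noteq> 0} = card (SIGMA l:K - {0}. {y\<in>KV. phi (l *s x) y = 0})"
    proof (rule bij_betw_same_card[symmetric, of "\<lambda>(l, y). cons4 l y"], rule bij_betwI[where g = "\<lambda>v. (v $ None, \<chi> j. v $ Some j)"])
      show "(\<lambda>(l, y). cons4 l y) \<in> (SIGMA l:K - {0}. {y\<in>KV. phi (l *s x) y = 0}) \<rightarrow> {v\<in>?Z. v $ None \<noteq> 0}"
        by (auto simp: quad_qm intro: cons4_KV)
      show "(\<lambda>v. (v $ None, \<chi> j. v $ Some j)) \<in> {v\<in>?Z. v $ None \<noteq> 0} \<rightarrow> (SIGMA l:K - {0}. {y\<in>KV. phi (l *s x) y = 0})"
      proof safe
        fix v assume v: "v \<in> KV" "quad (qm x) v = 0" "v $ None \<noteq> 0"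
        then show "v $ None \<in> K" "(\<chi> j. v $ Some j) \<in> KV" by (simp_all add: KV_iff)
        show "phi (v $ None *s x) (\<chi> j. v $ Some j) = 0"
          using v(2) qm_quad[of "v $ None" x "\<chi> j. v $ Some j"] by (simp add: cons4_collapse)
      qed
    qed (auto simp: cons4_collapse vec_eq_iff)
    also have "\<dots> = (\<Sum>l\<in>K - {0}. card {y\<in>KV. phi (l *s x) y = 0})"
      using finite_K by (intro card_SigmaI) (auto intro: finite_subset[OF _ finite_KV])
    finally show ?thesis by (simp add: G_def hc_def)
  qed
  ultimately show ?thesis by (simp add: zeros_def)
qed

lemma G_scale:
  assumes "l \<in> K" "l \<noteq> 0"
  shows "G (l *s x) = G x"
  unfolding G_def
  by (rule sum.reindex_bij_witness[of _ "\<lambda>m. m / l" "\<lambda>m. m * l"])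
    (use assms in \<open>auto intro: K_mult K_divide\<close>)

text \<open>Each of the q - 1 non-zero scalars permutes \<open>Z\<close>.\<close>

lemma sum_hc:
  assumes Z: "Z \<subseteq> KV" "\<And>l x. l \<in> K \<Longrightarrow> l \<noteq> 0 \<Longrightarrow> x \<in> Z \<Longrightarrow> l *s x \<in> Z"
  shows "(int q - 1) * (\<Sum>x\<in>Z. hc x) = (\<Sum>x\<in>Z. G x)"
proof -
  have "(\<Sum>x\<in>Z. G x) = (\<Sum>l\<in>K - {0}. \<Sum>x\<in>Z. hc (l *s x))"
    unfolding G_def by (rule sum.swap)
  also have "\<dots> = (\<Sum>l\<in>K - {0}. \<Sum>x\<in>Z. hc x)"
  proof (rule sum.cong[OF refl])
    fix l assume l: "l \<in> K - {0}"
    then have il: "inverse l \<in> K" "inverse l \<noteq> 0" by (auto intro: K_inverse)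
    show "(\<Sum>x\<in>Z. hc (l *s x)) = (\<Sum>x\<in>Z. hc x)"
    proof (rule sum.reindex_bij_witness[of _ "\<lambda>x. inverse l *s x" "\<lambda>x. l *s x"])
      show "inverse l *s (l *s x) = x" "l *s (inverse l *s x) = x" for x
        using l by simp_all
      show "l *s x \<in> Z" "inverse l *s x \<in> Z" if "x \<in> Z" for x
        using Z(2)[OF _ _ that] l il by auto
    qed simp
  qed
  finally show ?thesis
    using finite_K K_0 q_pos by (simp add: card_Diff_singleton of_nat_diff)
qed

end

subsection \<open>Good lines\<close>

lemma det_two_vanishing_rows:
  fixes M :: "'k::field poly ^ 'n::finite ^ 'n"
  assumes "i \<noteq> j" "\<And>k. poly (M $ i $ k) 0 = 0" "\<And>k. poly (M $ j $ k) 0 = 0"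
  obtains g where "det M = [:0, 1:] * ([:0, 1:] * g)"
proof -
  let ?x = "[:0, 1:] :: 'k poly"
  have "\<exists>a. M $ r $ k = ?x * a" if "r = i \<or> r = j" for r k
  proof -
    have "poly (M $ r $ k) 0 = 0" using that assms(2,3) by auto
    then have "[:- 0, 1:] dvd M $ r $ k" by (simp only: poly_eq_0_iff_dvd)
    then show ?thesis by (simp add: dvd_def)
  qed
  then obtain a where a: "\<And>r k. r = i \<or> r = j \<Longrightarrow> M $ r $ k = ?x * a r k" by metis
  define A where "A r = (\<chi> k. a r k)" for r
  have 1: "M $ r = ?x *s A r" if "r = i \<or> r = j" for r
    using a[OF that] by (simp add: vec_eq_iff A_def)
  define M' where "M' = (\<chi> r. if r = i then A r else M $ r)"
  have "det M = det (\<chi> r. if r = i then ?x *s A r else M $ r)"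
    using 1 by (intro arg_cong[of _ _ det]) (auto simp: vec_eq_iff)
  also have "\<dots> = ?x * det M'"
    unfolding M'_def by (rule det_row_mul)
  also have "det M' = det (\<chi> r. if r = j then ?x *s A r else M' $ r)"
    using 1 assms(1) by (intro arg_cong[of _ _ det]) (auto simp: vec_eq_iff M'_def)
  also have "\<dots> = ?x * det (\<chi> r. if r = j then A r else M' $ r)"
    by (rule det_row_mul)
  finally show ?thesis by (rule that)
qed

lemma (in odd_finite_subfield) card_kernel_le:
  fixes M :: "'a ^ 'n::finite ^ 'n"
  assumes "corank_le_1 M"
  shows "card {v\<in>KV. M *v v = 0} \<le> q"
proof -
  obtain P d i where P: "P \<in> KM" "det P \<noteq> 0" "transpose P ** M ** P = diag d" "\<And>j. j \<noteq> i \<Longrightarrow> d j \<noteq> 0"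
    using assms unfolding corank_le_1_def by blast
  have b: "bij_betw (\<lambda>v. P *v v) KV KV" by (rule bij_betw_KM[OF P(1,2)])
  let ?W = "{w\<in>KV. M *v (P *v w) = 0}"
  have sub: "{v\<in>KV. M *v v = 0} \<subseteq> (\<lambda>v. P *v v) ` ?W"
    using b unfolding bij_betw_def by auto
  have 0: "w $ j = 0" if "w \<in> ?W" "j \<noteq> i" for w j
  proof -
    have "diag d *v w = transpose P *v (M *v (P *v w))"
      unfolding P(3)[symmetric] by (simp only: matrix_vector_mul_assoc matrix_mul_assoc)
    then have "(diag d *v w) $ j = 0" using that(1) by simp
    moreover have "(diag d *v w) $ j = d j * w $ j"
      by (simp add: matrix_vector_mult_def diag_nth if_distrib[of "\<lambda>x. x * _"] cong: if_cong)
    ultimately show ?thesis using P(4)[OF that(2)] by simp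
  qed
  have "inj_on (\<lambda>w :: 'a ^ 'n. w $ i) ?W"
  proof (rule inj_onI)
    fix w w' assume *: "w \<in> ?W" "w' \<in> ?W" "w $ i = w' $ i"
    have "w $ j = w' $ j" for j using 0[OF *(1), of j] 0[OF *(2), of j] *(3) by (cases "j = i") simp_all
    then show "w = w'" by (simp add: vec_eq_iff)
  qed
  then have "card ?W \<le> q"
    by (rule card_inj_on_le) (use finite_K in \<open>auto simp: KV_iff\<close>)
  moreover have "finite ?W" by (rule finite_subset[OF _ finite_KV]) auto
  ultimately show ?thesis
    using card_mono[OF finite_imageI sub] card_image_le[of ?W "\<lambda>v. P *v v"] by linarith
qed

context cubic_fibration
begin

text \<open>As \<open>x\<close>, \<open>w\<close> range over all bases of the plane \<open>dot z x = 0\<close>, excluding a multiple root at the parameter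
  \<open>0\<close> excludes it everywhere on the line.\<close>

definition good_line :: "'a ^ 3 \<Rightarrow> bool" where
  "good_line z \<longleftrightarrow> z \<in> KV \<and> z \<noteq> 0 \<and>
     (\<forall>x w f. indep3 x w \<and> dot z x = 0 \<and> dot z w = 0 \<and> (\<forall>t. poly f t = det (qm (x + t *s w)))
        \<longrightarrow> \<not> (poly f 0 = 0 \<and> poly (pderiv f) 0 = 0)) \<and>
     (\<exists>x. dot z x = 0 \<and> det (low (qm x)) \<noteq> 0)"

lemma exists_indep3:
  assumes "z \<in> KV" "z \<noteq> 0" "x \<noteq> 0"
  shows "\<exists>w. dot z w = 0 \<and> indep3 x w"
proof (rule plane_parametrisation[OF assms(1,2)])
  fix a b assume ab: "indep3 a b" "dot z a = 0" "dot z b = 0"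
  obtain i where i: "x $ i \<noteq> 0" using assms(3) by (auto simp: vec_eq_iff)
  have "indep3 x a \<or> indep3 x b"
  proof (rule ccontr)
    assume n: "\<not> (indep3 x a \<or> indep3 x b)"
    then obtain c e where "a = c *s x" "b = e *s x" using not_indep3 i by blast
    then have "\<not> indep3 a b" by (simp add: indep3_def mult_ac)
    then show False using ab(1) by simp
  qed
  then show ?thesis using ab by blast
qed

text \<open>Where the corank is at least two, a diagonalising congruence makes two rows vanish at
  the parameter 0. Each contributes a factor to the determinant, so the discriminant along the line
  has a double zero.\<close>

lemma good_line_corank:
  assumes "good_line z" "x \<in> KV" "x \<noteq> 0" "dot z x = 0"
  shows "corank_le_1 (qm x)"
proof (rule ccontr)
  assume "\<not> corank_le_1 (qm x)"
  then obtain P d i j where P: "P \<in> KM" "det P \<noteq> 0" "transpose P ** qm x ** P = diag d" "i \<noteq> j" "d i = 0" "d j = 0"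
    using not_corank_le_1E[OF qm_KM[OF assms(2)] qm_sym] by metis
  obtain w where w: "dot z w = 0" "indep3 x w"
    using exists_indep3[of z x] assms by (auto simp: good_line_def)
  have "\<forall>a b. \<exists>p. \<forall>t. qm (x + t *s w) $ a $ b = poly p t"
    using qm_poly[of x w] unfolding polyfun_def by blast
  then obtain p where p: "\<And>a b t. qm (x + t *s w) $ a $ b = poly (p a b) t" by metis
  define Mp where "Mp = (\<chi> a b. p a b)"
  define C where "C = (\<chi> a b. [:P $ a $ b:])"
  have ev: "(\<chi> a b. poly (Mp $ a $ b) t) = qm (x + t *s w)" for t
    by (simp add: vec_eq_iff Mp_def p)
  have f: "poly (det Mp) t = det (qm (x + t *s w))" for t
    using hom_det[OF hom_poly, of Mp t] ev[of t] by simp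
  have PM: "poly ((transpose C ** Mp ** C) $ a $ b) t = (transpose P ** qm (x + t *s w) ** P) $ a $ b" for a b t
    by (simp add: mat_nth transpose_def poly_sum C_def ev[symmetric] mult.commute)
  have "poly ((transpose C ** Mp ** C) $ r $ k) 0 = 0" if "r = i \<or> r = j" for r k
    using that P(3,5,6) unfolding PM by (auto simp: diag_nth)
  then obtain g where g: "det (transpose C ** Mp ** C) = [:0, 1:] * ([:0, 1:] * g)"
    using det_two_vanishing_rows[OF P(4), of "transpose C ** Mp ** C"] by metis
  have dC: "det C = [:det P:]"
    unfolding C_def using hom_det[OF hom_pCons, of P] by simp
  have "det (transpose C ** Mp ** C) = [:det P ^ 2:] * det Mp"
    by (simp add: det_mul dC power2_eq_square)
  then have e: "smult (det P ^ 2) (det Mp) = [:0, 1:] * ([:0, 1:] * g)" using g by simp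
  have "poly (smult (det P ^ 2) (det Mp)) 0 = 0" unfolding e by simp
  then have 1: "poly (det Mp) 0 = 0" using P(2) by simp
  have "poly (pderiv (smult (det P ^ 2) (det Mp))) 0 = 0" unfolding e pderiv_mult by simp
  then have 2: "poly (pderiv (det Mp)) 0 = 0" using P(2) by (simp add: pderiv_smult)
  show False using assms(1,4) w f 1 2 unfolding good_line_def by blast
qed

text \<open>If the block were zero, the vectors with u = 0 that are orthogonal to the row
  \<open>b\<close> would lie in the kernel. They form a space of dimension at least two, whereas
  \<open>card_kernel_le\<close> admits only \<open>q\<close> elements.\<close>

lemma low_nonzero:
  assumes "x \<in> KV" "corank_le_1 (qm x)"
  shows "low (qm x) \<noteq> 0"
proof
  assume l: "low (qm x) = 0"
  define b where "b = (\<chi> j. qm x $ None $ Some j)"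
  have b: "b \<in> KV" using qm_KM[OF assms(1)] by (simp add: KM_iff KV_iff b_def)
  have "qm x *v cons4 0 y = 0" if "dot b y = 0" for y
  proof -
    have "qm x $ Some a $ Some c = 0" for a c
    proof -
      have "low (qm x) $ a $ c = 0" unfolding l by simp
      then show ?thesis by (simp add: low_def)
    qed
    then show ?thesis
      using that by (simp add: vec_eq_iff forall_option matrix_vector_mult_def sum_option b_def dot_def)
  qed
  then have "cons4 0 ` {y\<in>KV. dot b y = 0} \<subseteq> {v\<in>KV. qm x *v v = 0}"
    by (auto intro: cons4_KV K_0)
  then have "card (cons4 0 ` {y\<in>KV. dot b y = 0}) \<le> card {v\<in>KV. qm x *v v = 0}"
    by (intro card_mono finite_subset[OF _ finite_KV]) auto
  moreover have "inj_on (cons4 (0 :: 'a)) A" for A by (auto simp: inj_on_def cons4_eq_iff)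
  ultimately have "card {y\<in>KV. dot b y = 0} \<le> q"
    using card_kernel_le[OF assms(2)] by (simp add: card_image)
  moreover have "q < card {y\<in>KV. dot b y = 0}"
  proof (cases "b = 0")
    case True
    have "q ^ 1 < q ^ 3" using q_pos by (intro power_strict_increasing) auto
    then show ?thesis using True by (simp add: dot_def card_KV)
  next
    case False
    have "q ^ 1 < q ^ 2" using q_pos by (intro power_strict_increasing) auto
    then show ?thesis by (simp add: card_plane[OF b False])
  qed
  ultimately show False by simp
qed

text \<open>The deviation from the generic value: q^3 zeros of a form in four variables less q^2
  zeros of its restriction to u = 0.\<close>

definition E :: "'a ^ 3 \<Rightarrow> int" where
  "E x = G x - (int q ^ 3 - int q ^ 2)"

lemma E_scale: "l \<in> K \<Longrightarrow> l \<noteq> 0 \<Longrightarrow> E (l *s x) = E x"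
  by (simp add: E_def G_scale)

lemma E_corank:
  assumes "x \<in> KV" "corank_le_1 (qm x)"
  shows "E x = chi (det (qm x)) * (int q * (int q - 1)) + (int q ^ 2 - int (zeros (low (qm x))))"
  unfolding E_def G_eq using zeros_corank_le_1[OF qm_KM[OF assms(1)] assms(2)] by simp

lemma zeros_low_bound:
  assumes "x \<in> KV" "corank_le_1 (qm x)"
  shows "\<bar>int q ^ 2 - int (zeros (low (qm x)))\<bar> \<le> (if det (low (qm x)) = 0 then int q ^ 2 else 0)"
proof (cases "det (low (qm x)) = 0")
  case True
  have "q * zeros (low (qm x)) \<le> 2 * q ^ CARD(3)"
    by (rule zeros_le[OF low_KM[OF assms(1)] low_sym low_nonzero[OF assms]])
  also have "\<dots> = q * (2 * q ^ 2)" by (simp add: power2_eq_square power3_eq_cube)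
  finally have "zeros (low (qm x)) \<le> 2 * q ^ 2" using q_pos by simp
  then have "int (zeros (low (qm x))) \<le> int (2 * q ^ 2)" by (simp only: of_nat_le_iff)
  then have "int (zeros (low (qm x))) \<le> 2 * int q ^ 2" by simp
  then show ?thesis using True by simp
next
  case False
  then show ?thesis using zeros_3_nondegenerate[OF low_KM[OF assms(1)] low_sym] by simp
qed

lemma abs_E_corank:
  assumes "x \<in> KV" "corank_le_1 (qm x)"
  shows "\<bar>E x\<bar> \<le> 2 * int q ^ 2"
proof -
  have "\<bar>chi (det (qm x)) * (int q * (int q - 1))\<bar> \<le> 1 * (int q * (int q - 1))"
    unfolding abs_mult using abs_chi[of "det (qm x)"] q_pos by (intro mult_mono) auto
  moreover have "int q * (int q - 1) \<le> int q ^ 2" by (simp add: power2_eq_square algebra_simps)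
  moreover have "\<bar>int q ^ 2 - int (zeros (low (qm x)))\<bar> \<le> int q ^ 2"
    using zeros_low_bound[OF assms] by (auto split: if_splits)
  ultimately show ?thesis unfolding E_corank[OF assms] by linarith
qed

lemma abs_E:
  assumes "x \<in> KV" "x \<noteq> 0"
  shows "\<bar>E x\<bar> \<le> 2 * int q ^ 3"
proof -
  have "q * zeros (qm x) \<le> 2 * q ^ CARD(3 option)"
    by (rule zeros_le[OF qm_KM[OF assms(1)] qm_sym qm_nz[OF assms]])
  also have "\<dots> = q * (2 * q ^ 3)" by (simp add: card_UNIV_option power_numeral_reduce)
  finally have "zeros (qm x) \<le> 2 * q ^ 3" using q_pos by simp
  then have "int (zeros (qm x)) \<le> int (2 * q ^ 3)" by (simp only: of_nat_le_iff)
  then have 1: "int (zeros (qm x)) \<le> 2 * int q ^ 3" by simp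
  have "zeros (low (qm x)) \<le> card (KV :: ('a ^ 3) set)"
    unfolding zeros_def by (intro card_mono) auto
  then have "zeros (low (qm x)) \<le> q ^ 3" by (simp add: card_KV)
  then have "int (zeros (low (qm x))) \<le> int (q ^ 3)" by (simp only: of_nat_le_iff)
  then have 2: "int (zeros (low (qm x))) \<le> int q ^ 3" by simp
  have 3: "int q ^ 2 \<le> int q ^ 3" using q_pos by (intro power_increasing) auto
  have "G x \<ge> 0" unfolding G_def hc_def by (intro sum_nonneg) simp
  moreover have "int q ^ 2 \<ge> 0" by simp
  ultimately show ?thesis using 1 2 3 unfolding E_def G_eq by linarith
qed

text \<open>\<open>E\<close> is constant on the non-zero multiples of a vector, and the lines
  through the origin in the plane are represented by x + t w and by \<open>w\<close>, the point at
  infinity.\<close>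

lemma sum_E_plane:
  assumes z: "bij_betw (\<lambda>(a, b). a *s x + b *s w) (K \<times> K) {x\<in>KV. dot z x = 0}"
  shows "(\<Sum>y\<in>{x\<in>KV. dot z x = 0} - {0}. E y) = (int q - 1) * ((\<Sum>t\<in>K. E (x + t *s w)) + E w)"
proof -
  let ?Z = "{x\<in>KV. dot z x = 0}"
  have finZ: "finite ?Z" by (rule finite_subset[OF _ finite_KV]) auto
  have 0: "0 \<in> ?Z" by (simp add: dot_def)
  have split: "(\<Sum>a\<in>K. g a) = g 0 + (\<Sum>a\<in>K - {0}. g a)" for g :: "'a \<Rightarrow> int"
    using finite_K K_0 by (simp add: sum.remove)
  have c: "(\<Sum>a\<in>K - {0}. C) = (int q - 1) * C" for C :: int
    using finite_K K_0 q_pos by (simp add: card_Diff_singleton of_nat_diff)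
  have "(\<Sum>y\<in>?Z. E y) = (\<Sum>(a, b)\<in>K \<times> K. E (a *s x + b *s w))"
    by (subst sum.reindex_bij_betw[OF z, symmetric]) (simp add: case_prod_unfold)
  also have "\<dots> = (\<Sum>a\<in>K. \<Sum>b\<in>K. E (a *s x + b *s w))"
    by (simp add: sum.cartesian_product)
  also have "\<dots> = (\<Sum>b\<in>K. E (b *s w)) + (\<Sum>a\<in>K - {0}. \<Sum>b\<in>K. E (a *s x + b *s w))"
    by (subst split) simp
  also have "(\<Sum>b\<in>K. E (b *s w)) = E 0 + (\<Sum>b\<in>K - {0}. E w)"
    by (subst split) (auto intro!: sum.cong simp: E_scale)
  also have "(\<Sum>a\<in>K - {0}. \<Sum>b\<in>K. E (a *s x + b *s w)) = (\<Sum>a\<in>K - {0}. \<Sum>t\<in>K. E (x + t *s w))"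
  proof (rule sum.cong[OF refl])
    fix a assume a: "a \<in> K - {0}"
    have "(\<Sum>b\<in>K. E (a *s x + b *s w)) = (\<Sum>t\<in>K. E (a *s x + (a * t) *s w))"
      using a by (intro sum_K_scale[of a "\<lambda>b. E (a *s x + b *s w)", symmetric]) auto
    also have "\<dots> = (\<Sum>t\<in>K. E (a *s (x + t *s w)))"
      by (simp add: vector_add_ldistrib)
    also have "\<dots> = (\<Sum>t\<in>K. E (x + t *s w))"
      by (intro sum.cong refl E_scale) (use a in auto)
    finally show "(\<Sum>b\<in>K. E (a *s x + b *s w)) = (\<Sum>t\<in>K. E (x + t *s w))" .
  qed
  finally show ?thesis
    using sum.remove[OF finZ 0, of E] unfolding c by (simp add: algebra_simps)
qed

lemma reversal:
  assumes "\<And>t. poly f t = det (qm (x + t *s w))" "\<And>t. poly g t = det (qm (w + t *s x))" "t \<noteq> 0"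
  shows "poly f t = t ^ 6 * poly g (1 / t)"
proof -
  have eq: "x + t *s w = t *s (w + (1 / t) *s x)"
    using assms(3) by (simp add: vec_eq_iff field_simps)
  show ?thesis unfolding assms(1,2) unfolding eq by (rule det_qm_scale[OF assms(3)])
qed

lemma reversal_low:
  assumes "\<And>t. poly f t = det (low (qm (x + t *s w)))" "\<And>t. poly g t = det (low (qm (w + t *s x)))" "t \<noteq> 0"
  shows "poly f t = t ^ 3 * poly g (1 / t)"
proof -
  have eq: "x + t *s w = t *s (w + (1 / t) *s x)"
    using assms(3) by (simp add: vec_eq_iff field_simps)
  show ?thesis unfolding assms(1,2) unfolding eq by (rule det_low_scale[OF assms(3)])
qed

lemma det_poly: "\<exists>f. \<forall>t. poly f t = det (qm (x + t *s w))"
  using polyfun_det[OF qm_poly, of x w] unfolding polyfun_def by metis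

lemma low_poly: "\<exists>f. \<forall>t. poly f t = det (low (qm (x + t *s w)))"
proof -
  have "polyfun (\<lambda>t. det (low (qm (x + t *s w))))"
    by (rule polyfun_det) (simp add: low_def qm_poly)
  then show ?thesis unfolding polyfun_def by metis
qed

text \<open>Translating the parameter shows that any root of \<open>f\<close> is simple. A root
  exists because for constant \<open>f\<close> the opposite chart \<open>g\<close> would be c t^6,
  with a multiple root at zero.\<close>

lemma good_line_odd_order:
  assumes "good_line z" "indep3 x w" "dot z x = 0" "dot z w = 0" and f: "\<And>t. poly f t = det (qm (x + t *s w))"
  shows "f \<noteq> 0" "degree f \<le> 6" "\<exists>r. odd (order r f)"
proof -
  have no: "\<not> (poly f 0 = 0 \<and> poly (pderiv f) 0 = 0)"
    if "indep3 x w" "dot z x = 0" "dot z w = 0" "\<And>t. poly f t = det (qm (x + t *s w))" for x w f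
    using assms(1) that unfolding good_line_def by blast
  show f0: "f \<noteq> 0" using no[OF assms(2-4) f] by auto
  obtain g where g: "\<And>t. poly g t = det (qm (w + t *s x))" using det_poly[of w x] by blast
  show "degree f \<le> 6"
    by (rule degree_le_of_reversal[OF reversal[OF f g]])
  have "degree f \<noteq> 0"
  proof
    assume "degree f = 0"
    then obtain c where c: "f = [:c:]" by (metis degree_eq_zeroE)
    have "g = monom c 6"
      by (rule poly_eq_if_nonzero_eq) (simp add: reversal[OF g f] c poly_monom mult.commute)
    then have "poly g 0 = 0 \<and> poly (pderiv g) 0 = 0"
      by (simp add: poly_monom pderiv_monom)
    then show False using no[OF indep3_sym[OF assms(2)] assms(4,3) g] by simp
  qed
  then obtain r where r: "poly f r = 0" using alg_closed_imp_poly_has_root[of f] by auto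
  define h where "h = pcompose f [:r, 1:]"
  have h: "poly h t = det (qm ((x + r *s w) + t *s w))" for t
  proof -
    have eq: "(x + r *s w) + t *s w = x + (r + t) *s w" by (simp add: vec_eq_iff algebra_simps)
    show ?thesis unfolding eq by (simp add: h_def poly_pcompose f)
  qed
  have "dot z (x + r *s w) = 0" using assms(3,4) by (simp add: dot_right_add dot_right_scale)
  from no[OF indep3_add[OF assms(2)] this assms(4) h]
  have "poly (pderiv h) 0 \<noteq> 0" using r by (simp add: h_def poly_pcompose)
  then have d: "poly (pderiv f) r \<noteq> 0"
    by (simp add: h_def pderiv_pcompose poly_pcompose pderiv_pCons)
  have "order r f = 1"
  proof (rule ccontr)
    assume "order r f \<noteq> 1"
    moreover have "order r f \<noteq> 0" using r f0 by (simp add: order_root)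
    ultimately have "2 \<le> order r f" by linarith
    then have dvd: "[:- r, 1:] ^ 2 dvd f" unfolding order_divides by simp
    define l where "l = [:- r, 1:]"
    obtain g where "f = l ^ 2 * g" using dvd unfolding l_def[symmetric] by (elim dvdE)
    then have "f = l * (l * g)" by (simp add: power2_eq_square mult.assoc)
    moreover have "poly l r = 0" by (simp add: l_def)
    ultimately have "poly (pderiv f) r = 0" by (simp add: pderiv_mult)
    then show False using d by simp
  qed
  then have "odd (order r f)" by simp
  then show "\<exists>r. odd (order r f)" ..
qed

text \<open>The point of the line where the determinant is non-zero may be the one spanned by
  \<open>w\<close>, at infinity; then the opposite chart \<open>g\<close> decides. It cannot be the
  zero vector, as \<open>qm 0\<close> is zero.\<close>

lemma good_line_low:
  assumes "good_line z" "\<And>y. dot z y = 0 \<Longrightarrow> \<exists>a b. y = a *s x + b *s w"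
    and f: "\<And>t. poly f t = det (low (qm (x + t *s w)))"
  shows "f \<noteq> 0" "degree f \<le> 3"
proof -
  obtain g where g: "\<And>t. poly g t = det (low (qm (w + t *s x)))" using low_poly[of w x] by blast
  show "degree f \<le> 3"
    by (rule degree_le_of_reversal[OF reversal_low[OF f g]])
  show "f \<noteq> 0"
  proof
    assume f0: "f = 0"
    obtain y where y: "dot z y = 0" "det (low (qm y)) \<noteq> 0"
      using assms(1) by (auto simp: good_line_def)
    then obtain a b where ab: "y = a *s x + b *s w" using assms(2) by blast
    show False
    proof (cases "a = 0")
      case False
      then have eq: "y = a *s (x + (b / a) *s w)" by (simp add: ab vec_eq_iff field_simps)
      have "det (low (qm y)) = a ^ 3 * poly f (b / a)" unfolding eq f by (rule det_low_scale[OF False])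
      then show False using y f0 by simp
    next
      case True
      have "g = 0"
        by (rule poly_eq_if_nonzero_eq) (simp add: reversal_low[OF g f] f0)
      then have w0: "det (low (qm w)) = 0" using g[of 0] by simp
      show False
      proof (cases "b = 0")
        case False
        then show False using y w0 True ab by (simp add: det_low_scale)
      next
        case b: True
        have "0 = qm 0" by (rule qm_unique) (simp_all add: phi_0 transpose_def vec_eq_iff quad_def dot_def)
        then have "low (qm 0) = mscale 0 (low (qm 0))" by (simp add: vec_eq_iff low_def mscale_nth)
        then have "det (low (qm 0)) = det (mscale 0 (low (qm 0)))" by simp
        then have "det (low (qm 0)) = 0" unfolding det_mscale by simp
        then show False using y(2) True b ab by simp
      qed
    qed
  qed
qed

end

section \<open>Cancellation along a good line\<close>

locale cubic_weil = cubic_fibration +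
  fixes u v :: nat
  assumes char: "prime CHAR('a)" and P: "\<exists>i. 2 * u + 1 = CHAR('a) ^ i" and P': "\<exists>j. 2 * v + 1 = CHAR('a) ^ j"
    and q_eq: "card K = (2 * u + 1) * (2 * v + 1)" and uv: "u \<le> v" "u \<ge> 3"
begin

lemma q_ge: "q \<ge> 49"
proof -
  have "7 * 7 \<le> (2 * u + 1) * (2 * v + 1)" using uv by (intro mult_le_mono) auto
  then show ?thesis using q_eq by simp
qed

text \<open>Raising the coefficients to the q-th power preserves the values on \<open>K\<close>, by
  Frobenius. Two polynomials of degree below \<open>q\<close> that agree on \<open>K\<close>
  coincide.\<close>

lemma K_coeffs:
  fixes f :: "'a poly"
  assumes "degree f < q" "\<And>x. x \<in> K \<Longrightarrow> poly f x \<in> K"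
  shows "coeff f k \<in> K"
proof -
  obtain n where n: "q = CHAR('a) ^ n"
    using P P' q_eq by (metis power_add)
  define g where "g = (\<Sum>i\<le>degree f. monom (coeff f i ^ q) i)"
  have cg: "coeff g i = (if i \<le> degree f then coeff f i ^ q else 0)" for i
    by (simp add: g_def coeff_sum)
  have "poly (g - f) x = 0" if "x \<in> K" for x
  proof -
    have "poly g x = (\<Sum>i\<le>degree f. (coeff f i * x ^ i) ^ q)"
    proof -
      have "(coeff f i * x ^ i) ^ q = coeff f i ^ q * x ^ i" for i
      proof -
        have "(x ^ i) ^ q = (x ^ q) ^ i" by (simp only: power_mult[symmetric] mult.commute)
        then show ?thesis using power_q[OF that] by (simp add: power_mult_distrib)
      qed
      then show ?thesis by (simp add: g_def poly_sum poly_monom)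
    qed
    also have "\<dots> = poly f x ^ q"
      unfolding poly_altdef n by (rule freshmans_dream_sum'[OF char refl, symmetric])
    also have "\<dots> = poly f x" using assms(2)[OF that] by (rule power_q)
    finally show ?thesis by simp
  qed
  moreover have "degree (g - f) < q"
  proof -
    have "degree g \<le> degree f" by (rule degree_le) (simp add: cg)
    then show ?thesis using assms(1) degree_diff_le[of g "degree f" f] by simp
  qed
  ultimately have "g - f = 0"
    using card_roots_le[of "g - f" K] by force
  then have "coeff g k = coeff f k" by simp
  then have "coeff f k ^ q = coeff f k"
    using cg[of k] q_pos by (cases "k \<le> degree f") (auto simp: coeff_eq_0 power_0_left)
  then show ?thesis by (simp add: in_K_iff)
qed

text \<open>In units of q^2 and with p = 2 v + 1, the character sum of the discriminant contributes
  6 p + 6, the at most three zeros of the determinant of \<open>low\<close> contribute 3, and the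
  point at infinity contributes 2.\<close>

lemma good_line_sum:
  assumes "good_line z"
  shows "\<bar>\<Sum>y\<in>{x\<in>KV. dot z x = 0} - {0}. E y\<bar> \<le> (int q - 1) * (int q ^ 2 * (6 * int (2 * v + 1) + 11))"
proof (rule plane_parametrisation)
  show "z \<in> KV" "z \<noteq> 0" using assms by (auto simp: good_line_def)
  fix x w assume *: "x \<in> KV" "w \<in> KV" "indep3 x w" "dot z x = 0" "dot z w = 0"
    "bij_betw (\<lambda>(a, b). a *s x + b *s w) (K \<times> K) {x\<in>KV. dot z x = 0}"
    "\<And>y. dot z y = 0 \<Longrightarrow> \<exists>a b. y = a *s x + b *s w"
  obtain f where f: "\<And>t. poly f t = det (qm (x + t *s w))" using det_poly[of x w] by blast
  obtain g where g: "\<And>t. poly g t = det (low (qm (x + t *s w)))" using low_poly[of x w] by blast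
  note fg = good_line_odd_order[OF assms *(3-5) f] good_line_low[OF assms *(7) g]
  have xw: "x + t *s w \<in> KV" "dot z (x + t *s w) = 0" "x + t *s w \<noteq> 0" if "t \<in> K" for t
    using that * indep3_nonzero(1)[OF indep3_add[OF *(3)]]
    by (auto simp: dot_right_add dot_right_scale intro: KV_add KV_scale)
  have cor: "corank_le_1 (qm (x + t *s w))" if "t \<in> K" for t
    using good_line_corank[OF assms xw(1,3,2)] that by blast
  have corw: "corank_le_1 (qm w)"
    using good_line_corank[OF assms *(2) indep3_nonzero(2)[OF *(3)] *(5)] .
  let ?n = "\<lambda>t. int q ^ 2 - int (zeros (low (qm (x + t *s w))))"
  obtain r where r: "odd (order r f)" using fg(3) by blast
  obtain i j where ij: "2 * u + 1 = CHAR('a) ^ i" "2 * v + 1 = CHAR('a) ^ j" using P P' by blast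
  have fK: "coeff f k \<in> K" for k
  proof (rule K_coeffs)
    show "degree f < q" using fg(2) q_ge by linarith
    show "poly f t \<in> K" if "t \<in> K" for t
      unfolding f using xw(1)[OF that] by (intro K_det qm_KM)
  qed
  have S: "\<bar>\<Sum>t\<in>K. chi (poly f t)\<bar> \<le> 6 * int (2 * v + 1) + 6"
    by (rule sum_chi_poly_le[OF char ij q_eq uv fK fg(2,1) r])
  have "\<bar>\<Sum>t\<in>K. ?n t\<bar> \<le> (\<Sum>t\<in>K. if poly g t = 0 then int q ^ 2 else 0)"
    by (rule order.trans[OF sum_abs], rule sum_mono)
      (use zeros_low_bound[OF xw(1) cor] g in auto)
  also have "\<dots> = int (card {t\<in>K. poly g t = 0}) * int q ^ 2"
    using finite_K by (simp add: sum.If_cases Int_def)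
  also have "\<dots> \<le> 3 * int q ^ 2"
  proof -
    have "card {t\<in>K. poly g t = 0} \<le> degree g" by (rule card_roots_le[OF fg(4)]) auto
    then have "int (card {t\<in>K. poly g t = 0}) \<le> 3" using fg(5) by linarith
    then show ?thesis by (intro mult_right_mono) auto
  qed
  finally have N: "\<bar>\<Sum>t\<in>K. ?n t\<bar> \<le> 3 * int q ^ 2" .
  have "(\<Sum>t\<in>K. E (x + t *s w)) = (\<Sum>t\<in>K. chi (poly f t) * (int q * (int q - 1)) + ?n t)"
    by (intro sum.cong refl) (simp only: E_corank[OF xw(1) cor] f)
  then have sE: "(\<Sum>t\<in>K. E (x + t *s w)) = (\<Sum>t\<in>K. chi (poly f t)) * (int q * (int q - 1)) + (\<Sum>t\<in>K. ?n t)"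
    by (simp only: sum.distrib sum_distrib_right)
  have "\<bar>(\<Sum>t\<in>K. chi (poly f t)) * (int q * (int q - 1))\<bar> \<le> (6 * int (2 * v + 1) + 6) * int q ^ 2"
    unfolding abs_mult using S q_pos
    by (intro mult_mono) (auto simp: power2_eq_square intro!: mult_mono)
  moreover have "\<bar>E w\<bar> \<le> 2 * int q ^ 2" by (rule abs_E_corank[OF *(2) corw])
  ultimately have "\<bar>(\<Sum>t\<in>K. E (x + t *s w)) + E w\<bar> \<le> (6 * int (2 * v + 1) + 6) * int q ^ 2 + 3 * int q ^ 2 + 2 * int q ^ 2"
    unfolding sE using N by linarith
  also have "\<dots> = int q ^ 2 * (6 * int (2 * v + 1) + 11)" by (simp add: algebra_simps)
  finally show ?thesis
    unfolding sum_E_plane[OF *(6)] abs_mult using q_pos by (intro mult_mono) auto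
qed

end

subsection \<open>Averaging over all lines\<close>

context cubic_weil
begin

definition W :: "('a ^ 3) set" where
  "W = {x\<in>KV. x \<noteq> 0 \<and> \<not> corank_le_1 (qm x)}"

lemma finite_W: "finite W"
  by (rule finite_subset[OF _ finite_KV]) (auto simp: W_def)

lemma finite_plane: "finite {x\<in>KV. dot (z :: 'a ^ 3) x = 0}"
  by (rule finite_subset[OF _ finite_KV]) auto

lemma card_not_indep3:
  assumes "x \<in> KV" "x \<noteq> 0"
  shows "card {x'\<in>W. \<not> indep3 x x'} \<le> q"
proof -
  obtain i where i: "x $ i \<noteq> 0" using assms(2) by (auto simp: vec_eq_iff)
  have "{x'\<in>W. \<not> indep3 x x'} \<subseteq> (\<lambda>c. c *s x) ` K"
  proof safe
    fix x' assume x': "x' \<in> W" "\<not> indep3 x x'"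
    then have "x' = (x' $ i / x $ i) *s x" using not_indep3 i by blast
    moreover have "x' $ i / x $ i \<in> K" using x' assms by (auto simp: W_def KV_iff intro: K_divide)
    ultimately show "x' \<in> (\<lambda>c. c *s x) ` K" by blast
  qed
  then show ?thesis using finite_K surj_card_le by blast
qed

text \<open>No good line meets \<open>W\<close>, so all but few planes miss it, whereas the variance of the number of points
  of \<open>W\<close> on a random plane is small.\<close>

lemma card_W_le:
  assumes B: "B \<subseteq> KV" "card B \<le> d * q ^ 2" "\<And>z. z \<in> KV \<Longrightarrow> z \<notin> B \<Longrightarrow> z \<noteq> 0 \<Longrightarrow> good_line z"
    and qd: "2 * (d + 1) \<le> q"
  shows "card W \<le> 2 * (d + 1) * q"
proof -
  let ?B = "insert 0 B"
  define T where "T z = (\<Sum>x\<in>W. if dot z x = 0 then 1 else 0 :: real)" for z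
  have finB: "finite ?B" using finite_subset[OF B(1) finite_KV] by simp
  have cB: "real (card ?B) \<le> real (d + 1) * real q ^ 2"
  proof -
    have "card ?B \<le> d * q ^ 2 + 1" using B(2) finB by (simp add: card_insert_if)
    also have "\<dots> \<le> (d + 1) * q ^ 2" using q_pos by simp
    finally have "real (card ?B) \<le> real ((d + 1) * q ^ 2)" by (simp only: of_nat_le_iff)
    then show ?thesis by (simp add: algebra_simps)
  qed
  \<comment> \<open>Since a plane through a point of \<open>W\<close> always belongs to
    \<open>?B\<close>, summing over \<open>?B\<close> counts all planes through one or two points of
    \<open>W\<close>: q^2 through one, at most \<open>q\<close> through two independent
    ones.\<close>
  have inB: "z \<in> ?B" if "x \<in> W" "z \<in> KV" "dot z x = 0" for z x
  proof (rule ccontr)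
    assume "z \<notin> ?B"
    then have "good_line z" using B(3)[OF that(2)] by auto
    then show False using good_line_corank[of z x] that by (auto simp: W_def)
  qed
  have BK: "?B \<subseteq> KV" using B(1) by auto
  have one: "real (card {z\<in>?B. dot z x = 0}) = real q ^ 2" if x: "x \<in> W" for x
  proof -
    have "{z\<in>?B. dot z x = 0} = {z\<in>KV. dot x z = 0}"
      using inB[OF x] BK by (auto simp: dot_commute[of x])
    then show ?thesis using card_plane[of x] x by (simp add: W_def)
  qed
  have "(\<Sum>z\<in>?B. T z) = (\<Sum>x\<in>W. \<Sum>z\<in>?B. if dot z x = 0 then 1 else 0)"
    unfolding T_def by (rule sum.swap)
  also have "\<dots> = (\<Sum>x\<in>W. real (card {z\<in>?B. dot z x = 0}))"
    using finB by (intro sum.cong refl) (simp only: sum.inter_filter[symmetric] sum_constant mult_1_right)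
  also have "\<dots> = (\<Sum>x\<in>W. real q ^ 2)" by (rule sum.cong[OF refl one])
  also have "\<dots> = real (card W) * real q ^ 2" by simp
  finally have S1: "(\<Sum>z\<in>?B. T z) = real (card W) * real q ^ 2" .
  have two: "(\<Sum>z\<in>?B. (if dot z x = 0 then 1 else 0) * (if dot z x' = 0 then 1 else 0 :: real))
      \<le> real q + (if indep3 x x' then 0 else real q ^ 2)" if "x \<in> W" for x x'
  proof -
    have "(\<Sum>z\<in>?B. (if dot z x = 0 then 1 else 0) * (if dot z x' = 0 then 1 else 0 :: real))
      = (\<Sum>z\<in>?B. if dot z x = 0 \<and> dot z x' = 0 then 1 else 0)"
      by (intro sum.cong refl) auto
    also have "\<dots> = real (card {z\<in>?B. dot z x = 0 \<and> dot z x' = 0})"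
      using finB by (simp only: sum.inter_filter[symmetric] sum_constant mult_1_right)
    also have "\<dots> \<le> real q + (if indep3 x x' then 0 else real q ^ 2)"
    proof (cases "indep3 x x'")
      case True
      have "card {z\<in>?B. dot z x = 0 \<and> dot z x' = 0} \<le> card {z\<in>KV. dot z x = 0 \<and> dot z x' = 0}"
        using BK by (intro card_mono finite_subset[OF _ finite_KV]) auto
      then show ?thesis using card_line[OF True] True by simp
    next
      case False
      have "card {z\<in>?B. dot z x = 0 \<and> dot z x' = 0} \<le> card {z\<in>?B. dot z x = 0}"
        using finB by (intro card_mono) auto
      then have "real (card {z\<in>?B. dot z x = 0 \<and> dot z x' = 0}) \<le> real (card {z\<in>?B. dot z x = 0})"
        by (simp only: of_nat_le_iff)
      moreover have "0 \<le> real q" by simp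
      ultimately show ?thesis unfolding if_not_P[OF False] one[OF that] by linarith
    qed
    finally show ?thesis .
  qed
  have "(\<Sum>z\<in>?B. T z ^ 2) = (\<Sum>z\<in>?B. \<Sum>x\<in>W. \<Sum>x'\<in>W. (if dot z x = 0 then 1 else 0) * (if dot z x' = 0 then 1 else 0))"
    unfolding T_def power2_eq_square sum_product by (rule refl)
  also have "\<dots> = (\<Sum>x\<in>W. \<Sum>z\<in>?B. \<Sum>x'\<in>W. (if dot z x = 0 then 1 else 0) * (if dot z x' = 0 then 1 else 0))"
    by (rule sum.swap)
  also have "\<dots> = (\<Sum>x\<in>W. \<Sum>x'\<in>W. \<Sum>z\<in>?B. (if dot z x = 0 then 1 else 0) * (if dot z x' = 0 then 1 else 0))"
    by (rule sum.cong[OF refl], rule sum.swap)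
  also have "\<dots> \<le> (\<Sum>x\<in>W. \<Sum>x'\<in>W. real q + (if indep3 x x' then 0 else real q ^ 2))"
    by (intro sum_mono two)
  also have "\<dots> \<le> (\<Sum>x\<in>W. real (card W) * real q + real q * real q ^ 2)"
  proof (rule sum_mono)
    fix x assume x: "x \<in> W"
    have "(\<Sum>x'\<in>W. if indep3 x x' then 0 else real q ^ 2) = (\<Sum>x'\<in>W. if \<not> indep3 x x' then real q ^ 2 else 0)"
      by (intro sum.cong refl) auto
    also have "\<dots> = real (card {x'\<in>W. \<not> indep3 x x'}) * real q ^ 2"
      using finite_W by (simp only: sum.inter_filter[symmetric] sum_constant)
    also have "\<dots> \<le> real q * real q ^ 2"
      using card_not_indep3[of x] x by (intro mult_right_mono) (auto simp: W_def)
    finally show "(\<Sum>x'\<in>W. real q + (if indep3 x x' then 0 else real q ^ 2)) \<le> real (card W) * real q + real q * real q ^ 2"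
      by (simp only: sum.distrib sum_constant add_left_mono)
  qed
  finally have S2: "(\<Sum>z\<in>?B. T z ^ 2) \<le> real (card W) * (real (card W) * real q + real q * real q ^ 2)"
    by simp
  define w where "w = real (card W)"
  define Q where "Q = real q"
  define D where "D = real (d + 1)"
  have Q0: "Q > 0" using q_pos by (simp add: Q_def)
  have DQ: "2 * D \<le> Q"
    using qd unfolding D_def Q_def by linarith
  \<comment> \<open>Cauchy-Schwarz over the at most D Q^2 elements of \<open>?B\<close>. In the
    outcome w Q \<le> D (w + Q^2), the term D w is absorbed by the left hand side through
    \<open>DQ\<close>.\<close>
  have "(w * Q ^ 2) ^ 2 \<le> (\<Sum>z\<in>?B. T z ^ 2) * real (card ?B)"
    using sum_squared_le_sum_of_squares[of T ?B] unfolding S1 by (simp add: w_def Q_def)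
  also have "\<dots> \<le> (w * (w * Q + Q * Q ^ 2)) * (D * Q ^ 2)"
    using S2 cB unfolding w_def Q_def D_def by (intro mult_mono) (auto intro: sum_nonneg)
  finally have "w * (w * Q) * Q ^ 3 \<le> w * (D * (w + Q ^ 2)) * Q ^ 3"
    by (simp add: algebra_simps power2_eq_square power3_eq_cube)
  then have "w * (w * Q) \<le> w * (D * (w + Q ^ 2))"
    using Q0 by (simp del: mult_le_cancel_left mult_le_cancel_right add: mult_le_cancel_right_pos)
  moreover have "w \<ge> 0" by (simp add: w_def)
  ultimately have "w = 0 \<or> w * Q \<le> D * (w + Q ^ 2)"
    by (metis mult_le_cancel_left_pos order_le_less)
  then have "w \<le> 2 * D * Q"
  proof
    assume h: "w * Q \<le> D * (w + Q ^ 2)"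
    have "2 * D * w \<le> Q * w" using DQ \<open>w \<ge> 0\<close> by (rule mult_right_mono)
    then have "w * Q \<le> (2 * D * Q) * Q"
      using h by (simp add: algebra_simps power2_eq_square)
    then show ?thesis using Q0 by (simp only: mult_le_cancel_right_pos)
  qed (use Q0 in \<open>simp add: D_def\<close>)
  then have "real (card W) \<le> real (2 * (d + 1) * q)" by (simp add: w_def D_def Q_def algebra_simps)
  then show ?thesis by (simp only: of_nat_le_iff)
qed

text \<open>Every non-zero vector is orthogonal to q^2 - 1 non-zero \<open>z\<close>, so summing
  over planes recovers the sum of \<open>E\<close>. On the at most d q^2 planes without cancellation
  each vector costs 2 q^2, and each of the at most 2 (d + 1) q vectors of \<open>W\<close> costs a
  further 2 q^3; this gives the multiples 2 and 4 of d + 1.\<close>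

lemma sum_E_le:
  assumes B: "B \<subseteq> KV" "card B \<le> d * q ^ 2" "\<And>z. z \<in> KV \<Longrightarrow> z \<notin> B \<Longrightarrow> z \<noteq> 0 \<Longrightarrow> good_line z"
    and qd: "2 * (d + 1) \<le> q"
  shows "(int q ^ 2 - 1) * \<bar>\<Sum>x\<in>KV - {0}. E x\<bar> \<le> int q ^ 6 * (6 * int (2 * v + 1) + 11 + 7 * int (d + 1))"
proof -
  let ?pl = "\<lambda>z. {x\<in>KV. dot z x = 0} - {0 :: 'a ^ 3}"
  let ?KV = "KV - {0 :: 'a ^ 3}"
  define T where "T z = (\<Sum>y\<in>?pl z. E y)" for z
  have finB: "finite B" by (rule finite_subset[OF B(1) finite_KV])
  have fin0: "finite ?KV" by simp
  have Tsum: "T z = (\<Sum>y\<in>?KV. if dot z y = 0 then E y else 0)" for z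
    unfolding T_def using fin0 by (subst sum.inter_filter[symmetric]) (auto intro!: sum.cong)
  have "(\<Sum>z\<in>?KV. T z) = (\<Sum>y\<in>?KV. \<Sum>z\<in>?KV. if dot z y = 0 then E y else 0)"
    unfolding Tsum by (rule sum.swap)
  also have "\<dots> = (\<Sum>y\<in>?KV. (int q ^ 2 - 1) * E y)"
  proof (rule sum.cong[OF refl])
    fix y assume y: "y \<in> ?KV"
    have "{z\<in>?KV. dot z y = 0} = {z\<in>KV. dot y z = 0} - {0}" by (auto simp: dot_commute)
    moreover have "card ({z\<in>KV. dot y z = 0} - {0}) = q ^ 2 - 1"
      using card_plane[of y] y finite_plane[of y] by (subst card_Diff_singleton) (auto simp: dot_def)
    ultimately have "card {z\<in>?KV. dot z y = 0} = q ^ 2 - 1" by simp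
    then have "int (card {z\<in>?KV. dot z y = 0}) = int q ^ 2 - 1"
      using q_pos by (simp add: of_nat_diff)
    moreover have "(\<Sum>z\<in>?KV. if dot z y = 0 then E y else 0) = int (card {z\<in>?KV. dot z y = 0}) * E y"
      using fin0 by (simp only: sum.inter_filter[symmetric] sum_constant)
    ultimately show "(\<Sum>z\<in>?KV. if dot z y = 0 then E y else 0) = (int q ^ 2 - 1) * E y" by simp
  qed
  finally have tot: "(\<Sum>z\<in>?KV. T z) = (int q ^ 2 - 1) * (\<Sum>y\<in>?KV. E y)"
    by (simp add: sum_distrib_left)
  let ?c = "6 * int (2 * v + 1) + 11"
  have good: "(\<Sum>z\<in>?KV - B. \<bar>T z\<bar>) \<le> int q ^ 6 * ?c"
  proof -
    have "(\<Sum>z\<in>?KV - B. \<bar>T z\<bar>) \<le> (\<Sum>z\<in>?KV - B. int q * (int q ^ 2 * ?c))"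
    proof (rule sum_mono)
      fix z assume "z \<in> ?KV - B"
      then have "\<bar>T z\<bar> \<le> (int q - 1) * (int q ^ 2 * ?c)"
        unfolding T_def by (intro good_line_sum B(3)) auto
      also have "\<dots> \<le> int q * (int q ^ 2 * ?c)" by (intro mult_right_mono) auto
      finally show "\<bar>T z\<bar> \<le> int q * (int q ^ 2 * ?c)" .
    qed
    also have "\<dots> = int (card (?KV - B)) * (int q * (int q ^ 2 * ?c))" by simp
    also have "\<dots> \<le> int q ^ 3 * (int q * (int q ^ 2 * ?c))"
    proof (rule mult_right_mono)
      have "card (?KV - B) \<le> card (KV :: ('a ^ 3) set)" by (intro card_mono) auto
      then have "int (card (?KV - B)) \<le> int (q ^ 3)" by (simp only: of_nat_le_iff card_KV) simp
      then show "int (card (?KV - B)) \<le> int q ^ 3" by simp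
    qed simp
    also have "\<dots> = int q ^ 6 * ?c" by (simp add: power_numeral_reduce)
    finally show ?thesis .
  qed
  have bad: "(\<Sum>z\<in>B - {0}. \<bar>T z\<bar>) \<le> int q ^ 6 * (6 * int (d + 1))"
  proof -
    have e: "\<bar>E y\<bar> \<le> 2 * int q ^ 2 + (if y \<in> W then 2 * int q ^ 3 else 0)" if "y \<in> ?KV" for y
    proof (cases "y \<in> W")
      case True
      have "\<bar>E y\<bar> \<le> 2 * int q ^ 3" using abs_E[of y] that by auto
      moreover have "0 \<le> 2 * int q ^ 2" by simp
      ultimately show ?thesis unfolding if_P[OF True] by linarith
    next
      case False
      then show ?thesis using abs_E_corank[of y] that by (simp add: W_def)
    qed
    have "(\<Sum>z\<in>B - {0}. \<bar>T z\<bar>) \<le> (\<Sum>z\<in>B - {0}. int q ^ 2 * (2 * int q ^ 2) + (\<Sum>y\<in>W. if dot z y = 0 then 2 * int q ^ 3 else 0))"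
    proof (rule sum_mono)
      fix z assume z: "z \<in> B - {0}"
      have "\<bar>T z\<bar> \<le> (\<Sum>y\<in>?pl z. \<bar>E y\<bar>)" unfolding T_def by (rule sum_abs)
      also have "\<dots> \<le> (\<Sum>y\<in>?pl z. 2 * int q ^ 2 + (if y \<in> W then 2 * int q ^ 3 else 0))"
        by (intro sum_mono e) auto
      also have "\<dots> = int (card (?pl z)) * (2 * int q ^ 2) + (\<Sum>y\<in>?pl z. if y \<in> W then 2 * int q ^ 3 else 0)"
        by (simp only: sum.distrib sum_constant)
      also have "(\<Sum>y\<in>?pl z. if y \<in> W then 2 * int q ^ 3 else 0) = (\<Sum>y\<in>W. if dot z y = 0 then 2 * int q ^ 3 else 0)"
      proof -
        have fin: "finite (?pl z)" using finite_plane by simp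
        have eq: "{y\<in>?pl z. y \<in> W} = {y\<in>W. dot z y = 0}" by (auto simp: W_def)
        show ?thesis
          by (simp only: sum.inter_filter[OF fin, symmetric] sum.inter_filter[OF finite_W, symmetric] eq)
      qed
      also have "int (card (?pl z)) * (2 * int q ^ 2) \<le> int q ^ 2 * (2 * int q ^ 2)"
      proof (rule mult_right_mono)
        have "card (?pl z) \<le> card {x\<in>KV. dot z x = 0}" by (intro card_mono finite_plane) auto
        also have "\<dots> = q ^ 2" using z B(1) by (intro card_plane) auto
        finally have "int (card (?pl z)) \<le> int (q ^ 2)" by (simp only: of_nat_le_iff)
        then show "int (card (?pl z)) \<le> int q ^ 2" by simp
      qed simp
      finally show "\<bar>T z\<bar> \<le> int q ^ 2 * (2 * int q ^ 2) + (\<Sum>y\<in>W. if dot z y = 0 then 2 * int q ^ 3 else 0)" by simp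
    qed
    also have "\<dots> = int (card (B - {0})) * (int q ^ 2 * (2 * int q ^ 2)) + (\<Sum>z\<in>B - {0}. \<Sum>y\<in>W. if dot z y = 0 then 2 * int q ^ 3 else 0)"
      by (simp only: sum.distrib sum_constant)
    also have "(\<Sum>z\<in>B - {0}. \<Sum>y\<in>W. if dot z y = 0 then 2 * int q ^ 3 else 0) = (\<Sum>y\<in>W. \<Sum>z\<in>B - {0}. if dot z y = 0 then 2 * int q ^ 3 else 0)"
      by (rule sum.swap)
    also have "\<dots> \<le> (\<Sum>y\<in>W. int q ^ 2 * (2 * int q ^ 3))"
    proof (rule sum_mono)
      fix y assume y: "y \<in> W"
      have "(\<Sum>z\<in>B - {0}. if dot z y = 0 then 2 * int q ^ 3 else 0) = int (card {z\<in>B - {0}. dot z y = 0}) * (2 * int q ^ 3)"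
        using finB by (subst sum.inter_filter[symmetric]) auto
      also have "\<dots> \<le> int q ^ 2 * (2 * int q ^ 3)"
      proof (rule mult_right_mono)
        have "card {z\<in>B - {0}. dot z y = 0} \<le> card {z\<in>KV. dot y z = 0}"
          using B(1) by (intro card_mono finite_plane) (auto simp: dot_commute[of y])
        also have "\<dots> = q ^ 2" using y by (intro card_plane) (auto simp: W_def)
        finally have "int (card {z\<in>B - {0}. dot z y = 0}) \<le> int (q ^ 2)" by (simp only: of_nat_le_iff)
        then show "int (card {z\<in>B - {0}. dot z y = 0}) \<le> int q ^ 2" by simp
      qed simp
      finally show "(\<Sum>z\<in>B - {0}. if dot z y = 0 then 2 * int q ^ 3 else 0) \<le> int q ^ 2 * (2 * int q ^ 3)" .
    qed
    also have "\<dots> = int (card W) * (int q ^ 2 * (2 * int q ^ 3))" by simp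
    also have "\<dots> \<le> (2 * int (d + 1) * int q) * (int q ^ 2 * (2 * int q ^ 3))"
    proof (rule mult_right_mono)
      have "int (card W) \<le> int (2 * (d + 1) * q)" unfolding of_nat_le_iff by (rule card_W_le[OF B(1,2) _ qd]) (rule B(3))
      then show "int (card W) \<le> 2 * int (d + 1) * int q" by (simp add: algebra_simps)
    qed simp
    also have "int (card (B - {0})) * (int q ^ 2 * (2 * int q ^ 2)) \<le> (int (d + 1) * int q ^ 2) * (int q ^ 2 * (2 * int q ^ 2))"
    proof (rule mult_right_mono)
      have "card (B - {0}) \<le> card B" using finB by (intro card_mono) auto
      also have "card B \<le> (d + 1) * q ^ 2" using B(2) by simp
      finally have "int (card (B - {0})) \<le> int ((d + 1) * q ^ 2)" by (simp only: of_nat_le_iff)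
      then show "int (card (B - {0})) \<le> int (d + 1) * int q ^ 2" by (simp add: algebra_simps)
    qed simp
    finally have "(\<Sum>z\<in>B - {0}. \<bar>T z\<bar>) \<le> (int (d + 1) * int q ^ 2) * (int q ^ 2 * (2 * int q ^ 2))
      + (2 * int (d + 1) * int q) * (int q ^ 2 * (2 * int q ^ 3))" by simp
    also have "\<dots> = int q ^ 6 * (6 * int (d + 1))"
      by (simp add: power_numeral_reduce algebra_simps)
    finally show ?thesis .
  qed
  have "\<bar>\<Sum>z\<in>?KV. T z\<bar> \<le> (\<Sum>z\<in>?KV. \<bar>T z\<bar>)" by (rule sum_abs)
  also have "\<dots> = (\<Sum>z\<in>(?KV - B) \<union> (B - {0}). \<bar>T z\<bar>)"
    using B(1) by (intro sum.cong) auto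
  also have "\<dots> = (\<Sum>z\<in>?KV - B. \<bar>T z\<bar>) + (\<Sum>z\<in>B - {0}. \<bar>T z\<bar>)"
    using finB by (intro sum.union_disjoint) auto
  also have "\<dots> \<le> int q ^ 6 * ?c + int q ^ 6 * (6 * int (d + 1))" using good bad by linarith
  also have "\<dots> \<le> int q ^ 6 * (?c + 7 * int (d + 1))"
    unfolding distrib_left[symmetric] by (intro mult_left_mono) auto
  finally have "\<bar>\<Sum>z\<in>?KV. T z\<bar> \<le> int q ^ 6 * (?c + 7 * int (d + 1))" .
  moreover have "int q ^ 2 - 1 \<ge> 0" using q_pos by simp
  ultimately show ?thesis unfolding tot abs_mult by simp
qed

text \<open>Once Q^4 is removed, the expected values leave (Q - 1) (Q^2 - 2 Q^3). In units of Q^3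
  the bound collects 2 for this, 6 p + 11 for the plane of \<open>z\<close>, and four times 6 p + 11
  + 7 (d + 1) for the sum over all vectors, with p = 2 v + 1.\<close>

theorem count_estimate:
  assumes B: "B \<subseteq> KV" "card B \<le> d * q ^ 2" "\<And>z. z \<in> KV \<Longrightarrow> z \<notin> B \<Longrightarrow> z \<noteq> 0 \<Longrightarrow> good_line z"
    and qd: "2 * (d + 1) \<le> q" and z: "good_line z"
  shows "\<bar>int q * (\<Sum>x\<in>{x\<in>KV. dot z x = 0}. hc x) - (\<Sum>x\<in>KV. hc x) - int q ^ 4\<bar>
    \<le> int q ^ 3 * (30 * int (2 * v + 1) + 57 + 28 * int (d + 1))"
proof -
  define Q where "Q = int q"
  have Q: "Q \<ge> 2" using q_pos by (simp add: Q_def)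
  define SE where "SE = (\<Sum>x\<in>KV - {0 :: 'a ^ 3}. E x)"
  define T where "T = (\<Sum>y\<in>{x\<in>KV. dot z x = 0} - {0}. E y)"
  define N where "N = (\<Sum>x\<in>KV. hc x)"
  define Nz where "Nz = (\<Sum>x\<in>{x\<in>KV. dot z x = 0}. hc x)"
  have hc0: "hc 0 = Q ^ 3" by (simp add: hc_def phi_0 card_KV Q_def)
  have GE: "(\<Sum>x\<in>A. G x) = int (card A) * (Q ^ 3 - Q ^ 2) + (\<Sum>x\<in>A. E x)" for A
    by (simp add: E_def Q_def sum_subtractf)
  have c1: "int (card (KV - {0 :: 'a ^ 3})) = Q ^ 3 - 1"
    using q_pos by (simp add: card_Diff_singleton card_KV of_nat_diff Q_def)
  have zK: "z \<in> KV" "z \<noteq> 0" using z by (auto simp: good_line_def)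
  have c2: "int (card ({x\<in>KV. dot z x = 0} - {0})) = Q ^ 2 - 1"
    using q_pos card_plane[OF zK] finite_plane[of z] by (subst card_Diff_singleton) (auto simp: of_nat_diff Q_def dot_def)
  have "(Q - 1) * (\<Sum>x\<in>KV - {0}. hc x) = (\<Sum>x\<in>KV - {0}. G x)"
    unfolding Q_def by (rule sum_hc) (auto intro: KV_scale)
  moreover have "N = hc 0 + (\<Sum>x\<in>KV - {0}. hc x)"
    unfolding N_def by (rule sum.remove) auto
  ultimately have N: "(Q - 1) * N = (Q - 1) * Q ^ 3 + ((Q ^ 3 - 1) * (Q ^ 3 - Q ^ 2) + SE)"
    unfolding GE c1 hc0 SE_def by (simp add: distrib_left)
  have "(Q - 1) * (\<Sum>x\<in>{x\<in>KV. dot z x = 0} - {0}. hc x) = (\<Sum>x\<in>{x\<in>KV. dot z x = 0} - {0}. G x)"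
    unfolding Q_def by (rule sum_hc) (auto intro: KV_scale simp: dot_right_scale)
  moreover have "Nz = hc 0 + (\<Sum>x\<in>{x\<in>KV. dot z x = 0} - {0}. hc x)"
    unfolding Nz_def by (rule sum.remove) (auto simp: finite_plane dot_def)
  ultimately have Nz: "(Q - 1) * Nz = (Q - 1) * Q ^ 3 + ((Q ^ 2 - 1) * (Q ^ 3 - Q ^ 2) + T)"
    unfolding GE c2 hc0 T_def by (simp add: distrib_left)
  define \<Delta> where "\<Delta> = Q * Nz - N - Q ^ 4"
  have "(Q - 1) * \<Delta> = Q * ((Q - 1) * Nz) - (Q - 1) * N - (Q - 1) * Q ^ 4"
    by (simp add: \<Delta>_def algebra_simps)
  also have "\<dots> = (Q - 1) * (Q ^ 2 - 2 * Q ^ 3) + Q * T - SE"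
    unfolding N Nz by (simp add: algebra_simps power_numeral_reduce)
  finally have D: "(Q - 1) * \<Delta> = (Q - 1) * (Q ^ 2 - 2 * Q ^ 3) + Q * T - SE" .
  define p where "p = int (2 * v + 1)"
  have p: "p \<ge> 0" by (simp add: p_def)
  define A where "A = 6 * p + 11 + 7 * int (d + 1)"
  have A: "A \<ge> 0" using p by (simp add: A_def)
  have "\<bar>T\<bar> \<le> (Q - 1) * (Q ^ 2 * (6 * p + 11))"
    unfolding T_def Q_def p_def by (rule good_line_sum[OF z])
  then have "\<bar>Q * T\<bar> \<le> Q * ((Q - 1) * (Q ^ 2 * (6 * p + 11)))"
    unfolding abs_mult using Q by (simp add: mult_left_mono)
  then have 1: "\<bar>Q * T\<bar> \<le> (Q - 1) * (Q ^ 3 * (6 * p + 11))"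
    by (simp add: power2_eq_square power3_eq_cube mult_ac)
  have 2: "\<bar>SE\<bar> \<le> (Q - 1) * (4 * Q ^ 3 * A)"
  proof (rule ccontr)
    assume n: "\<not> \<bar>SE\<bar> \<le> (Q - 1) * (4 * Q ^ 3 * A)"
    have "2 * 2 \<le> Q * Q" using Q by (intro mult_mono) auto
    then have Q2: "Q ^ 2 - 1 > 0" by (simp add: power2_eq_square)
    \<comment> \<open>The factor four arises here: Q - 1 and Q^2 - 1 are at least half of Q and
      Q^2.\<close>
    have h: "Q ^ 3 \<le> (2 * (Q ^ 2 - 1)) * (2 * (Q - 1))"
    proof -
      have "Q ^ 2 \<le> 2 * (Q ^ 2 - 1)"
      proof -
        have "2 * 2 \<le> Q * Q" using Q by (intro mult_mono) auto
        then show ?thesis by (simp add: power2_eq_square)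
      qed
      moreover have "Q \<le> 2 * (Q - 1)" using Q by simp
      ultimately have "Q ^ 2 * Q \<le> (2 * (Q ^ 2 - 1)) * (2 * (Q - 1))"
        using Q Q2 by (intro mult_mono; linarith)
      then show ?thesis by (simp add: power2_eq_square power3_eq_cube)
    qed
    have "Q ^ 6 * A = Q ^ 3 * (Q ^ 3 * A)" by (simp add: power_numeral_reduce)
    also have "\<dots> \<le> ((2 * (Q ^ 2 - 1)) * (2 * (Q - 1))) * (Q ^ 3 * A)"
      using h A Q by (intro mult_right_mono) auto
    also have "\<dots> = (Q ^ 2 - 1) * ((Q - 1) * (4 * Q ^ 3 * A))" by (simp add: algebra_simps)
    also have "\<dots> < (Q ^ 2 - 1) * \<bar>SE\<bar>" using n Q2 by (intro mult_strict_left_mono) auto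
    also have "\<dots> \<le> Q ^ 6 * A"
      unfolding SE_def Q_def A_def p_def by (rule sum_E_le[OF B(1,2) _ qd]) (rule B(3))
    finally show False by simp
  qed
  have 3: "\<bar>(Q - 1) * (Q ^ 2 - 2 * Q ^ 3)\<bar> \<le> (Q - 1) * (2 * Q ^ 3)"
  proof -
    have "Q ^ 2 \<le> Q ^ 3" "Q ^ 2 \<ge> 0" "Q ^ 3 \<ge> 0" using Q by (auto intro: power_increasing)
    then have "\<bar>Q ^ 2 - 2 * Q ^ 3\<bar> \<le> 2 * Q ^ 3" by linarith
    then show ?thesis unfolding abs_mult using Q by (simp add: mult_left_mono)
  qed
  have "(Q - 1) * \<bar>\<Delta>\<bar> = \<bar>(Q - 1) * (Q ^ 2 - 2 * Q ^ 3) + Q * T - SE\<bar>"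
    using D Q by (metis abs_mult abs_of_nonneg diff_ge_0_iff_ge order.trans one_le_numeral)
  also have "\<dots> \<le> (Q - 1) * (2 * Q ^ 3) + (Q - 1) * (Q ^ 3 * (6 * p + 11)) + (Q - 1) * (4 * Q ^ 3 * A)"
    using 1 2 3 by linarith
  also have "\<dots> = (Q - 1) * (Q ^ 3 * (30 * p + 57 + 28 * int (d + 1)))"
    by (simp add: A_def algebra_simps)
  finally have "\<bar>\<Delta>\<bar> \<le> Q ^ 3 * (30 * p + 57 + 28 * int (d + 1))"
    using Q by simp
  then show ?thesis by (simp only: \<Delta>_def N_def Nz_def Q_def p_def)
qed

end

section \<open>Good vectors and good lines\<close>

definition join3 :: "'k ^ 3 \<Rightarrow> 'k ^ 3 \<Rightarrow> 'k ^ (3 + 3)" where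
  "join3 x y = (\<chi> i. case i of Inl a \<Rightarrow> x $ a | Inr b \<Rightarrow> y $ b)"

lemma join3_nth [simp]: "join3 x y $ Inl a = x $ a" "join3 x y $ Inr a = y $ a"
  by (simp_all add: join3_def)

lemma forall_sum: "(\<forall>i. P i) \<longleftrightarrow> (\<forall>a. P (Inl a)) \<and> (\<forall>b. P (Inr b))"
  by (metis sum.exhaust)

lemma join3_add: "join3 (x + x') (y + y') = join3 x y + join3 x' y'"
  by (simp add: vec_eq_iff forall_sum)

lemma join3_scale: "join3 (c *s x) (c *s y) = c *s join3 x y"
  by (simp add: vec_eq_iff forall_sum)

lemma join3_collapse: "join3 (\<chi> a. v $ Inl a) (\<chi> a. v $ Inr a) = v"
  by (simp add: vec_eq_iff forall_sum)

lemma join3_split: "join3 x y = join3 x 0 + join3 0 (y :: 'k::comm_monoid_add ^ 3)"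
  by (simp add: vec_eq_iff forall_sum)

lemma join3_0: "join3 0 0 = 0"
  by (simp add: vec_eq_iff forall_sum)

lemma dot_axis_1: "dot (axis i 1) b = b $ i"
  by (simp add: dot_def axis_def if_distrib[of "\<lambda>x. x * _"] cong: if_cong)

lemma dot_linear_form: "mp_value (linear_form a) x = dot a x"
  by (simp add: mp_value_def mp_eval_linear_form[OF hom_id] dot_def)

lemma gradient_linear_form: "mp_gradient (linear_form a) p = (a :: 'k::idom ^ 'n::finite)"
proof -
  have "dot v (mp_gradient (linear_form a) p) = dot v a" for v
  proof -
    have "line_poly (linear_form a) p v = [:dot a p, dot a v:]"
    proof -
      have "(\<Sum>i\<in>A. [:a $ i:] * [:p $ i, v $ i:]) = [:\<Sum>i\<in>A. a $ i * p $ i, \<Sum>i\<in>A. a $ i * v $ i:]" for A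
        by (induction A rule: infinite_finite_induct) auto
      then show ?thesis
        unfolding line_poly_def mp_eval_linear_form[OF hom_pCons] dot_def .
    qed
    then show ?thesis
      using pderiv_line_poly[of "linear_form a" p v] by (simp add: pderiv_pCons dot_commute)
  qed
  note * = this
  show ?thesis
    unfolding vec_eq_iff
  proof
    fix i
    show "mp_gradient (linear_form a) p $ i = a $ i" using *[of "axis i 1"] by (simp add: dot_axis_1)
  qed
qed

lemma adapted_value:
  assumes "adapted_coordinates F L g Q"
  shows "mp_value F (g *v v) = (\<Sum>i\<in>UNIV. v $ Inl i * mp_value (Q i) v)"
proof -
  have "mp_value (mp_eval Const (\<lambda>i. linear_form (g $ i)) F) v = mp_value (\<Sum>i\<in>UNIV. Var (Inl i) * Q i) v"
    using assms by (simp add: adapted_coordinates_def)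
  moreover have "mp_value (\<Sum>i\<in>UNIV. Var (Inl i) * Q i) v = (\<Sum>i\<in>UNIV. v $ Inl i * mp_value (Q i) v)"
    by (simp add: hom_sum[OF mp_value_hom] hom_mult[OF mp_value_hom]) (simp add: mp_value_def hom_id)
  moreover have "mp_value (mp_eval Const (\<lambda>i. linear_form (g $ i)) F) v = mp_value F (g *v v)"
  proof -
    have "vec_nth (g *v v) = (\<lambda>i. dot (g $ i) v)"
      by (simp add: fun_eq_iff matrix_vector_mult_def dot_def)
    then show ?thesis
      unfolding mp_value_def[of F]
      by (subst hom_of_mp_eval[OF mp_value_hom]) (simp add: dot_linear_form, simp add: mp_value_def hom_id)
  qed
  ultimately show ?thesis by simp
qed

text \<open>The coefficients of \<open>fibre_form\<close> are polynomials in s; evaluating them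
  first makes \<open>C_form\<close> and \<open>D_form\<close> determinants of a numerical matrix and
  of its block.\<close>

definition FM :: "(3 \<Rightarrow> (3 + 3, 'k::field) mpoly) \<Rightarrow> 'k ^ 3 \<Rightarrow> 'k ^ 3 option ^ 3 option" where
  "FM Q s = quad_matrix (1 / 2) (Poly_Mapping.map (\<lambda>c. mp_value c s) (fibre_form Q))"

lemma FM_sym: "transpose (FM Q s) = FM Q s"
  by (simp add: FM_def quad_matrix_symmetric)

lemma fibre_form_degree:
  assumes "\<And>i. form_of_degree 2 (Q i)"
  shows "form_of_degree 2 (fibre_form Q)"
  unfolding fibre_form_def
proof (rule form_sum)
  fix i
  have v: "form_of_degree 1 (case k of Inl i \<Rightarrow> Var None * Const (Var i) | Inr j \<Rightarrow> Var (Some j))" for k :: "3 + 3"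
    using form_mult[OF form_Var form_Const] form_Var by (auto split: sum.splits)
  have "form_of_degree 2 (mp_eval (\<lambda>a. Const (Const a)) (\<lambda>k. case k of Inl i \<Rightarrow> Var None * Const (Var i) | Inr j \<Rightarrow> Var (Some j)) (Q i))"
    by (rule form_mp_eval[OF assms form_Const v])
  from form_mult[OF form_Const this]
  show "form_of_degree 2 (Const (Var i) * mp_eval (\<lambda>a. Const (Const a)) (\<lambda>k. case k of Inl i \<Rightarrow> Var None * Const (Var i) | Inr j \<Rightarrow> Var (Some j)) (Q i))"
    by (simp only: add_0)
qed

lemma quad_FM:
  fixes Q :: "3 \<Rightarrow> (3 + 3, 'k::field) mpoly"
  assumes "\<And>i. form_of_degree 2 (Q i)" "(2 :: 'k) \<noteq> 0"
  shows "quad (FM Q s) (cons4 c y) = (\<Sum>i\<in>UNIV. s $ i * mp_value (Q i) (join3 (c *s s) y))"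
proof -
  let ?ev = "\<lambda>p. mp_value p s"
  let ?v = "vec_nth (cons4 c y)"
  let ?y = "\<lambda>k. case k of Inl i \<Rightarrow> Var None * Const (Var i) | Inr j \<Rightarrow> Var (Some j)"
  have ev: "ring_hom_fun ?ev" by (rule mp_value_hom)
  have h: "(1 / 2 :: 'k) + 1 / 2 = 1" using assms(2) by (simp add: field_simps)
  have "quad (FM Q s) (cons4 c y) = mp_value (Poly_Mapping.map ?ev (fibre_form Q)) (cons4 c y)"
    unfolding FM_def
    by (rule quad_form_expand[symmetric, OF _ h], rule form_of_degree_map[where h = ?ev])
      (rule hom_0[OF ev], rule fibre_form_degree[OF assms(1)])
  also have "\<dots> = mp_eval ?ev ?v (fibre_form Q)"
    by (rule mp_value_map[where h = ?ev]) (rule hom_0[OF ev])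
  also have "\<dots> = (\<Sum>i\<in>UNIV. s $ i * mp_value (Q i) (join3 (c *s s) y))"
    unfolding fibre_form_def
  proof (simp only: mp_eval_sum[OF ev] mp_eval_mult[OF ev] mp_eval_Const[OF ev], rule sum.cong[OF refl])
    fix i
    have "mp_eval ?ev ?v (mp_eval (\<lambda>a. Const (Const a)) ?y (Q i))
      = mp_eval (\<lambda>a. mp_eval ?ev ?v (Const (Const a))) (\<lambda>k. mp_eval ?ev ?v (?y k)) (Q i)"
      by (rule hom_of_mp_eval[OF hom_mp_eval[OF ev]])
    also have "(\<lambda>a. mp_eval ?ev ?v (Const (Const a))) = (\<lambda>a. a)"
      unfolding mp_eval_Const[OF ev] by (simp add: mp_value_def hom_id)
    also have "(\<lambda>k. mp_eval ?ev ?v (?y k)) = vec_nth (join3 (c *s s) y)"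
      by (auto simp: fun_eq_iff mp_eval_mult[OF ev] mp_eval_Const[OF ev] mp_eval_Var[OF ev] join3_def split: sum.splits)
        (simp add: mp_value_def hom_id)
    finally show "mp_value (Var i) s * mp_eval ?ev ?v (mp_eval (\<lambda>a. Const (Const a)) ?y (Q i))
       = s $ i * mp_value (Q i) (join3 (c *s s) y)"
      by (simp add: mp_value_def hom_id)
  qed
  finally show ?thesis .
qed

lemma C_form_value: "mp_value (C_form Q) s = det (FM Q s)"
proof -
  have "(\<chi> i j. mp_value (quad_matrix (Const (1 / 2)) (fibre_form Q) $ i $ j) s) = FM Q s"
  proof -
    have "mp_value (quad_matrix (Const (1 / 2)) (fibre_form Q) $ i $ j) s = FM Q s $ i $ j" for i j
    proof -
      have "mp_value (Const c) s = c" for c by (simp add: mp_value_def hom_id)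
      then show ?thesis
        unfolding FM_def quad_matrix_def
        by (simp add: hom_mult[OF mp_value_hom] hom_1[OF mp_value_hom] lookup_map[where h = "\<lambda>c. mp_value c s", OF hom_0[OF mp_value_hom]])
    qed
    then show ?thesis by (simp add: vec_eq_iff)
  qed
  then show ?thesis unfolding C_form_def by (subst hom_det[OF mp_value_hom]) simp
qed

text \<open>Both symmetric matrices represent the sum of the s_i Q_i(0, y), and the form determines
  the matrix.\<close>

lemma D_form_value:
  fixes Q :: "3 \<Rightarrow> (3 + 3, 'k::field) mpoly"
  assumes "\<And>i. form_of_degree 2 (Q i)" "(2 :: 'k) \<noteq> 0"
  shows "mp_value (D_form Q) s = det (low (FM Q s))"
proof -
  define DM where "DM = (\<chi> a b. \<Sum>i\<in>UNIV. s $ i * net_matrix Q i $ a $ b)"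
  have sa: "(\<Sum>i\<in>UNIV. f i) $ a $ b = (\<Sum>i\<in>UNIV. f i $ a $ b)" for f :: "3 \<Rightarrow> (3, 'k) mpoly ^ 3 ^ 3" and a b
    by simp
  have "mp_value (D_form Q) s = det DM"
    unfolding D_form_def hom_det[OF mp_value_hom] DM_def sa
    by (simp add: hom_sum[OF mp_value_hom] hom_mult[OF mp_value_hom]) (simp add: mp_value_def hom_id)
  also have "DM = low (FM Q s)"
  proof (rule symmetric_quad_eq)
    have "net_matrix Q i $ a $ b = net_matrix Q i $ b $ a" for i a b
      unfolding net_matrix_def by (rule symmetric_nth[OF quad_matrix_symmetric])
    then show "transpose DM = DM" by (simp add: transpose_def DM_def)
    show "transpose (low (FM Q s)) = low (FM Q s)"
      by (simp add: transpose_def low_def symmetric_nth[OF FM_sym, of Q s])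
    show "(2 :: 'k) \<noteq> 0" by fact
    fix y
    have h: "(1 / 2 :: 'k) + 1 / 2 = 1" using assms(2) by (simp add: field_simps)
    have net: "quad (net_matrix Q i) y = mp_value (Q i) (join3 0 y)" for i
    proof -
      let ?q = "mp_eval Const (\<lambda>k. case k of Inl _ \<Rightarrow> 0 | Inr j \<Rightarrow> Var j) (Q i)"
      have "form_of_degree 2 ?q"
        by (rule form_mp_eval[OF assms(1) form_Const]) (auto intro: form_Var[simplified] split: sum.splits)
      then have "quad (net_matrix Q i) y = mp_value ?q y"
        unfolding net_matrix_def by (rule quad_form_expand[symmetric, OF _ h])
      also have "\<dots> = mp_eval (\<lambda>a. mp_value (Const a) y) (\<lambda>k. mp_value (case k of Inl _ \<Rightarrow> 0 | Inr j \<Rightarrow> Var j) y) (Q i)"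
        by (rule hom_of_mp_eval[OF mp_value_hom])
      also have "(\<lambda>a. mp_value (Const a) y) = (\<lambda>a. a)"
        by (simp add: mp_value_def hom_id)
      also have "(\<lambda>k. mp_value (case k of Inl _ \<Rightarrow> 0 | Inr j \<Rightarrow> Var j) y) = vec_nth (join3 0 y)"
        by (auto simp: fun_eq_iff join3_def mp_value_def hom_id split: sum.splits)
      finally show ?thesis by (simp add: mp_value_def)
    qed
    have "quad DM y = (\<Sum>i\<in>UNIV. s $ i * quad (net_matrix Q i) y)"
    proof -
      have "(\<Sum>i\<in>UNIV. s $ i * quad (net_matrix Q i) y) = (\<Sum>i\<in>UNIV. \<Sum>a\<in>UNIV. \<Sum>b\<in>UNIV. y $ a * (s $ i * net_matrix Q i $ a $ b * y $ b))"
        by (simp add: quad_def dot_def matrix_vector_mult_def sum_distrib_left mult_ac)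
      also have "\<dots> = (\<Sum>a\<in>UNIV. \<Sum>i\<in>UNIV. \<Sum>b\<in>UNIV. y $ a * (s $ i * net_matrix Q i $ a $ b * y $ b))"
        by (rule sum.swap)
      also have "\<dots> = (\<Sum>a\<in>UNIV. \<Sum>b\<in>UNIV. \<Sum>i\<in>UNIV. y $ a * (s $ i * net_matrix Q i $ a $ b * y $ b))"
        by (rule sum.cong[OF refl], rule sum.swap)
      also have "\<dots> = quad DM y"
        by (simp add: quad_def dot_def matrix_vector_mult_def DM_def sum_distrib_left sum_distrib_right mult_ac)
      finally show ?thesis by simp
    qed
    also have "\<dots> = quad (FM Q s) (cons4 0 y)"
      unfolding net quad_FM[OF assms] by simp
    also have "\<dots> = quad (low (FM Q s)) y" by (rule quad_cons4_0)
    finally show "quad DM y = quad (low (FM Q s)) y" .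
  qed
  finally show ?thesis .
qed

section \<open>Comparison of two coordinate systems adapted to the plane\<close>

lemma cons4_zero: "cons4 0 0 = (0 :: 'k::zero ^ 3 option)"
  by (simp add: vec_eq_iff forall_option)

text \<open>\<open>good\<close> provides some coordinates \<open>g\<close> over the algebraically
  closed field, whereas points are counted in coordinates \<open>g0\<close> defined over the residue
  field. Both carry the subspace x = 0 to \<open>L\<close>, so the transition matrix
  \<open>R\<close> is block triangular, with \<open>A\<close> acting on x while \<open>B\<close> and
  \<open>D\<close> produce y.\<close>

locale two_charts =
  fixes F :: "(6, 'a::alg_closed_field) mpoly" and L :: "('a ^ 6) set"
    and g0 g :: "'a ^ (3 + 3) ^ 6" and Q :: "3 \<Rightarrow> (3 + 3, 'a) mpoly"
  assumes two: "(2 :: 'a) \<noteq> 0"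
    and inv0: "invertible g0" and L0: "\<And>v. g0 *v v \<in> L \<longleftrightarrow> (\<forall>i. v $ Inl i = 0)"
    and adapted: "adapted_coordinates F L g Q"
begin

lemma inv: "invertible g" and L: "\<And>v. g *v v \<in> L \<longleftrightarrow> (\<forall>i. v $ Inl i = 0)"
  and degQ: "\<And>i. form_of_degree 2 (Q i)"
  using adapted by (auto simp: adapted_coordinates_def)

lemma invertible_cancel: "invertible (A :: 'a ^ (3 + 3) ^ 6) \<Longrightarrow> A *v v = 0 \<Longrightarrow> v = 0"
  unfolding invertible_def by (metis matrix_vector_mul_assoc matrix_vector_mul_lid matrix_vector_mult_0_right)

definition R :: "'a ^ (3 + 3) ^ (3 + 3)" where "R = matrix_inv g ** g0"

lemma gR: "g *v (R *v v) = g0 *v v"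
proof -
  have "g ** matrix_inv g = mat 1"
    using someI_ex[OF inv[unfolded invertible_def]] unfolding matrix_inv_def by blast
  then have "g ** R = g0" unfolding R_def by (simp add: matrix_mul_assoc)
  then show ?thesis by (simp add: matrix_vector_mul_assoc)
qed

definition A :: "'a ^ 3 ^ 3" where "A = (\<chi> a b. R $ Inl a $ Inl b)"
definition B :: "'a ^ 3 ^ 3" where "B = (\<chi> a b. R $ Inr a $ Inl b)"
definition D :: "'a ^ 3 ^ 3" where "D = (\<chi> a b. R $ Inr a $ Inr b)"

lemma sum_sum: "(\<Sum>i\<in>UNIV. f i) = (\<Sum>a\<in>UNIV. f (Inl a)) + (\<Sum>b\<in>UNIV. f (Inr b))" for f :: "3 + 3 \<Rightarrow> 'a"
  by (simp add: UNIV_Plus_UNIV[symmetric] sum.Plus del: UNIV_Plus_UNIV)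

lemma R_join: "R *v join3 x y = join3 (A *v x) (B *v x + D *v y)"
proof -
  have "(R *v join3 0 y) $ Inl a = 0" for a
  proof -
    have "g0 *v join3 0 y \<in> L" by (simp add: L0)
    then show ?thesis unfolding gR[symmetric] L by blast
  qed
  then have "(\<Sum>b\<in>UNIV. R $ Inl a $ Inr b * y $ b) = 0" for a
    by (simp add: matrix_vector_mult_def sum_sum)
  then show ?thesis
    by (simp add: vec_eq_iff forall_sum matrix_vector_mult_def sum_sum A_def B_def D_def)
qed

lemma g_join: "g *v join3 (A *v x) (B *v x + D *v y) = g0 *v join3 x y"
  unfolding R_join[symmetric] by (rule gR)

lemma A_0: "A *v x = 0 \<Longrightarrow> x = 0"
proof -
  assume "A *v x = 0"
  then have "g0 *v join3 x 0 \<in> L"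
    unfolding g_join[symmetric] L by simp
  then show "x = 0" unfolding L0 by (simp add: vec_eq_iff)
qed

lemma D_0: "D *v y = 0 \<Longrightarrow> y = 0"
proof -
  assume "D *v y = 0"
  then have "g0 *v join3 0 y = 0" using g_join[of 0 y] by (simp add: join3_0)
  then have "join3 0 y = 0" by (rule invertible_cancel[OF inv0])
  then show "y = 0" by (simp add: vec_eq_iff forall_sum)
qed

lemma det_nz:
  fixes M :: "'a ^ 'n::finite ^ 'n"
  assumes "\<And>v. M *v v = 0 \<Longrightarrow> v = 0"
  shows "det M \<noteq> 0"
proof -
  have "inj ((*v) M)"
  proof (rule injI)
    fix v w assume "M *v v = M *v w"
    then have "M *v (v - w) = 0" by (simp add: matrix_vector_mult_diff_distrib)
    then show "v = w" using assms[of "v - w"] by simp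
  qed
  then have "\<exists>B. B ** M = mat 1" by (simp add: matrix_left_invertible_injective)
  then show ?thesis by (metis invertible_det_nz invertible_left_inverse)
qed

lemma A_surj: "\<exists>x. s = A *v x"
proof -
  have "invertible A" using det_nz[OF A_0] invertible_det_nz by metis
  then obtain B where "A ** B = mat 1" by (auto simp: invertible_def)
  then have "A *v (B *v s) = s" by (simp add: matrix_vector_mul_assoc)
  then show ?thesis by metis
qed

text \<open>The map that \<open>R\<close> induces on the fibre over \<open>x\<close>: u is kept and
  y becomes u B x + D y.\<close>

definition T :: "'a ^ 3 \<Rightarrow> 'a ^ 3 option ^ 3 option" where
  "T x = (\<chi> i j. case i of None \<Rightarrow> (if j = None then 1 else 0)
     | Some a \<Rightarrow> (case j of None \<Rightarrow> (B *v x) $ a | Some b \<Rightarrow> D $ a $ b))"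

lemma T_cons4: "T x *v cons4 c y = cons4 c (c *s (B *v x) + D *v y)"
  by (simp add: vec_eq_iff forall_option T_def matrix_vector_mult_def sum_option mult.commute)

lemma det_T: "det (T x) \<noteq> 0"
proof (rule det_nz)
  fix v assume "T x *v v = 0"
  then have "T x *v cons4 (v $ None) (\<chi> j. v $ Some j) = 0" by (simp only: cons4_collapse)
  then have 0: "cons4 (v $ None) ((v $ None) *s (B *v x) + D *v (\<chi> j. v $ Some j)) = cons4 0 0"
    unfolding T_cons4 cons4_zero .
  then have n: "v $ None = 0" and d: "(v $ None) *s (B *v x) + D *v (\<chi> j. v $ Some j) = 0"
    unfolding cons4_eq_iff by blast+
  have "(\<chi> j. v $ Some j) = 0"
    using d unfolding n vector_smult_lzero add_0 by (rule D_0)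
  with n have "v $ None = 0" "(\<chi> j. v $ Some j) = 0" by auto
  then have "cons4 (v $ None) (\<chi> j. v $ Some j) = cons4 0 0" by simp
  then show "v = 0" by (simp add: cons4_collapse) (simp add: vec_eq_iff forall_option)
qed

lemma polyfun_det_T: "polyfun (\<lambda>t. det (T (x + t *s w)))"
proof (rule polyfun_det)
  fix i j
  show "polyfun (\<lambda>t. T (x + t *s w) $ i $ j)"
  proof (cases i; cases j)
    fix a assume "i = Some a" "j = None"
    then have "(\<lambda>t. T (x + t *s w) $ i $ j) = (\<lambda>t. (B *v x) $ a + t * (B *v w) $ a)"
      by (simp add: fun_eq_iff T_def matrix_vector_right_distrib) (simp add: matrix_vector_mult_def sum_distrib_left mult_ac)
    then show ?thesis by (simp only:) (intro polyfun_add polyfun_mult polyfun_const polyfun_ident)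
  qed (auto simp: T_def polyfun_const)
qed

text \<open>The fibre matrix of the chart \<open>g\<close> over A x, pulled back along
  \<open>T\<close>. As \<open>N_quad\<close> describes it by \<open>F\<close> and \<open>g0\<close>
  alone, \<open>qm_unique\<close> can identify it with \<open>qm x\<close>.\<close>

definition N :: "'a ^ 3 \<Rightarrow> 'a ^ 3 option ^ 3 option" where
  "N x = transpose (T x) ** FM Q (A *v x) ** T x"

lemma N_sym: "transpose (N x) = N x"
  unfolding N_def by (simp add: matrix_transpose_mul matrix_mul_assoc transpose_transpose FM_sym)

lemma matrix_scale: "M *v (c *s v) = c *s (M *v (v :: 'a ^ 'n::finite))"
  by (simp add: vec_eq_iff matrix_vector_mult_def sum_distrib_left mult_ac)

lemma N_quad: "c * quad (N x) (cons4 c y) = mp_value F (g0 *v join3 (c *s x) y)"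
proof -
  have "c * quad (N x) (cons4 c y) = c * (\<Sum>i\<in>UNIV. (A *v x) $ i * mp_value (Q i) (join3 (c *s (A *v x)) (c *s (B *v x) + D *v y)))"
    unfolding N_def quad_congruence T_cons4 quad_FM[OF degQ two] ..
  also have "\<dots> = (\<Sum>i\<in>UNIV. join3 (c *s (A *v x)) (c *s (B *v x) + D *v y) $ Inl i
      * mp_value (Q i) (join3 (c *s (A *v x)) (c *s (B *v x) + D *v y)))"
    by (simp add: sum_distrib_left mult_ac)
  also have "\<dots> = mp_value F (g *v join3 (c *s (A *v x)) (c *s (B *v x) + D *v y))"
    by (rule adapted_value[OF adapted, symmetric])
  also have "\<dots> = mp_value F (g0 *v join3 (c *s x) y)"
    unfolding g_join[symmetric] matrix_scale ..
  finally show ?thesis .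
qed

lemma det_N: "det (N x) = det (T x) ^ 2 * mp_value (C_form Q) (A *v x)"
  by (simp add: N_def det_mul C_form_value power2_eq_square)

lemma det_low_N: "det (low (N x)) = det D ^ 2 * mp_value (D_form Q) (A *v x)"
proof -
  have "low (N x) = transpose D ** low (FM Q (A *v x)) ** D"
  proof (rule symmetric_quad_eq[OF _ _ two])
    show "transpose (low (N x)) = low (N x)"
      by (simp add: transpose_def low_def symmetric_nth[OF N_sym, of x])
    have "transpose (low (FM Q (A *v x))) = low (FM Q (A *v x))"
      by (simp add: transpose_def low_def symmetric_nth[OF FM_sym, of Q])
    then show "transpose (transpose D ** low (FM Q (A *v x)) ** D) = transpose D ** low (FM Q (A *v x)) ** D"
      by (simp add: matrix_transpose_mul matrix_mul_assoc transpose_transpose)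
    fix y
    have "quad (low (N x)) y = quad (N x) (cons4 0 y)" by (simp add: quad_cons4_0)
    also have "\<dots> = quad (FM Q (A *v x)) (cons4 0 (D *v y))"
      unfolding N_def quad_congruence T_cons4 by simp
    also have "\<dots> = quad (transpose D ** low (FM Q (A *v x)) ** D) y"
      by (simp add: quad_cons4_0 quad_congruence)
    finally show "quad (low (N x)) y = quad (transpose D ** low (FM Q (A *v x)) ** D) y" .
  qed
  then show ?thesis by (simp add: det_mul D_form_value[OF degQ two] power2_eq_square)
qed

end

context two_charts
begin

text \<open>The discrepancy between the charts is a vector of \<open>L\<close>, which
  \<open>c\<close> annihilates, so the two equations of the line correspond under
  \<open>A\<close>.\<close>

lemma dot_transfer:
  assumes "c \<in> orth L"
  shows "dot (\<chi> i. (transpose g *v c) $ Inl i) (A *v x) = dot (\<chi> i. (transpose g0 *v c) $ Inl i) x"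
proof -
  have dj: "dot (\<chi> i. (transpose h *v c) $ Inl i) s = dot c (h *v join3 s 0)" for h :: "'a ^ (3 + 3) ^ 6" and s
  proof -
    have "dot c (h *v join3 s 0) = dot (transpose h *v c) (join3 s 0)"
      by (simp add: dot_matrix_vector)
    also have "\<dots> = dot (\<chi> i. (transpose h *v c) $ Inl i) s"
      by (simp add: dot_def sum_sum)
    finally show ?thesis by simp
  qed
  have "g *v join3 0 (B *v x) \<in> L" by (simp add: L)
  then have "dot c (g *v join3 0 (B *v x)) = 0" using assms by (auto simp: orth_def)
  then have "dot c (g *v join3 (A *v x) 0) = dot c (g *v join3 (A *v x) 0 + g *v join3 0 (B *v x))"
    by (simp add: dot_right_add)
  also have "\<dots> = dot c (g *v join3 (A *v x) (B *v x))"
    by (simp add: matrix_vector_right_distrib[symmetric] join3_split[symmetric])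
  also have "\<dots> = dot c (g0 *v join3 x 0)"
    using g_join[of x 0] by simp
  finally show ?thesis unfolding dj .
qed

end

text \<open>A double zero at the parameter 0 makes the gradient of \<open>C_form\<close> orthogonal
  to the direction of the line, and by homogeneity it is orthogonal to the point as well. It is then
  a multiple of the equation of the line, against the Jacobian criterion. If the determinant of
  \<open>low\<close> vanished on the whole line, that equation would divide
  \<open>D_form\<close>.\<close>

lemma (in cubic_fibration) good_line_charts:
  assumes tc: "two_charts F L g0 g Q"
    and phi: "\<And>x y. phi x y = mp_value F (g0 *v join3 x y)"
    and c: "c \<in> orth L"
    and z_def: "z = (\<chi> i. (transpose g0 *v c) $ Inl i)" and z: "z \<in> KV" "z \<noteq> 0"
    and smooth: "smooth_of_dim_0 (line_form g c) (C_form Q)"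
    and ndvd: "\<not> line_form g c dvd D_form Q"
  shows "good_line z"
proof -
  interpret two_charts F L g0 g Q by (rule tc)
  have NQ: "N x = qm x" for x
    by (rule qm_unique[OF N_sym]) (simp add: N_quad phi)
  define z' where "z' = (\<chi> i. (transpose g *v c) $ Inl i)"
  have lz: "line_form g c = linear_form z'" by (simp add: line_form_def z'_def)
  have zA: "dot z' (A *v x) = dot z x" for x
    unfolding z'_def z_def by (rule dot_transfer[OF c])
  have z'0: "z' \<noteq> 0"
  proof
    assume "z' = 0"
    then have "dot z x = 0" for x using zA[of x] by (simp add: dot_def)
    then have "z $ i = 0" for i
      by (metis (no_types) dot_commute dot_axis_1)
    then show False using z(2) by (simp add: vec_eq_iff)
  qed
  show ?thesis
    unfolding good_line_def
  proof (intro conjI allI impI z)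
    show "\<exists>x. dot z x = 0 \<and> det (low (qm x)) \<noteq> 0"
    proof (rule ccontr)
      assume n: "\<nexists>x. dot z x = 0 \<and> det (low (qm x)) \<noteq> 0"
      have "linear_form z' dvd D_form Q"
      proof (rule linear_form_dvd[OF infinite_alg_closed z'0])
        fix s assume s: "dot z' s = 0"
        obtain x where x: "s = A *v x" using A_surj by blast
        have "dot z x = 0" using s x zA by simp
        then have "det (low (N x)) = 0" using n NQ by auto
        then show "mp_value (D_form Q) s = 0"
          unfolding det_low_N x using det_nz[OF D_0] by simp
      qed
      then show False using ndvd lz by simp
    qed
    fix x w f
    assume *: "indep3 x w \<and> dot z x = 0 \<and> dot z w = 0 \<and> (\<forall>t. poly f t = det (qm (x + t *s w)))"
    show "\<not> (poly f 0 = 0 \<and> poly (pderiv f) 0 = 0)"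
    proof
      assume f0: "poly f 0 = 0 \<and> poly (pderiv f) 0 = 0"
      let ?p = "A *v x" and ?v = "A *v w" and ?C = "C_form Q"
      have x0: "x \<noteq> 0" using * indep3_nonzero by blast
      have p0: "?p \<noteq> 0" using A_0 x0 by blast
      obtain tp where tp: "\<And>t. det (T (x + t *s w)) = poly tp t"
        using polyfun_det_T[of x w] unfolding polyfun_def by blast
      let ?c = "line_poly ?C ?p ?v"
      \<comment> \<open>The square of the determinant of \<open>T\<close> is non-zero at the
        parameter 0, so the double zero belongs to \<open>C_form\<close>.\<close>
      have fe: "f = tp ^ 2 * ?c"
      proof (rule poly_eq_if_nonzero_eq)
        fix t :: 'a
        have "A *v (x + t *s w) = ?p + t *s ?v"
          by (simp add: matrix_vector_right_distrib matrix_scale)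
        then show "poly f t = poly (tp ^ 2 * ?c) t"
          using * det_N[of "x + t *s w"] tp[of t] by (simp add: NQ poly_line_poly)
      qed
      have t0: "poly tp 0 \<noteq> 0" using tp[of 0] det_T[of "x + 0 *s w"] by simp
      have c0: "poly ?c 0 = 0" using f0 t0 unfolding fe by simp
      have "poly (pderiv ?c) 0 = 0"
        using f0 t0 c0 unfolding fe by (simp add: pderiv_mult)
      then have d1: "dot (mp_gradient ?C ?p) ?v = 0"
        by (simp add: pderiv_line_poly dot_commute)
      have Cp: "mp_value ?C ?p = 0" using c0 by (simp add: poly_line_poly)
      have dq: "det (qm x) = 0" using det_N[of x] Cp NQ[of x] by simp
      \<comment> \<open>The scaling of \<open>qm\<close> shows that \<open>C_form\<close> vanishes
        on all multiples of \<open>?p\<close>, which makes its radial derivative zero.\<close>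
      have Csc: "mp_value ?C (l *s ?p) = 0" if "l \<noteq> 0" for l
      proof -
        have "det (N (l *s x)) = 0" using det_qm_scale[OF that, of x] dq by (simp add: NQ)
        then show ?thesis unfolding det_N matrix_scale using det_T by simp
      qed
      have "line_poly ?C 0 ?p = 0"
        by (rule poly_eq_if_nonzero_eq) (simp add: poly_line_poly Csc)
      then have C_all: "mp_value ?C (l *s ?p) = 0" for l
        using poly_line_poly[of ?C 0 ?p l] by simp
      have "line_poly ?C ?p ?p = 0"
      proof (rule poly_eq_if_nonzero_eq)
        fix t :: 'a
        have "?p + t *s ?p = (1 + t) *s ?p" by (simp add: vec_eq_iff algebra_simps)
        then show "poly (line_poly ?C ?p ?p) t = poly 0 t"
          unfolding poly_line_poly using C_all[of "1 + t"] by simp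
      qed
      then have d2: "dot (mp_gradient ?C ?p) ?p = 0"
        using pderiv_line_poly[of ?C ?p ?p] by (simp add: dot_commute)
      have ind: "indep3 ?p ?v"
      proof (rule ccontr)
        assume "\<not> indep3 ?p ?v"
        moreover obtain i where "?p $ i \<noteq> 0" using p0 by (auto simp: vec_eq_iff)
        ultimately obtain k where "?v = k *s ?p" using not_indep3 by blast
        then have "A *v (w - k *s x) = 0" by (simp add: matrix_vector_mult_diff_distrib matrix_scale)
        then have "w - k *s x = 0" by (rule A_0)
        then have "w = k *s x" by simp
        then have "\<not> indep3 x w" by (simp add: indep3_def mult_ac)
        then show False using * by simp
      qed
      have "dot z' ?p = 0" "dot z' ?v = 0" using * zA by simp_all
      then obtain m where m: "mp_gradient ?C ?p = m *s z'"
        using indep3_annihilator[OF ind d2 d1 _ _ z'0] by blast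
      have "mp_value (line_form g c) ?p = 0"
        unfolding lz dot_linear_form by fact
      moreover have "(- m) *s mp_gradient (line_form g c) ?p + 1 *s mp_gradient ?C ?p = 0"
        unfolding lz gradient_linear_form m by (simp add: vec_eq_iff)
      ultimately have "- m = 0 \<and> (1 :: 'a) = 0"
        using smooth p0 Cp unfolding smooth_of_dim_0_def by blast
      then show False by simp
    qed
  qed
qed

subsection \<open>A smooth cubic fourfold contains no three-dimensional linear space\<close>

text \<open>The diagonalised first form splits into two binary forms, each with an isotropic vector,
  and the line joining these lies on the first quadric. On that line the second form is binary and
  has a zero.\<close>

lemma two_quadrics_common_zero:
  fixes M M' :: "'a::alg_closed_field ^ 3 option ^ 3 option"
  assumes two: "(2 :: 'a) \<noteq> 0" and sym: "transpose M = M"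
  shows "\<exists>v. v \<noteq> 0 \<and> quad M v = 0 \<and> quad M' v = 0"
proof -
  interpret odd_subfield "UNIV :: 'a set"
    by standard (auto simp: two)
  obtain P d where P: "det P \<noteq> 0" "transpose P ** M ** P = diag d"
    using diagonalize[OF _ sym] by (auto simp: KM_iff)
  have iso: "\<exists>a b. (a, b) \<noteq> (0, 0) \<and> x * a ^ 2 + y * b ^ 2 = 0" for x y :: 'a
  proof (cases "x = 0")
    case True
    then show ?thesis by (intro exI[of _ 1] exI[of _ 0]) simp
  next
    case False
    obtain a where "a ^ 2 = - y / x" using nth_root_exists[of 2 "- y / x"] by auto
    then show ?thesis using False by (intro exI[of _ a] exI[of _ 1]) simp
  qed
  obtain a b where ab: "(a, b) \<noteq> (0, 0)" "d None * a ^ 2 + d (Some 1) * b ^ 2 = 0" using iso by blast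
  obtain a' b' where ab': "(a', b') \<noteq> (0, 0)" "d (Some 2) * a' ^ 2 + d (Some 3) * b' ^ 2 = 0" using iso by blast
  define e where "e s t = ((\<chi> i. if i = None then s * a else if i = Some 1 then s * b
    else if i = Some 2 then t * a' else t * b') :: 'a ^ 3 option)" for s t :: 'a
  have nth: "e s t $ None = s * a" "e s t $ Some 1 = s * b" "e s t $ Some 2 = t * a'" "e s t $ Some 3 = t * b'" for s t
    by (simp_all add: e_def)
  have lin: "e s t = s *s e 1 0 + t *s e 0 1" for s t
    by (simp add: vec_eq_iff e_def)
  have q1: "quad M (P *v e s t) = 0" for s t
  proof -
    have "quad M (P *v e s t) = quad (diag d) (e s t)" by (simp only: quad_congruence[symmetric] P(2))
    also have "\<dots> = s ^ 2 * (d None * a ^ 2 + d (Some 1) * b ^ 2) + t ^ 2 * (d (Some 2) * a' ^ 2 + d (Some 3) * b' ^ 2)"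
      by (simp add: quad_diag UNIV_3_option nth power_mult_distrib algebra_simps)
    also have "\<dots> = 0" by (simp only: ab(2) ab'(2)) simp
    finally show ?thesis .
  qed
  define x where "x = P *v e 1 0"
  define y where "y = P *v e 0 1"
  have Pe: "P *v e s t = s *s x + t *s y" for s t
    unfolding x_def y_def lin[of s t] by (simp add: vec_eq_iff matrix_vector_mult_def sum_distrib_left distrib_left sum.distrib mult_ac)
  have sc: "quad M' (k *s v) = k ^ 2 * quad M' v" for k v
    by (simp add: quad_def dot_def matrix_vector_mult_def sum_distrib_left power2_eq_square mult_ac)
  let ?h = "dot x (M' *v y) + dot y (M' *v x)"
  have q2: "quad M' (P *v e s t) = s ^ 2 * quad M' x + t ^ 2 * quad M' y + s * t * ?h" for s t
  proof -
    have "dot (s *s x) (M' *v (t *s y)) = s * t * dot x (M' *v y)" "dot (t *s y) (M' *v (s *s x)) = s * t * dot y (M' *v x)"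
      by (simp_all add: dot_def matrix_vector_mult_def sum_distrib_left mult_ac)
    then show ?thesis unfolding Pe quad_add sc by (simp add: algebra_simps)
  qed
  obtain s t where st: "(s, t) \<noteq> (0, 0)" "quad M' (P *v e s t) = 0"
  proof (cases "quad M' x = 0")
    case True
    then show ?thesis using that[of 1 0] by (simp add: q2)
  next
    case False
    define p where "p = [:quad M' y, ?h, quad M' x:]"
    have "degree p > 0" using False by (simp add: p_def)
    then obtain s where "poly p s = 0" using alg_closed_imp_poly_has_root by blast
    then show ?thesis using that[of s 1] by (simp add: q2 p_def algebra_simps power2_eq_square)
  qed
  have "e s t \<noteq> 0"
  proof
    assume "e s t = 0"
    then have "s * a = 0" "s * b = 0" "t * a' = 0" "t * b' = 0" using nth[of s t] by simp_all
    then show False using st(1) ab(1) ab'(1) by auto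
  qed
  then have "P *v e s t \<noteq> 0"
  proof -
    obtain R where "R ** P = mat 1" using P(1) invertible_det_nz unfolding invertible_def by metis
    then have "R *v (P *v e s t) = e s t" by (simp add: matrix_vector_mul_assoc)
    then show ?thesis using \<open>e s t \<noteq> 0\<close> by auto
  qed
  then show ?thesis using q1 st(2) by blast
qed

text \<open>If \<open>F\<close> vanished on the four-dimensional space of all
  \<open>g *v join3 (c *s x) y\<close>, its gradient at points of this space would annihilate the
  space. The derivatives in two complementary directions are quadratic forms on it, and a common
  zero of these is a singular point. This provides the non-zero fibre matrices of
  \<open>qm_nz\<close>.\<close>

lemma smooth_cubic_no_linear_space:
  fixes F :: "(6, 'a::alg_closed_field) mpoly" and g :: "'a ^ (3 + 3) ^ 6"
  assumes two: "(2 :: 'a) \<noteq> 0" and F: "form_of_degree 3 F" "smooth_hypersurface F"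
    and inv: "invertible g" and x: "x \<noteq> 0"
  shows "\<exists>c y. mp_value F (g *v join3 (c *s x) y) \<noteq> 0"
proof (rule ccontr)
  assume "\<nexists>c y. mp_value F (g *v join3 (c *s x) y) \<noteq> 0"
  then have F0: "mp_value F (g *v join3 (c *s x) y) = 0" for c y by blast
  obtain k where k: "x $ k \<noteq> 0" using x by (auto simp: vec_eq_iff)
  from other_indices[of k] obtain i j where ij: "i \<noteq> j \<and> i \<noteq> k \<and> j \<noteq> k \<and> (\<forall>l. l = i \<or> l = j \<or> l = k)"
    by (elim exE)
  define E where "E = (\<chi> r m. case m of None \<Rightarrow> (g *v join3 x 0) $ r | Some b \<Rightarrow> g $ r $ Inr b)"
  have Ec: "E *v cons4 c y = g *v join3 (c *s x) y" for c y
  proof -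
    have "(E *v cons4 c y) $ r = (g *v join3 (c *s x) y) $ r" for r
    proof -
      have ss: "(\<Sum>i\<in>UNIV. f i) = (\<Sum>a\<in>UNIV. f (Inl a)) + (\<Sum>b\<in>UNIV. f (Inr b))" for f :: "3 + 3 \<Rightarrow> 'a"
        by (simp add: UNIV_Plus_UNIV[symmetric] sum.Plus del: UNIV_Plus_UNIV)
      show ?thesis
        by (simp add: E_def matrix_vector_mult_def sum_option ss sum_distrib_left mult_ac)
    qed
    then show ?thesis by (simp add: vec_eq_iff)
  qed
  have h: "(1 / 2 :: 'a) + 1 / 2 = 1" using two by (simp add: field_simps)
  \<comment> \<open>The derivative of a cubic in the direction \<open>e\<close> is a quadratic form;
    this is its matrix.\<close>
  define R where "R e = (\<chi> a b. \<Sum>l\<in>UNIV. e $ l * quad_matrix (1 / 2) (mp_deriv l F) $ a $ b)" for e :: "'a ^ 6"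
  have R: "quad (R e) v = dot e (mp_gradient F v)" for e v
  proof -
    have "quad (R e) v = (\<Sum>a\<in>UNIV. \<Sum>b\<in>UNIV. \<Sum>l\<in>UNIV. v $ a * (e $ l * quad_matrix (1 / 2) (mp_deriv l F) $ a $ b * v $ b))"
      by (simp add: quad_def dot_def matrix_vector_mult_def R_def sum_distrib_left sum_distrib_right mult_ac)
    also have "\<dots> = (\<Sum>a\<in>UNIV. \<Sum>l\<in>UNIV. \<Sum>b\<in>UNIV. v $ a * (e $ l * quad_matrix (1 / 2) (mp_deriv l F) $ a $ b * v $ b))"
      by (rule sum.cong[OF refl], rule sum.swap)
    also have "\<dots> = (\<Sum>l\<in>UNIV. \<Sum>a\<in>UNIV. \<Sum>b\<in>UNIV. v $ a * (e $ l * quad_matrix (1 / 2) (mp_deriv l F) $ a $ b * v $ b))"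
      by (rule sum.swap)
    also have "\<dots> = (\<Sum>l\<in>UNIV. e $ l * quad (quad_matrix (1 / 2) (mp_deriv l F)) v)"
      by (simp add: quad_def dot_def matrix_vector_mult_def sum_distrib_left mult_ac)
    also have "\<dots> = (\<Sum>l\<in>UNIV. e $ l * mp_value (mp_deriv l F) v)"
      using form_deriv[OF F(1)] by (simp add: quad_form_expand[OF _ h])
    finally show ?thesis by (simp add: dot_def mp_gradient_def)
  qed
  have Rsym: "transpose (R e) = R e" for e
    by (simp add: transpose_def R_def symmetric_nth[OF quad_matrix_symmetric, of "1 / 2"])
  define e where "e l = g *v join3 (axis l 1) 0" for l :: 3
  have "transpose (transpose E ** R (e i) ** E) = transpose E ** R (e i) ** E"
    by (simp add: matrix_transpose_mul matrix_mul_assoc transpose_transpose Rsym)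
  then obtain v where v: "v \<noteq> 0" "quad (transpose E ** R (e i) ** E) v = 0" "quad (transpose E ** R (e j) ** E) v = 0"
    using two_quadrics_common_zero[OF two] by blast
  define p where "p = E *v v"
  have pv: "p = g *v join3 ((v $ None) *s x) (\<chi> b. v $ Some b)"
    unfolding p_def by (metis Ec cons4_collapse)
  have ginj: "u = 0" if "g *v u = 0" for u
    using inv that unfolding invertible_def
    by (metis matrix_vector_mul_assoc matrix_vector_mul_lid matrix_vector_mult_0_right)
  have p0: "p \<noteq> 0"
  proof
    assume "p = 0"
    then have "join3 ((v $ None) *s x) (\<chi> b. v $ Some b) = 0" using pv ginj by simp
    then have "(v $ None) *s x = 0" "(\<chi> b. v $ Some b) = 0"
      by (simp_all add: vec_eq_iff forall_sum)
    then have "cons4 (v $ None) (\<chi> b. v $ Some b) = 0"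
      using x by (simp add: vec_eq_iff forall_option) metis
    then show False using v(1) by (simp add: cons4_collapse)
  qed
  let ?G = "mp_gradient F p"
  have g_ij: "dot (e i) ?G = 0" "dot (e j) ?G = 0"
    using v(2,3) by (simp_all only: quad_congruence R p_def)
  have matsc: "g *v (c *s u) = c *s (g *v u)" for c u
    by (simp add: vec_eq_iff matrix_vector_mult_def sum_distrib_left mult_ac)
  have dU: "dot (g *v join3 (c *s x) y) ?G = 0" for c y
  proof -
    have "line_poly F p (g *v join3 (c *s x) y) = 0"
    proof (rule poly_eq_if_nonzero_eq)
      fix t :: 'a
      have eq: "p + t *s (g *v join3 (c *s x) y) = g *v join3 ((v $ None + t * c) *s x) ((\<chi> b. v $ Some b) + t *s y)"
        unfolding pv matsc[symmetric] matrix_vector_right_distrib[symmetric]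
        by (rule arg_cong[of _ _ "\<lambda>u. g *v u"]) (simp add: vec_eq_iff forall_sum algebra_simps)
      show "poly (line_poly F p (g *v join3 (c *s x) y)) t = poly 0 t"
        unfolding poly_line_poly eq F0 by simp
    qed
    then show ?thesis using pderiv_line_poly[of F p "g *v join3 (c *s x) y"] by simp
  qed
  have dadd: "dot (a + b) u = dot a u + dot b u" "dot (c *s a) u = c * dot a u" for a b u :: "'a ^ 6" and c
    using dot_right_add[of u a b] dot_right_scale[of u c a] by (simp_all add: dot_commute)
  have all: "dot (g *v join3 s y) ?G = 0" for s y
  proof -
    define c where "c = s $ k / x $ k"
    define a where "a = s $ i - c * x $ i"
    define b where "b = s $ j - c * x $ j"
    have s: "s = c *s x + (a *s axis i 1 + b *s axis j 1)"
      unfolding vec_eq_iff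
    proof
      fix l
      have "l = i \<or> l = j \<or> l = k" using ij by blast
      then show "s $ l = (c *s x + (a *s axis i 1 + b *s axis j 1)) $ l"
        using ij k by (auto simp: axis_def a_def b_def c_def)
    qed
    have "join3 s y = join3 (c *s x) y + (a *s join3 (axis i 1) 0 + b *s join3 (axis j 1) 0)"
      unfolding s by (simp add: vec_eq_iff forall_sum)
    then have "g *v join3 s y = g *v join3 (c *s x) y + (a *s e i + b *s e j)"
      by (simp only: matrix_vector_right_distrib matsc e_def)
    then show ?thesis by (simp only: dadd dU g_ij) simp
  qed
  have "?G $ l = 0" for l
  proof -
    obtain h where "g ** h = mat 1" using inv unfolding invertible_def by blast
    then have "g *v (h *v axis l 1) = axis l 1" by (simp add: matrix_vector_mul_assoc)
    then have "dot (axis l 1) ?G = 0" using all by (metis join3_collapse)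
    then show ?thesis by (simp add: dot_axis_1)
  qed
  then have "?G = 0" by (simp add: vec_eq_iff)
  moreover have "mp_value F p = 0" unfolding pv by (rule F0)
  ultimately show False using F(2) p0 unfolding smooth_hypersurface_def by blast
qed

section \<open>Additive characters and exponential sums\<close>

lemma prime_char_finite_field: "prime CHAR('a::finite_field)"
  by (rule prime_CHAR_semidom) (simp add: CHAR_pos)

text \<open>Among the additive subgroups of p-power order take a largest one. Adjoining an element
  outside would give a subgroup p times as large.\<close>

lemma card_finite_field: "\<exists>r. CARD('a::finite_field) = CHAR('a) ^ r \<and> r > 0"
proof -
  let ?p = "CHAR('a)"
  have p: "prime ?p" by (rule prime_char_finite_field)
  then have p1: "?p > 1" by (rule prime_gt_1_nat)
  define S where "S = {H :: 'a set. 0 \<in> H \<and> (\<forall>x\<in>H. \<forall>y\<in>H. x - y \<in> H) \<and> (\<exists>r. card H = ?p ^ r)}"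
  have "{0} \<in> S" by (auto simp: S_def intro: exI[of _ 0])
  then obtain H where H: "H \<in> S" and max: "\<And>H'. H' \<in> S \<Longrightarrow> card H' \<le> card H"
    using ex_has_greatest_nat[of "\<lambda>H. H \<in> S" "{0}" card "Suc CARD('a)"] by (auto simp: less_Suc_eq_le card_mono)
  have sub: "x - y \<in> H" if "x \<in> H" "y \<in> H" for x y using H that by (auto simp: S_def)
  have H0: "0 \<in> H" using H by (auto simp: S_def)
  have neg: "- x \<in> H" if "x \<in> H" for x using sub[OF H0 that] by simp
  have add: "x + y \<in> H" if "x \<in> H" "y \<in> H" for x y using sub[OF that(1) neg[OF that(2)]] by simp
  obtain r where r: "card H = ?p ^ r" using H by (auto simp: S_def)
  have "H = UNIV"
  proof (rule ccontr)
    assume "H \<noteq> UNIV"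
    then obtain x where x: "x \<notin> H" by blast
    have nH: "of_nat n * h \<in> H" if "h \<in> H" for n h
      using that by (induction n) (auto simp: H0 distrib_right intro: add)
    have inj: "inj_on (\<lambda>(k, h). of_nat k * x + h) ({..<?p} \<times> H)"
    proof (rule inj_onI, clarify)
      fix k h k' h' assume a: "k < ?p" "h \<in> H" "k' < ?p" "h' \<in> H" and e: "of_nat k * x + h = of_nat k' * x + h'"
      have aux: "k = k'" if "k < ?p" "k' < ?p" "k' \<le> k" "of_nat (k - k') * x \<in> H" for k k'
      proof (rule ccontr)
        assume "k \<noteq> k'"
        then have "0 < k - k'" "k - k' < ?p" using that by auto
        then have "\<not> ?p dvd k - k'" by (rule nat_dvd_not_less)
        then have "coprime ?p (k - k')" by (rule prime_imp_coprime[OF p])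
        then have "coprime (k - k') ?p" by (rule coprime_commute[THEN iffD1])
        \<comment> \<open>The multiplier \<open>m\<close> inverts k - k' modulo p and would bring
          \<open>x\<close> itself into \<open>H\<close>.\<close>
        then obtain m where "[(k - k') * m = 1] (mod ?p)" using cong_solve_coprime_nat by auto
        then have "of_nat ((k - k') * m) = (1 :: 'a)" using of_nat_eq_iff_cong_CHAR[of "(k - k') * m" 1, where ?'a = 'a] by simp
        then have "of_nat (k - k') * of_nat m = (1 :: 'a)" by (simp only: of_nat_mult)
        moreover have "of_nat m * (of_nat (k - k') * x) = (of_nat (k - k') * of_nat m) * x"
          by (simp only: mult_ac)
        ultimately have "of_nat m * (of_nat (k - k') * x) = x" by simp
        then show False using nH[OF that(4), of m] x by metis
      qed
      have "k = k'"
      proof (cases "k' \<le> k")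
        case True
        have "of_nat (k - k') * x = h' - h" using e True by (simp add: of_nat_diff algebra_simps)
        then show ?thesis using aux[OF a(1,3) True] sub[OF a(4,2)] by simp
      next
        case False
        have "of_nat (k' - k) * x = h - h'" using e False by (simp add: of_nat_diff algebra_simps)
        then show ?thesis using aux[OF a(3,1)] False sub[OF a(2,4)] by simp
      qed
      then show "k = k' \<and> h = h'" using e by simp
    qed
    define H' where "H' = (\<lambda>(k, h). of_nat k * x + h) ` ({..<?p} \<times> H)"
    have c: "card H' = ?p ^ Suc r"
      unfolding H'_def using card_image[OF inj] r by (simp add: card_cartesian_product)
    have memH': "of_nat k * x + h \<in> H'" if "h \<in> H" for k h
    proof -
      have "of_nat k = (of_nat (k mod ?p) :: 'a)"
        by (simp add: of_nat_eq_iff_cong_CHAR cong_def)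
      then have e: "of_nat k * x + h = (\<lambda>(k, h). of_nat k * x + h) (k mod ?p, h)"
        by (simp only: prod.case)
      show ?thesis unfolding H'_def e using that p1 by (intro imageI) auto
    qed
    have "H' \<in> S"
      unfolding S_def
    proof (safe intro!: exI[of _ "Suc r"])
      show "0 \<in> H'" using memH'[OF H0, of 0] by simp
      fix u w assume "u \<in> H'" "w \<in> H'"
      then obtain k h k' h' where uw: "u = of_nat k * x + h" "h \<in> H" "w = of_nat k' * x + h'" "h' \<in> H"
        by (auto simp: H'_def)
      have "(of_nat ?p :: 'a) = 0" by simp
      then have "of_nat (?p - 1) = (- 1 :: 'a)" using p1 by (simp only: of_nat_diff[OF less_imp_le]) simp
      then have "u - w = of_nat (k + (?p - 1) * k') * x + (h - h')"
        unfolding uw of_nat_add of_nat_mult by (simp only:) (simp add: algebra_simps)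
      then show "u - w \<in> H'" using memH'[OF sub[OF uw(2,4)]] by (simp only:)
    qed (rule c)
    from max[OF this] show False using r c p1 by simp
  qed
  then have "CARD('a) = ?p ^ r" using r by simp
  moreover have "r > 0"
  proof (rule ccontr)
    assume "\<not> r > 0"
    then have "CARD('a) = 1" using \<open>CARD('a) = ?p ^ r\<close> by simp
    moreover have "card {0, 1 :: 'a} \<le> CARD('a)" by (intro card_mono) auto
    ultimately show False by simp
  qed
  ultimately show ?thesis by blast
qed

text \<open>\<open>psi\<close> sees only the coefficient of 1/t; this is the resulting character of
  the constant field.\<close>

definition psi0 :: "'a::finite_field \<Rightarrow> complex" where
  "psi0 x = exp (2 * pi * \<i> * of_nat (trace_rep x) / of_nat CHAR('a))"

lemma abs_trace_eq:
  assumes "CARD('a::finite_field) = CHAR('a) ^ r"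
  shows "abs_trace (x :: 'a) = (\<Sum>j<r. x ^ (CHAR('a) ^ j))"
proof -
  have "{j. CHAR('a) ^ j < CARD('a)} = {..<r}"
    using prime_gt_1_nat[OF prime_char_finite_field[where 'a = 'a]] by (auto simp: assms)
  then show ?thesis by (simp add: abs_trace_def)
qed

lemma abs_trace_add: "abs_trace (x + y) = abs_trace x + abs_trace (y :: 'a::finite_field)"
proof -
  obtain r where r: "CARD('a) = CHAR('a) ^ r" using card_finite_field by blast
  show ?thesis
    unfolding abs_trace_eq[OF r] sum.distrib[symmetric]
    by (intro sum.cong refl freshmans_dream'[OF prime_char_finite_field refl])
qed

text \<open>The trace is fixed by Frobenius, and the p multiples of one exhaust the roots of X^p -
  X. Hence the least \<open>k\<close> in the definition exists.\<close>

lemma trace_rep: "of_nat (trace_rep x) = abs_trace (x :: 'a::finite_field)"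
proof -
  let ?p = "CHAR('a)"
  have p: "prime ?p" by (rule prime_char_finite_field)
  obtain r where r: "CARD('a) = ?p ^ r" "r > 0" using card_finite_field by blast
  have "abs_trace x ^ ?p = (\<Sum>j<r. (x ^ (?p ^ j)) ^ ?p)"
    unfolding abs_trace_eq[OF r(1)] by (rule freshmans_dream_sum[OF p refl])
  also have "\<dots> = (\<Sum>j<r. x ^ (?p ^ Suc j))"
    by (simp only: power_mult[symmetric] power_Suc mult.commute)
  also have "\<dots> = (\<Sum>j\<in>{1..<Suc r}. x ^ (?p ^ j))"
    by (rule sum.reindex_bij_witness[of _ "\<lambda>j. j - 1" Suc]) auto
  also have "\<dots> = (\<Sum>j\<in>{1..<r}. x ^ (?p ^ j)) + x ^ (?p ^ r)"
    using r(2) by (subst sum.atLeastLessThan_Suc) auto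
  also have "x ^ (?p ^ r) = x ^ (?p ^ 0)"
    using finite_field_power_card_eq_same[of x] by (simp add: r(1))
  also have "(\<Sum>j\<in>{1..<r}. x ^ (?p ^ j)) + x ^ (?p ^ 0) = (\<Sum>j<r. x ^ (?p ^ j))"
    using r(2) by (simp add: lessThan_atLeast0 sum.atLeast_Suc_lessThan[of 0 r])
  finally have y: "abs_trace x ^ ?p = abs_trace x" by (simp only: abs_trace_eq[OF r(1)])
  have fx: "(of_nat k :: 'a) ^ ?p = of_nat k" for k
    by (induction k) (auto simp: freshmans_dream[OF p] power_0_left prime_gt_0_nat[OF p])
  have "abs_trace x \<in> of_nat ` {..<?p}"
  proof (rule ccontr)
    assume n: "abs_trace x \<notin> of_nat ` {..<?p}"
    let ?P = "monom 1 ?p - monom 1 1 :: 'a poly"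
    have p1: "?p > 1" using p by (rule prime_gt_1_nat)
    have "inj_on (of_nat :: nat \<Rightarrow> 'a) {..<?p}"
      by (rule inj_onI) (auto simp: of_nat_eq_iff_cong_CHAR cong_def)
    then have "card (insert (abs_trace x) (of_nat ` {..<?p})) = Suc ?p"
      using n by (simp add: card_image)
    moreover have "coeff ?P ?p = 1" using p1 by simp
    then have P0: "?P \<noteq> 0" by (metis coeff_0 zero_neq_one)
    then have "card (insert (abs_trace x) (of_nat ` {..<?p})) \<le> card {z. poly ?P z = 0}"
      using y fx by (intro card_mono poly_roots_finite) (auto simp: poly_monom)
    moreover have "card {z. poly ?P z = 0} \<le> degree ?P" using P0 by (rule card_poly_roots_bound)
    moreover have "degree ?P \<le> ?p"
      using p1 by (intro degree_diff_le) (auto simp: degree_monom_eq)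
    ultimately show False by simp
  qed
  then have "\<exists>k. of_nat k = abs_trace x" by auto
  then show ?thesis unfolding trace_rep_def by (rule LeastI_ex)
qed

lemma exp_root_of_unity_eq:
  assumes "[k = m] (mod n)" "n > 0"
  shows "exp (2 * pi * \<i> * of_nat k / of_nat n) = exp (2 * pi * \<i> * of_nat m / of_nat n)"
proof -
  have *: "exp (2 * pi * \<i> * of_nat k / of_nat n) = exp (2 * pi * \<i> * of_nat (k mod n) / of_nat n)" for k
  proof -
    have "(of_nat k :: complex) = of_nat (n * (k div n) + k mod n)" by simp
    then have "2 * pi * \<i> * of_nat k / of_nat n
        = 2 * pi * \<i> * of_nat (k mod n) / of_nat n + of_nat (k div n) * (2 * pi * \<i>)"
      using assms(2) by (simp only: of_nat_add of_nat_mult) (simp add: field_simps)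
    moreover have "exp (of_nat (k div n) * (2 * pi * \<i>)) = 1"
      using exp_integer_2pi[of "of_nat (k div n)"] by (simp add: mult_ac)
    ultimately show ?thesis by (simp add: exp_add)
  qed
  show ?thesis using *[of k] *[of m] assms(1) by (simp add: cong_def)
qed

lemma psi0_add: "psi0 (x + y) = psi0 x * psi0 (y :: 'a::finite_field)"
proof -
  have "of_nat (trace_rep (x + y)) = (of_nat (trace_rep x + trace_rep y) :: 'a)"
    by (simp add: trace_rep abs_trace_add)
  then have "[trace_rep (x + y) = trace_rep x + trace_rep y] (mod CHAR('a))"
    by (simp only: of_nat_eq_iff_cong_CHAR)
  then have "psi0 (x + y) = exp (2 * pi * \<i> * of_nat (trace_rep x + trace_rep y) / of_nat CHAR('a))"
    unfolding psi0_def by (rule exp_root_of_unity_eq) (simp add: CHAR_pos)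
  then show ?thesis
    by (simp add: psi0_def exp_add[symmetric] add_divide_distrib distrib_left)
qed

text \<open>As a polynomial the trace has degree at most p^(r - 1), less than the number of
  elements, so it does not vanish everywhere; a non-zero trace gives a root of unity other than
  one.\<close>

lemma psi0_nontrivial: "\<exists>x :: 'a::finite_field. psi0 x \<noteq> 1"
proof -
  let ?p = "CHAR('a)"
  have p: "prime ?p" by (rule prime_char_finite_field)
  then have p1: "?p > 1" by (rule prime_gt_1_nat)
  obtain r where r: "CARD('a) = ?p ^ r" "r > 0" using card_finite_field by blast
  have "\<exists>x :: 'a. abs_trace x \<noteq> 0"
  proof (rule ccontr)
    assume n: "\<nexists>x :: 'a. abs_trace x \<noteq> 0"
    define P where "P = (\<Sum>j<r. monom 1 (?p ^ j) :: 'a poly)"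
    have "coeff P (?p ^ 0) = (\<Sum>j<r. if j = 0 then 1 else 0)"
      unfolding P_def coeff_sum using p1 by (intro sum.cong) auto
    then have "coeff P 1 = 1" using r(2) by simp
    then have P0: "P \<noteq> 0" by (metis coeff_0 zero_neq_one)
    have "{x. poly P x = 0} = UNIV"
      using n by (auto simp: P_def poly_sum poly_monom abs_trace_eq[OF r(1)])
    then have "?p ^ r \<le> degree P" using card_poly_roots_bound[OF P0] r(1) by simp
    also have "degree P \<le> ?p ^ (r - 1)"
      unfolding P_def using p1
      by (intro degree_sum_le) (auto simp: degree_monom_eq intro!: power_increasing)
    also have "\<dots> < ?p ^ r" using p1 r(2) by (intro power_strict_increasing) auto
    finally show False by simp
  qed
  then obtain x :: 'a where x: "abs_trace x \<noteq> 0" by blast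
  have "psi0 x \<noteq> 1"
  proof
    assume "psi0 x = 1"
    then obtain m :: int where m: "2 * pi * \<i> * of_nat (trace_rep x) / of_nat ?p = of_int (2 * m) * pi * \<i>"
      unfolding psi0_def exp_eq_1 by (auto simp: complex_eq_iff)
    then have "(of_nat (trace_rep x) :: complex) = of_int m * of_nat ?p"
      using p1 by (simp add: field_simps)
    then have "(of_int (int (trace_rep x)) :: complex) = of_int (m * int ?p)" by simp
    then have "int (trace_rep x) = m * int ?p" by (simp only: of_int_eq_iff)
    then have "?p dvd trace_rep x" by (metis dvd_triv_right int_dvd_int_iff)
    then have "(of_nat (trace_rep x) :: 'a) = 0" by (simp add: of_nat_eq_0_iff_char_dvd)
    then show False using x by (simp add: trace_rep)
  qed
  then show ?thesis by blast
qed

subsection \<open>Character sums over a finite subfield\<close>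

context finite_subfield
begin

lemma sum_KV_shift:
  "x0 \<in> KV \<Longrightarrow> (\<Sum>x\<in>KV. f (x + x0)) = (\<Sum>x\<in>KV. f x)"
  by (rule sum.reindex_bij_witness[of _ "\<lambda>x. x - x0" "\<lambda>x. x + x0"])
    (auto simp: KV_iff intro: K_add K_diff)

context
  fixes \<Psi> :: "'a \<Rightarrow> complex"
  assumes add: "\<And>x y. x \<in> K \<Longrightarrow> y \<in> K \<Longrightarrow> \<Psi> (x + y) = \<Psi> x * \<Psi> y"
    and nontrivial: "\<exists>b\<in>K. \<Psi> b \<noteq> 1" and Psi_0: "\<Psi> 0 = 1"
begin

lemma sum_character:
  assumes "y \<in> K"
  shows "(\<Sum>a\<in>K. \<Psi> (a * y)) = (if y = 0 then of_nat q else 0)"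
proof (cases "y = 0")
  case False
  obtain b where b: "b \<in> K" "\<Psi> b \<noteq> 1" using nontrivial by blast
  have byK: "b / y \<in> K" using b assms by (intro K_divide)
  have "(\<Sum>a\<in>K. \<Psi> (a * y)) = (\<Sum>a\<in>K. \<Psi> ((a + b / y) * y))"
    by (rule sum.reindex_bij_witness[of _ "\<lambda>a. a + b / y" "\<lambda>a. a - b / y"]) (use byK in \<open>auto intro: K_add K_diff\<close>)
  also have "\<dots> = (\<Sum>a\<in>K. \<Psi> (a * y) * \<Psi> b)"
    by (intro sum.cong refl) (use False assms b in \<open>auto simp: distrib_right add K_mult\<close>)
  also have "\<dots> = (\<Sum>a\<in>K. \<Psi> (a * y)) * \<Psi> b" by (simp add: sum_distrib_right)
  finally show ?thesis using b(2) False by (metis mult_cancel_left mult.right_neutral)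
qed (simp add: Psi_0)

lemma sum_character_nonzero:
  assumes "y \<in> K"
  shows "(\<Sum>a\<in>K - {0}. \<Psi> (a * y)) = (if y = 0 then of_nat q else 0) - 1"
proof -
  have "(\<Sum>a\<in>K. \<Psi> (a * y)) = 1 + (\<Sum>a\<in>K - {0}. \<Psi> (a * y))"
    using finite_K K_0 by (subst sum.remove[of K 0]) (auto simp: Psi_0)
  then show ?thesis unfolding sum_character[OF assms] by (simp only: eq_diff_eq add.commute)
qed

text \<open>Orthogonality in \<open>a\<close> detects \<open>f x = 0\<close>, and the missing term
  \<open>a = 0\<close> contributes nothing because \<open>c\<close> is non-zero. The sum left over
  the zero set is invariant under scaling \<open>x\<close>; averaging it over the q - 1 scalars
  detects \<open>dot c x = 0\<close> by orthogonality again.\<close>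

lemma exponential_sum_eq_count:
  fixes c :: "'a ^ 'n::finite" and f :: "'a ^ 'n \<Rightarrow> 'a"
  assumes c: "c \<in> KV" "c \<noteq> 0" and f: "\<And>x. x \<in> KV \<Longrightarrow> f x \<in> K"
    and hom: "\<And>l x. l \<in> K \<Longrightarrow> l \<noteq> 0 \<Longrightarrow> f x = 0 \<Longrightarrow> f (l *s x) = 0"
  shows "(of_nat q - 1) * (\<Sum>a\<in>K - {0}. \<Sum>x\<in>KV. \<Psi> (a * f x - dot c x))
    = of_nat q * (of_nat q * of_nat (card {x\<in>KV. f x = 0 \<and> dot c x = 0}) - of_nat (card {x\<in>KV. f x = 0}))"
proof -
  let ?Z = "{x\<in>KV. f x = 0}"
  have finZ: "finite ?Z" by (rule finite_subset[OF _ finite_KV]) auto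
  have dK: "dot c x \<in> K" if "x \<in> KV" for x using c(1) that by (rule K_dot)
  have zero: "(\<Sum>x\<in>KV. \<Psi> (- dot c x)) = 0"
  proof -
    obtain b where b: "b \<in> K" "\<Psi> b \<noteq> 1" using nontrivial by blast
    obtain k where k: "c $ k \<noteq> 0" using c(2) by (auto simp: vec_eq_iff)
    define x0 where "x0 = axis k (- b / c $ k)"
    have "c $ k \<in> K" using c(1) by (simp add: KV_iff)
    then have x0: "x0 \<in> KV" using b by (auto simp: x0_def KV_iff axis_def intro: K_closed)
    have dx0: "dot c x0 = - b"
      using k by (simp add: dot_def x0_def axis_def if_distrib[of "\<lambda>x. _ * x"] cong: if_cong)
    have "(\<Sum>x\<in>KV. \<Psi> (- dot c x)) = (\<Sum>x\<in>KV. \<Psi> (- dot c (x + x0)))"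
      by (rule sum_KV_shift[OF x0, symmetric])
    also have "\<dots> = (\<Sum>x\<in>KV. \<Psi> (- dot c x) * \<Psi> b)"
    proof (rule sum.cong[OF refl])
      fix x :: "'a ^ 'n" assume "x \<in> KV"
      then have "- dot c x \<in> K" by (intro K_uminus dK)
      moreover have eq: "- dot c (x + x0) = - dot c x + b"
        using dx0 by (simp add: dot_def distrib_left sum.distrib)
      ultimately show "\<Psi> (- dot c (x + x0)) = \<Psi> (- dot c x) * \<Psi> b"
        unfolding eq using b(1) by (intro add)
    qed
    also have "\<dots> = (\<Sum>x\<in>KV. \<Psi> (- dot c x)) * \<Psi> b" by (simp add: sum_distrib_right)
    finally show ?thesis using b(2) by (metis mult_cancel_left mult.right_neutral)
  qed
  have "(\<Sum>a\<in>K - {0}. \<Sum>x\<in>KV. \<Psi> (a * f x - dot c x)) = (\<Sum>x\<in>KV. \<Sum>a\<in>K - {0}. \<Psi> (a * f x - dot c x))"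
    by (rule sum.swap)
  also have "\<dots> = (\<Sum>x\<in>KV. (if f x = 0 then of_nat q * \<Psi> (- dot c x) else 0) - \<Psi> (- dot c x))"
  proof (rule sum.cong[OF refl])
    fix x :: "'a ^ 'n" assume x: "x \<in> KV"
    have "(\<Sum>a\<in>K - {0}. \<Psi> (a * f x - dot c x)) = (\<Sum>a\<in>K - {0}. \<Psi> (a * f x) * \<Psi> (- dot c x))"
    proof (rule sum.cong[OF refl])
      fix a assume "a \<in> K - {0}"
      then show "\<Psi> (a * f x - dot c x) = \<Psi> (a * f x) * \<Psi> (- dot c x)"
        using add[of "a * f x" "- dot c x"] f[OF x] dK[OF x] K_mult K_uminus by simp
    qed
    also have "\<dots> = ((if f x = 0 then of_nat q else 0) - 1) * \<Psi> (- dot c x)"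
      by (simp only: sum_distrib_right[symmetric] sum_character_nonzero[OF f[OF x]])
    finally show "(\<Sum>a\<in>K - {0}. \<Psi> (a * f x - dot c x))
      = (if f x = 0 then of_nat q * \<Psi> (- dot c x) else 0) - \<Psi> (- dot c x)"
      by (simp add: algebra_simps)
  qed
  also have "\<dots> = (\<Sum>x\<in>?Z. of_nat q * \<Psi> (- dot c x))"
    by (simp add: sum_subtractf zero sum.inter_filter)
  finally have S: "(\<Sum>a\<in>K - {0}. \<Sum>x\<in>KV. \<Psi> (a * f x - dot c x)) = of_nat q * (\<Sum>x\<in>?Z. \<Psi> (- dot c x))"
    by (simp add: sum_distrib_left)
  have "(of_nat q - 1) * (\<Sum>x\<in>?Z. \<Psi> (- dot c x)) = (\<Sum>l\<in>K - {0}. \<Sum>x\<in>?Z. \<Psi> (- dot c x))"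
    using finite_K K_0 q_pos by (simp add: card_Diff_singleton of_nat_diff)
  also have "\<dots> = (\<Sum>l\<in>K - {0}. \<Sum>x\<in>?Z. \<Psi> (l * - dot c x))"
  proof (rule sum.cong[OF refl])
    fix l assume l: "l \<in> K - {0}"
    show "(\<Sum>x\<in>?Z. \<Psi> (- dot c x)) = (\<Sum>x\<in>?Z. \<Psi> (l * - dot c x))"
    proof (rule sum.reindex_bij_witness[of _ "\<lambda>x. l *s x" "\<lambda>x. (1 / l) *s x"])
      fix x assume "x \<in> ?Z"
      then show "(1 / l) *s x \<in> ?Z" "l *s x \<in> ?Z"
        using l hom[of "1 / l" x] hom[of l x] by (auto intro!: KV_scale K_divide K_1)
      show "l *s ((1 / l) *s x) = x" "(1 / l) *s (l *s x) = x" using l by simp_all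
      show "\<Psi> (l * - dot c ((1 / l) *s x)) = \<Psi> (- dot c x)"
        using l by (simp add: dot_def sum_distrib_left mult.left_commute[of l])
    qed
  qed
  also have "\<dots> = (\<Sum>x\<in>?Z. \<Sum>l\<in>K - {0}. \<Psi> (l * - dot c x))" by (rule sum.swap)
  also have "\<dots> = (\<Sum>x\<in>?Z. (if dot c x = 0 then of_nat q else 0) - 1)"
  proof (rule sum.cong[OF refl])
    fix x assume "x \<in> ?Z"
    then have "- dot c x \<in> K" by (intro K_uminus dK) simp
    from sum_character_nonzero[OF this]
    show "(\<Sum>l\<in>K - {0}. \<Psi> (l * - dot c x)) = (if dot c x = 0 then of_nat q else 0) - 1" by simp
  qed
  also have "\<dots> = of_nat q * of_nat (card {x\<in>?Z. dot c x = 0}) - of_nat (card ?Z)"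
    using finZ by (simp add: sum_subtractf sum.inter_filter[symmetric] del: Collect_case_prod)
  also have "{x\<in>?Z. dot c x = 0} = {x\<in>KV. f x = 0 \<and> dot c x = 0}" by blast
  finally show ?thesis unfolding S by (simp add: mult.left_commute)
qed

end

end

section \<open>Reduction modulo a prime\<close>

lemma mp_value_map_hom:
  assumes "ring_hom_fun h"
  shows "mp_value (Poly_Mapping.map h f) (vmap h x) = h (mp_value f x)"
proof -
  have "mp_value (Poly_Mapping.map h f) (vmap h x) = mp_eval h (\<lambda>i. h (x $ i)) f"
    by (subst mp_value_map[of h]) (simp_all add: hom_0[OF assms] vmap_def vec_lambda_inverse)
  also have "\<dots> = h (mp_value f x)"
    unfolding mp_value_def hom_of_mp_eval[OF assms] ..
  finally show ?thesis .
qed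

lemma hom_dot: "ring_hom_fun h \<Longrightarrow> dot (vmap h x) (vmap h y) = h (dot x y)"
  by (simp add: dot_def vmap_def hom_sum hom_mult)

lemma hom_poly_map:
  fixes x :: "'s::comm_ring_1"
  assumes e: "ring_hom_fun e"
  shows "ring_hom_fun (\<lambda>f. poly (map_poly e f) x)"
proof -
  note [simp] = map_poly_pCons[of e, OF hom_0[OF e]]
  have add: "poly (map_poly e (f + g)) x = poly (map_poly e f) x + poly (map_poly e g) x" for f g
  proof (induction f arbitrary: g rule: pCons_induct)
    case (pCons a f g)
    obtain b g' where "g = pCons b g'" by (cases g)
    then show ?case using pCons.IH[of g'] by (simp add: hom_add[OF e] algebra_simps)
  qed simp
  have smult: "poly (map_poly e (Polynomial.smult a g)) x = e a * poly (map_poly e g) x" for a g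
    by (induction g) (simp_all add: hom_mult[OF e] algebra_simps)
  have "poly (map_poly e (f * g)) x = poly (map_poly e f) x * poly (map_poly e g) x" for f g
    by (induction f) (simp_all add: add smult hom_0[OF e] algebra_simps)
  moreover have "poly (map_poly e 1) x = 1"
    using map_poly_pCons[of e, OF hom_0[OF e], of 1 0] by (simp add: hom_1[OF e] one_pCons)
  ultimately show ?thesis using add by (simp add: ring_hom_fun_def)
qed

lemma hom_to_ac: "ring_hom_fun (to_ac :: 'a::field \<Rightarrow> _)"
  by (simp add: ring_hom_fun_def)

lemma hom_reduce_at: "ring_hom_fun (reduce_at \<theta>)"
  unfolding reduce_at_def by (rule hom_poly_map[OF hom_to_ac])

lemma hom_fls_const: "ring_hom_fun (fls_const :: 'a::comm_ring_1 \<Rightarrow> _)"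
  by (simp add: ring_hom_fun_def fls_plus_const fls_const_mult_const)

lemma hom_to_laurent: "ring_hom_fun to_laurent"
  unfolding to_laurent_def by (rule hom_poly_map[OF hom_fls_const])

lemma to_laurent_smult: "to_laurent (Polynomial.smult a f) = fls_const a * to_laurent f"
proof -
  have "Polynomial.smult a f = [:a:] * f" by simp
  moreover have "to_laurent [:a:] = fls_const a"
    unfolding to_laurent_def by (simp add: map_poly_pCons)
  ultimately show ?thesis by (simp only: hom_mult[OF hom_to_laurent])
qed

lemma to_laurent_nth: "fls_nth (to_laurent f) n = (if n \<le> 0 then Polynomial.coeff f (nat (- n)) else 0)"
proof (induction f arbitrary: n rule: pCons_induct)
  case (pCons a f n)
  have "fls_nth (to_laurent (pCons a f)) n = (if n = 0 then a else 0) + fls_nth (to_laurent f) (n + 1)"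
    unfolding to_laurent_def by (simp add: map_poly_pCons fls_X_inv_times_conv_shift)
  moreover have "nat (- n) = Suc (nat (- (n + 1)))" if "n < 0" using that by simp
  ultimately show ?case using pCons.IH[of "n + 1"] by (cases "n = 0"; cases "n < 0") auto
qed (simp add: to_laurent_def)

lemma to_laurent_subdegree:
  assumes "f \<noteq> 0"
  shows "fls_subdegree (to_laurent f) = - int (degree f)"
  by (rule fls_subdegree_eqI) (auto simp: to_laurent_nth assms coeff_eq_0)

lemma to_laurent_eq_0_iff: "to_laurent f = 0 \<longleftrightarrow> f = 0"
proof
  assume "to_laurent f = 0"
  moreover have "fls_nth (to_laurent f) (- int (degree f)) = lead_coeff f" by (simp add: to_laurent_nth)
  ultimately show "f = 0" by simp
qed (simp add: hom_0[OF hom_to_laurent])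

section \<open>The residue field inside an algebraic closure\<close>

lemma exists_root_of:
  fixes \<pi> :: "'a::finite_field poly"
  assumes "Factorial_Ring.irreducible \<pi>"
  shows "\<exists>\<theta>. root_of \<theta> \<pi>"
proof -
  have "\<pi> \<noteq> 0" "\<not> is_unit \<pi>" using assms by (auto simp: Factorial_Ring.irreducible_def)
  then have "degree \<pi> > 0" using is_unit_iff_degree by blast
  then have "degree (map_poly to_ac \<pi>) > 0" by (simp add: degree_map_poly)
  from alg_closed_imp_poly_has_root[OF this] show ?thesis by (simp add: root_of_def reduce_at_def)
qed

locale residue_field =
  fixes \<theta> :: "'a::finite_field alg_closure" and \<pi> :: "'a poly"
  assumes root: "root_of \<theta> \<pi>" and irr: "Factorial_Ring.irreducible \<pi>" and char3: "CHAR('a) > 3"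
begin

abbreviation red where "red \<equiv> reduce_at \<theta>"

lemma red_simps [simp]: "red 0 = 0" "red 1 = 1" "red (a + b) = red a + red b"
  "red (a - b) = red a - red b" "red (- a) = - red a" "red (a * b) = red a * red b"
  using hom_reduce_at[of \<theta>]
  by (simp_all add: hom_0 hom_1 hom_add hom_diff hom_uminus hom_mult)

lemma pi_nz: "\<pi> \<noteq> 0" and degree_pi: "degree \<pi> > 0"
proof -
  show nz: "\<pi> \<noteq> 0" using irr by (auto simp: Factorial_Ring.irreducible_def)
  have "\<not> is_unit \<pi>" using irr by (auto simp: Factorial_Ring.irreducible_def)
  then show "degree \<pi> > 0" using nz is_unit_iff_degree by blast
qed

lemma red_pi: "red \<pi> = 0"
  using root by (simp add: root_of_def)

text \<open>The kernel is generated by an element \<open>m\<close> of least degree. It divides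
  \<open>\<pi>\<close> and is not a unit, so by irreducibility it is an associate of
  \<open>\<pi>\<close>.\<close>

lemma red_eq_0_iff: "red f = 0 \<longleftrightarrow> \<pi> dvd f"
proof
  assume f: "red f = 0"
  obtain m where m: "red m = 0" "m \<noteq> 0" and min: "\<And>g. red g = 0 \<Longrightarrow> g \<noteq> 0 \<Longrightarrow> degree m \<le> degree g"
    using ex_has_least_nat[of "\<lambda>g. red g = 0 \<and> g \<noteq> 0" \<pi> degree] red_pi pi_nz by blast
  have dvd: "m dvd g" if "red g = 0" for g
  proof (rule ccontr)
    assume nd: "\<not> m dvd g"
    have "red g = red (g div m * m + g mod m)" by (simp only: div_mult_mod_eq)
    also have "\<dots> = red (g div m) * red m + red (g mod m)" by (simp only: red_simps)
    finally have "red g = red (g div m) * red m + red (g mod m)" .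
    then have "red (g mod m) = 0" using m that by simp
    then have "degree m \<le> degree (g mod m)" using min nd by (auto simp: dvd_eq_mod_eq_0)
    with degree_mod_less_degree[OF m(2) nd] show False by simp
  qed
  obtain k where k: "\<pi> = m * k" using dvd[OF red_pi] by (auto elim: dvdE)
  have "\<not> is_unit m"
  proof
    assume "is_unit m"
    then obtain l where "1 = m * l" by (auto elim: dvdE)
    then have "red 1 = red (m * l)" by (simp only:)
    then have "1 = red m * red l" by (simp only: red_simps)
    then show False using m by simp
  qed
  then have "is_unit k" using irreducibleD[OF irr k] by blast
  then have "\<pi> dvd m" unfolding k by (simp add: mult_unit_dvd_iff)
  then show "\<pi> dvd f" using dvd[OF f] by (rule dvd_trans)
qed (auto elim!: dvdE simp: red_pi)

text \<open>The summation range of \<open>exp_sum\<close> for the modulus \<open>\<pi>\<close>, see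
  \<open>O_norm_less_iff\<close>. Zero has degree 0 and belongs to it because \<open>\<pi>\<close>
  is not constant.\<close>

definition reps :: "'a poly set" where
  "reps = {f. degree f < degree \<pi>}"

lemma bij_betw_reps: "bij_betw red reps (range red)"
proof (rule bij_betw_imageI)
  show "inj_on red reps"
  proof (rule inj_onI)
    fix f g assume fg: "f \<in> reps" "g \<in> reps" "red f = red g"
    then have "red (f - g) = 0" by simp
    then have "\<pi> dvd f - g" by (simp only: red_eq_0_iff)
    moreover have "degree (f - g) < degree \<pi>" using fg by (auto simp: reps_def intro: degree_diff_less)
    ultimately have "f - g = 0" using dvd_imp_degree_le[of \<pi> "f - g"] by linarith
    then show "f = g" by simp
  qed
  have "red f \<in> red ` reps" for f
  proof
    have "red f = red (f div \<pi> * \<pi> + f mod \<pi>)" by (simp only: div_mult_mod_eq)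
    also have "\<dots> = red (f mod \<pi>)" by (simp only: red_simps red_pi mult_zero_right add_0)
    finally show "red f = red (f mod \<pi>)" .
    show "f mod \<pi> \<in> reps"
      using degree_mod_less[OF pi_nz, of f] degree_pi by (auto simp: reps_def)
  qed
  then show "red ` reps = range red" by auto
qed

lemma two_nz_base: "(2 :: 'a) \<noteq> 0"
proof
  assume "(2 :: 'a) = 0"
  then have "of_nat 2 = (0 :: 'a)" by simp
  then have "CHAR('a) dvd 2" by (simp only: of_nat_eq_0_iff_char_dvd)
  then have "CHAR('a) \<le> 2" by (rule dvd_imp_le) simp
  then show False using char3 by simp
qed

lemma card_reps: "finite reps" "card reps = CARD('a) ^ degree \<pi>"
proof -
  interpret U: odd_finite_subfield "UNIV :: 'a set"
    by unfold_locales (auto simp: two_nz_base)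
  have "reps = U.PK (degree \<pi>)"
  proof (intro equalityI subsetI)
    fix f assume "f \<in> U.PK (degree \<pi>)"
    then have "\<forall>k\<ge>degree \<pi>. Polynomial.coeff f k = 0" by (simp add: U.PK_def)
    then show "f \<in> reps" using degree_lessI[of f "degree \<pi>"] degree_pi by (auto simp: reps_def)
  qed (auto simp: reps_def U.PK_def coeff_eq_0)
  then show "finite reps" "card reps = CARD('a) ^ degree \<pi>"
    using U.PK_finite U.card_PK by auto
qed

text \<open>Inverses exist because multiplication by a non-zero element is injective on the finite
  set \<open>range red\<close> and hence reaches one.\<close>

sublocale odd_finite_subfield "range red"
proof
  show "finite (range red)" using bij_betw_finite[OF bij_betw_reps] card_reps by simp
  show "(2 :: 'a alg_closure) \<noteq> 0"
    using two_nz_base by (metis to_ac_numeral to_ac_eq_0_iff)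
  have c: "red a * red b \<in> range red" "red a - red b \<in> range red" for a b
    by (simp_all flip: red_simps)
  then show "x * y \<in> range red" "x - y \<in> range red" if "x \<in> range red" "y \<in> range red" for x y
    using that by auto
  show "0 \<in> range red" "1 \<in> range red" by (metis rangeI red_simps(1), metis rangeI red_simps(2))
  show "inverse x \<in> range red" if x: "x \<in> range red" for x
  proof (cases "x = 0")
    case True then show ?thesis using \<open>0 \<in> range red\<close> by simp
  next
    case False
    have "inj_on ((*) x) (range red)" using False by (auto simp: inj_on_def)
    moreover have "(*) x ` range red \<subseteq> range red" using x c by auto
    ultimately have "(*) x ` range red = range red"
      using \<open>finite (range red)\<close> by (intro endo_inj_surj)
    then obtain y where "y \<in> range red" "x * y = 1" using \<open>1 \<in> range red\<close> by (metis imageE)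
    then show ?thesis by (metis inverse_unique)
  qed
qed

lemma card_residue_field: "card (range red) = CARD('a) ^ degree \<pi>"
  using bij_betw_same_card[OF bij_betw_reps] card_reps by simp

lemma O_norm_less_iff: "O_norm a < O_norm \<pi> \<longleftrightarrow> a \<in> reps"
proof -
  have "card {0, 1 :: 'a} \<le> CARD('a)" by (intro card_mono) auto
  then have "CARD('a) > 1" by simp
  then show ?thesis using pi_nz degree_pi by (auto simp: O_norm_def reps_def power_strict_increasing_iff)
qed

lemma coprime_pi_iff: "coprime a \<pi> \<longleftrightarrow> red a \<noteq> 0"
proof
  assume "coprime a \<pi>"
  show "red a \<noteq> 0"
  proof
    assume "red a = 0"
    then have "\<pi> dvd a" by (simp add: red_eq_0_iff)
    then have "is_unit \<pi>" using \<open>coprime a \<pi>\<close> by (meson coprime_common_divisor dvd_refl)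
    then show False using irr by (simp add: Factorial_Ring.irreducible_def)
  qed
next
  assume a: "red a \<noteq> 0"
  show "coprime a \<pi>"
  proof (rule coprimeI)
    fix d assume d: "d dvd a" "d dvd \<pi>"
    then obtain k where k: "\<pi> = d * k" by (auto elim: dvdE)
    from irreducibleD[OF irr this] show "is_unit d"
    proof
      assume "is_unit k"
      then have "\<pi> dvd d" unfolding k by (simp add: mult_unit_dvd_iff)
      then have "\<pi> dvd a" using d(1) by (rule dvd_trans)
      then show ?thesis using a by (simp add: red_eq_0_iff)
    qed
  qed
qed

section \<open>The additive character of the residue field\<close>

definition res :: "'a poly \<Rightarrow> 'a" where
  "res h = fls_nth (to_laurent h / to_laurent \<pi>) 1"

lemma res_add: "res (f + g) = res f + res g"
  by (simp add: res_def hom_add[OF hom_to_laurent] add_divide_distrib)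

lemma res_smult: "res (Polynomial.smult a f) = a * res f"
  unfolding res_def to_laurent_smult times_divide_eq_right[symmetric] by (simp only: fls_mult_const_nth)

text \<open>A polynomial has no term in 1/t. With additivity this makes \<open>res\<close> depend
  only on the class modulo \<open>\<pi>\<close>.\<close>

lemma res_mult_pi: "res (\<pi> * f) = 0"
  by (simp add: res_def hom_mult[OF hom_to_laurent] to_laurent_eq_0_iff pi_nz to_laurent_nth)

text \<open>For a numerator of degree one less than that of \<open>\<pi>\<close> the quotient starts
  exactly at 1/t.\<close>

lemma res_nonzero: "\<exists>h. res h \<noteq> 0"
proof
  let ?h = "Polynomial.monom 1 (degree \<pi> - 1) :: 'a poly" and ?n = "degree \<pi>"
  have nz: "to_laurent ?h \<noteq> 0" "to_laurent \<pi> \<noteq> 0" by (simp_all add: to_laurent_eq_0_iff pi_nz)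
  have "fls_subdegree (to_laurent ?h) = - int (?n - 1)"
    by (subst to_laurent_subdegree) (simp_all add: degree_monom_eq)
  then have "fls_subdegree (to_laurent ?h / to_laurent \<pi>) = 1"
    using degree_pi fls_divide_subdegree[OF nz] to_laurent_subdegree[OF pi_nz] by simp
  then show "res ?h \<noteq> 0"
    unfolding res_def using nth_fls_subdegree_nonzero[of "to_laurent ?h / to_laurent \<pi>"] nz by auto
qed

text \<open>The choice of representative is immaterial, and \<open>add_char_red\<close> is the form
  in which the character is used.\<close>

definition add_char :: "'a alg_closure \<Rightarrow> complex" where
  "add_char x = psi0 (res (inv_into reps red x))"

lemma add_char_red: "add_char (red h) = psi0 (res h)"
proof -
  let ?h = "inv_into reps red (red h)"
  have "red ?h = red h"
    using bij_betw_inv_into_right[OF bij_betw_reps, of "red h"] by simp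
  then have "red (?h - h) = 0" by simp
  then have "\<pi> dvd ?h - h" by (simp only: red_eq_0_iff)
  then obtain k where "?h - h = \<pi> * k" by (auto elim: dvdE)
  then have "?h = \<pi> * k + h" by (simp add: algebra_simps)
  then have "res ?h = res h" by (simp only: res_add res_mult_pi add_0)
  then show ?thesis by (simp add: add_char_def)
qed

lemma add_char_add: "x \<in> range red \<Longrightarrow> y \<in> range red \<Longrightarrow> add_char (x + y) = add_char x * add_char y"
  by (auto simp: add_char_red res_add psi0_add simp flip: red_simps)

lemma add_char_0: "add_char 0 = 1"
proof -
  have "add_char 0 = add_char 0 * add_char 0" using add_char_add[OF K_0 K_0] by simp
  moreover have "add_char 0 \<noteq> 0" by (simp add: add_char_def psi0_def)
  ultimately show ?thesis by simp
qed

lemma add_char_nontrivial: "\<exists>b\<in>range red. add_char b \<noteq> 1"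
proof -
  obtain x :: 'a where x: "psi0 x \<noteq> 1" using psi0_nontrivial by blast
  obtain h where h: "res h \<noteq> 0" using res_nonzero by blast
  have "add_char (red (Polynomial.smult (x / res h) h)) = psi0 x"
    using h by (simp add: add_char_red res_smult)
  then show ?thesis using x by (metis rangeI)
qed

lemma bij_betw_vmap_red: "bij_betw (vmap red) {x :: 'a poly ^ 'n::finite. \<forall>i. x $ i \<in> reps} KV"
proof (rule bij_betwI[where g = "vmap (inv_into reps red)"])
  note b = bij_betw_reps
  show "vmap red \<in> {x. \<forall>i. x $ i \<in> reps} \<rightarrow> KV" by (auto simp: vmap_def KV_iff)
  have i: "inv_into reps red x \<in> reps" if "x \<in> range red" for x
    using that bij_betw_imp_surj_on[OF b] by (intro inv_into_into) simp
  show "vmap (inv_into reps red) \<in> KV \<rightarrow> {x. \<forall>i. x $ i \<in> reps}"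
    using i by (auto simp: vmap_def KV_iff)
  show "vmap (inv_into reps red) (vmap red x) = x" if "x \<in> {x. \<forall>i. x $ i \<in> reps}" for x :: "'a poly ^ 'n"
    using that bij_betw_inv_into_left[OF b] by (simp add: vmap_def vec_eq_iff)
  show "vmap red (vmap (inv_into reps red) x) = x" if "x \<in> KV" for x :: "'a alg_closure ^ 'n"
    using that bij_betw_inv_into_right[OF b] by (simp add: vmap_def vec_eq_iff KV_iff)
qed

lemma exp_sum_eq:
  fixes F :: "(6, 'a poly) mpoly" and c :: "'a poly ^ 6"
  shows "exp_sum F \<pi> c = (\<Sum>a\<in>range red - {0}. \<Sum>x\<in>KV.
    add_char (a * mp_value (Poly_Mapping.map red F) x - dot (vmap red c) x))"
proof -
  have "psi (to_laurent (a * mp_value F x - dot c x) / to_laurent \<pi>)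
    = add_char (red a * mp_value (Poly_Mapping.map red F) (vmap red x) - dot (vmap red c) (vmap red x))" for a x
    unfolding mp_value_map_hom[OF hom_reduce_at] hom_dot[OF hom_reduce_at]
    by (simp only: red_simps[symmetric] add_char_red) (simp only: psi_def psi0_def res_def)
  then have "exp_sum F \<pi> c = (\<Sum>a | a \<in> reps \<and> red a \<noteq> 0. \<Sum>x | \<forall>i. x $ i \<in> reps.
      add_char (red a * mp_value (Poly_Mapping.map red F) (vmap red x) - dot (vmap red c) (vmap red x)))"
    by (simp only: exp_sum_def O_norm_less_iff coprime_pi_iff)
  also have "\<dots> = (\<Sum>a | a \<in> reps \<and> red a \<noteq> 0. \<Sum>x\<in>KV.
      add_char (red a * mp_value (Poly_Mapping.map red F) x - dot (vmap red c) x))"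
    by (rule sum.cong[OF refl]) (rule sum.reindex_bij_betw[OF bij_betw_vmap_red])
  also have "\<dots> = (\<Sum>a\<in>range red - {0}. \<Sum>x\<in>KV.
    add_char (a * mp_value (Poly_Mapping.map red F) x - dot (vmap red c) x))"
  proof (rule sum.reindex_bij_betw[of red])
    have "red ` {a. a \<in> reps \<and> red a \<noteq> 0} = red ` reps - {0}" by auto
    then show "bij_betw red {a. a \<in> reps \<and> red a \<noteq> 0} (range red - {0})"
      using bij_betw_reps by (simp add: bij_betw_def inj_on_def)
  qed
  finally show ?thesis .
qed

end

section \<open>Integral coordinates adapted to a subspace\<close>

definition mmap :: "('r \<Rightarrow> 's) \<Rightarrow> 'r ^ 'n ^ 'm \<Rightarrow> 's ^ 'n::finite ^ 'm::finite" where
  "mmap h A = (\<chi> i j. h (A $ i $ j))"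

lemma mmap_mult: "ring_hom_fun h \<Longrightarrow> mmap h (A ** B) = mmap h A ** mmap h B"
  by (simp add: mmap_def matrix_matrix_mult_def hom_sum hom_mult)

lemma mmap_vec: "ring_hom_fun h \<Longrightarrow> mmap h A *v vmap h x = vmap h (A *v x)"
  by (simp add: mmap_def vmap_def matrix_vector_mult_def hom_sum hom_mult)

lemma mmap_mat: "ring_hom_fun h \<Longrightarrow> mmap h (mat c) = mat (h c)"
  by (simp add: mmap_def mat_def vec_eq_iff hom_0)

lemma mmap_transpose: "mmap h (transpose A) = transpose (mmap h A)"
  by (simp add: mmap_def transpose_def)

lemma vmap_0: "h 0 = 0 \<Longrightarrow> vmap h 0 = 0"
  by (simp add: vmap_def vec_eq_iff)

lemma mat_vec: "mat c *v x = c *s (x :: 'r::comm_ring_1 ^ 'n::finite)"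
  by (simp add: mat_def matrix_vector_mult_def vec_eq_iff if_distrib[of "\<lambda>x. x * _"] cong: if_cong)

lemma transpose_mat_scalar: "transpose (mat c) = mat c"
  by (auto simp: transpose_def mat_def vec_eq_iff)

lemma dot_transpose: "dot (transpose A *v c) v = dot c (A *v (v :: 'r::comm_ring_1 ^ 'n::finite))"
  by (simp add: dot_matrix_vector)

lemma dot_join: "dot (u :: 'r::comm_ring_1 ^ (3 + 3)) v
    = (\<Sum>i\<in>UNIV. u $ Inl i * v $ Inl i) + (\<Sum>i\<in>UNIV. u $ Inr i * v $ Inr i)"
  by (simp add: dot_def UNIV_Plus_UNIV[symmetric] sum.Plus del: UNIV_Plus_UNIV)

text \<open>A basis of \<open>L\<close>, indexed by \<open>Inr\<close>, is completed to a basis of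
  the whole space by vectors indexed by \<open>Inl\<close>; so \<open>L\<close> becomes x =
  0.\<close>

lemma subspace_coordinates:
  fixes L :: "('k::field ^ 6) set"
  assumes L: "vec.subspace L" "vec.dim L = 3"
  shows "\<exists>(g :: 'k ^ (3 + 3) ^ 6) h. g ** h = mat 1 \<and> h ** g = mat 1 \<and>
    (\<forall>v. g *v v \<in> L \<longleftrightarrow> (\<forall>i. v $ Inl i = 0))"
proof -
  obtain S where S: "S \<subseteq> L" "vec.independent S" "L \<subseteq> vec.span S" "card S = 3"
    using vec.basis_exists[of L] L(2) by metis
  obtain T where T: "S \<subseteq> T" "vec.independent T" "UNIV \<subseteq> vec.span T"
    using vec.maximal_independent_subset_extend[OF subset_UNIV S(2)] by metis
  have "card T = 6"
    using vec.dim_eq_card[of T UNIV] T by (simp add: card_cart_basis top.extremum_unique)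
  then have fin: "finite T" "finite S" using S(4) by (auto intro!: card_ge_0_finite)
  have "card (T - S) = 3" using \<open>card T = 6\<close> S(4) T(1) fin by (simp add: card_Diff_subset)
  then obtain e2 :: "3 \<Rightarrow> _" where e2: "bij_betw e2 UNIV (T - S)"
    using finite_same_card_bij[of "UNIV :: 3 set" "T - S"] fin by auto
  obtain e1 :: "3 \<Rightarrow> _" where e1: "bij_betw e1 UNIV S"
    using finite_same_card_bij[of "UNIV :: 3 set" S] fin S(4) by auto
  define f where "f = case_sum e2 e1"
  have ne: "e2 i \<noteq> e1 j" for i j
  proof -
    have "e2 i \<in> T - S" "e1 j \<in> S" using e1 e2 by (auto simp: bij_betw_def)
    then show ?thesis by auto
  qed
  have "bij_betw f (UNIV <+> UNIV) T"
  proof (rule bij_betw_imageI)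
    show "inj_on f (UNIV <+> UNIV)"
      using e1 e2 ne ne[symmetric] by (auto simp: inj_on_def bij_betw_def f_def split: sum.splits)
    have "f ` (UNIV <+> UNIV) = range e2 \<union> range e1"
      unfolding Plus_def by (simp add: image_Un image_image f_def)
    then show "f ` (UNIV <+> UNIV) = T" using e1 e2 T(1) by (auto simp: bij_betw_def)
  qed
  then have f: "bij_betw f UNIV T" by simp
  define g :: "'k ^ (3 + 3) ^ 6" where "g = (\<chi> a j. f j $ a)"
  have gv: "g *v v = (\<Sum>j\<in>UNIV. v $ j *s f j)" for v
    by (simp add: g_def vec_eq_iff matrix_vector_mult_def mult.commute)
  have gu: "g *v (\<chi> j. u (f j)) = (\<Sum>b\<in>T. u b *s b)" for u
    unfolding gv using sum.reindex_bij_betw[OF f, of "\<lambda>b. u b *s b"] by simp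
  have "inj ((*v) g)"
  proof (rule injI)
    fix v w assume "g *v v = g *v w"
    define u where "u b = (v - w) $ (inv_into UNIV f b)" for b
    have "v - w = (\<chi> j. u (f j))" using bij_betw_imp_inj_on[OF f] by (simp add: u_def vec_eq_iff)
    moreover have "g *v (v - w) = 0"
      using \<open>g *v v = g *v w\<close> by (simp add: matrix_vector_mult_diff_distrib)
    ultimately have "(\<Sum>b\<in>T. u b *s b) = 0" by (simp add: gu)
    then have "u b = 0" if "b \<in> T" for b
      using vec.independentD[OF T(2) fin(1) subset_refl _ that] by blast
    then have "u (f j) = 0" for j using f by (auto simp: bij_betw_def)
    then show "v = w" using \<open>v - w = (\<chi> j. u (f j))\<close> by (simp add: vec_eq_iff)
  qed
  have "surj ((*v) g)"
    unfolding surj_def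
  proof
    fix w
    have "w \<in> vec.span T" using T by blast
    then obtain u where "w = (\<Sum>b\<in>T. u b *s b)" unfolding vec.span_finite[OF fin(1)] by blast
    then show "\<exists>v. w = g *v v" using gu by metis
  qed
  obtain h where h: "h ** g = mat 1" using \<open>inj ((*v) g)\<close> matrix_left_invertible_injective by blast
  obtain h' where h': "g ** h' = mat 1" using \<open>surj ((*v) g)\<close> matrix_right_invertible_surjective by blast
  have "h = h ** (g ** h')" by (simp add: h')
  also have "\<dots> = h'" by (simp add: matrix_mul_assoc h)
  finally have "h = h'" .
  have "g *v v \<in> L \<longleftrightarrow> (\<forall>i. v $ Inl i = 0)" for v
  proof
    assume "\<forall>i. v $ Inl i = 0"
    then have "g *v v = (\<Sum>i\<in>UNIV. v $ Inr i *s e1 i)"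
      unfolding gv by (simp add: UNIV_Plus_UNIV[symmetric] sum.Plus f_def del: UNIV_Plus_UNIV)
    moreover have "e1 i \<in> L" for i using e1 S(1) by (auto simp: bij_betw_def)
    ultimately show "g *v v \<in> L" using L(1) by (simp add: vec.subspace_sum vec.subspace_scale)
  next
    assume "g *v v \<in> L"
    then have "g *v v \<in> vec.span S" using S by blast
    then obtain u where u: "g *v v = (\<Sum>b\<in>S. u b *s b)" unfolding vec.span_finite[OF fin(2)] by blast
    also have "\<dots> = (\<Sum>b\<in>T. (if b \<in> S then u b else 0) *s b)"
      using fin T(1) by (intro sum.mono_neutral_cong_left) auto
    also have "\<dots> = g *v (\<chi> j. if f j \<in> S then u (f j) else 0)" by (rule gu[symmetric])
    finally have "v = (\<chi> j. if f j \<in> S then u (f j) else 0)" using \<open>inj ((*v) g)\<close> by (simp add: inj_eq)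
    moreover have "f (Inl i) \<notin> S" for i using e2 by (auto simp: f_def bij_betw_def)
    ultimately show "\<forall>i. v $ Inl i = 0" by simp
  qed
  then show ?thesis using h h' \<open>h = h'\<close> by blast
qed

lemma hom_to_fract: "ring_hom_fun (to_fract :: 'r::idom \<Rightarrow> _)"
  by (simp add: ring_hom_fun_def)

lemma clear_denominators:
  assumes "finite (S :: 'r::idom fract set)"
  shows "\<exists>\<alpha>. \<alpha> \<noteq> 0 \<and> (\<forall>x\<in>S. to_fract \<alpha> * x \<in> range to_fract)"
  using assms
proof induction
  case empty
  then show ?case by (intro exI[of _ 1]) simp
next
  case (insert x S)
  then obtain \<alpha> where \<alpha>: "\<alpha> \<noteq> 0" "\<forall>x\<in>S. to_fract \<alpha> * x \<in> range to_fract" by blast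
  obtain a b where x: "x = Fract a b" "b \<noteq> 0" by (cases x) auto
  have "to_fract (\<alpha> * b) * x = to_fract (\<alpha> * a)"
    using x by (simp add: to_fract_def eq_fract)
  moreover have "to_fract (\<alpha> * b) * y \<in> range to_fract" if y: "y \<in> S" for y
  proof -
    obtain a' where "to_fract \<alpha> * y = to_fract a'" using \<alpha>(2) y by blast
    then have "to_fract (\<alpha> * b) * y = to_fract (b * a')" by (simp add: mult_ac)
    then show ?thesis by (simp only: rangeI)
  qed
  ultimately show ?case using \<alpha>(1) x(2) by (intro exI[of _ "\<alpha> * b"]) (metis insert_iff mult_eq_0_iff rangeI)
qed

lemma clear_denominators_matrix:
  fixes A :: "'r::idom fract ^ 'n::finite ^ 'm::finite"
  shows "\<exists>\<alpha> A'. \<alpha> \<noteq> 0 \<and> (\<forall>i j. to_fract \<alpha> * A $ i $ j = to_fract (A' $ i $ j))"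
proof -
  have "finite (range (\<lambda>(i, j). A $ i $ j))" by simp
  from clear_denominators[OF this] obtain \<alpha> where \<alpha>: "\<alpha> \<noteq> 0"
    and "\<forall>i j. \<exists>a. to_fract \<alpha> * A $ i $ j = to_fract a" by (auto simp: image_iff)
  then obtain a where "\<And>i j. to_fract \<alpha> * A $ i $ j = to_fract (a i j)" by metis
  then show ?thesis using \<alpha> by (intro exI[of _ \<alpha>] exI[of _ "\<chi> i j. a i j"]) simp
qed

text \<open>\<open>\<delta>\<close> is the common denominator of the change of coordinates and of its inverse.\<close>

locale integral_coordinates =
  fixes L :: "('a::field poly fract ^ 6) set"
    and G :: "'a poly ^ (3 + 3) ^ 6" and H :: "'a poly ^ 6 ^ (3 + 3)" and \<delta> :: "'a poly"
  assumes \<delta>_nz: "\<delta> \<noteq> 0" and GH: "G ** H = mat \<delta>" and HG: "H ** G = mat \<delta>"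
    and in_L_iff: "x \<in> integral_points L \<longleftrightarrow> (\<forall>i. (H *v x) $ Inl i = 0)"
    and in_orth_iff: "c \<in> integral_points (orth L) \<longleftrightarrow> (\<forall>i. (transpose G *v c) $ Inr i = 0)"

text \<open>Denominators of \<open>g\<close> and of its inverse are cleared by \<alpha> and \<beta>
  separately, so \<delta> = \<alpha> \<beta>. Scaling does not affect which coordinates
  vanish.\<close>

lemma exists_integral_coordinates:
  fixes L :: "('a::field poly fract ^ 6) set"
  assumes L: "vec.subspace L" "vec.dim L = 3"
  shows "\<exists>G H \<delta>. integral_coordinates L G H \<delta>"
proof -
  note hf = hom_to_fract
  obtain g :: "'a poly fract ^ (3 + 3) ^ 6" and h where gh: "g ** h = mat 1" "h ** g = mat 1"
    and gL: "\<And>v. g *v v \<in> L \<longleftrightarrow> (\<forall>i. v $ Inl i = 0)"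
    using subspace_coordinates[OF L] by metis
  obtain \<alpha> G where \<alpha>: "\<alpha> \<noteq> 0" and G: "\<And>i j. to_fract \<alpha> * g $ i $ j = to_fract (G $ i $ j)"
    using clear_denominators_matrix[of g] by blast
  obtain \<beta> H where \<beta>: "\<beta> \<noteq> 0" and H: "\<And>i j. to_fract \<beta> * h $ i $ j = to_fract (H $ i $ j)"
    using clear_denominators_matrix[of h] by blast
  have mG: "mmap to_fract G = (\<chi> i j. to_fract \<alpha> * g $ i $ j)"
    and mH: "mmap to_fract H = (\<chi> i j. to_fract \<beta> * h $ i $ j)"
    by (simp_all add: mmap_def G H)
  have mGv: "mmap to_fract G *v v = g *v (to_fract \<alpha> *s v)" for v
    by (simp add: mG matrix_vector_mult_def vec_eq_iff mult_ac)
  have mHv: "mmap to_fract H *v v = to_fract \<beta> *s (h *v v)" for v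
    by (simp add: mH matrix_vector_mult_def vec_eq_iff sum_distrib_left mult_ac)
  have inj: "A = B" if "mmap to_fract A = mmap to_fract B" for A B :: "'a poly ^ 'n::finite ^ 'm::finite"
    using that by (simp add: mmap_def vec_eq_iff)
  have GH: "G ** H = mat (\<alpha> * \<beta>)"
  proof (rule inj)
    have "mmap to_fract G ** mmap to_fract H = (\<chi> i j. to_fract \<alpha> * to_fract \<beta> * (g ** h) $ i $ j)"
      unfolding mG mH matrix_matrix_mult_def by (simp add: vec_eq_iff sum_distrib_left mult_ac)
    then show "mmap to_fract (G ** H) = mmap to_fract (mat (\<alpha> * \<beta>))"
      unfolding mmap_mult[OF hf] mmap_mat[OF hf] gh by (simp add: mat_def vec_eq_iff)
  qed
  have HG: "H ** G = mat (\<alpha> * \<beta>)"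
  proof (rule inj)
    have "mmap to_fract H ** mmap to_fract G = (\<chi> i j. to_fract \<alpha> * to_fract \<beta> * (h ** g) $ i $ j)"
      unfolding mG mH matrix_matrix_mult_def by (simp add: vec_eq_iff sum_distrib_left mult_ac)
    then show "mmap to_fract (H ** G) = mmap to_fract (mat (\<alpha> * \<beta>))"
      unfolding mmap_mult[OF hf] mmap_mat[OF hf] gh by (simp add: mat_def vec_eq_iff)
  qed
  have ghv: "g *v (h *v x) = x" for x by (simp add: matrix_vector_mul_assoc gh)
  have "x \<in> integral_points L \<longleftrightarrow> (\<forall>i. (H *v x) $ Inl i = 0)" for x
  proof -
    have "x \<in> integral_points L \<longleftrightarrow> g *v (h *v vmap to_fract x) \<in> L"
      by (simp add: integral_points_def ghv)
    also have "\<dots> \<longleftrightarrow> (\<forall>i. (mmap to_fract H *v vmap to_fract x) $ Inl i = 0)"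
      unfolding gL mHv using \<beta> by simp
    also have "\<dots> \<longleftrightarrow> (\<forall>i. (H *v x) $ Inl i = 0)"
      unfolding mmap_vec[OF hf] by (simp add: vmap_def)
    finally show ?thesis .
  qed
  moreover have "c \<in> integral_points (orth L) \<longleftrightarrow> (\<forall>i. (transpose G *v c) $ Inr i = 0)" for c
  proof -
    let ?c = "vmap to_fract c" and ?G = "mmap to_fract G"
    have G': "transpose ?G *v ?c = vmap to_fract (transpose G *v c)"
      by (simp only: mmap_transpose[symmetric] mmap_vec[OF hf])
    have "c \<in> integral_points (orth L) \<longleftrightarrow> (\<forall>i. (transpose ?G *v ?c) $ Inr i = 0)"
    proof
      assume "c \<in> integral_points (orth L)"
      then have c: "dot ?c x = 0" if "x \<in> L" for x
        using that by (simp add: integral_points_def orth_def)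
      show "\<forall>i. (transpose ?G *v ?c) $ Inr i = 0"
      proof
        fix i
        have "(transpose ?G *v ?c) $ Inr i = dot (transpose ?G *v ?c) (axis (Inr i) 1)"
          by (simp add: dot_def axis_def if_distrib[of "\<lambda>x. _ * x"] cong: if_cong)
        also have "\<dots> = 0" unfolding dot_transpose mGv by (rule c) (simp add: gL axis_def)
        finally show "(transpose ?G *v ?c) $ Inr i = 0" .
      qed
    next
      assume z: "\<forall>i. (transpose ?G *v ?c) $ Inr i = 0"
      have "dot ?c x = 0" if "x \<in> L" for x
      proof -
        define v where "v = inverse (to_fract \<alpha>) *s (h *v x)"
        have x: "x = ?G *v v" using \<alpha> by (simp add: mGv v_def ghv)
        have "g *v (h *v x) \<in> L" using that by (simp add: ghv)
        then have "v $ Inl i = 0" for i unfolding gL by (simp add: v_def)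
        then show ?thesis using z unfolding x dot_transpose[symmetric] dot_join by simp
      qed
      then show "c \<in> integral_points (orth L)" by (simp add: integral_points_def orth_def)
    qed
    then show ?thesis unfolding G' by (simp add: vmap_def)
  qed
  ultimately have "integral_coordinates L G H (\<alpha> * \<beta>)"
    using \<alpha> \<beta> GH HG by unfold_locales auto
  then show ?thesis by blast
qed

context integral_coordinates
begin

text \<open>An integral vector orthogonal to \<open>L\<close> with coordinates \<delta> z, see
  \<open>transpose_dual\<close>. Modulo a prime not dividing \<delta> such vectors reach every
  coordinate vector.\<close>

definition dual :: "'a poly ^ 3 \<Rightarrow> 'a poly ^ 6" where
  "dual z = transpose H *v join3 z 0"

lemma transpose_dual: "transpose G *v dual z = \<delta> *s join3 z 0"
proof -
  have "transpose G ** transpose H = mat \<delta>"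
    by (simp only: matrix_transpose_mul[symmetric] HG transpose_mat_scalar)
  then show ?thesis unfolding dual_def matrix_vector_mul_assoc by (simp only: mat_vec)
qed

lemma dual_mem: "dual z \<in> integral_points (orth L)"
  unfolding in_orth_iff transpose_dual by simp

lemma dual_nonzero: "z \<noteq> 0 \<Longrightarrow> dual z \<noteq> 0"
proof
  assume "z \<noteq> 0" "dual z = 0"
  then have e: "(\<delta> *s join3 z 0) = 0" using transpose_dual[of z] by simp
  have "\<delta> * z $ i = 0" for i
    using arg_cong[OF e, of "\<lambda>v. v $ Inl i"] by simp
  then show False using \<open>z \<noteq> 0\<close> \<delta>_nz by (simp add: vec_eq_iff)
qed

text \<open>The coordinates \<open>Z\<close>, in which \<open>B\<close> is given, as functions of
  the argument of \<open>dual\<close>.\<close>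

definition MZ :: "'a poly ^ 6 ^ 3 \<Rightarrow> 'a poly ^ 3 ^ 3" where
  "MZ Z = (\<chi> a i. (\<Sum>k\<in>UNIV. Z $ a $ k * H $ Inl i $ k))"

lemma Z_dual: "Z *v dual z = MZ Z *v z"
proof -
  have "dual z $ k = (\<Sum>i\<in>UNIV. H $ Inl i $ k * z $ i)" for k
    unfolding dual_def matrix_vector_mult_def
    by (simp add: UNIV_Plus_UNIV[symmetric] sum.Plus transpose_def del: UNIV_Plus_UNIV)
  then have "(Z *v dual z) $ a = (\<Sum>k\<in>UNIV. \<Sum>i\<in>UNIV. Z $ a $ k * H $ Inl i $ k * z $ i)" for a
    by (simp add: matrix_vector_mult_def sum_distrib_left mult.assoc)
  moreover have "(MZ Z *v z) $ a = (\<Sum>i\<in>UNIV. \<Sum>k\<in>UNIV. Z $ a $ k * H $ Inl i $ k * z $ i)" for a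
    by (simp add: MZ_def matrix_vector_mult_def sum_distrib_right)
  ultimately show ?thesis by (simp add: vec_eq_iff sum.swap[of _ "UNIV :: 6 set"])
qed

text \<open>A kernel vector over the fraction field becomes integral after clearing denominators,
  and its \<open>dual\<close> would be a non-zero vector on which \<open>Z\<close> vanishes.\<close>

lemma det_MZ:
  assumes inj: "\<And>c. c \<in> integral_points (orth L) \<Longrightarrow> Z *v c = 0 \<Longrightarrow> c = 0"
  shows "det (MZ Z) \<noteq> 0"
proof
  let ?M = "mmap to_fract (MZ Z)"
  assume "det (MZ Z) = 0"
  then have "det ?M = 0" using hom_det[OF hom_to_fract, of "MZ Z"] by (simp add: mmap_def)
  then have "\<not> invertible ?M" by (simp add: invertible_det_nz)
  then obtain v where v: "?M *v v = 0" "v \<noteq> 0"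
    unfolding invertible_left_inverse matrix_left_invertible_ker by blast
  \<comment> \<open>\<open>clear_denominators_matrix\<close> is applied to the matrix all of whose
    columns are \<open>v\<close>; the column with index 0 of the result is kept.\<close>
  obtain \<alpha> A where \<alpha>: "\<alpha> \<noteq> 0" and A: "\<And>i j. to_fract \<alpha> * (\<chi> i (j::3). v $ i) $ i $ j = to_fract (A $ i $ j)"
    using clear_denominators_matrix[of "\<chi> i (j::3). v $ i"] by blast
  define z where "z = (\<chi> i. A $ i $ 0)"
  have z: "vmap to_fract z = to_fract \<alpha> *s v"
    using A[of _ 0] by (simp add: z_def vmap_def vec_eq_iff)
  have "?M *v vmap to_fract z = to_fract \<alpha> *s (?M *v v)"
    unfolding z by (simp add: matrix_vector_mult_def vec_eq_iff sum_distrib_left mult_ac)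
  then have "vmap to_fract (MZ Z *v z) = 0" by (simp add: v mmap_vec[OF hom_to_fract])
  then have "Z *v dual z = 0" by (simp add: Z_dual vmap_def vec_eq_iff)
  then have "z = 0" using inj[OF dual_mem] dual_nonzero by blast
  then have "to_fract \<alpha> *s v = 0" using z by (simp add: vmap_0)
  then show False using \<alpha> v by (simp add: vec_eq_iff)
qed

end

section \<open>The exponential sum modulo a large prime\<close>

text \<open>The three conditions on \<open>reduce_at\<close> keep the coordinates invertible and the
  reduction of \<open>B\<close> non-zero. The first size condition serves the factorisation of the
  field order in \<open>half_powers\<close>, the second the absorption in
  \<open>card_W_le\<close>.\<close>

locale large_prime = residue_field \<theta> \<pi> + integral_coordinates L G H \<delta>
  for \<theta> :: "'a::finite_field alg_closure" and \<pi> :: "'a poly"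
    and L :: "('a poly fract ^ 6) set" and G :: "'a poly ^ (3 + 3) ^ 6" and H :: "'a poly ^ 6 ^ (3 + 3)"
    and \<delta> :: "'a poly" +
  fixes F :: "(6, 'a poly) mpoly" and Z :: "'a poly ^ 6 ^ 3" and B :: "(3, 'a poly) mpoly"
    and d :: nat and b0 :: "3 \<Rightarrow>\<^sub>0 nat" and c0 :: "'a poly ^ 6"
  assumes monic: "lead_coeff \<pi> = 1"
    and F: "form_of_degree 3 F" "smooth_over_O F"
    and detects: "detects_bad F L Z B" and B: "form_of_degree d B"
    and red_\<delta>: "reduce_at \<theta> \<delta> \<noteq> 0" and red_MZ: "reduce_at \<theta> (det (MZ Z)) \<noteq> 0"
    and red_B: "reduce_at \<theta> (Poly_Mapping.lookup B b0) \<noteq> 0"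
    and c0: "c0 \<in> integral_points (orth L)" "c0 \<noteq> 0" "\<not> \<pi> dvd B_value B Z c0"
    and large: "degree \<pi> \<ge> 4" "2 * (d + 1) \<le> CARD('a) ^ degree \<pi>"
begin

abbreviation "Fb \<equiv> Poly_Mapping.map red F"
abbreviation "Gb \<equiv> mmap red G"
abbreviation "Hb \<equiv> mmap red H"
abbreviation "Lb \<equiv> vec.span (vmap red ` integral_points L)"

definition phi :: "'a alg_closure ^ 3 \<Rightarrow> 'a alg_closure ^ 3 \<Rightarrow> 'a alg_closure" where
  "phi x y = mp_value Fb (Gb *v join3 x y)"

lemma GHb: "Gb ** Hb = mat (red \<delta>)" "Hb ** Gb = mat (red \<delta>)"
  by (simp_all only: mmap_mult[OF hom_reduce_at, symmetric] GH HG mmap_mat[OF hom_reduce_at])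

lemma GHb_vec: "Gb *v (Hb *v x) = red \<delta> *s x" "Hb *v (Gb *v v) = red \<delta> *s v"
  by (simp_all only: matrix_vector_mul_assoc GHb mat_vec)

lemma Gb_KM: "Gb \<in> KM" and Hb_KM: "Hb \<in> KM"
  by (simp_all add: KM_iff mmap_def)

lemma invertible_Gb: "invertible Gb"
proof -
  let ?A = "\<chi> i j. inverse (red \<delta>) * Hb $ i $ j"
  have "Gb ** ?A = (\<chi> i j. inverse (red \<delta>) * (Gb ** Hb) $ i $ j)"
    and "?A ** Gb = (\<chi> i j. inverse (red \<delta>) * (Hb ** Gb) $ i $ j)"
    unfolding matrix_matrix_mult_def by (simp_all add: vec_eq_iff sum_distrib_left mult_ac)
  then have "Gb ** ?A = mat 1" "?A ** Gb = mat 1"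
    unfolding GHb using red_\<delta> by (simp_all add: mat_def vec_eq_iff)
  then show ?thesis unfolding invertible_def by blast
qed

text \<open>Reductions of integral points satisfy x = 0 because the equations in \<open>H\<close>
  are integral; conversely the columns of \<open>G\<close> indexed by \<open>Inr\<close> are
  integral points of \<open>L\<close>, and their reductions span.\<close>

lemma Gb_mem_Lb: "Gb *v v \<in> Lb \<longleftrightarrow> (\<forall>i. v $ Inl i = 0)"
proof
  assume "Gb *v v \<in> Lb"
  moreover have "vec.subspace {w. \<forall>i. (Hb *v w) $ Inl i = 0}"
    unfolding vec.subspace_def
    by (simp add: matrix_vector_right_distrib vector_scalar_commute)
  moreover have "vmap red ` integral_points L \<subseteq> {w. \<forall>i. (Hb *v w) $ Inl i = 0}"
    using in_L_iff by (auto simp: mmap_vec[OF hom_reduce_at]) (simp add: vmap_def)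
  ultimately have "(Hb *v (Gb *v v)) $ Inl i = 0" for i
    using vec.span_minimal by blast
  then show "\<forall>i. v $ Inl i = 0" unfolding GHb_vec using red_\<delta> by simp
next
  assume v: "\<forall>i. v $ Inl i = 0"
  have col: "vmap red (G *v axis (Inr i) 1) \<in> Lb" for i
  proof (rule vec.span_base, rule imageI)
    have "H *v (G *v axis (Inr i) 1) = \<delta> *s axis (Inr i) 1"
      by (simp only: matrix_vector_mul_assoc HG mat_vec)
    then show "G *v axis (Inr i) 1 \<in> integral_points L"
      unfolding in_L_iff by (simp add: axis_def)
  qed
  have "vmap red (G *v axis j 1) = (\<chi> k. Gb $ k $ j)" for j
    by (simp add: vmap_def mmap_def matrix_vector_mult_def axis_def if_distrib[of "\<lambda>x. _ * x"] cong: if_cong)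
  then have "Gb *v v = (\<Sum>j\<in>UNIV. v $ j *s vmap red (G *v axis j 1))"
    by (simp add: vec_eq_iff matrix_vector_mult_def mult.commute)
  also have "\<dots> = (\<Sum>i\<in>UNIV. v $ Inr i *s vmap red (G *v axis (Inr i) 1))"
    using v by (simp add: UNIV_Plus_UNIV[symmetric] sum.Plus del: UNIV_Plus_UNIV)
  also have "\<dots> \<in> Lb" by (intro vec.span_sum vec.span_scale col)
  finally show "Gb *v v \<in> Lb" .
qed

text \<open>The coefficients of the line to which the hyperplane of \<open>c\<close> projects; by
  \<open>dot_Gb\<close> the variables y drop out.\<close>

definition coords :: "'a poly ^ 6 \<Rightarrow> 'a alg_closure ^ 3" where
  "coords c = (\<chi> i. (transpose Gb *v vmap red c) $ Inl i)"

lemma transpose_Gb_vec: "transpose Gb *v vmap red c = vmap red (transpose G *v c)"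
  by (simp only: mmap_transpose[symmetric] mmap_vec[OF hom_reduce_at])

lemma coords_KV: "coords c \<in> KV"
  unfolding coords_def transpose_Gb_vec by (simp add: KV_iff vmap_def)

lemma dot_Gb:
  assumes "c \<in> integral_points (orth L)"
  shows "dot (vmap red c) (Gb *v join3 x y) = dot (coords c) x"
proof -
  have "(transpose Gb *v vmap red c) $ Inr i = 0" for i
    using assms unfolding transpose_Gb_vec in_orth_iff by (simp add: vmap_def)
  then show ?thesis
    unfolding dot_transpose[symmetric] dot_join by (simp add: dot_def coords_def)
qed

lemma coords_nz:
  assumes c: "c \<in> integral_points (orth L)" "vmap red c \<noteq> 0"
  shows "coords c \<noteq> 0"
proof
  assume 0: "coords c = 0"
  have "dot (vmap red c) (red \<delta> *s w) = 0" for w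
  proof -
    let ?v = "Hb *v w"
    have "dot (vmap red c) (Gb *v ?v) = dot (vmap red c) (Gb *v join3 (\<chi> i. ?v $ Inl i) (\<chi> i. ?v $ Inr i))"
      by (simp only: join3_collapse)
    also have "\<dots> = 0" unfolding dot_Gb[OF c(1)] 0 by (simp add: dot_def)
    finally show ?thesis by (simp only: GHb_vec)
  qed
  from this[of "axis k 1" for k] have "red \<delta> * vmap red c $ k = 0" for k
    unfolding dot_right_scale by (simp add: dot_def axis_def if_distrib[of "\<lambda>x. _ * x"] cong: if_cong)
  then show False using red_\<delta> c(2) by (simp add: vec_eq_iff)
qed

lemma good_reduction:
  assumes c: "c \<in> integral_points (orth L)" "c \<noteq> 0" "\<not> \<pi> dvd B_value B Z c"
  shows "\<exists>g Q. two_charts Fb Lb Gb g Q \<and> vmap red c \<noteq> 0 \<and> vmap red c \<in> orth Lb \<and>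
    smooth_of_dim_0 (line_form g (vmap red c)) (C_form Q) \<and>
    \<not> line_form g (vmap red c) dvd D_form Q"
proof -
  have "good_mod \<pi> F L c" using detects c irr monic unfolding detects_bad_def by blast
  from this[unfolded good_mod_def, THEN spec, THEN mp, OF root]
  have nz: "vmap red c \<noteq> 0" and "good Fb Lb (vmap red c)"
    by (rule conjunct1, rule conjunct2)
  then obtain g Q where gQ: "vmap red c \<in> orth Lb" "adapted_coordinates Fb Lb g Q"
    "smooth_of_dim_0 (line_form g (vmap red c)) (C_form Q)" "\<not> line_form g (vmap red c) dvd D_form Q"
    unfolding good_def by blast
  have "two_charts Fb Lb Gb g Q"
    using two_nz invertible_Gb Gb_mem_Lb gQ(2) by unfold_locales auto
  then show ?thesis using gQ nz by blast
qed

text \<open>The chart that comes with the good reduction of \<open>c0\<close> yields the fibre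
  matrices, pulled back to the integral coordinates.\<close>

lemma exists_quadratic_fibration:
  "\<exists>qm. cubic_fibration (range red) phi qm"
proof -
  obtain g Q where "two_charts Fb Lb Gb g Q" using good_reduction[OF c0] by blast
  then interpret t: two_charts Fb Lb Gb g Q .
  have quad: "c * quad (t.N x) (cons4 c y) = phi (c *s x) y" for c x y
    unfolding phi_def by (rule t.N_quad)
  have F3: "form_of_degree 3 Fb" using F(1) by (intro form_of_degree_map) auto
  have sm: "smooth_hypersurface Fb" using F(2) by (simp add: smooth_over_O_def)
  have "cubic_fibration (range red) phi t.N"
  proof
    show "transpose (t.N x) = t.N x" for x by (rule t.N_sym)
    show "c * quad (t.N x) (cons4 c y) = phi (c *s x) y" for c x y by (rule quad)
    show "phi x y \<in> range red" if xy: "x \<in> KV" "y \<in> KV" for x y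
    proof -
      have "join3 x y \<in> KV" using xy by (auto simp: KV_iff join3_def split: sum.splits)
      then have "Gb *v join3 x y \<in> KV" by (rule KM_vec[OF Gb_KM])
      then show ?thesis unfolding phi_def mp_value_def mp_eval_def
        by (intro K_sum K_mult K_prod K_power) (auto simp: KV_iff lookup_map)
    qed
    show "polyfun (\<lambda>t. phi (x + t *s w) y)" for x w y
    proof (rule polyfunI)
      fix t
      have "join3 (x + t *s w) y = join3 x y + t *s join3 w 0"
        unfolding join3_scale[symmetric] join3_add[symmetric] by simp
      then have "Gb *v join3 (x + t *s w) y = Gb *v join3 x y + t *s (Gb *v join3 w 0)"
        by (simp add: matrix_vector_right_distrib vector_scalar_commute)
      then show "phi (x + t *s w) y = poly (line_poly Fb (Gb *v join3 x y) (Gb *v join3 w 0)) t"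
        by (simp add: phi_def poly_line_poly)
    qed
    show "t.N x \<noteq> 0" if x: "x \<in> KV" "x \<noteq> 0" for x
    proof
      assume "t.N x = 0"
      then have "phi (c *s x) y = 0" for c y using quad[of c x y] by (simp add: quad_def dot_def)
      then show False
        using smooth_cubic_no_linear_space[OF two_nz F3 sm invertible_Gb x(2)] by (auto simp: phi_def)
    qed
  qed
  then show ?thesis by blast
qed

lemma prime_char: "prime CHAR('a)"
  by (rule prime_char_finite_field)

text \<open>The exponents are half the degree, rounded down and up. With at least four constants and
  degree at least four the smaller power is at least 16, whence \<open>u \<ge> 3\<close>.\<close>

lemma half_powers:
  "\<exists>u v. 2 * u + 1 = CARD('a) ^ (degree \<pi> div 2) \<and>
    2 * v + 1 = CARD('a) ^ (degree \<pi> - degree \<pi> div 2) \<and> u \<le> v \<and> u \<ge> 3"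
proof -
  let ?q = "CARD('a)" and ?n = "degree \<pi>"
  obtain r where r: "?q = CHAR('a) ^ r" "r > 0" using card_finite_field by blast
  have "odd CHAR('a)" using prime_char char3 prime_odd_nat by force
  then have odd: "odd (?q ^ k)" for k by (simp add: r)
  have "CHAR('a) ^ 1 \<le> ?q" unfolding r using r(2) char3 by (intro power_increasing) auto
  then have q4: "?q \<ge> 4" using char3 by simp
  have half: "2 * ((m - 1) div 2) + 1 = m" if "odd m" for m :: nat using that by presburger
  define u where "u = (?q ^ (?n div 2) - 1) div 2"
  define v where "v = (?q ^ (?n - ?n div 2) - 1) div 2"
  have u: "2 * u + 1 = ?q ^ (?n div 2)" and v: "2 * v + 1 = ?q ^ (?n - ?n div 2)"
    unfolding u_def v_def using half[OF odd] by auto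
  have le: "?q ^ (?n div 2) \<le> ?q ^ (?n - ?n div 2)" using q4 by (intro power_increasing) auto
  have "4 ^ 2 \<le> ?q ^ 2" using q4 by (rule power_mono) simp
  also have "\<dots> \<le> ?q ^ (?n div 2)" using q4 large(1) by (intro power_increasing) auto
  finally show ?thesis using u v le by (intro exI[of _ u] exI[of _ v]) simp
qed

text \<open>The zeros of the reduction of \<open>B\<close>, moved to the coordinates of
  \<open>coords\<close>. Homogeneity of \<open>B\<close> makes the factor \<delta> between
  \<open>coords (dual z)\<close> and z harmless.\<close>

definition bad_coords :: "('a alg_closure ^ 3) set" where
  "bad_coords = {w \<in> KV. mp_value (Poly_Mapping.map red B) (mmap red (MZ Z) *v w) = 0}"

lemma card_bad_coords: "card bad_coords \<le> d * q ^ 2"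
proof -
  let ?B = "Poly_Mapping.map red B" and ?M = "mmap red (MZ Z)"
  let ?S = "{x. (\<forall>i. x $ i \<in> range red) \<and> mp_value ?B x = 0}"
  have M: "?M \<in> KM" "det ?M \<noteq> 0"
    using red_MZ hom_det[OF hom_reduce_at, of \<theta> "MZ Z"] by (simp_all add: KM_iff mmap_def)
  note b = bij_betw_KM[OF M]
  have "Poly_Mapping.lookup ?B b0 \<noteq> 0" using red_B by (simp add: lookup_map)
  then have "?B \<noteq> 0" by auto
  moreover have "form_of_degree d ?B" using B by (intro form_of_degree_map) auto
  ultimately have "q * card ?S \<le> d * q ^ CARD(3)"
    by (intro schwartz_zippel) (auto simp: finite_K form_of_degree_def)
  also have "\<dots> = q * (d * q ^ 2)" by (simp add: power2_eq_square power3_eq_cube)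
  finally have "card ?S \<le> d * q ^ 2" using q_pos by simp
  moreover have "card bad_coords \<le> card ?S"
  proof (rule card_inj_on_le)
    show "inj_on ((*v) ?M) bad_coords"
      using b by (auto simp: bij_betw_def bad_coords_def intro: inj_on_subset)
    show "(*v) ?M ` bad_coords \<subseteq> ?S"
      using KM_vec[OF M(1)] by (auto simp: bad_coords_def KV_iff)
    show "finite ?S" by (rule finite_subset[OF _ finite_KV]) (auto simp: KV_iff)
  qed
  ultimately show ?thesis by linarith
qed

text \<open>As \<open>coords (dual z)\<close> is \<delta> times the reduction of z, the vector to be
  lifted is w / \<delta>.\<close>

lemma lift_coords:
  assumes w: "w \<in> KV" "w \<notin> bad_coords" "w \<noteq> 0"
  shows "\<exists>c. c \<in> integral_points (orth L) \<and> c \<noteq> 0 \<and> \<not> \<pi> dvd B_value B Z c \<and> coords c = w"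
proof -
  let ?B = "Poly_Mapping.map red B" and ?e = "inverse (red \<delta>)"
  have "?e *s w \<in> KV" using w(1) by (intro KV_scale K_inverse) auto
  then have "\<forall>i. \<exists>f. red f = (?e *s w) $ i" by (auto simp: KV_iff) (metis rangeE)
  then obtain f where f: "\<And>i. red (f i) = (?e *s w) $ i" by metis
  define z where "z = (\<chi> i. f i)"
  have z: "vmap red z = ?e *s w" by (simp add: z_def vmap_def vec_eq_iff f)
  have "mp_value ?B (mmap red (MZ Z) *v w) \<noteq> 0" using w by (simp add: bad_coords_def)
  moreover have "red (B_value B Z (dual z)) = mp_value ?B (mmap red (MZ Z) *v (?e *s w))"
    unfolding B_value_def Z_dual z[symmetric] mmap_vec[OF hom_reduce_at] mp_value_map_hom[OF hom_reduce_at] ..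
  then have "red (B_value B Z (dual z)) = ?e ^ d * mp_value ?B (mmap red (MZ Z) *v w)"
    using B by (simp add: vector_scalar_commute mp_value_scale[of d] form_of_degree_map)
  ultimately have "\<not> \<pi> dvd B_value B Z (dual z)"
    using red_\<delta> by (simp flip: red_eq_0_iff)
  moreover have "z \<noteq> 0"
  proof
    assume "z = 0"
    then have "?e *s w = 0" using z by (simp add: vmap_0)
    then show False using w(3) red_\<delta> by (simp add: vec_eq_iff)
  qed
  moreover have "coords (dual z) $ i = w $ i" for i
  proof -
    have "coords (dual z) $ i = red \<delta> * vmap red z $ i"
      unfolding coords_def transpose_Gb_vec transpose_dual by (simp add: vmap_def)
    then show ?thesis unfolding z using red_\<delta> by simp
  qed
  then have "coords (dual z) = w" by (simp add: vec_eq_iff)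
  ultimately show ?thesis using dual_mem dual_nonzero by blast
qed

lemma count_by_fibres:
  assumes P: "\<And>x y. P (Gb *v join3 x y) \<longleftrightarrow> R x"
  shows "card {w\<in>KV. mp_value Fb w = 0 \<and> P w} = (\<Sum>x\<in>{x\<in>KV. R x}. card {y\<in>KV. phi x y = 0})"
proof -
  let ?S = "SIGMA x:{x\<in>KV. R x}. {y\<in>KV. phi x y = 0}"
  have fin: "finite {x\<in>KV. R x}" "finite {y\<in>KV. phi x y = 0}" for x :: "'a alg_closure ^ 3"
    using finite_KV by simp_all
  have "bij_betw (\<lambda>(x, y). Gb *v join3 x y) ?S {w\<in>KV. mp_value Fb w = 0 \<and> P w}"
  proof (rule bij_betw_byWitness[where f' = "\<lambda>w. (\<chi> i. inverse (red \<delta>) * (Hb *v w) $ Inl i, \<chi> i. inverse (red \<delta>) * (Hb *v w) $ Inr i)"])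
    show "\<forall>a\<in>?S. (\<lambda>w. (\<chi> i. inverse (red \<delta>) * (Hb *v w) $ Inl i, \<chi> i. inverse (red \<delta>) * (Hb *v w) $ Inr i))
        ((\<lambda>(x, y). Gb *v join3 x y) a) = a"
      using red_\<delta> by (auto simp: GHb_vec vec_eq_iff)
    have inv: "Gb *v join3 (\<chi> i. inverse (red \<delta>) * (Hb *v w) $ Inl i) (\<chi> i. inverse (red \<delta>) * (Hb *v w) $ Inr i) = w" for w
    proof -
      have "join3 (\<chi> i. inverse (red \<delta>) * (Hb *v w) $ Inl i) (\<chi> i. inverse (red \<delta>) * (Hb *v w) $ Inr i)
          = inverse (red \<delta>) *s (Hb *v w)"
        by (simp add: vec_eq_iff join3_def split: sum.splits)
      then show ?thesis using red_\<delta> by (simp add: vector_scalar_commute[symmetric] GHb_vec)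
    qed
    then show "\<forall>w\<in>{w\<in>KV. mp_value Fb w = 0 \<and> P w}. (\<lambda>(x, y). Gb *v join3 x y)
        (\<chi> i. inverse (red \<delta>) * (Hb *v w) $ Inl i, \<chi> i. inverse (red \<delta>) * (Hb *v w) $ Inr i) = w"
      by simp
    show "(\<lambda>(x, y). Gb *v join3 x y) ` ?S \<subseteq> {w\<in>KV. mp_value Fb w = 0 \<and> P w}"
    proof (rule image_subsetI)
      fix p assume "p \<in> ?S"
      then obtain x y where p: "p = (x, y)" and xy: "x \<in> KV" "R x" "y \<in> KV" "phi x y = 0" by blast
      have "join3 x y \<in> KV" using xy by (auto simp: KV_iff join3_def split: sum.splits)
      then show "(\<lambda>(x, y). Gb *v join3 x y) p \<in> {w\<in>KV. mp_value Fb w = 0 \<and> P w}"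
        using xy KM_vec[OF Gb_KM] unfolding p by (simp add: P phi_def)
    qed
    show "(\<lambda>w. (\<chi> i. inverse (red \<delta>) * (Hb *v w) $ Inl i, \<chi> i. inverse (red \<delta>) * (Hb *v w) $ Inr i))
        ` {w\<in>KV. mp_value Fb w = 0 \<and> P w} \<subseteq> ?S"
    proof (rule image_subsetI)
      fix w assume "w \<in> {w\<in>KV. mp_value Fb w = 0 \<and> P w}"
      then have w: "w \<in> KV" "mp_value Fb w = 0" "P w" by simp_all
      let ?x = "\<chi> i. inverse (red \<delta>) * (Hb *v w) $ Inl i" and ?y = "\<chi> i. inverse (red \<delta>) * (Hb *v w) $ Inr i"
      have "Hb *v w \<in> KV" by (rule KM_vec[OF Hb_KM w(1)])
      then have "?x \<in> KV" "?y \<in> KV" by (auto simp: KV_iff intro!: K_mult K_inverse)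
      moreover have "R ?x" using w(3) P[of ?x ?y] by (simp only: inv)
      moreover have "phi ?x ?y = 0" using w(2) by (simp only: phi_def inv)
      ultimately show "(?x, ?y) \<in> ?S" by blast
    qed
  qed
  then have "card {w\<in>KV. mp_value Fb w = 0 \<and> P w} = card ?S" by (simp add: bij_betw_same_card)
  also have "\<dots> = (\<Sum>x\<in>{x\<in>KV. R x}. card {y\<in>KV. phi x y = 0})"
    using fin by (intro card_SigmaI) auto
  finally show ?thesis .
qed

text \<open>By \<open>lift_coords\<close> every non-zero coordinate vector outside
  \<open>bad_coords\<close> comes from an integral vector to which \<open>detects_bad\<close>
  applies, and thus gives a good line.\<close>

lemma point_count:
  assumes v: "2 * v + 1 = CARD('a) ^ (degree \<pi> - degree \<pi> div 2)"
  shows "\<bar>int q * int (card {x\<in>KV. mp_value Fb x = 0 \<and> dot (vmap red c0) x = 0})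
      - int (card {x\<in>KV. mp_value Fb x = 0}) - int q ^ 4\<bar>
    \<le> int q ^ 3 * (30 * int (2 * v + 1) + 57 + 28 * int (d + 1))"
proof -
  obtain qm where "cubic_fibration (range red) phi qm" using exists_quadratic_fibration by blast
  then interpret c: cubic_fibration "range red" phi qm .
  obtain u v' where uv: "2 * u + 1 = CARD('a) ^ (degree \<pi> div 2)"
    "2 * v' + 1 = CARD('a) ^ (degree \<pi> - degree \<pi> div 2)" "u \<le> v'" "u \<ge> 3"
    using half_powers by blast
  have [simp]: "v' = v" using uv(2) v by simp
  obtain r where r: "CARD('a) = CHAR('a) ^ r" using card_finite_field by blast
  interpret w: cubic_weil "range red" phi qm u v
  proof
    show "prime CHAR('a alg_closure)" using prime_char by simp
    show "\<exists>i. 2 * u + 1 = CHAR('a alg_closure) ^ i" "\<exists>j. 2 * v + 1 = CHAR('a alg_closure) ^ j"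
      unfolding uv(1) v unfolding r by (auto simp flip: power_mult)
    show "card (range red) = (2 * u + 1) * (2 * v + 1)"
      unfolding uv(1) v card_residue_field by (simp flip: power_add)
    show "u \<le> v" "3 \<le> u" using uv by simp_all
  qed
  have good: "c.good_line (coords c)"
    if c: "c \<in> integral_points (orth L)" "c \<noteq> 0" "\<not> \<pi> dvd B_value B Z c" for c
  proof -
    obtain g Q where gQ: "two_charts Fb Lb Gb g Q" "vmap red c \<noteq> 0" "vmap red c \<in> orth Lb"
      "smooth_of_dim_0 (line_form g (vmap red c)) (C_form Q)" "\<not> line_form g (vmap red c) dvd D_form Q"
      using good_reduction[OF c] by blast
    show ?thesis
      by (rule c.good_line_charts[OF gQ(1) phi_def gQ(3) coords_def coords_KV coords_nz[OF c(1) gQ(2)] gQ(4,5)])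
  qed
  have "good_w": "c.good_line z" if "z \<in> KV" "z \<notin> bad_coords" "z \<noteq> 0" for z
    using lift_coords[OF that] good by blast
  have N: "int (card {x\<in>KV. mp_value Fb x = 0}) = (\<Sum>x\<in>KV. c.hc x)"
    using count_by_fibres[of "\<lambda>_. True" "\<lambda>_. True"] by (simp add: c.hc_def)
  have Nc: "int (card {x\<in>KV. mp_value Fb x = 0 \<and> dot (vmap red c0) x = 0})
      = (\<Sum>x\<in>{x\<in>KV. dot (coords c0) x = 0}. c.hc x)"
    using count_by_fibres[of "\<lambda>x. dot (vmap red c0) x = 0" "\<lambda>x. dot (coords c0) x = 0"]
    by (simp add: c.hc_def dot_Gb[OF c0(1)])
  show ?thesis
    unfolding N Nc
  proof (rule w.count_estimate[where B = bad_coords])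
    show "bad_coords \<subseteq> KV" by (auto simp: bad_coords_def)
    show "2 * (d + 1) \<le> card (range red)" using large(2) by (simp only: card_residue_field)
  qed (use card_bad_coords good_w good[OF c0] in auto)
qed

lemma exp_sum_count: "(of_nat q - 1) * exp_sum F \<pi> c0
    = of_nat q * (of_nat q * of_nat (card {x\<in>KV. mp_value Fb x = 0 \<and> dot (vmap red c0) x = 0})
      - of_nat (card {x\<in>KV. mp_value Fb x = 0}))"
  unfolding exp_sum_eq
proof (rule exponential_sum_eq_count)
  show "add_char (x + y) = add_char x * add_char y" if "x \<in> range red" "y \<in> range red" for x y
    using that by (rule add_char_add)
  show "\<exists>b\<in>range red. add_char b \<noteq> 1" by (rule add_char_nontrivial)
  show "add_char 0 = 1" by (rule add_char_0)
  show "vmap red c0 \<in> KV" by (simp add: KV_iff vmap_def)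
  show "vmap red c0 \<noteq> 0" using good_reduction[OF c0] by blast
  show "mp_value Fb x \<in> range red" if "x \<in> KV" for x
    using that unfolding mp_value_def mp_eval_def
    by (intro K_sum K_mult K_prod K_power) (auto simp: KV_iff lookup_map)
  show "mp_value Fb (l *s x) = 0" if "mp_value Fb x = 0" for l x
    using that F(1) by (simp add: mp_value_scale[of 3] form_of_degree_map)
qed

lemma O_norm_pi: "O_norm \<pi> = real q"
  using pi_nz by (simp add: O_norm_def card_residue_field)

text \<open>The factor 2 comes from x - 1 \<ge> x / 2. In the dominant term 2 v + 1 is a power of
  \<open>CARD('a)\<close> with exponent at most (degree \<pi> + 1) / 2, so divided by the square
  root of \<open>q\<close> it is at most \<open>CARD('a)\<close>, whatever \<open>\<pi>\<close>
  is.\<close>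

theorem S_nat_estimate:
  "cmod (S_nat F \<pi> c0 - of_real (O_norm \<pi> powr (1 / 2))) \<le> 60 * real CARD('a) + 2 * (58 + 28 * real (d + 1))"
proof -
  obtain u v where v: "2 * v + 1 = CARD('a) ^ (degree \<pi> - degree \<pi> div 2)" using half_powers by blast
  define x where "x = real q"
  define Nc where "Nc = real (card {x\<in>KV. mp_value Fb x = 0 \<and> dot (vmap red c0) x = 0})"
  define N' where "N' = real (card {x\<in>KV. mp_value Fb x = 0})"
  define A where "A = 30 * real (2 * v + 1) + 57 + 28 * real (d + 1)"
  define s where "s = x * (x * Nc - N') / (x - 1)"
  have x: "x \<ge> 2" using q_pos by (simp add: x_def)
  have "real_of_int \<bar>int q * int (card {x\<in>KV. mp_value Fb x = 0 \<and> dot (vmap red c0) x = 0})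
      - int (card {x\<in>KV. mp_value Fb x = 0}) - int q ^ 4\<bar>
    \<le> real_of_int (int q ^ 3 * (30 * int (2 * v + 1) + 57 + 28 * int (d + 1)))"
    using point_count[OF v] by (simp only: of_int_le_iff)
  then have T: "\<bar>x * Nc - N' - x ^ 4\<bar> \<le> x ^ 3 * A"
    by (simp add: x_def Nc_def N'_def A_def)
  have "(of_real (x - 1) :: complex) * exp_sum F \<pi> c0 = of_real (x * (x * Nc - N'))"
    using exp_sum_count by (simp add: x_def Nc_def N'_def)
  then have S: "exp_sum F \<pi> c0 = of_real s"
    using x by (simp add: s_def field_simps flip: of_real_mult of_real_diff)
  have "s - x ^ 4 = (x * (x * Nc - N' - x ^ 4) + x ^ 4) / (x - 1)"
    using x by (simp add: s_def field_simps power_numeral_reduce)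
  also have "\<bar>\<dots>\<bar> \<le> (x * (x ^ 3 * A) + x ^ 4) / (x - 1)"
  proof -
    have "\<bar>x * (x * Nc - N' - x ^ 4) + x ^ 4\<bar> \<le> x * \<bar>x * Nc - N' - x ^ 4\<bar> + x ^ 4"
      using x by (intro order_trans[OF abs_triangle_ineq]) (simp add: abs_mult)
    also have "\<dots> \<le> x * (x ^ 3 * A) + x ^ 4" using x T by (intro add_mono mult_left_mono) auto
    finally show ?thesis using x by (simp add: divide_right_mono)
  qed
  also have "\<dots> = x ^ 4 * (A + 1) / (x - 1)" by (simp add: algebra_simps power_numeral_reduce)
  also have "\<dots> \<le> x ^ 4 * (A + 1) / (x / 2)"
    using x by (intro divide_left_mono) (auto simp: A_def)
  also have "\<dots> = x ^ 3 * (2 * (A + 1))" using x by (simp add: field_simps power_numeral_reduce)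
  finally have s: "\<bar>s - x ^ 4\<bar> \<le> x ^ 3 * (2 * (A + 1))" .
  have pw: "x powr (- 7 / 2) * x ^ k = x powr (real k - 7 / 2)" for k
    using x by (simp add: powr_realpow[symmetric] powr_add[symmetric])
  have "S_nat F \<pi> c0 - of_real (O_norm \<pi> powr (1 / 2)) = of_real (x powr (- 7 / 2) * (s - x ^ 4))"
    using pw[of 4] by (simp add: S_nat_def O_norm_pi S algebra_simps flip: x_def)
  then have "cmod (S_nat F \<pi> c0 - of_real (O_norm \<pi> powr (1 / 2))) = x powr (- 7 / 2) * \<bar>s - x ^ 4\<bar>"
    by (simp only: norm_of_real abs_mult) simp
  also have "\<dots> \<le> x powr (- 7 / 2) * (x ^ 3 * (2 * (A + 1)))" using s by (intro mult_left_mono) auto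
  also have "\<dots> = x powr (- 1 / 2) * (2 * (A + 1))"
    using pw[of 3] by (simp only: mult.assoc[symmetric]) simp
  also have "\<dots> = 60 * (x powr (- 1 / 2) * real (2 * v + 1)) + x powr (- 1 / 2) * (2 * (58 + 28 * real (d + 1)))"
    by (simp add: A_def algebra_simps)
  also have "\<dots> \<le> 60 * real CARD('a) + 1 * (2 * (58 + 28 * real (d + 1)))"
  proof (intro add_mono mult_left_mono mult_right_mono)
    let ?c = "real CARD('a)" and ?n = "degree \<pi>"
    have c1: "?c \<ge> 1" by (simp add: Suc_le_eq)
    have xc: "x = ?c ^ ?n" by (simp add: x_def card_residue_field)
    have "x powr (- 1 / 2) * real (2 * v + 1) = ?c powr (real (?n - ?n div 2) - real ?n / 2)"
      unfolding v xc using c1 by (simp add: powr_realpow[symmetric] powr_powr powr_add[symmetric] algebra_simps)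
    also have "\<dots> \<le> ?c powr 1"
    proof (rule powr_mono[OF _ c1])
      have "2 * (?n - ?n div 2) \<le> ?n + 1" by linarith
      then have "2 * real (?n - ?n div 2) \<le> real ?n + 1" by linarith
      then show "real (?n - ?n div 2) - real ?n / 2 \<le> 1" by linarith
    qed
    finally show "x powr (- 1 / 2) * real (2 * v + 1) \<le> ?c" using c1 by simp
    show "x powr (- 1 / 2) \<le> 1" using x powr_mono[of "- 1 / 2" 0 x] by simp
  qed auto
  finally show ?thesis by simp
qed

end

section \<open>Small primes and the uniform constant\<close>

lemma norm_psi: "cmod (psi \<alpha>) = 1"
proof -
  have "psi \<alpha> = exp (\<i> * of_real (2 * pi * real (trace_rep (fls_nth \<alpha> 1)) / real CHAR('a::finite_field)))"
    for \<alpha> :: "'a fls" by (simp add: psi_def mult_ac)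
  then show ?thesis by (simp only: norm_exp_i_times)
qed

text \<open>The exponential sum has at most q^7 terms of absolute value one; for bounded degree of
  \<open>\<pi>\<close> this is a constant.\<close>

lemma (in residue_field) S_nat_trivial_bound:
  "cmod (S_nat F \<pi> c - of_real (O_norm \<pi> powr (1 / 2))) \<le> 2 * real CARD('a) ^ (7 * degree \<pi>)"
proof -
  define x where "x = real q"
  have x: "x \<ge> 1" using q_pos by (simp add: x_def)
  have Ox: "O_norm \<pi> = x" using pi_nz by (simp add: O_norm_def card_residue_field x_def)
  let ?X = "{x :: 'a poly ^ 6. \<forall>i. x $ i \<in> reps}"
  have card_X: "card ?X = q ^ 6"
  proof -
    have "bij_betw (vmap red) ?X KV" by (rule bij_betw_vmap_red)
    from bij_betw_same_card[OF this] show ?thesis by (simp add: card_KV)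
  qed
  have "cmod (exp_sum F \<pi> c) \<le> (\<Sum>a | a \<in> reps \<and> coprime a \<pi>. \<Sum>x\<in>?X. 1)"
    unfolding exp_sum_def O_norm_less_iff
    by (intro sum_norm_le) (simp add: norm_psi)
  also have "\<dots> = real (card {a. a \<in> reps \<and> coprime a \<pi>} * q ^ 6)" by (simp add: card_X)
  also have "\<dots> \<le> real (q * q ^ 6)"
    using card_reps card_mono[OF card_reps(1), of "{a. a \<in> reps \<and> coprime a \<pi>}"]
    by (intro of_nat_mono mult_right_mono) (auto simp: card_residue_field)
  finally have E: "cmod (exp_sum F \<pi> c) \<le> x ^ 7" by (simp add: x_def power_numeral_reduce mult_ac)
  have p: "x powr (- 7 / 2) \<le> 1" "x powr (1 / 2) \<le> x ^ 7"
    using x powr_mono[of "- 7 / 2" 0 x] powr_mono[of "1 / 2" 7 x] by (simp_all add: powr_numeral)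
  have "cmod (S_nat F \<pi> c) = x powr (- 7 / 2) * cmod (exp_sum F \<pi> c)"
    by (simp add: S_nat_def norm_mult Ox)
  also have "\<dots> \<le> 1 * x ^ 7" using p E x by (intro mult_mono) auto
  finally have "cmod (S_nat F \<pi> c - of_real (O_norm \<pi> powr (1 / 2))) \<le> x ^ 7 + x powr (1 / 2)"
    unfolding Ox by (intro order_trans[OF norm_triangle_ineq4]) simp
  also have "\<dots> \<le> 2 * x ^ 7" using p by simp
  also have "x ^ 7 = real CARD('a) ^ (7 * degree \<pi>)"
    by (simp add: x_def card_residue_field power_mult[symmetric] mult.commute)
  finally show ?thesis .
qed

theorem proposition10p6:
  fixes F :: "(6, 'a::finite_field poly) mpoly"
    and L :: "('a poly fract ^ 6) set"
    and Z :: "'a poly ^ 6 ^ 3"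
    and B :: "(3, 'a poly) mpoly"
  assumes "CHAR('a) > 3"
    and "form_of_degree 3 F"
    and "smooth_over_O F"
    and "vec.subspace L" and "vec.dim L = 3"
    and "\<forall>x\<in>L. mp_value (Poly_Mapping.map to_fract F) x = 0"
    and "detects_bad F L Z B"
  shows "\<exists>C::real. \<forall>c \<pi>.
    c \<in> integral_points (orth L) \<and> c \<noteq> 0 \<and> good_generic F L c \<and>
    Factorial_Ring.irreducible \<pi> \<and> lead_coeff \<pi> = 1 \<and> \<not> \<pi> dvd B_value B Z c \<longrightarrow>
    cmod (S_nat F \<pi> c - of_real (O_norm \<pi> powr (1 / 2))) \<le> C"
proof -
  obtain G H \<delta> where "integral_coordinates L G H \<delta>"
    using exists_integral_coordinates assms(4,5) by blast
  then interpret ic: integral_coordinates L G H \<delta> .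
  note detects = assms(7)[unfolded detects_bad_def]
  have Bnz: "B \<noteq> 0" by (rule detects[THEN conjunct2, THEN conjunct1])
  obtain d where d: "form_of_degree d B"
    using detects[THEN conjunct2, THEN conjunct2, THEN conjunct1] ..
  obtain b0 where b0: "Poly_Mapping.lookup B b0 \<noteq> 0"
    using Bnz by (metis lookup_zero poly_mapping_eqI)
  have det: "det (ic.MZ Z) \<noteq> 0"
    using assms(7) unfolding detects_bad_def by (intro ic.det_MZ) blast
  \<comment> \<open>A prime of larger degree than this product cannot divide it, so all three
    factors survive reduction.\<close>
  define \<Delta> where "\<Delta> = \<delta> * det (ic.MZ Z) * Poly_Mapping.lookup B b0"
  have \<Delta>: "\<Delta> \<noteq> 0" using ic.\<delta>_nz det b0 by (simp add: \<Delta>_def)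
  \<comment> \<open>The summands serve three conditions on a degree n above \<open>D\<close>: n
    exceeds the degree of \<open>\<Delta>\<close>, n is at least four, and
    \<open>2 * (d + 1)\<close> is below 2^n because n < 2^n.\<close>
  define D where "D = degree \<Delta> + 4 + 2 * (d + 1)"
  define q where "q = real CARD('a)"
  have q1: "q \<ge> 1" by (simp add: q_def Suc_le_eq)
  define C1 where "C1 = 60 * q + 2 * (58 + 28 * real (d + 1))"
  have C1: "C1 \<ge> 0" using q1 by (simp add: C1_def)
  show ?thesis
  proof (intro exI[of _ "C1 + 2 * q ^ (7 * D)"] allI impI, elim conjE)
    fix c \<pi>
    assume c: "c \<in> integral_points (orth L)" "c \<noteq> 0" "\<not> \<pi> dvd B_value B Z c"
      and irr: "Factorial_Ring.irreducible \<pi>" and monic: "lead_coeff \<pi> = 1"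
    obtain \<theta> where "root_of \<theta> \<pi>" using exists_root_of[OF irr] by blast
    then interpret r: residue_field \<theta> \<pi> using irr assms(1) by unfold_locales
    show "cmod (S_nat F \<pi> c - of_real (O_norm \<pi> powr (1 / 2))) \<le> C1 + 2 * q ^ (7 * D)"
    proof (cases "degree \<pi> \<le> D")
      case True
      then have "q ^ (7 * degree \<pi>) \<le> q ^ (7 * D)" using q1 by (intro power_increasing) auto
      then show ?thesis using r.S_nat_trivial_bound[of F c] C1 unfolding q_def by linarith
    next
      case False
      have "\<not> \<pi> dvd \<Delta>" using False dvd_imp_degree_le[of \<pi> \<Delta>] \<Delta> by (auto simp: D_def)
      then have "reduce_at \<theta> \<Delta> \<noteq> 0" by (simp add: r.red_eq_0_iff)
      then have red: "reduce_at \<theta> \<delta> \<noteq> 0" "reduce_at \<theta> (det (ic.MZ Z)) \<noteq> 0"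
        "reduce_at \<theta> (Poly_Mapping.lookup B b0) \<noteq> 0" by (auto simp: \<Delta>_def)
      have "2 * (d + 1) \<le> degree \<pi>" using False by (simp add: D_def)
      also have "\<dots> < 2 ^ degree \<pi>" by (rule less_exp)
      also have "(2 :: nat) ^ degree \<pi> \<le> CARD('a) ^ degree \<pi>"
      proof (rule power_mono)
        have "card {0, 1 :: 'a} \<le> CARD('a)" by (intro card_mono) auto
        then show "2 \<le> CARD('a)" by simp
      qed simp
      finally have size: "2 * (d + 1) \<le> CARD('a) ^ degree \<pi>" by simp
      interpret lp: large_prime \<theta> \<pi> L G H \<delta> F Z B d b0 c
        using monic assms(2,3,7) d red c size False by unfold_locales (simp_all add: D_def)
      have "2 * q ^ (7 * D) \<ge> 0" using q1 by simp
      then show ?thesis using lp.S_nat_estimate unfolding C1_def q_def by linarith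
    qed
  qed
qed

end
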